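(* (1) The category $\mathbf{OrdMon}$ of ordered monoids and monotone monoid homomorphisms is dually equivalent to the category $\mathbf{DerACDL}$ of derivation ACDLs and residuation morphisms, equivalently to the category $\mathbf{Comon}$ of ACDL-comonoids and pure morphisms: $$\mathbf{OrdMon}\;\simeq^{\mathrm{op}}\;\mathbf{Comon}\;\cong\;\mathbf{DerACDL}.$$ (2) The category $\mathbf{RelOrdMon}$ of ordered monoids and relational morphisms is dually equivalent to the category $\mathbf{RelDerACDL}$ of derivation ACDLs and corelational residuation morphisms, equivalently to the category $\mathbf{RelComon}$ of ACDL-comonoids and corelational morphisms: $$\mathbf{RelOrdMon}\;\simeq^{\mathrm{op}}\;\mathbf{RelComon}\;\cong\;\mathbf{RelDerACDL}.$$
   Context: Lattices: an ACDL is an algebraic, completely distributive (complete) lattice; $\mathbf{ACDL}$ has as morphisms maps preserving all joins and meets. $p$ is completely join-prime if $p\le\bigvee A$ implies $p\le a$ for some $a\in A$; $\mathcal JD$ is the set of such elements of $D$. $D\otimes_C E$ is the tensor product of complete join-semilattices (representing maps preserving all joins in each variable); for ACDLs $D,E$ it is the coproduct $D+E$ in $\mathbf{ACDL}$, with injections $d\mapsto d\otimes1$, $e\mapsto1\otimes e$. Ordered monoids: an ordered monoid is a monoid with a partial order for which multiplication is monotone. A relational morphism $M\to N$ is a monotone map $\rho$ from $M$ to the set of non-empty downsets of $N$ (ordered by inclusion) with $\rho(x)\rho(y)\subseteq\rho(xy)$ for all $x,y$ and $1_N\in\rho(1_M)$. They compose as relations, with identities $x\mapsto{\downarrow}x$.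 Residuation ACDLs: an ACDL $R$ with operations $\backslash,/\colon R\times R\to R$ such that $x\backslash(-)$, $(-)/y$ preserve all meets, $(-)\backslash z$, $z/(-)$ turn all joins into meets, and $b\le a\backslash c\iff a\le c/b$. It is a derivation ACDL if it is: associative, $x\backslash(z/y)=(x\backslash z)/y$; prime-unital, i.e. there is a completely join-prime $e\in R$ with $e\backslash z=z=z/e$ for all $z$; and pure, i.e. for every $p\in\mathcal JR$ the maps $p\backslash(-)$ and $(-)/p$ preserve all joins. A residuation morphism $f\colon R\to S$ (units $e,e'$) is an $\mathbf{ACDL}$-morphism with: (Forth) $f(x\backslash z)\le f(x)\backslash f(z)$ and $f(z/x)\le f(z)/f(x)$; (Back) for all $y\in S,z\in R$ there is $x\in R$ with $y\le f(x)$ and $y\backslash f(z)=f(x\backslash z)$; (Back') for all $y\in S,z\in R$ there is $x\in R$ with $y\le f(x)$ and $f(z)/y=f(z/x)$; (Unit) $e\le x\iff e'\le f(x)$ for all $x\in R$. A corelational residuation morphism $\rho\colon R\to S$ is a map preserving all joins and the top element with $\rho(x\backslash z)\le\rho(x)\backslash\rho(z)$ and $e'\le\rho(e)$. ACDL-comonoids: an ACDL $C$ with $\mathbf{ACDL}$-morphisms $\gamma\colon C\to C+C$ and $\epsilon\colon C\to2$ satisfying $(\gamma+\mathrm{id})\gamma=(\mathrm{id}+\gamma)\gamma$ and $(\epsilon+\mathrm{id})\gamma=\mathrm{id}=(\mathrm{id}+\epsilon)\gamma$. A pure morphism $f\colon C\to C'$ is an $\mathbf{ACDL}$-morphism with $(f+f)\gamma=\gamma'f$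 and $\epsilon=\epsilon'f$. A corelational morphism $\rho\colon C\to C'$ is a map preserving all joins with $\rho(1)=1$, $(\rho\otimes_C\rho)\gamma\le\gamma'\rho$ and $\epsilon\le\epsilon'\rho$ pointwise. *)

theory Defs
  imports "HOL-Algebra.Group" "HOL-Library.Equipollence"
begin

section \<open>Categories, dual equivalence and isomorphism\<close>

text \<open>
  \<open>Comp C X Y Z g f\<close> is the composite \<open>g \<circ> f : X \<rightarrow> Z\<close> of \<open>f : X \<rightarrow> Y\<close> and \<open>g : Y \<rightarrow> Z\<close>.
  Hom-sets need not be disjoint, so a functor is given by an object map \<open>Fo\<close> and an arrow map
  \<open>Fm\<close> that also receives the source and the target of the arrow.
\<close>

record ('o, 'm) cat =
  Ob :: "'o set"
  Hom :: "'o \<Rightarrow> 'o \<Rightarrow> 'm set"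
  Id :: "'o \<Rightarrow> 'm"
  Comp :: "'o \<Rightarrow> 'o \<Rightarrow> 'o \<Rightarrow> 'm \<Rightarrow> 'm \<Rightarrow> 'm"

locale category =
  fixes C :: "('o, 'm) cat"
  assumes Id_in_Hom: "X \<in> Ob C \<Longrightarrow> Id C X \<in> Hom C X X"
    and Comp_in_Hom:
      "\<lbrakk>X \<in> Ob C; Y \<in> Ob C; Z \<in> Ob C; f \<in> Hom C X Y; g \<in> Hom C Y Z\<rbrakk>
       \<Longrightarrow> Comp C X Y Z g f \<in> Hom C X Z"
    and Comp_Id_left:
      "\<lbrakk>X \<in> Ob C; Y \<in> Ob C; f \<in> Hom C X Y\<rbrakk> \<Longrightarrow> Comp C X Y Y (Id C Y) f = f"
    and Comp_Id_right:
      "\<lbrakk>X \<in> Ob C; Y \<in> Ob C; f \<in> Hom C X Y\<rbrakk> \<Longrightarrow> Comp C X X Y f (Id C X) = f"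
    and Comp_assoc:
      "\<lbrakk>W \<in> Ob C; X \<in> Ob C; Y \<in> Ob C; Z \<in> Ob C;
        f \<in> Hom C W X; g \<in> Hom C X Y; h \<in> Hom C Y Z\<rbrakk>
       \<Longrightarrow> Comp C W Y Z h (Comp C W X Y g f) = Comp C W X Z (Comp C X Y Z h g) f"

definition opposite :: "('o, 'm) cat \<Rightarrow> ('o, 'm) cat" where
  "opposite C =
    \<lparr>Ob = Ob C, Hom = (\<lambda>X Y. Hom C Y X), Id = Id C, Comp = (\<lambda>X Y Z g f. Comp C Z Y X f g)\<rparr>"

locale cat_functor = A: category A + B: category B
  for A :: "('o, 'm) cat" and B :: "('p, 'n) cat"
    and Fo :: "'o \<Rightarrow> 'p" and Fm :: "'o \<Rightarrow> 'o \<Rightarrow> 'm \<Rightarrow> 'n" +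
  assumes Fo_in_Ob: "X \<in> Ob A \<Longrightarrow> Fo X \<in> Ob B"
    and Fm_in_Hom:
      "\<lbrakk>X \<in> Ob A; Y \<in> Ob A; f \<in> Hom A X Y\<rbrakk> \<Longrightarrow> Fm X Y f \<in> Hom B (Fo X) (Fo Y)"
    and Fm_Id: "X \<in> Ob A \<Longrightarrow> Fm X X (Id A X) = Id B (Fo X)"
    and Fm_Comp:
      "\<lbrakk>X \<in> Ob A; Y \<in> Ob A; Z \<in> Ob A; f \<in> Hom A X Y; g \<in> Hom A Y Z\<rbrakk>
       \<Longrightarrow> Fm X Z (Comp A X Y Z g f) = Comp B (Fo X) (Fo Y) (Fo Z) (Fm Y Z g) (Fm X Y f)"

definition iso_arrow :: "('o, 'm) cat \<Rightarrow> 'o \<Rightarrow> 'o \<Rightarrow> 'm \<Rightarrow> bool" where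
  "iso_arrow C X Y f \<longleftrightarrow>
     f \<in> Hom C X Y \<and> (\<exists>g \<in> Hom C Y X. Comp C X Y X g f = Id C X \<and> Comp C Y X Y f g = Id C Y)"

definition natural_iso ::
  "('o, 'm) cat \<Rightarrow> ('p, 'n) cat \<Rightarrow> ('o \<Rightarrow> 'p) \<Rightarrow> ('o \<Rightarrow> 'o \<Rightarrow> 'm \<Rightarrow> 'n)
     \<Rightarrow> ('o \<Rightarrow> 'p) \<Rightarrow> ('o \<Rightarrow> 'o \<Rightarrow> 'm \<Rightarrow> 'n) \<Rightarrow> ('o \<Rightarrow> 'n) \<Rightarrow> bool" where
  "natural_iso A B Fo Fm Go Gm \<eta> \<longleftrightarrow>
     (\<forall>X \<in> Ob A. iso_arrow B (Fo X) (Go X) (\<eta> X)) \<and>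
     (\<forall>X \<in> Ob A. \<forall>Y \<in> Ob A. \<forall>f \<in> Hom A X Y.
        Comp B (Fo X) (Fo Y) (Go Y) (\<eta> Y) (Fm X Y f)
          = Comp B (Fo X) (Go X) (Go Y) (Gm X Y f) (\<eta> X))"

definition equivalent_categories :: "('o, 'm) cat \<Rightarrow> ('p, 'n) cat \<Rightarrow> bool" where
  "equivalent_categories A B \<longleftrightarrow>
     (\<exists>Fo Fm Go Gm \<eta> \<theta>.
        cat_functor A B Fo Fm \<and> cat_functor B A Go Gm \<and>
        natural_iso A A (\<lambda>X. X) (\<lambda>X Y f. f)
          (\<lambda>X. Go (Fo X)) (\<lambda>X Y f. Gm (Fo X) (Fo Y) (Fm X Y f)) \<eta> \<and>
        natural_iso B B (\<lambda>X. Fo (Go X)) (\<lambda>X Y f. Fm (Go X) (Go Y) (Gm X Y f))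
          (\<lambda>X. X) (\<lambda>X Y f. f) \<theta>)"

definition dually_equivalent_categories :: "('o, 'm) cat \<Rightarrow> ('p, 'n) cat \<Rightarrow> bool" where
  "dually_equivalent_categories A B \<longleftrightarrow> equivalent_categories (opposite A) B"

definition isomorphic_categories :: "('o, 'm) cat \<Rightarrow> ('p, 'n) cat \<Rightarrow> bool" where
  "isomorphic_categories A B \<longleftrightarrow>
     (\<exists>Fo Fm Go Gm.
        cat_functor A B Fo Fm \<and> cat_functor B A Go Gm \<and>
        (\<forall>X \<in> Ob A. Go (Fo X) = X) \<and> (\<forall>Y \<in> Ob B. Fo (Go Y) = Y) \<and>
        (\<forall>X \<in> Ob A. \<forall>Y \<in> Ob A. \<forall>f \<in> Hom A X Y. Gm (Fo X) (Fo Y) (Fm X Y f) = f) \<and>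
        (\<forall>X \<in> Ob B. \<forall>Y \<in> Ob B. \<forall>g \<in> Hom B X Y. Fm (Go X) (Go Y) (Gm X Y g) = g))"


section \<open>Ordered monoids\<close>

text \<open>
  All morphisms below are extensional functions (\<open>\<rightarrow>\<^sub>E\<close>: \<^const>\<open>undefined\<close> off the carrier of their
  source), so that equality of morphisms is pointwise equality on the carrier.
\<close>

record 'a ord_monoid = "'a monoid" +
  mle :: "'a \<Rightarrow> 'a \<Rightarrow> bool" (infixl \<open>\<preceq>\<index>\<close> 50)

locale ordered_monoid = monoid M for M :: "'a ord_monoid" (structure) +
  assumes mle_partial_order:
      "partial_order \<lparr>carrier = carrier M, eq = (=), le = mle M\<rparr>"
    and mult_mono:
      "\<lbrakk>x \<in> carrier M; x' \<in> carrier M; y \<in> carrier M; y' \<in> carrier M; x \<preceq> x'; y \<preceq> y'\<rbrakk>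
       \<Longrightarrow> x \<otimes> y \<preceq> x' \<otimes> y'"

definition monotone_monoid_homs :: "'a ord_monoid \<Rightarrow> 'b ord_monoid \<Rightarrow> ('a \<Rightarrow> 'b) set" where
  "monotone_monoid_homs M N =
     {h \<in> carrier M \<rightarrow>\<^sub>E carrier N.
        h \<in> hom M N \<and> h \<one>\<^bsub>M\<^esub> = \<one>\<^bsub>N\<^esub> \<and>
        (\<forall>x \<in> carrier M. \<forall>y \<in> carrier M. x \<preceq>\<^bsub>M\<^esub> y \<longrightarrow> h x \<preceq>\<^bsub>N\<^esub> h y)}"

definition downsets :: "'a ord_monoid \<Rightarrow> 'a set set" where
  "downsets M = {A. A \<subseteq> carrier M \<and> (\<forall>a \<in> A. \<forall>x \<in> carrier M. x \<preceq>\<^bsub>M\<^esub> a \<longrightarrow> x \<in> A)}"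

definition relational_morphisms :: "'a ord_monoid \<Rightarrow> 'b ord_monoid \<Rightarrow> ('a \<Rightarrow> 'b set) set" where
  "relational_morphisms M N =
     {\<rho> \<in> carrier M \<rightarrow>\<^sub>E (downsets N - {{}}).
        (\<forall>x \<in> carrier M. \<forall>y \<in> carrier M. x \<preceq>\<^bsub>M\<^esub> y \<longrightarrow> \<rho> x \<subseteq> \<rho> y) \<and>
        (\<forall>x \<in> carrier M. \<forall>y \<in> carrier M. \<forall>a \<in> \<rho> x. \<forall>b \<in> \<rho> y. a \<otimes>\<^bsub>N\<^esub> b \<in> \<rho> (x \<otimes>\<^bsub>M\<^esub> y)) \<and>
        \<one>\<^bsub>N\<^esub> \<in> \<rho> \<one>\<^bsub>M\<^esub>}"


section \<open>Algebraic completely distributive lattices\<close>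

locale acdl = complete_lattice D for D (structure) +
  assumes algebraic:
      "x \<in> carrier D \<Longrightarrow>
       x = \<Squnion> {k \<in> carrier D. k \<sqsubseteq> x \<and>
              (\<forall>A. A \<subseteq> carrier D \<and> k \<sqsubseteq> \<Squnion> A \<longrightarrow> (\<exists>F. finite F \<and> F \<subseteq> A \<and> k \<sqsubseteq> \<Squnion> F))}"
    and completely_distributive:
      "\<forall>A \<in> \<A>. A \<subseteq> carrier D \<Longrightarrow>
       \<Sqinter> ((\<lambda>A. \<Squnion> A) ` \<A>) = \<Squnion> {\<Sqinter> (\<phi> ` \<A>) | \<phi>. \<forall>A \<in> \<A>. \<phi> A \<in> A}"

definition completely_join_primes :: "('a, 'x) gorder_scheme \<Rightarrow> 'a set" where
  "completely_join_primes D =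
     {p \<in> carrier D. \<forall>A. A \<subseteq> carrier D \<and> p \<sqsubseteq>\<^bsub>D\<^esub> \<Squnion>\<^bsub>D\<^esub> A \<longrightarrow> (\<exists>a \<in> A. p \<sqsubseteq>\<^bsub>D\<^esub> a)}"

definition preserves_joins ::
  "('a, 'x) gorder_scheme \<Rightarrow> ('b, 'y) gorder_scheme \<Rightarrow> ('a \<Rightarrow> 'b) \<Rightarrow> bool" where
  "preserves_joins D E f \<longleftrightarrow> (\<forall>A. A \<subseteq> carrier D \<longrightarrow> f (\<Squnion>\<^bsub>D\<^esub> A) = \<Squnion>\<^bsub>E\<^esub> (f ` A))"

definition preserves_meets ::
  "('a, 'x) gorder_scheme \<Rightarrow> ('b, 'y) gorder_scheme \<Rightarrow> ('a \<Rightarrow> 'b) \<Rightarrow> bool" where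
  "preserves_meets D E f \<longleftrightarrow> (\<forall>A. A \<subseteq> carrier D \<longrightarrow> f (\<Sqinter>\<^bsub>D\<^esub> A) = \<Sqinter>\<^bsub>E\<^esub> (f ` A))"

definition joins_to_meets ::
  "('a, 'x) gorder_scheme \<Rightarrow> ('b, 'y) gorder_scheme \<Rightarrow> ('a \<Rightarrow> 'b) \<Rightarrow> bool" where
  "joins_to_meets D E f \<longleftrightarrow> (\<forall>A. A \<subseteq> carrier D \<longrightarrow> f (\<Squnion>\<^bsub>D\<^esub> A) = \<Sqinter>\<^bsub>E\<^esub> (f ` A))"

definition acdl_morphisms ::
  "('a, 'x) gorder_scheme \<Rightarrow> ('b, 'y) gorder_scheme \<Rightarrow> ('a \<Rightarrow> 'b) set" where
  "acdl_morphisms D E =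
     {f \<in> carrier D \<rightarrow>\<^sub>E carrier E. preserves_joins D E f \<and> preserves_meets D E f}"


section \<open>The tensor product of complete join-semilattices\<close>

text \<open>
  \<open>D \<otimes> E\<close> is realised as the lattice of those downsets of \<open>D \<times> E\<close> that are closed under joins in
  each variable, and \<open>d \<otimes> e\<close> as the least of these containing \<open>(d, e)\<close>. The lemmas
  \<open>pure_tensor_bimorphism\<close> and \<open>tensor_universal\<close> below show that this represents the maps
  preserving all joins in each variable.
\<close>

definition tensor ::
  "('a, 'x) gorder_scheme \<Rightarrow> ('b, 'y) gorder_scheme \<Rightarrow> ('a \<times> 'b) set gorder" where
  "tensor D E =
     \<lparr>carrier = {I. I \<subseteq> carrier D \<times> carrier E \<and>
        (\<forall>(d, e) \<in> I. \<forall>d' \<in> carrier D. \<forall>e' \<in> carrier E.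
           d' \<sqsubseteq>\<^bsub>D\<^esub> d \<and> e' \<sqsubseteq>\<^bsub>E\<^esub> e \<longrightarrow> (d', e') \<in> I) \<and>
        (\<forall>A e. A \<subseteq> carrier D \<and> e \<in> carrier E \<and> A \<times> {e} \<subseteq> I \<longrightarrow> (\<Squnion>\<^bsub>D\<^esub> A, e) \<in> I) \<and>
        (\<forall>d B. d \<in> carrier D \<and> B \<subseteq> carrier E \<and> {d} \<times> B \<subseteq> I \<longrightarrow> (d, \<Squnion>\<^bsub>E\<^esub> B) \<in> I)},
      eq = (=), le = (\<subseteq>)\<rparr>"

definition pure_tensor ::
  "('a, 'x) gorder_scheme \<Rightarrow> ('b, 'y) gorder_scheme \<Rightarrow> 'a \<Rightarrow> 'b \<Rightarrow> ('a \<times> 'b) set" where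
  "pure_tensor D E d e = \<Inter> {I \<in> carrier (tensor D E). (d, e) \<in> I}"

definition bimorphism ::
  "('a, 'x) gorder_scheme \<Rightarrow> ('b, 'y) gorder_scheme \<Rightarrow> ('c, 'z) gorder_scheme
     \<Rightarrow> ('a \<Rightarrow> 'b \<Rightarrow> 'c) \<Rightarrow> bool" where
  "bimorphism D E F \<beta> \<longleftrightarrow>
     (\<forall>d \<in> carrier D. \<forall>e \<in> carrier E. \<beta> d e \<in> carrier F) \<and>
     (\<forall>e \<in> carrier E. preserves_joins D F (\<lambda>d. \<beta> d e)) \<and>
     (\<forall>d \<in> carrier D. preserves_joins E F (\<beta> d))"

text \<open>The join-preserving extension of a bimorphism, see \<open>tensor_universal\<close>.\<close>

definition tensor_lift ::
  "('a, 'x) gorder_scheme \<Rightarrow> ('b, 'y) gorder_scheme \<Rightarrow> ('c, 'z) gorder_scheme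
     \<Rightarrow> ('a \<Rightarrow> 'b \<Rightarrow> 'c) \<Rightarrow> ('a \<times> 'b) set \<Rightarrow> 'c" where
  "tensor_lift D E F \<beta> =
     (\<lambda>I \<in> carrier (tensor D E). \<Squnion>\<^bsub>F\<^esub> {\<beta> d e | d e. (d, e) \<in> I})"

text \<open>
  \<open>f \<otimes> g\<close> for join-preserving \<open>f : D \<rightarrow> D'\<close> and \<open>g : E \<rightarrow> E'\<close>. For ACDL-morphisms this is the
  coproduct map \<open>f + g\<close>; see \<open>coproduct_map_eq_tensor_map\<close>.
\<close>

definition tensor_map ::
  "('a, 'x) gorder_scheme \<Rightarrow> ('b, 'y) gorder_scheme
     \<Rightarrow> ('c, 'z) gorder_scheme \<Rightarrow> ('d, 'w) gorder_scheme
     \<Rightarrow> ('a \<Rightarrow> 'c) \<Rightarrow> ('b \<Rightarrow> 'd) \<Rightarrow> ('a \<times> 'b) set \<Rightarrow> ('c \<times> 'd) set" where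
  "tensor_map D E D' E' f g =
     tensor_lift D E (tensor D' E') (\<lambda>d e. pure_tensor D' E' (f d) (g e))"

definition tensor_assoc ::
  "('a, 'x) gorder_scheme \<Rightarrow> ('b, 'y) gorder_scheme \<Rightarrow> ('c, 'z) gorder_scheme
     \<Rightarrow> (('a \<times> 'b) set \<times> 'c) set \<Rightarrow> ('a \<times> ('b \<times> 'c) set) set" where
  "tensor_assoc D E F =
     tensor_lift (tensor D E) F (tensor D (tensor E F))
       (\<lambda>I z. tensor_lift D E (tensor D (tensor E F))
          (\<lambda>x y. pure_tensor D (tensor E F) x (pure_tensor E F y z)) I)"

definition two :: "bool gorder" where
  "two = \<lparr>carrier = UNIV, eq = (=), le = (\<le>)\<rparr>"

definition tensor_left_unitor :: "('a, 'x) gorder_scheme \<Rightarrow> (bool \<times> 'a) set \<Rightarrow> 'a" where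
  "tensor_left_unitor D = tensor_lift two D D (\<lambda>b d. if b then d else \<bottom>\<^bsub>D\<^esub>)"

definition tensor_right_unitor :: "('a, 'x) gorder_scheme \<Rightarrow> ('a \<times> bool) set \<Rightarrow> 'a" where
  "tensor_right_unitor D = tensor_lift D two D (\<lambda>d b. if b then d else \<bottom>\<^bsub>D\<^esub>)"


section \<open>ACDL-comonoids\<close>

record 'a comonoid = "'a gorder" +
  comult :: "'a \<Rightarrow> ('a \<times> 'a) set"
  counit :: "'a \<Rightarrow> bool"

text \<open>
  The comonoid laws are stated through the canonical isomorphisms
  \<open>(C + C) + C \<cong> C + (C + C)\<close>, \<open>2 + C \<cong> C\<close> and \<open>C + 2 \<cong> C\<close>.
\<close>

locale acdl_comonoid = acdl C for C :: "'a comonoid" (structure) +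
  assumes comult_morphism: "comult C \<in> acdl_morphisms C (tensor C C)"
    and counit_morphism: "counit C \<in> acdl_morphisms C two"
    and coassociative:
      "c \<in> carrier C \<Longrightarrow>
       tensor_assoc C C C
         (tensor_map C C (tensor C C) C (comult C) (\<lambda>x. x) (comult C c))
       = tensor_map C C C (tensor C C) (\<lambda>x. x) (comult C) (comult C c)"
    and counit_left:
      "c \<in> carrier C \<Longrightarrow>
       tensor_left_unitor C (tensor_map C C two C (counit C) (\<lambda>x. x) (comult C c)) = c"
    and counit_right:
      "c \<in> carrier C \<Longrightarrow>
       tensor_right_unitor C (tensor_map C C C two (\<lambda>x. x) (counit C) (comult C c)) = c"

definition pure_comonoid_morphisms :: "'a comonoid \<Rightarrow> 'b comonoid \<Rightarrow> ('a \<Rightarrow> 'b) set" where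
  "pure_comonoid_morphisms C C' =
     {f \<in> acdl_morphisms C C'.
        (\<forall>c \<in> carrier C. tensor_map C C C' C' f f (comult C c) = comult C' (f c)) \<and>
        (\<forall>c \<in> carrier C. counit C c = counit C' (f c))}"

definition corelational_comonoid_morphisms ::
  "'a comonoid \<Rightarrow> 'b comonoid \<Rightarrow> ('a \<Rightarrow> 'b) set" where
  "corelational_comonoid_morphisms C C' =
     {\<rho> \<in> carrier C \<rightarrow>\<^sub>E carrier C'.
        preserves_joins C C' \<rho> \<and> \<rho> \<top>\<^bsub>C\<^esub> = \<top>\<^bsub>C'\<^esub> \<and>
        (\<forall>c \<in> carrier C.
           tensor_map C C C' C' \<rho> \<rho> (comult C c) \<sqsubseteq>\<^bsub>tensor C' C'\<^esub> comult C' (\<rho> c)) \<and>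
        (\<forall>c \<in> carrier C. counit C c \<sqsubseteq>\<^bsub>two\<^esub> counit C' (\<rho> c))}"


section \<open>Residuation and derivation ACDLs\<close>

text \<open>\<open>lres R x z\<close> is \<open>x \ z\<close> and \<open>rres R z y\<close> is \<open>z / y\<close>.\<close>

record 'a residuation = "'a gorder" +
  lres :: "'a \<Rightarrow> 'a \<Rightarrow> 'a" (infixr \<open>\<rightharpoondown>\<index>\<close> 65)
  rres :: "'a \<Rightarrow> 'a \<Rightarrow> 'a" (infixl \<open>\<leftharpoondown>\<index>\<close> 65)

locale residuation_acdl = acdl R for R :: "'a residuation" (structure) +
  assumes lres_closed: "lres R \<in> carrier R \<rightarrow>\<^sub>E carrier R \<rightarrow>\<^sub>E carrier R"
    and rres_closed: "rres R \<in> carrier R \<rightarrow>\<^sub>E carrier R \<rightarrow>\<^sub>E carrier R"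
    and lres_meets: "x \<in> carrier R \<Longrightarrow> preserves_meets R R (\<lambda>z. x \<rightharpoondown> z)"
    and rres_meets: "y \<in> carrier R \<Longrightarrow> preserves_meets R R (\<lambda>z. z \<leftharpoondown> y)"
    and lres_joins_to_meets: "z \<in> carrier R \<Longrightarrow> joins_to_meets R R (\<lambda>x. x \<rightharpoondown> z)"
    and rres_joins_to_meets: "z \<in> carrier R \<Longrightarrow> joins_to_meets R R (\<lambda>y. z \<leftharpoondown> y)"
    and residuation:
      "\<lbrakk>a \<in> carrier R; b \<in> carrier R; c \<in> carrier R\<rbrakk> \<Longrightarrow> b \<sqsubseteq> a \<rightharpoondown> c \<longleftrightarrow> a \<sqsubseteq> c \<leftharpoondown> b"

definition is_residuation_unit :: "'a residuation \<Rightarrow> 'a \<Rightarrow> bool" where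
  "is_residuation_unit R e \<longleftrightarrow>
     e \<in> completely_join_primes R \<and> (\<forall>z \<in> carrier R. e \<rightharpoondown>\<^bsub>R\<^esub> z = z \<and> z \<leftharpoondown>\<^bsub>R\<^esub> e = z)"

locale derivation_acdl = residuation_acdl +
  assumes associative:
      "\<lbrakk>x \<in> carrier R; y \<in> carrier R; z \<in> carrier R\<rbrakk>
       \<Longrightarrow> x \<rightharpoondown> (z \<leftharpoondown> y) = (x \<rightharpoondown> z) \<leftharpoondown> y"
    and prime_unital: "\<exists>e. is_residuation_unit R e"
    and pure_left: "p \<in> completely_join_primes R \<Longrightarrow> preserves_joins R R (\<lambda>z. p \<rightharpoondown> z)"
    and pure_right: "p \<in> completely_join_primes R \<Longrightarrow> preserves_joins R R (\<lambda>z. z \<leftharpoondown> p)"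

text \<open>The unit is unique; see \<open>residuation_unit_unique\<close>.\<close>

definition residuation_unit :: "'a residuation \<Rightarrow> 'a" where
  "residuation_unit R = (THE e. is_residuation_unit R e)"

definition residuation_morphisms :: "'a residuation \<Rightarrow> 'b residuation \<Rightarrow> ('a \<Rightarrow> 'b) set" where
  "residuation_morphisms R S =
     {f \<in> acdl_morphisms R S.
        (\<forall>x \<in> carrier R. \<forall>z \<in> carrier R.
           f (x \<rightharpoondown>\<^bsub>R\<^esub> z) \<sqsubseteq>\<^bsub>S\<^esub> f x \<rightharpoondown>\<^bsub>S\<^esub> f z \<and> f (z \<leftharpoondown>\<^bsub>R\<^esub> x) \<sqsubseteq>\<^bsub>S\<^esub> f z \<leftharpoondown>\<^bsub>S\<^esub> f x) \<and>
        (\<forall>y \<in> carrier S. \<forall>z \<in> carrier R. \<exists>x \<in> carrier R.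
           y \<sqsubseteq>\<^bsub>S\<^esub> f x \<and> y \<rightharpoondown>\<^bsub>S\<^esub> f z = f (x \<rightharpoondown>\<^bsub>R\<^esub> z)) \<and>
        (\<forall>y \<in> carrier S. \<forall>z \<in> carrier R. \<exists>x \<in> carrier R.
           y \<sqsubseteq>\<^bsub>S\<^esub> f x \<and> f z \<leftharpoondown>\<^bsub>S\<^esub> y = f (z \<leftharpoondown>\<^bsub>R\<^esub> x)) \<and>
        (\<forall>x \<in> carrier R. residuation_unit R \<sqsubseteq>\<^bsub>R\<^esub> x \<longleftrightarrow> residuation_unit S \<sqsubseteq>\<^bsub>S\<^esub> f x)}"

definition corelational_residuation_morphisms ::
  "'a residuation \<Rightarrow> 'b residuation \<Rightarrow> ('a \<Rightarrow> 'b) set" where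
  "corelational_residuation_morphisms R S =
     {\<rho> \<in> carrier R \<rightarrow>\<^sub>E carrier S.
        preserves_joins R S \<rho> \<and> \<rho> \<top>\<^bsub>R\<^esub> = \<top>\<^bsub>S\<^esub> \<and>
        (\<forall>x \<in> carrier R. \<forall>z \<in> carrier R. \<rho> (x \<rightharpoondown>\<^bsub>R\<^esub> z) \<sqsubseteq>\<^bsub>S\<^esub> \<rho> x \<rightharpoondown>\<^bsub>S\<^esub> \<rho> z) \<and>
        residuation_unit S \<sqsubseteq>\<^bsub>S\<^esub> \<rho> (residuation_unit R)}"


section \<open>The six categories\<close>

text \<open>
  The categories are relative to a notion of smallness: a predicate \<open>small\<close> on the subsets of a
  type \<^typ>\<open>'a\<close>. Ordered monoids live on small subsets of \<^typ>\<open>'a\<close>; lattices live on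
  subsets of \<^typ>\<open>'a set\<close>, subject to their set of completely join-primes being equipollent to a
  small set. An ACDL \<open>D\<close> has at least as many elements as completely join-primes and at most as
  many as there are sets of these. So it is the set of primes that has the size of the dual
  ordered monoid; when the small sets are those below a strong limit cardinal, it is small
  exactly if \<open>D\<close> is. For \<open>small = (\<lambda>_. True)\<close> the ordered monoids are all those on subsets of
  \<^typ>\<open>'a\<close>.
\<close>

definition small_primes :: "('a set \<Rightarrow> bool) \<Rightarrow> ('b, 'x) gorder_scheme \<Rightarrow> bool" where
  "small_primes small D \<longleftrightarrow> (\<exists>A. small A \<and> A \<approx> completely_join_primes D)"

definition OrdMon :: "('a set \<Rightarrow> bool) \<Rightarrow> ('a ord_monoid, 'a \<Rightarrow> 'a) cat" where
  "OrdMon small =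
     \<lparr>Ob = {M. ordered_monoid M \<and> small (carrier M)},
      Hom = monotone_monoid_homs,
      Id = (\<lambda>M. \<lambda>x \<in> carrier M. x),
      Comp = (\<lambda>M N P g f. compose (carrier M) g f)\<rparr>"

definition RelOrdMon :: "('a set \<Rightarrow> bool) \<Rightarrow> ('a ord_monoid, 'a \<Rightarrow> 'a set) cat" where
  "RelOrdMon small =
     \<lparr>Ob = {M. ordered_monoid M \<and> small (carrier M)},
      Hom = relational_morphisms,
      Id = (\<lambda>M. \<lambda>x \<in> carrier M. {y \<in> carrier M. y \<preceq>\<^bsub>M\<^esub> x}),
      Comp = (\<lambda>M N P \<sigma> \<rho>. \<lambda>x \<in> carrier M. \<Union>y \<in> \<rho> x. \<sigma> y)\<rparr>"

definition Comon ::
  "('a set \<Rightarrow> bool) \<Rightarrow> ('a set comonoid, 'a set \<Rightarrow> 'a set) cat" where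
  "Comon small =
     \<lparr>Ob = {C. acdl_comonoid C \<and> small_primes small C},
      Hom = pure_comonoid_morphisms,
      Id = (\<lambda>C. \<lambda>x \<in> carrier C. x),
      Comp = (\<lambda>C D E g f. compose (carrier C) g f)\<rparr>"

definition RelComon ::
  "('a set \<Rightarrow> bool) \<Rightarrow> ('a set comonoid, 'a set \<Rightarrow> 'a set) cat" where
  "RelComon small =
     \<lparr>Ob = {C. acdl_comonoid C \<and> small_primes small C},
      Hom = corelational_comonoid_morphisms,
      Id = (\<lambda>C. \<lambda>x \<in> carrier C. x),
      Comp = (\<lambda>C D E g f. compose (carrier C) g f)\<rparr>"

definition DerACDL ::
  "('a set \<Rightarrow> bool) \<Rightarrow> ('a set residuation, 'a set \<Rightarrow> 'a set) cat" where
  "DerACDL small =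
     \<lparr>Ob = {R. derivation_acdl R \<and> small_primes small R},
      Hom = residuation_morphisms,
      Id = (\<lambda>R. \<lambda>x \<in> carrier R. x),
      Comp = (\<lambda>R S T g f. compose (carrier R) g f)\<rparr>"

definition RelDerACDL ::
  "('a set \<Rightarrow> bool) \<Rightarrow> ('a set residuation, 'a set \<Rightarrow> 'a set) cat" where
  "RelDerACDL small =
     \<lparr>Ob = {R. derivation_acdl R \<and> small_primes small R},
      Hom = corelational_residuation_morphisms,
      Id = (\<lambda>R. \<lambda>x \<in> carrier R. x),
      Comp = (\<lambda>R S T g f. compose (carrier R) g f)\<rparr>"


section \<open>The constructions are the intended ones\<close>

lemma residuation_unit_unique:
  fixes R :: "'a residuation" (structure)
  assumes R: "residuation_acdl R" and e: "is_residuation_unit R e" and e': "is_residuation_unit R e'"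
  shows "e = e'"
proof -
  interpret residuation_acdl R by (rule R)
  have c: "e \<in> carrier R" "e' \<in> carrier R"
    using e e' by (auto simp: is_residuation_unit_def completely_join_primes_def)
  have iff: "e' \<sqsubseteq> z \<longleftrightarrow> e \<sqsubseteq> z" if "z \<in> carrier R" for z
    using residuation[OF c that] e e' that by (simp add: is_residuation_unit_def)
  show ?thesis
    using iff[of e] iff[of e'] c le_antisym[of e e'] by simp
qed

locale two_complete_lattices = D: complete_lattice D + E: complete_lattice E
  for D :: "('a, 'x) gorder_scheme" and E :: "('b, 'y) gorder_scheme"
begin

abbreviation "T \<equiv> tensor D E"

lemma tensor_memD:
  assumes "I \<in> carrier T"
  shows "\<And>d e. (d, e) \<in> I \<Longrightarrow> d \<in> carrier D"
    and "\<And>d e. (d, e) \<in> I \<Longrightarrow> e \<in> carrier E"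
    and "\<And>d e d' e'. \<lbrakk>(d, e) \<in> I; d' \<in> carrier D; e' \<in> carrier E; d' \<sqsubseteq>\<^bsub>D\<^esub> d; e' \<sqsubseteq>\<^bsub>E\<^esub> e\<rbrakk> \<Longrightarrow> (d', e') \<in> I"
    and "\<And>A e. \<lbrakk>A \<subseteq> carrier D; e \<in> carrier E; \<And>a. a \<in> A \<Longrightarrow> (a, e) \<in> I\<rbrakk> \<Longrightarrow> (\<Squnion>\<^bsub>D\<^esub> A, e) \<in> I"
    and "\<And>d B. \<lbrakk>d \<in> carrier D; B \<subseteq> carrier E; \<And>b. b \<in> B \<Longrightarrow> (d, b) \<in> I\<rbrakk> \<Longrightarrow> (d, \<Squnion>\<^bsub>E\<^esub> B) \<in> I"
proof -
  have I: "I \<subseteq> carrier D \<times> carrier E"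
    "\<forall>(d, e) \<in> I. \<forall>d' \<in> carrier D. \<forall>e' \<in> carrier E. d' \<sqsubseteq>\<^bsub>D\<^esub> d \<and> e' \<sqsubseteq>\<^bsub>E\<^esub> e \<longrightarrow> (d', e') \<in> I"
    "\<forall>A e. A \<subseteq> carrier D \<and> e \<in> carrier E \<and> A \<times> {e} \<subseteq> I \<longrightarrow> (\<Squnion>\<^bsub>D\<^esub> A, e) \<in> I"
    "\<forall>d B. d \<in> carrier D \<and> B \<subseteq> carrier E \<and> {d} \<times> B \<subseteq> I \<longrightarrow> (d, \<Squnion>\<^bsub>E\<^esub> B) \<in> I"
    using assms unfolding tensor_def by simp_all
  show "\<And>d e. (d, e) \<in> I \<Longrightarrow> d \<in> carrier D" using I(1) by blast
  show "\<And>d e. (d, e) \<in> I \<Longrightarrow> e \<in> carrier E" using I(1) by blast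
  show "\<And>d e d' e'. \<lbrakk>(d, e) \<in> I; d' \<in> carrier D; e' \<in> carrier E; d' \<sqsubseteq>\<^bsub>D\<^esub> d; e' \<sqsubseteq>\<^bsub>E\<^esub> e\<rbrakk> \<Longrightarrow> (d', e') \<in> I"
    using I(2) by blast
  show "\<And>A e. \<lbrakk>A \<subseteq> carrier D; e \<in> carrier E; \<And>a. a \<in> A \<Longrightarrow> (a, e) \<in> I\<rbrakk> \<Longrightarrow> (\<Squnion>\<^bsub>D\<^esub> A, e) \<in> I"
    using I(3) by blast
  show "\<And>d B. \<lbrakk>d \<in> carrier D; B \<subseteq> carrier E; \<And>b. b \<in> B \<Longrightarrow> (d, b) \<in> I\<rbrakk> \<Longrightarrow> (d, \<Squnion>\<^bsub>E\<^esub> B) \<in> I"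
    using I(4) by blast
qed

lemma tensor_memI:
  assumes "I \<subseteq> carrier D \<times> carrier E"
    and "\<And>d e d' e'. \<lbrakk>(d, e) \<in> I; d' \<in> carrier D; e' \<in> carrier E; d' \<sqsubseteq>\<^bsub>D\<^esub> d; e' \<sqsubseteq>\<^bsub>E\<^esub> e\<rbrakk> \<Longrightarrow> (d', e') \<in> I"
    and "\<And>A e. \<lbrakk>A \<subseteq> carrier D; e \<in> carrier E; \<And>a. a \<in> A \<Longrightarrow> (a, e) \<in> I\<rbrakk> \<Longrightarrow> (\<Squnion>\<^bsub>D\<^esub> A, e) \<in> I"
    and "\<And>d B. \<lbrakk>d \<in> carrier D; B \<subseteq> carrier E; \<And>b. b \<in> B \<Longrightarrow> (d, b) \<in> I\<rbrakk> \<Longrightarrow> (d, \<Squnion>\<^bsub>E\<^esub> B) \<in> I"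
  shows "I \<in> carrier T"
proof -
  have "\<forall>(d, e) \<in> I. \<forall>d' \<in> carrier D. \<forall>e' \<in> carrier E. d' \<sqsubseteq>\<^bsub>D\<^esub> d \<and> e' \<sqsubseteq>\<^bsub>E\<^esub> e \<longrightarrow> (d', e') \<in> I"
    using assms(2) by blast
  moreover have "\<forall>A e. A \<subseteq> carrier D \<and> e \<in> carrier E \<and> A \<times> {e} \<subseteq> I \<longrightarrow> (\<Squnion>\<^bsub>D\<^esub> A, e) \<in> I"
  proof (intro allI impI)
    fix A e assume "A \<subseteq> carrier D \<and> e \<in> carrier E \<and> A \<times> {e} \<subseteq> I"
    then show "(\<Squnion>\<^bsub>D\<^esub> A, e) \<in> I" by (intro assms(3)) auto
  qed
  moreover have "\<forall>d B. d \<in> carrier D \<and> B \<subseteq> carrier E \<and> {d} \<times> B \<subseteq> I \<longrightarrow> (d, \<Squnion>\<^bsub>E\<^esub> B) \<in> I"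
  proof (intro allI impI)
    fix d B assume "d \<in> carrier D \<and> B \<subseteq> carrier E \<and> {d} \<times> B \<subseteq> I"
    then show "(d, \<Squnion>\<^bsub>E\<^esub> B) \<in> I" by (intro assms(4)) auto
  qed
  ultimately show ?thesis using assms(1) unfolding tensor_def by simp
qed

lemma tensor_Inter:
  assumes "\<A> \<subseteq> carrier T" shows "(carrier D \<times> carrier E) \<inter> \<Inter> \<A> \<in> carrier T"
proof (rule tensor_memI)
  fix d e d' e'
  assume *: "(d, e) \<in> (carrier D \<times> carrier E) \<inter> \<Inter> \<A>" "d' \<in> carrier D" "e' \<in> carrier E"
    "d' \<sqsubseteq>\<^bsub>D\<^esub> d" "e' \<sqsubseteq>\<^bsub>E\<^esub> e"
  have "(d', e') \<in> I" if "I \<in> \<A>" for I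
    using tensor_memD(3)[of I d e d' e'] that assms * by blast
  then show "(d', e') \<in> (carrier D \<times> carrier E) \<inter> \<Inter> \<A>" using * by blast
next
  fix A e
  assume *: "A \<subseteq> carrier D" "e \<in> carrier E" "\<And>a. a \<in> A \<Longrightarrow> (a, e) \<in> (carrier D \<times> carrier E) \<inter> \<Inter> \<A>"
  have "(\<Squnion>\<^bsub>D\<^esub> A, e) \<in> I" if "I \<in> \<A>" for I
    using tensor_memD(4)[of I A e] that assms * by blast
  then show "(\<Squnion>\<^bsub>D\<^esub> A, e) \<in> (carrier D \<times> carrier E) \<inter> \<Inter> \<A>" using * by auto
next
  fix d B
  assume *: "d \<in> carrier D" "B \<subseteq> carrier E" "\<And>b. b \<in> B \<Longrightarrow> (d, b) \<in> (carrier D \<times> carrier E) \<inter> \<Inter> \<A>"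
  have "(d, \<Squnion>\<^bsub>E\<^esub> B) \<in> I" if "I \<in> \<A>" for I
    using tensor_memD(5)[of I d B] that assms * by blast
  then show "(d, \<Squnion>\<^bsub>E\<^esub> B) \<in> (carrier D \<times> carrier E) \<inter> \<Inter> \<A>" using * by auto
qed simp

lemma tensor_le [simp]: "I \<sqsubseteq>\<^bsub>T\<^esub> J \<longleftrightarrow> I \<subseteq> J"
  by (simp add: tensor_def)

lemma tensor_complete_lattice: "complete_lattice T"
proof -
  have po: "partial_order T"
    by unfold_locales (auto simp: tensor_def)
  have sub: "I \<subseteq> carrier D \<times> carrier E" if "I \<in> carrier T" for I
    using tensor_memD(1,2)[OF that] by auto
  have inf_ex: "greatest T ((carrier D \<times> carrier E) \<inter> \<Inter> \<A>) (Lower T \<A>)" if "\<A> \<subseteq> carrier T" for \<A>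
    using tensor_Inter[OF that] sub that by (auto simp: greatest_def Lower_def)
  have sup_ex: "least T ((carrier D \<times> carrier E) \<inter> \<Inter> (Upper T \<A>)) (Upper T \<A>)"
    if \<A>: "\<A> \<subseteq> carrier T" for \<A>
  proof -
    have U: "Upper T \<A> = {J \<in> carrier T. \<forall>I \<in> \<A>. I \<subseteq> J}"
      using \<A> by (auto simp: Upper_def)
    have c: "(carrier D \<times> carrier E) \<inter> \<Inter> (Upper T \<A>) \<in> carrier T"
      by (rule tensor_Inter) (simp add: U)
    have "I \<subseteq> (carrier D \<times> carrier E) \<inter> \<Inter> (Upper T \<A>)" if "I \<in> \<A>" for I
      using sub[of I] that \<A> unfolding U by blast
    then show ?thesis using c by (auto simp: least_def U)
  qed
  show ?thesis
    using po inf_ex sup_ex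
    by (intro complete_lattice.intro complete_lattice_axioms.intro) blast+
qed

sublocale T: complete_lattice T
  by (rule tensor_complete_lattice)

lemma pure_tensor_closed:
  assumes "d \<in> carrier D" "e \<in> carrier E" shows "pure_tensor D E d e \<in> carrier T"
    and "(d, e) \<in> pure_tensor D E d e"
proof -
  have "carrier D \<times> carrier E \<in> carrier T" by (rule tensor_memI) auto
  then have "pure_tensor D E d e
      = (carrier D \<times> carrier E) \<inter> \<Inter> {I \<in> carrier T. (d, e) \<in> I}"
    using assms by (auto simp: pure_tensor_def)
  then show "pure_tensor D E d e \<in> carrier T" using tensor_Inter[of "{I \<in> carrier T. (d, e) \<in> I}"] by auto
  show "(d, e) \<in> pure_tensor D E d e" by (simp add: pure_tensor_def)
qed

lemma pure_tensor_le_iff: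
  assumes "I \<in> carrier T" "d \<in> carrier D" "e \<in> carrier E"
  shows "pure_tensor D E d e \<subseteq> I \<longleftrightarrow> (d, e) \<in> I"
  using assms pure_tensor_closed(2) by (auto simp: pure_tensor_def)

lemma pure_tensor_bimorphism: "bimorphism D E T (pure_tensor D E)"
proof -
  have l: "pure_tensor D E (\<Squnion>\<^bsub>D\<^esub> A) e = \<Squnion>\<^bsub>T\<^esub> ((\<lambda>d. pure_tensor D E d e) ` A)"
    if A: "A \<subseteq> carrier D" and e: "e \<in> carrier E" for A e
  proof -
    have c: "(\<lambda>d. pure_tensor D E d e) ` A \<subseteq> carrier T" using A e pure_tensor_closed by blast
    let ?S = "\<Squnion>\<^bsub>T\<^esub> ((\<lambda>d. pure_tensor D E d e) ` A)"
    have S: "?S \<in> carrier T" using c by simp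
    have a: "(a, e) \<in> ?S" if "a \<in> A" for a
    proof -
      have "pure_tensor D E a e \<sqsubseteq>\<^bsub>T\<^esub> ?S" using c that by (intro T.sup_upper) auto
      then show ?thesis using A e that pure_tensor_closed(2)[of a e] by auto
    qed
    have "(\<Squnion>\<^bsub>D\<^esub> A, e) \<in> ?S" by (rule tensor_memD(4)[OF S A e a])
    then have 1: "pure_tensor D E (\<Squnion>\<^bsub>D\<^esub> A) e \<subseteq> ?S"
      using pure_tensor_le_iff[OF S, of "\<Squnion>\<^bsub>D\<^esub> A" e] A e by simp
    have P: "pure_tensor D E (\<Squnion>\<^bsub>D\<^esub> A) e \<in> carrier T" "(\<Squnion>\<^bsub>D\<^esub> A, e) \<in> pure_tensor D E (\<Squnion>\<^bsub>D\<^esub> A) e"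
      using pure_tensor_closed[of "\<Squnion>\<^bsub>D\<^esub> A" e] A e by simp_all
    have "pure_tensor D E a e \<subseteq> pure_tensor D E (\<Squnion>\<^bsub>D\<^esub> A) e" if "a \<in> A" for a
    proof -
      have "(a, e) \<in> pure_tensor D E (\<Squnion>\<^bsub>D\<^esub> A) e"
        using tensor_memD(3)[OF P(1) P(2), of a e] A e that D.sup_upper[OF A that] by auto
      then show ?thesis using pure_tensor_le_iff[OF P(1), of a e] A e that by auto
    qed
    then have "?S \<sqsubseteq>\<^bsub>T\<^esub> pure_tensor D E (\<Squnion>\<^bsub>D\<^esub> A) e"
      using c P by (intro T.sup_least) auto
    then show ?thesis using 1 by auto
  qed
  have r: "pure_tensor D E d (\<Squnion>\<^bsub>E\<^esub> B) = \<Squnion>\<^bsub>T\<^esub> (pure_tensor D E d ` B)"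
    if B: "B \<subseteq> carrier E" and d: "d \<in> carrier D" for B d
  proof -
    have c: "pure_tensor D E d ` B \<subseteq> carrier T" using B d pure_tensor_closed by blast
    let ?S = "\<Squnion>\<^bsub>T\<^esub> (pure_tensor D E d ` B)"
    have S: "?S \<in> carrier T" using c by simp
    have a: "(d, b) \<in> ?S" if "b \<in> B" for b
    proof -
      have "pure_tensor D E d b \<sqsubseteq>\<^bsub>T\<^esub> ?S" using c that by (intro T.sup_upper) auto
      then show ?thesis using B d that pure_tensor_closed(2)[of d b] by auto
    qed
    have "(d, \<Squnion>\<^bsub>E\<^esub> B) \<in> ?S" by (rule tensor_memD(5)[OF S d B a])
    then have 1: "pure_tensor D E d (\<Squnion>\<^bsub>E\<^esub> B) \<subseteq> ?S"
      using pure_tensor_le_iff[OF S, of d "\<Squnion>\<^bsub>E\<^esub> B"] B d by simp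
    have P: "pure_tensor D E d (\<Squnion>\<^bsub>E\<^esub> B) \<in> carrier T" "(d, \<Squnion>\<^bsub>E\<^esub> B) \<in> pure_tensor D E d (\<Squnion>\<^bsub>E\<^esub> B)"
      using pure_tensor_closed[of d "\<Squnion>\<^bsub>E\<^esub> B"] B d by simp_all
    have "pure_tensor D E d b \<subseteq> pure_tensor D E d (\<Squnion>\<^bsub>E\<^esub> B)" if "b \<in> B" for b
    proof -
      have "(d, b) \<in> pure_tensor D E d (\<Squnion>\<^bsub>E\<^esub> B)"
        using tensor_memD(3)[OF P(1) P(2), of d b] B d that E.sup_upper[OF B that] by auto
      then show ?thesis using pure_tensor_le_iff[OF P(1), of d b] B d that by auto
    qed
    then have "?S \<sqsubseteq>\<^bsub>T\<^esub> pure_tensor D E d (\<Squnion>\<^bsub>E\<^esub> B)"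
      using c P by (intro T.sup_least) auto
    then show ?thesis using 1 by auto
  qed
  show ?thesis
    using l r pure_tensor_closed by (auto simp: bimorphism_def preserves_joins_def)
qed

lemma tensor_eq_sup_pure:
  assumes I: "I \<in> carrier T"
  shows "I = \<Squnion>\<^bsub>T\<^esub> {pure_tensor D E d e | d e. (d, e) \<in> I}" (is "I = \<Squnion>\<^bsub>T\<^esub> ?P")
proof -
  have c: "?P \<subseteq> carrier T" using tensor_memD(1,2)[OF I] pure_tensor_closed by blast
  have "\<Squnion>\<^bsub>T\<^esub> ?P \<sqsubseteq>\<^bsub>T\<^esub> I"
  proof (rule T.sup_least[OF c I])
    fix x assume "x \<in> ?P"
    then obtain d e where "x = pure_tensor D E d e" "(d, e) \<in> I" by blast
    then show "x \<sqsubseteq>\<^bsub>T\<^esub> I"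
      using pure_tensor_le_iff[OF I] tensor_memD(1,2)[OF I] by simp
  qed
  moreover have "(d, e) \<in> \<Squnion>\<^bsub>T\<^esub> ?P" if "(d, e) \<in> I" for d e
  proof -
    have "pure_tensor D E d e \<sqsubseteq>\<^bsub>T\<^esub> \<Squnion>\<^bsub>T\<^esub> ?P" using that by (intro T.sup_upper[OF c]) auto
    then show ?thesis
      using pure_tensor_closed(2)[OF tensor_memD(1,2)[OF I that]] by auto
  qed
  ultimately show ?thesis by auto
qed

theorem tensor_universal:
  fixes F :: "('c, 'z) gorder_scheme"
  assumes F: "complete_lattice F" and \<beta>: "bimorphism D E F \<beta>"
  shows "tensor_lift D E F \<beta> \<in> carrier T \<rightarrow>\<^sub>E carrier F"
    and "preserves_joins T F (tensor_lift D E F \<beta>)"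
    and "\<And>d e. \<lbrakk>d \<in> carrier D; e \<in> carrier E\<rbrakk> \<Longrightarrow> tensor_lift D E F \<beta> (pure_tensor D E d e) = \<beta> d e"
    and "\<And>h. \<lbrakk>h \<in> carrier T \<rightarrow>\<^sub>E carrier F; preserves_joins T F h;
           \<And>d e. \<lbrakk>d \<in> carrier D; e \<in> carrier E\<rbrakk> \<Longrightarrow> h (pure_tensor D E d e) = \<beta> d e\<rbrakk>
         \<Longrightarrow> h = tensor_lift D E F \<beta>"
proof -
  interpret F: complete_lattice F by (rule F)
  let ?h = "tensor_lift D E F \<beta>"
  have \<beta>c: "\<beta> d e \<in> carrier F" if "d \<in> carrier D" "e \<in> carrier E" for d e
    using \<beta> that by (auto simp: bimorphism_def)
  have \<beta>l: "\<beta> (\<Squnion>\<^bsub>D\<^esub> A) e = \<Squnion>\<^bsub>F\<^esub> ((\<lambda>d. \<beta> d e) ` A)" if "A \<subseteq> carrier D" "e \<in> carrier E" for A e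
    using \<beta> that by (auto simp: bimorphism_def preserves_joins_def)
  have \<beta>r: "\<beta> d (\<Squnion>\<^bsub>E\<^esub> B) = \<Squnion>\<^bsub>F\<^esub> (\<beta> d ` B)" if "d \<in> carrier D" "B \<subseteq> carrier E" for d B
    using \<beta> that by (auto simp: bimorphism_def preserves_joins_def)
  have ml: "\<beta> d e \<sqsubseteq>\<^bsub>F\<^esub> \<beta> d' e"
    if d: "d \<in> carrier D" "d' \<in> carrier D" "e \<in> carrier E" "d \<sqsubseteq>\<^bsub>D\<^esub> d'" for d d' e
  proof -
    have "\<Squnion>\<^bsub>D\<^esub> {d, d'} = d'"
      using d by (intro D.le_antisym D.sup_least D.sup_upper) auto
    then have "\<beta> d' e = \<Squnion>\<^bsub>F\<^esub> ((\<lambda>d. \<beta> d e) ` {d, d'})" using \<beta>l[of "{d, d'}" e] d by simp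
    moreover have "\<beta> d e \<sqsubseteq>\<^bsub>F\<^esub> \<Squnion>\<^bsub>F\<^esub> ((\<lambda>d. \<beta> d e) ` {d, d'})"
      using d \<beta>c by (intro F.sup_upper) auto
    ultimately show ?thesis by simp
  qed
  have mr: "\<beta> d e \<sqsubseteq>\<^bsub>F\<^esub> \<beta> d e'"
    if d: "d \<in> carrier D" "e \<in> carrier E" "e' \<in> carrier E" "e \<sqsubseteq>\<^bsub>E\<^esub> e'" for d e e'
  proof -
    have "\<Squnion>\<^bsub>E\<^esub> {e, e'} = e'"
      using d by (intro E.le_antisym E.sup_least E.sup_upper) auto
    then have "\<beta> d e' = \<Squnion>\<^bsub>F\<^esub> (\<beta> d ` {e, e'})" using \<beta>r[of d "{e, e'}"] d by simp
    moreover have "\<beta> d e \<sqsubseteq>\<^bsub>F\<^esub> \<Squnion>\<^bsub>F\<^esub> (\<beta> d ` {e, e'})"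
      using d \<beta>c by (intro F.sup_upper) auto
    ultimately show ?thesis by simp
  qed
  define K where "K u = {(d, e). d \<in> carrier D \<and> e \<in> carrier E \<and> \<beta> d e \<sqsubseteq>\<^bsub>F\<^esub> u}" for u
  have K: "K u \<in> carrier T" if u: "u \<in> carrier F" for u
  proof (rule tensor_memI)
    fix d e d' e'
    assume *: "(d, e) \<in> K u" "d' \<in> carrier D" "e' \<in> carrier E" "d' \<sqsubseteq>\<^bsub>D\<^esub> d" "e' \<sqsubseteq>\<^bsub>E\<^esub> e"
    then have c: "d \<in> carrier D" "e \<in> carrier E" "\<beta> d e \<sqsubseteq>\<^bsub>F\<^esub> u" by (auto simp: K_def)
    have "\<beta> d' e' \<sqsubseteq>\<^bsub>F\<^esub> \<beta> d e"
      using F.le_trans[OF ml[of d' d e'] mr[of d e' e]] * c \<beta>c by simp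
    then have "\<beta> d' e' \<sqsubseteq>\<^bsub>F\<^esub> u" using F.le_trans[of "\<beta> d' e'" "\<beta> d e" u] * c \<beta>c u by simp
    then show "(d', e') \<in> K u" using * by (simp add: K_def)
  next
    fix A e
    assume *: "A \<subseteq> carrier D" "e \<in> carrier E" "\<And>a. a \<in> A \<Longrightarrow> (a, e) \<in> K u"
    have "\<Squnion>\<^bsub>F\<^esub> ((\<lambda>d. \<beta> d e) ` A) \<sqsubseteq>\<^bsub>F\<^esub> u"
      using * u \<beta>c by (intro F.sup_least) (auto simp: K_def)
    then show "(\<Squnion>\<^bsub>D\<^esub> A, e) \<in> K u" using * \<beta>l by (simp add: K_def)
  next
    fix d B
    assume *: "d \<in> carrier D" "B \<subseteq> carrier E" "\<And>b. b \<in> B \<Longrightarrow> (d, b) \<in> K u"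
    have "\<Squnion>\<^bsub>F\<^esub> (\<beta> d ` B) \<sqsubseteq>\<^bsub>F\<^esub> u"
      using * u \<beta>c by (intro F.sup_least) (auto simp: K_def)
    then show "(d, \<Squnion>\<^bsub>E\<^esub> B) \<in> K u" using * \<beta>r by (simp add: K_def)
  qed (auto simp: K_def)
  have sub: "{\<beta> d e | d e. (d, e) \<in> I} \<subseteq> carrier F" if "I \<in> carrier T" for I
    using tensor_memD(1,2)[OF that] \<beta>c by blast
  have hle: "?h I \<sqsubseteq>\<^bsub>F\<^esub> u \<longleftrightarrow> I \<subseteq> K u" if I: "I \<in> carrier T" and u: "u \<in> carrier F" for I u
  proof
    assume le: "?h I \<sqsubseteq>\<^bsub>F\<^esub> u"
    show "I \<subseteq> K u"
    proof (rule subrelI)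
      fix d e assume de: "(d, e) \<in> I"
      then have "\<beta> d e \<sqsubseteq>\<^bsub>F\<^esub> ?h I"
        using sub[OF I] I by (auto simp: tensor_lift_def intro!: F.sup_upper)
      then have "\<beta> d e \<sqsubseteq>\<^bsub>F\<^esub> u"
        using F.le_trans[OF _ le] de tensor_memD(1,2)[OF I de] \<beta>c sub[OF I] I u
        by (simp add: tensor_lift_def)
      then show "(d, e) \<in> K u" using tensor_memD(1,2)[OF I de] by (simp add: K_def)
    qed
  next
    assume "I \<subseteq> K u"
    then show "?h I \<sqsubseteq>\<^bsub>F\<^esub> u"
      using sub[OF I] I u by (auto simp: tensor_lift_def K_def intro!: F.sup_least)
  qed
  show 1: "?h \<in> carrier T \<rightarrow>\<^sub>E carrier F"
    using sub by (auto simp: tensor_lift_def)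
  have hc: "?h I \<in> carrier F" if "I \<in> carrier T" for I using 1 that by auto
  show "preserves_joins T F ?h"
    unfolding preserves_joins_def
  proof (intro allI impI)
    fix \<A> assume \<A>: "\<A> \<subseteq> carrier T"
    have img: "?h ` \<A> \<subseteq> carrier F" using hc \<A> by blast
    let ?u = "\<Squnion>\<^bsub>F\<^esub> (?h ` \<A>)"
    have u: "?u \<in> carrier F" using img by simp
    have S: "\<Squnion>\<^bsub>T\<^esub> \<A> \<in> carrier T" using \<A> by simp
    have "I \<subseteq> K ?u" if "I \<in> \<A>" for I
      using hle[of I ?u] F.sup_upper[OF img, of "?h I"] that \<A> u by blast
    then have "\<Squnion>\<^bsub>T\<^esub> \<A> \<sqsubseteq>\<^bsub>T\<^esub> K ?u" using \<A> K[OF u] by (intro T.sup_least) auto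
    then have a: "?h (\<Squnion>\<^bsub>T\<^esub> \<A>) \<sqsubseteq>\<^bsub>F\<^esub> ?u" using hle[OF S u] by simp
    have "?h I \<sqsubseteq>\<^bsub>F\<^esub> ?h (\<Squnion>\<^bsub>T\<^esub> \<A>)" if "I \<in> \<A>" for I
    proof -
      have I: "I \<in> carrier T" using that \<A> by blast
      have "I \<sqsubseteq>\<^bsub>T\<^esub> \<Squnion>\<^bsub>T\<^esub> \<A>" using T.sup_upper[OF \<A> that] .
      moreover have "\<Squnion>\<^bsub>T\<^esub> \<A> \<subseteq> K (?h (\<Squnion>\<^bsub>T\<^esub> \<A>))" using hle[OF S hc[OF S]] hc[OF S] by simp
      ultimately have "I \<subseteq> K (?h (\<Squnion>\<^bsub>T\<^esub> \<A>))" by auto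
      then show ?thesis using hle[OF I hc[OF S]] by simp
    qed
    then have "?u \<sqsubseteq>\<^bsub>F\<^esub> ?h (\<Squnion>\<^bsub>T\<^esub> \<A>)" using hc[OF S] img by (intro F.sup_least) auto
    then show "?h (\<Squnion>\<^bsub>T\<^esub> \<A>) = ?u" using a hc[OF S] u F.le_antisym by blast
  qed
  show "?h (pure_tensor D E d e) = \<beta> d e" if de: "d \<in> carrier D" "e \<in> carrier E" for d e
  proof -
    note P = pure_tensor_closed[OF de]
    have "pure_tensor D E d e \<subseteq> K (\<beta> d e)"
      using pure_tensor_le_iff[OF K[OF \<beta>c[OF de]] de] de \<beta>c[OF de] by (simp add: K_def)
    then have "?h (pure_tensor D E d e) \<sqsubseteq>\<^bsub>F\<^esub> \<beta> d e" using hle[OF P(1) \<beta>c[OF de]] by simp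
    moreover have "\<beta> d e \<sqsubseteq>\<^bsub>F\<^esub> ?h (pure_tensor D E d e)"
      using P sub[OF P(1)] by (auto simp: tensor_lift_def intro!: F.sup_upper)
    ultimately show ?thesis using hc[OF P(1)] \<beta>c[OF de] F.le_antisym by blast
  qed
  show "h = ?h"
    if h: "h \<in> carrier T \<rightarrow>\<^sub>E carrier F" "preserves_joins T F h"
      "\<And>d e. \<lbrakk>d \<in> carrier D; e \<in> carrier E\<rbrakk> \<Longrightarrow> h (pure_tensor D E d e) = \<beta> d e" for h
  proof (rule PiE_ext[OF h(1) 1])
    fix I assume I: "I \<in> carrier T"
    let ?P = "{pure_tensor D E d e | d e. (d, e) \<in> I}"
    have "?P \<subseteq> carrier T" using tensor_memD(1,2)[OF I] pure_tensor_closed by blast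
    then have "h (\<Squnion>\<^bsub>T\<^esub> ?P) = \<Squnion>\<^bsub>F\<^esub> (h ` ?P)" using h(2) by (simp add: preserves_joins_def)
    moreover have "h ` ?P = {\<beta> d e | d e. (d, e) \<in> I}"
    proof -
      have "h ` ?P = {h (pure_tensor D E d e) | d e. (d, e) \<in> I}" by blast
      also have "\<dots> = {\<beta> d e | d e. (d, e) \<in> I}"
      proof (rule Collect_cong)
        fix x
        show "(\<exists>d e. x = h (pure_tensor D E d e) \<and> (d, e) \<in> I) \<longleftrightarrow> (\<exists>d e. x = \<beta> d e \<and> (d, e) \<in> I)"
          using h(3) tensor_memD(1,2)[OF I] by metis
      qed
      finally show ?thesis .
    qed
    ultimately show "h I = ?h I"
      using tensor_eq_sup_pure[OF I] I by (simp add: tensor_lift_def)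
  qed
qed

lemma pure_tensor_eq_meet:
  assumes d: "d \<in> carrier D" and e: "e \<in> carrier E"
  shows "pure_tensor D E d e
    = \<Sqinter>\<^bsub>T\<^esub> {pure_tensor D E d \<top>\<^bsub>E\<^esub>, pure_tensor D E \<top>\<^bsub>D\<^esub> e}" (is "_ = \<Sqinter>\<^bsub>T\<^esub> {?A, ?B}")
proof -
  note c = pure_tensor_closed[OF d e] pure_tensor_closed[OF d E.top_closed]
    pure_tensor_closed[OF D.top_closed e]
  have sub: "{?A, ?B} \<subseteq> carrier T" using c by simp
  have "(d, e) \<in> ?A" using tensor_memD(3)[OF c(3,4) d e] d e by simp
  moreover have "(d, e) \<in> ?B" using tensor_memD(3)[OF c(5,6) d e] d e by simp
  ultimately have "pure_tensor D E d e \<sqsubseteq>\<^bsub>T\<^esub> \<Sqinter>\<^bsub>T\<^esub> {?A, ?B}"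
    using pure_tensor_le_iff[OF c(3) d e] pure_tensor_le_iff[OF c(5) d e]
    by (intro T.inf_greatest[OF sub c(1)]) auto
  moreover have "\<Sqinter>\<^bsub>T\<^esub> {?A, ?B} \<subseteq> pure_tensor D E d e"
  proof (rule subrelI)
    let ?botL = "{\<bottom>\<^bsub>D\<^esub>} \<times> carrier E" and ?botR = "carrier D \<times> {\<bottom>\<^bsub>E\<^esub>}"
    have botD: "x = \<bottom>\<^bsub>D\<^esub>" if "x \<in> carrier D" "x \<sqsubseteq>\<^bsub>D\<^esub> \<bottom>\<^bsub>D\<^esub>" for x
      using that D.le_antisym D.bottom_lower by auto
    have botE: "x = \<bottom>\<^bsub>E\<^esub>" if "x \<in> carrier E" "x \<sqsubseteq>\<^bsub>E\<^esub> \<bottom>\<^bsub>E\<^esub>" for x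
      using that E.le_antisym E.bottom_lower by auto
    define J where "J a b = {(x, y). x \<in> carrier D \<and> y \<in> carrier E \<and>
        (x = \<bottom>\<^bsub>D\<^esub> \<or> y = \<bottom>\<^bsub>E\<^esub> \<or> (x \<sqsubseteq>\<^bsub>D\<^esub> a \<and> y \<sqsubseteq>\<^bsub>E\<^esub> b))}" for a b
    have J: "J a b \<in> carrier T" if a: "a \<in> carrier D" and b: "b \<in> carrier E" for a b
    proof (rule tensor_memI)
      fix x y x' y'
      assume *: "(x, y) \<in> J a b" "x' \<in> carrier D" "y' \<in> carrier E" "x' \<sqsubseteq>\<^bsub>D\<^esub> x" "y' \<sqsubseteq>\<^bsub>E\<^esub> y"
      then have "x \<in> carrier D" "y \<in> carrier E"
        and "x = \<bottom>\<^bsub>D\<^esub> \<or> y = \<bottom>\<^bsub>E\<^esub> \<or> (x \<sqsubseteq>\<^bsub>D\<^esub> a \<and> y \<sqsubseteq>\<^bsub>E\<^esub> b)"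
        by (simp_all add: J_def)
      then have "x' = \<bottom>\<^bsub>D\<^esub> \<or> y' = \<bottom>\<^bsub>E\<^esub> \<or> (x' \<sqsubseteq>\<^bsub>D\<^esub> a \<and> y' \<sqsubseteq>\<^bsub>E\<^esub> b)"
        using D.le_trans[OF *(4), of a] E.le_trans[OF *(5), of b] botD botE * a b by blast
      then show "(x', y') \<in> J a b" using * by (simp add: J_def)
    next
      fix A y assume *: "A \<subseteq> carrier D" "y \<in> carrier E" "\<And>x. x \<in> A \<Longrightarrow> (x, y) \<in> J a b"
      show "(\<Squnion>\<^bsub>D\<^esub> A, y) \<in> J a b"
      proof (cases "y = \<bottom>\<^bsub>E\<^esub> \<or> A \<subseteq> {\<bottom>\<^bsub>D\<^esub>}")
        case True
        have "\<Squnion>\<^bsub>D\<^esub> A \<sqsubseteq>\<^bsub>D\<^esub> \<bottom>\<^bsub>D\<^esub>" if "A \<subseteq> {\<bottom>\<^bsub>D\<^esub>}"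
          using that * by (intro D.sup_least) auto
        then show ?thesis using True * botD by (auto simp: J_def)
      next
        case False
        then have "y \<sqsubseteq>\<^bsub>E\<^esub> b" using *(3) by (auto simp: J_def)
        moreover have "\<Squnion>\<^bsub>D\<^esub> A \<sqsubseteq>\<^bsub>D\<^esub> a"
          using * a False D.bottom_lower by (intro D.sup_least) (auto simp: J_def)
        ultimately show ?thesis using * by (auto simp: J_def)
      qed
    next
      fix x B assume *: "x \<in> carrier D" "B \<subseteq> carrier E" "\<And>y. y \<in> B \<Longrightarrow> (x, y) \<in> J a b"
      show "(x, \<Squnion>\<^bsub>E\<^esub> B) \<in> J a b"
      proof (cases "x = \<bottom>\<^bsub>D\<^esub> \<or> B \<subseteq> {\<bottom>\<^bsub>E\<^esub>}")
        case True
        have "\<Squnion>\<^bsub>E\<^esub> B \<sqsubseteq>\<^bsub>E\<^esub> \<bottom>\<^bsub>E\<^esub>" if "B \<subseteq> {\<bottom>\<^bsub>E\<^esub>}"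
          using that * by (intro E.sup_least) auto
        then show ?thesis using True * botE by (auto simp: J_def)
      next
        case False
        then have "x \<sqsubseteq>\<^bsub>D\<^esub> a" using *(3) by (auto simp: J_def)
        moreover have "\<Squnion>\<^bsub>E\<^esub> B \<sqsubseteq>\<^bsub>E\<^esub> b"
          using * b False E.bottom_lower by (intro E.sup_least) (auto simp: J_def)
        ultimately show ?thesis using * by (auto simp: J_def)
      qed
    qed (auto simp: J_def)
    fix x y assume xy: "(x, y) \<in> \<Sqinter>\<^bsub>T\<^esub> {?A, ?B}"
    have I: "\<Sqinter>\<^bsub>T\<^esub> {?A, ?B} \<in> carrier T" using sub by simp
    note xyc = tensor_memD(1,2)[OF I xy]
    have "?A \<subseteq> J d \<top>\<^bsub>E\<^esub>"
      using pure_tensor_le_iff[OF J[OF d E.top_closed] d E.top_closed] d by (simp add: J_def)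
    moreover have "\<Sqinter>\<^bsub>T\<^esub> {?A, ?B} \<sqsubseteq>\<^bsub>T\<^esub> ?A" by (rule T.inf_lower[OF sub]) simp
    ultimately have xA: "(x, y) \<in> J d \<top>\<^bsub>E\<^esub>" using xy by auto
    have "?B \<subseteq> J \<top>\<^bsub>D\<^esub> e"
      using pure_tensor_le_iff[OF J[OF D.top_closed e] D.top_closed e] e by (simp add: J_def)
    moreover have "\<Sqinter>\<^bsub>T\<^esub> {?A, ?B} \<sqsubseteq>\<^bsub>T\<^esub> ?B" by (rule T.inf_lower[OF sub]) simp
    ultimately have xB: "(x, y) \<in> J \<top>\<^bsub>D\<^esub> e" using xy by auto
    have sD: "\<Squnion>\<^bsub>D\<^esub> {} = \<bottom>\<^bsub>D\<^esub>" and sE: "\<Squnion>\<^bsub>E\<^esub> {} = \<bottom>\<^bsub>E\<^esub>"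
      using botD[of "\<Squnion>\<^bsub>D\<^esub> {}"] botE[of "\<Squnion>\<^bsub>E\<^esub> {}"] D.sup_least[of "{}" "\<bottom>\<^bsub>D\<^esub>"] E.sup_least[of "{}" "\<bottom>\<^bsub>E\<^esub>"]
      by auto
    show "(x, y) \<in> pure_tensor D E d e"
    proof (cases "x = \<bottom>\<^bsub>D\<^esub> \<or> y = \<bottom>\<^bsub>E\<^esub>")
      case True
      then show ?thesis
        using tensor_memD(4)[OF c(1), of "{}" y] tensor_memD(5)[OF c(1), of x "{}"] xyc sD sE by auto
    next
      case False
      then have "x \<sqsubseteq>\<^bsub>D\<^esub> d" "y \<sqsubseteq>\<^bsub>E\<^esub> e" using xA xB by (auto simp: J_def)
      then show ?thesis using tensor_memD(3)[OF c(1,2)] xyc by auto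
    qed
  qed
  ultimately show ?thesis by auto
qed

end

text \<open>
  An ACDL-morphism \<open>D + E \<rightarrow> D' + E'\<close> that restricts along the injections \<open>d \<mapsto> d \<otimes> 1\<close> and
  \<open>e \<mapsto> 1 \<otimes> e\<close> to \<open>f\<close> and \<open>g\<close>, i.e. the map \<open>f + g\<close>, is \<^const>\<open>tensor_map\<close> of \<open>f\<close> and \<open>g\<close>.
\<close>

theorem coproduct_map_eq_tensor_map:
  fixes D :: "('a, 'x) gorder_scheme" and E :: "('b, 'y) gorder_scheme"
    and D' :: "('c, 'z) gorder_scheme" and E' :: "('d, 'w) gorder_scheme"
  assumes "complete_lattice D" "complete_lattice E" "complete_lattice D'" "complete_lattice E'"
    and f: "f \<in> acdl_morphisms D D'" and g: "g \<in> acdl_morphisms E E'"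
    and h: "h \<in> acdl_morphisms (tensor D E) (tensor D' E')"
    and left: "\<And>d. d \<in> carrier D \<Longrightarrow>
      h (pure_tensor D E d \<top>\<^bsub>E\<^esub>) = pure_tensor D' E' (f d) \<top>\<^bsub>E'\<^esub>"
    and right: "\<And>e. e \<in> carrier E \<Longrightarrow>
      h (pure_tensor D E \<top>\<^bsub>D\<^esub> e) = pure_tensor D' E' \<top>\<^bsub>D'\<^esub> (g e)"
  shows "h = tensor_map D E D' E' f g"
proof -
  interpret S: two_complete_lattices D E using assms by (simp add: two_complete_lattices_def)
  interpret T: two_complete_lattices D' E' using assms by (simp add: two_complete_lattices_def)
  have fc: "f d \<in> carrier D'" if "d \<in> carrier D" for d using f that by (auto simp: acdl_morphisms_def)
  have gc: "g e \<in> carrier E'" if "e \<in> carrier E" for e using g that by (auto simp: acdl_morphisms_def)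
  have fj: "f (\<Squnion>\<^bsub>D\<^esub> A) = \<Squnion>\<^bsub>D'\<^esub> (f ` A)" if "A \<subseteq> carrier D" for A
    using f that by (auto simp: acdl_morphisms_def preserves_joins_def)
  have gj: "g (\<Squnion>\<^bsub>E\<^esub> B) = \<Squnion>\<^bsub>E'\<^esub> (g ` B)" if "B \<subseteq> carrier E" for B
    using g that by (auto simp: acdl_morphisms_def preserves_joins_def)
  have bc: "pure_tensor D' E' (f d) (g e) \<in> carrier (tensor D' E')"
    if "d \<in> carrier D" "e \<in> carrier E" for d e
    using T.pure_tensor_closed fc gc that by simp
  have bl: "pure_tensor D' E' (f (\<Squnion>\<^bsub>D\<^esub> A)) (g e)
      = \<Squnion>\<^bsub>tensor D' E'\<^esub> ((\<lambda>d. pure_tensor D' E' (f d) (g e)) ` A)"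
    if "A \<subseteq> carrier D" "e \<in> carrier E" for A e
  proof -
    have "f ` A \<subseteq> carrier D'" using that fc by blast
    then show ?thesis
      using T.pure_tensor_bimorphism fj[OF that(1)] gc[OF that(2)]
      by (simp add: bimorphism_def preserves_joins_def image_image)
  qed
  have br: "pure_tensor D' E' (f d) (g (\<Squnion>\<^bsub>E\<^esub> B))
      = \<Squnion>\<^bsub>tensor D' E'\<^esub> ((\<lambda>e. pure_tensor D' E' (f d) (g e)) ` B)"
    if "B \<subseteq> carrier E" "d \<in> carrier D" for B d
  proof -
    have "g ` B \<subseteq> carrier E'" using that gc by blast
    then show ?thesis
      using T.pure_tensor_bimorphism gj[OF that(1)] fc[OF that(2)]
      by (simp add: bimorphism_def preserves_joins_def image_image)
  qed
  have bi: "bimorphism D E (tensor D' E') (\<lambda>d e. pure_tensor D' E' (f d) (g e))"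
    using bc bl br by (simp add: bimorphism_def preserves_joins_def)
  have pure: "h (pure_tensor D E d e) = pure_tensor D' E' (f d) (g e)"
    if d: "d \<in> carrier D" and e: "e \<in> carrier E" for d e
  proof -
    let ?X = "{pure_tensor D E d \<top>\<^bsub>E\<^esub>, pure_tensor D E \<top>\<^bsub>D\<^esub> e}"
    have X: "?X \<subseteq> carrier (tensor D E)"
      using S.pure_tensor_closed d e S.D.top_closed S.E.top_closed by blast
    have hm: "h (\<Sqinter>\<^bsub>tensor D E\<^esub> Y) = \<Sqinter>\<^bsub>tensor D' E'\<^esub> (h ` Y)" if "Y \<subseteq> carrier (tensor D E)" for Y
      using h that by (simp add: acdl_morphisms_def preserves_meets_def)
    have "h (pure_tensor D E d e) = \<Sqinter>\<^bsub>tensor D' E'\<^esub> (h ` ?X)"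
      unfolding S.pure_tensor_eq_meet[OF d e] by (rule hm[OF X])
    also have "\<dots> = pure_tensor D' E' (f d) (g e)"
      by (simp add: left[OF d] right[OF e] T.pure_tensor_eq_meet[OF fc[OF d] gc[OF e]])
    finally show ?thesis .
  qed
  show ?thesis
    unfolding tensor_map_def
    using h pure
    by (intro S.tensor_universal(4)[OF T.tensor_complete_lattice bi])
      (simp_all add: acdl_morphisms_def)
qed

end

theory Submission
  imports Defs
begin

text \<open>
  An ACDL is a complete lattice in which every element is a join of completely join-primes, so
  identities in iterated tensor products can be checked on tensors of such primes. An element of
  \<open>C \<otimes> C\<close> is a set of pairs, and \<open>\<gamma>(c) = {(a, b). b \<le> a \ c}\<close>, \<open>\<epsilon>(c) \<longleftrightarrow> e \<le> c\<close> translate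
  derivation ACDLs into comonoids and back; coassociativity becomes \<open>p \ (c / r) = (p \ c) / r\<close> for
  primes. For morphisms, the element \<open>x\<close> required by (Back) for \<open>y\<close> is the value at \<open>y\<close> of the left
  adjoint of \<open>f\<close>.

  The dual of an ordered monoid \<open>M\<close> is its lattice of upsets with
  \<open>A \ C = {b. \<forall>a \<in> A. a \<cdot> b \<in> C}\<close>, and a relational morphism \<open>\<rho>\<close> acts by
  \<open>V \<mapsto> {x. \<rho> x \<inter> V \<noteq> {}}\<close>. The monoid is recovered from a derivation ACDL as its set of
  completely join-primes: purity says that the product \<open>p \<cdot> q = \<Sqinter> {c. q \<le> p \ c}\<close> of primes is prime.
\<close>

section \<open>Equivalences of categories\<close>

text \<open>\<open>DerACDL\<close> is the hub: the passage to comonoids keeps carriers, orders and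
  arrows and only renames objects, so the category axioms and the duality are proved for residuals
  and carried over. The passage works because an element of the tensor product, a set of pairs
  closed downwards and under joins in each variable, is the graph of a Galois connection, whose two
  halves are \<open>a \<rightharpoondown> c\<close> and \<open>c \<leftharpoondown> b\<close>. The
  obstacle is that joins in the tensor product are not unions. They do agree with unions on pairs of
  primes, and this is why purity asks residuals by primes to preserve joins. It also forces the
  detour through \<open>spatial_lattice\<close>: the definition of an ACDL mentions compact elements
  and choice functions but no primes, and enough primes have to be produced by Zorn's lemma. A
  second obstacle is one of types: primes have type \<open>'a set\<close> while monoids live on
  \<open>'a\<close>, so the monoid of primes is rebuilt on a small set along a bijection, and a
  lattice is recovered up to isomorphism. Both dualities use the object map
  \<open>upset_residuation\<close>; they differ in the bijections between hom-sets.\<close>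

lemma (in category) opposite_category: "category (opposite C)"
  by unfold_locales
    (auto simp: opposite_def Id_in_Hom Comp_in_Hom Comp_Id_left Comp_Id_right Comp_assoc)

text \<open>Extensional functions under \<open>compose\<close> satisfy the unit and associativity
  laws by themselves, so a category of structured sets only owes closure under identities and
  composition. Relational morphisms compose differently and are not covered.\<close>

lemma concrete_category:
  fixes C :: "('o, 'a \<Rightarrow> 'a) cat" and U :: "'o \<Rightarrow> 'a set"
  assumes Id: "\<And>X. Id C X = (\<lambda>x \<in> U X. x)"
    and Comp: "\<And>X Y Z f g. Comp C X Y Z g f = compose (U X) g f"
    and Hom: "\<And>X Y f. f \<in> Hom C X Y \<Longrightarrow> f \<in> U X \<rightarrow>\<^sub>E U Y"
    and Id_Hom: "\<And>X. X \<in> Ob C \<Longrightarrow> (\<lambda>x \<in> U X. x) \<in> Hom C X X"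
    and Comp_Hom: "\<And>X Y Z f g. \<lbrakk>X \<in> Ob C; Y \<in> Ob C; Z \<in> Ob C; f \<in> Hom C X Y; g \<in> Hom C Y Z\<rbrakk>
      \<Longrightarrow> compose (U X) g f \<in> Hom C X Z"
  shows "category C"
proof
  fix X Y f assume "f \<in> Hom C X Y"
  then have f: "f \<in> U X \<rightarrow> U Y" "f \<in> extensional (U X)" using Hom by (auto simp: PiE_iff)
  show "Comp C X Y Y (Id C Y) f = f" "Comp C X X Y f (Id C X) = f"
    using Id_compose[OF f] compose_Id[OF f] by (simp_all add: Id Comp)
next
  fix W X Y Z f g h assume "f \<in> Hom C W X"
  then have "f \<in> U W \<rightarrow> U X" using Hom by (auto simp: PiE_iff)
  from compose_assoc[OF this]
  show "Comp C W Y Z h (Comp C W X Y g f) = Comp C W X Z (Comp C X Y Z h g) f" by (simp add: Comp)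
qed (simp_all add: Id Comp Id_Hom Comp_Hom)

section \<open>Fully faithful and essentially surjective functors\<close>

locale full_faithful_surjective = cat_functor A B Fo Fm
  for A :: "('o, 'm) cat" and B :: "('p, 'n) cat"
    and Fo :: "'o \<Rightarrow> 'p" and Fm :: "'o \<Rightarrow> 'o \<Rightarrow> 'm \<Rightarrow> 'n" +
  assumes full_faithful:
      "\<lbrakk>X \<in> Ob A; Y \<in> Ob A\<rbrakk> \<Longrightarrow> bij_betw (Fm X Y) (Hom A X Y) (Hom B (Fo X) (Fo Y))"
    and essentially_surjective: "Z \<in> Ob B \<Longrightarrow> \<exists>X \<in> Ob A. \<exists>f. iso_arrow B (Fo X) Z f"
begin

lemma Fm_eqD:
  assumes "X \<in> Ob A" "Y \<in> Ob A" "f \<in> Hom A X Y" "g \<in> Hom A X Y" "Fm X Y f = Fm X Y g"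
  shows "f = g"
  using inj_onD[OF bij_betw_imp_inj_on[OF full_faithful[OF assms(1,2)]]] assms(3-5) by blast

text \<open>The quasi-inverse sends \<open>Z\<close> to a chosen \<open>Go Z\<close> with an
  isomorphism \<open>t Z\<close> from \<open>Fo (Go Z)\<close> to \<open>Z\<close>, and an arrow to
  the preimage of its conjugate by these isomorphisms. Since \<open>Fm\<close> is injective on
  hom-sets, equations in \<open>A\<close> are checked after applying \<open>Fm\<close>.\<close>

theorem equivalent: "equivalent_categories A B"
proof -
  \<comment> \<open>The membership \<open>Z \<in> Ob B\<close> stands under the existential
    quantifiers so that the choice functions \<open>Go\<close>, \<open>t\<close> and
    \<open>s\<close> are total.\<close>
  have "\<forall>Z. \<exists>X f g. Z \<in> Ob B \<longrightarrow> X \<in> Ob A \<and> f \<in> Hom B (Fo X) Z \<and> g \<in> Hom B Z (Fo X) \<and>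
      Comp B (Fo X) Z (Fo X) g f = Id B (Fo X) \<and> Comp B Z (Fo X) Z f g = Id B Z"
    using essentially_surjective unfolding iso_arrow_def by meson
  then obtain Go t s where *: "\<And>Z. Z \<in> Ob B \<longrightarrow> Go Z \<in> Ob A \<and> t Z \<in> Hom B (Fo (Go Z)) Z \<and>
      s Z \<in> Hom B Z (Fo (Go Z)) \<and>
      Comp B (Fo (Go Z)) Z (Fo (Go Z)) (s Z) (t Z) = Id B (Fo (Go Z)) \<and>
      Comp B Z (Fo (Go Z)) Z (t Z) (s Z) = Id B Z"
    by metis
  note Go = *[rule_format, THEN conjunct1]
    and t = *[rule_format, THEN conjunct2, THEN conjunct1]
    and s = *[rule_format, THEN conjunct2, THEN conjunct2, THEN conjunct1]
    and st = *[rule_format, THEN conjunct2, THEN conjunct2, THEN conjunct2, THEN conjunct1]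
    and ts = *[rule_format, THEN conjunct2, THEN conjunct2, THEN conjunct2, THEN conjunct2]
  define pre where "pre X Y g = inv_into (Hom A X Y) (Fm X Y) g" for X Y g
  have pre: "pre X Y g \<in> Hom A X Y" "Fm X Y (pre X Y g) = g"
    if "X \<in> Ob A" "Y \<in> Ob A" "g \<in> Hom B (Fo X) (Fo Y)" for X Y g
    using bij_betw_imp_surj_on[OF full_faithful[OF that(1,2)]] that(3)
    by (auto simp: pre_def inv_into_into f_inv_into_f)
  \<comment> \<open>The conjugate of \<open>g\<close>, with \<open>s Z'\<close> inverse to
    \<open>t Z'\<close>; it is the image under \<open>Fm\<close> that the arrow
    \<open>Gm Z Z' g\<close> must have.\<close>
  define mid where "mid Z Z' g = Comp B (Fo (Go Z)) Z (Fo (Go Z')) (Comp B Z Z' (Fo (Go Z')) (s Z') g) (t Z)"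
    for Z Z' g
  have FG: "Fo (Go Z) \<in> Ob B" if "Z \<in> Ob B" for Z using Fo_in_Ob Go that by blast
  have mid: "mid Z Z' g \<in> Hom B (Fo (Go Z)) (Fo (Go Z'))"
    if "Z \<in> Ob B" "Z' \<in> Ob B" "g \<in> Hom B Z Z'" for Z Z' g
    unfolding mid_def using that FG s t by (meson B.Comp_in_Hom)
  have t_mid: "Comp B (Fo (Go Z)) (Fo (Go Z')) Z' (t Z') (mid Z Z' g) = Comp B (Fo (Go Z)) Z Z' g (t Z)"
    if "Z \<in> Ob B" "Z' \<in> Ob B" "g \<in> Hom B Z Z'" for Z Z' g
  proof -
    have sg: "Comp B Z Z' (Fo (Go Z')) (s Z') g \<in> Hom B Z (Fo (Go Z'))"
      using that FG s by (meson B.Comp_in_Hom)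
    have "Comp B (Fo (Go Z)) (Fo (Go Z')) Z' (t Z') (mid Z Z' g)
      = Comp B (Fo (Go Z)) Z Z' (Comp B Z (Fo (Go Z')) Z' (t Z') (Comp B Z Z' (Fo (Go Z')) (s Z') g)) (t Z)"
      unfolding mid_def using that FG s t sg by (intro B.Comp_assoc) auto
    also have "Comp B Z (Fo (Go Z')) Z' (t Z') (Comp B Z Z' (Fo (Go Z')) (s Z') g)
      = Comp B Z Z' Z' (Comp B Z' (Fo (Go Z')) Z' (t Z') (s Z')) g"
      using that FG s t by (intro B.Comp_assoc) auto
    also have "\<dots> = g" using that ts B.Comp_Id_left by simp
    finally show ?thesis .
  qed
  \<comment> \<open>\<open>t Z'\<close> can be cancelled on the left, so the conjugate is the only
    arrow that completes the naturality square of \<open>t\<close>. Both functor laws of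
    \<open>Gm\<close> reduce to this uniqueness.\<close>
  have mid_eqI: "h = mid Z Z' g"
    if "Z \<in> Ob B" "Z' \<in> Ob B" "g \<in> Hom B Z Z'" "h \<in> Hom B (Fo (Go Z)) (Fo (Go Z'))"
      "Comp B (Fo (Go Z)) (Fo (Go Z')) Z' (t Z') h = Comp B (Fo (Go Z)) Z Z' g (t Z)" for Z Z' g h
  proof -
    have cancel: "k = Comp B (Fo (Go Z)) Z' (Fo (Go Z')) (s Z') (Comp B (Fo (Go Z)) (Fo (Go Z')) Z' (t Z') k)"
      if "k \<in> Hom B (Fo (Go Z)) (Fo (Go Z'))" for k
    proof -
      have "Comp B (Fo (Go Z)) Z' (Fo (Go Z')) (s Z') (Comp B (Fo (Go Z)) (Fo (Go Z')) Z' (t Z') k)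
        = Comp B (Fo (Go Z)) (Fo (Go Z')) (Fo (Go Z')) (Comp B (Fo (Go Z')) Z' (Fo (Go Z')) (s Z') (t Z')) k"
        using that \<open>Z \<in> Ob B\<close> \<open>Z' \<in> Ob B\<close> FG s t by (intro B.Comp_assoc) auto
      then show ?thesis using st \<open>Z \<in> Ob B\<close> \<open>Z' \<in> Ob B\<close> FG that by (simp add: B.Comp_Id_left)
    qed
    show ?thesis
      using cancel[OF that(4)] cancel[OF mid[OF that(1-3)]] that(5) t_mid[OF that(1-3)] by simp
  qed
  define Gm where "Gm Z Z' g = pre (Go Z) (Go Z') (mid Z Z' g)" for Z Z' g
  have Gm: "Gm Z Z' g \<in> Hom A (Go Z) (Go Z')" "Fm (Go Z) (Go Z') (Gm Z Z' g) = mid Z Z' g"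
    if "Z \<in> Ob B" "Z' \<in> Ob B" "g \<in> Hom B Z Z'" for Z Z' g
    using pre[OF Go Go mid] that by (simp_all add: Gm_def)
  have G: "cat_functor B A Go Gm"
  proof unfold_locales
    fix Z assume Z: "Z \<in> Ob B"
    then show "Go Z \<in> Ob A" by (rule Go)
    have "Id B (Fo (Go Z)) = mid Z Z (Id B Z)"
      using Z FG t by (intro mid_eqI)
        (simp_all add: B.Id_in_Hom B.Comp_Id_left B.Comp_Id_right)
    then show "Gm Z Z (Id B Z) = Id A (Go Z)"
      using Z Go Gm by (intro Fm_eqD) (auto simp: B.Id_in_Hom A.Id_in_Hom Fm_Id)
  next
    fix X Y Z f g
    assume a: "X \<in> Ob B" "Y \<in> Ob B" "Z \<in> Ob B" "f \<in> Hom B X Y" "g \<in> Hom B Y Z"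
    let ?FG = "\<lambda>X. Fo (Go X)"
    note gf = B.Comp_in_Hom[OF a]
    have "Comp B (?FG X) (?FG Y) (?FG Z) (mid Y Z g) (mid X Y f) = mid X Z (Comp B X Y Z g f)"
    proof (rule mid_eqI[OF a(1,3) gf])
      show "Comp B (?FG X) (?FG Y) (?FG Z) (mid Y Z g) (mid X Y f) \<in> Hom B (?FG X) (?FG Z)"
        using mid a FG by (meson B.Comp_in_Hom)
      have "Comp B (?FG X) (?FG Z) Z (t Z) (Comp B (?FG X) (?FG Y) (?FG Z) (mid Y Z g) (mid X Y f))
        = Comp B (?FG X) (?FG Y) Z (Comp B (?FG Y) (?FG Z) Z (t Z) (mid Y Z g)) (mid X Y f)"
        using mid a FG t by (intro B.Comp_assoc) auto
      also have "\<dots> = Comp B (?FG X) (?FG Y) Z (Comp B (?FG Y) Y Z g (t Y)) (mid X Y f)"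
        using t_mid a by simp
      also have "\<dots> = Comp B (?FG X) Y Z g (Comp B (?FG X) (?FG Y) Y (t Y) (mid X Y f))"
        using mid a FG t by (intro B.Comp_assoc[symmetric]) auto
      also have "\<dots> = Comp B (?FG X) Y Z g (Comp B (?FG X) X Y f (t X))"
        using t_mid a by simp
      also have "\<dots> = Comp B (?FG X) X Z (Comp B X Y Z g f) (t X)"
        using a FG t by (intro B.Comp_assoc) auto
      finally show "Comp B (?FG X) (?FG Z) Z (t Z) (Comp B (?FG X) (?FG Y) (?FG Z) (mid Y Z g) (mid X Y f))
        = Comp B (?FG X) X Z (Comp B X Y Z g f) (t X)" .
    qed
    then show "Gm X Z (Comp B X Y Z g f) = Comp A (Go X) (Go Y) (Go Z) (Gm Y Z g) (Gm X Y f)"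
      using a Gm gf Go by (intro Fm_eqD) (auto simp: Fm_Comp intro!: A.Comp_in_Hom)
  qed (simp add: Gm)
  have \<theta>: "natural_iso B B (\<lambda>Z. Fo (Go Z)) (\<lambda>Z Z' g. Fm (Go Z) (Go Z') (Gm Z Z' g))
      (\<lambda>Z. Z) (\<lambda>Z Z' g. g) t"
  proof -
    have "iso_arrow B (Fo (Go Z)) Z (t Z)" if "Z \<in> Ob B" for Z
      unfolding iso_arrow_def using t s st ts that by blast
    then show ?thesis using t_mid Gm by (simp add: natural_iso_def)
  qed
  \<comment> \<open>The unit at \<open>X\<close> has to lie over an arrow from \<open>Fo X\<close>
    to \<open>Fo (Go (Fo X))\<close>, and \<open>s (Fo X)\<close> is one; the inverse of the unit
    lies over \<open>t (Fo X)\<close>.\<close>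
  define \<eta> where "\<eta> X = pre X (Go (Fo X)) (s (Fo X))" for X
  define \<eta>' where "\<eta>' X = pre (Go (Fo X)) X (t (Fo X))" for X
  have \<eta>: "\<eta> X \<in> Hom A X (Go (Fo X))" "Fm X (Go (Fo X)) (\<eta> X) = s (Fo X)"
    and \<eta>': "\<eta>' X \<in> Hom A (Go (Fo X)) X" "Fm (Go (Fo X)) X (\<eta>' X) = t (Fo X)"
    if "X \<in> Ob A" for X
    using that Go Fo_in_Ob pre s t by (simp_all add: \<eta>_def \<eta>'_def)
  have iso: "iso_arrow A X (Go (Fo X)) (\<eta> X)" if X: "X \<in> Ob A" for X
  proof -
    have "Comp A X (Go (Fo X)) X (\<eta>' X) (\<eta> X) = Id A X"
      using X \<eta>[OF X] \<eta>'[OF X] Go Fo_in_Ob ts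
      by (intro Fm_eqD[of X X]) (auto simp: Fm_Comp Fm_Id A.Id_in_Hom intro!: A.Comp_in_Hom)
    moreover have "Comp A (Go (Fo X)) X (Go (Fo X)) (\<eta> X) (\<eta>' X) = Id A (Go (Fo X))"
      using X \<eta>[OF X] \<eta>'[OF X] Go Fo_in_Ob st
      by (intro Fm_eqD[of "Go (Fo X)" "Go (Fo X)"]) (auto simp: Fm_Comp Fm_Id A.Id_in_Hom intro!: A.Comp_in_Hom)
    ultimately show ?thesis using \<eta>[OF X] \<eta>'[OF X] by (auto simp: iso_arrow_def)
  qed
  have nat: "Comp A X Y (Go (Fo Y)) (\<eta> Y) f
      = Comp A X (Go (Fo X)) (Go (Fo Y)) (Gm (Fo X) (Fo Y) (Fm X Y f)) (\<eta> X)"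
    if XY: "X \<in> Ob A" "Y \<in> Ob A" and f: "f \<in> Hom A X Y" for X Y f
  proof (rule Fm_eqD[of X "Go (Fo Y)"])
    note o = XY Go[OF Fo_in_Ob[OF XY(1)]] Go[OF Fo_in_Ob[OF XY(2)]]
    note b = Fo_in_Ob[OF XY(1)] Fo_in_Ob[OF XY(2)] 
    note g = Gm[OF b Fm_in_Hom[OF XY f]]
    show "X \<in> Ob A" "Go (Fo Y) \<in> Ob A" using o by auto
    show "Comp A X Y (Go (Fo Y)) (\<eta> Y) f \<in> Hom A X (Go (Fo Y))"
      using o \<eta>(1)[OF XY(2)] f A.Comp_in_Hom by blast
    show "Comp A X (Go (Fo X)) (Go (Fo Y)) (Gm (Fo X) (Fo Y) (Fm X Y f)) (\<eta> X) \<in> Hom A X (Go (Fo Y))"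
      using o g(1) \<eta>(1)[OF XY(1)] A.Comp_in_Hom by blast
    have "Fm X (Go (Fo Y)) (Comp A X (Go (Fo X)) (Go (Fo Y)) (Gm (Fo X) (Fo Y) (Fm X Y f)) (\<eta> X))
      = Comp B (Fo X) (Fo (Go (Fo X))) (Fo (Go (Fo Y))) (mid (Fo X) (Fo Y) (Fm X Y f)) (s (Fo X))"
      using o g \<eta>[OF XY(1)] by (simp add: Fm_Comp)
    \<comment> \<open>Rebracketing brings \<open>t (Fo X)\<close> next to \<open>s (Fo X)\<close>,
      where they cancel.\<close>
    also have "\<dots> = Comp B (Fo X) (Fo X) (Fo (Go (Fo Y)))
        (Comp B (Fo X) (Fo Y) (Fo (Go (Fo Y))) (s (Fo Y)) (Fm X Y f))
        (Comp B (Fo X) (Fo (Go (Fo X))) (Fo X) (t (Fo X)) (s (Fo X)))"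
      unfolding mid_def
      using b s t FG Fm_in_Hom[OF XY f]
      by (intro B.Comp_assoc[symmetric] B.Comp_in_Hom[of _ "Fo Y"]) auto
    also have "\<dots> = Comp B (Fo X) (Fo Y) (Fo (Go (Fo Y))) (s (Fo Y)) (Fm X Y f)"
      unfolding ts[OF b(1)]
      using b s t FG Fm_in_Hom[OF XY f]
      by (intro B.Comp_Id_right B.Comp_in_Hom[of _ "Fo Y"]) auto
    finally show "Fm X (Go (Fo Y)) (Comp A X Y (Go (Fo Y)) (\<eta> Y) f)
      = Fm X (Go (Fo Y)) (Comp A X (Go (Fo X)) (Go (Fo Y)) (Gm (Fo X) (Fo Y) (Fm X Y f)) (\<eta> X))"
      using o f \<eta>[OF XY(2)] by (simp add: Fm_Comp)
  qed
  have "natural_iso A A (\<lambda>X. X) (\<lambda>X Y f. f)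
      (\<lambda>X. Go (Fo X)) (\<lambda>X Y f. Gm (Fo X) (Fo Y) (Fm X Y f)) \<eta>"
    using iso nat by (simp add: natural_iso_def)
  then show ?thesis
    unfolding equivalent_categories_def using cat_functor_axioms G \<theta> by blast
qed

end

section \<open>Renaming the objects of a category while keeping its arrows\<close>

locale relabelling =
  fixes A :: "('o, 'm) cat" and B :: "('p, 'm) cat" and Fo :: "'o \<Rightarrow> 'p" and Go :: "'p \<Rightarrow> 'o"
  assumes source_category: "category A"
    and Fo_in_Ob: "X \<in> Ob A \<Longrightarrow> Fo X \<in> Ob B"
    and Go_in_Ob: "W \<in> Ob B \<Longrightarrow> Go W \<in> Ob A"
    and Go_Fo: "X \<in> Ob A \<Longrightarrow> Go (Fo X) = X"
    and Fo_Go: "W \<in> Ob B \<Longrightarrow> Fo (Go W) = W"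
    and Hom_Fo: "\<lbrakk>X \<in> Ob A; Y \<in> Ob A\<rbrakk> \<Longrightarrow> Hom B (Fo X) (Fo Y) = Hom A X Y"
    and Id_Fo: "X \<in> Ob A \<Longrightarrow> Id B (Fo X) = Id A X"
    and Comp_Fo: "\<lbrakk>X \<in> Ob A; Y \<in> Ob A; Z \<in> Ob A\<rbrakk> \<Longrightarrow> Comp B (Fo X) (Fo Y) (Fo Z) = Comp A X Y Z"
begin

lemma Hom_Go: "\<lbrakk>X \<in> Ob B; Y \<in> Ob B\<rbrakk> \<Longrightarrow> Hom A (Go X) (Go Y) = Hom B X Y"
  using Hom_Fo[of "Go X" "Go Y"] by (simp add: Go_in_Ob Fo_Go)

lemma Id_Go: "X \<in> Ob B \<Longrightarrow> Id A (Go X) = Id B X"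
  using Id_Fo[of "Go X"] by (simp add: Go_in_Ob Fo_Go)

lemma Comp_Go: "\<lbrakk>X \<in> Ob B; Y \<in> Ob B; Z \<in> Ob B\<rbrakk> \<Longrightarrow> Comp A (Go X) (Go Y) (Go Z) = Comp B X Y Z"
  using Comp_Fo[of "Go X" "Go Y" "Go Z"] by (simp add: Go_in_Ob Fo_Go)

text \<open>Hom-sets, identities and composition of \<open>B\<close> are those of \<open>A\<close>
  at the renamed objects, so the axioms pass from \<open>A\<close> to \<open>B\<close>.\<close>

lemma target_category: "category B"
proof -
  interpret A: category A by (rule source_category)
  show ?thesis
    by unfold_locales
      (auto simp: Hom_Go[symmetric] Id_Go[symmetric] Comp_Go[symmetric] Go_in_Ob A.Id_in_Hom
        A.Comp_in_Hom A.Comp_Id_left A.Comp_Id_right intro!: A.Comp_assoc)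
qed

lemma inverse: "relabelling B A Go Fo"
  by (simp add: relabelling_def target_category Fo_in_Ob Go_in_Ob Go_Fo Fo_Go Hom_Go Id_Go Comp_Go)

lemma relabelling_functor: "cat_functor A B Fo (\<lambda>X Y f. f)"
  using source_category target_category
  by (simp add: cat_functor_def cat_functor_axioms_def Fo_in_Ob Hom_Fo Id_Fo Comp_Fo)

theorem isomorphic: "isomorphic_categories A B"
  unfolding isomorphic_categories_def
  using relabelling_functor relabelling.relabelling_functor[OF inverse] Go_Fo Fo_Go by blast

text \<open>Renaming acts as the identity on arrows, so \<open>Hm\<close> remains the arrow map, and
  an isomorphism from \<open>Ho X\<close> to \<open>Go Z\<close> is literally one from
  \<open>Fo (Ho X)\<close> to \<open>Z\<close>. This turns each duality for residuation lattices
  into one for comonoids.\<close>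

theorem full_faithful_surjective_comp:
  assumes "full_faithful_surjective D A Ho Hm"
  shows "full_faithful_surjective D B (\<lambda>X. Fo (Ho X)) Hm"
proof -
  interpret H: full_faithful_surjective D A Ho Hm by (rule assms)
  interpret B: category B by (rule target_category)
  show ?thesis
  proof unfold_locales
    fix Z assume Z: "Z \<in> Ob B"
    then obtain X f where "X \<in> Ob D" "iso_arrow A (Ho X) (Go Z) f"
      using H.essentially_surjective Go_in_Ob by blast
    then have "iso_arrow B (Fo (Ho X)) Z f"
      using Z H.Fo_in_Ob Hom_Fo[of "Ho X" "Go Z"] Hom_Fo[of "Go Z" "Ho X"] Id_Fo[of "Ho X"]
        Id_Fo[of "Go Z"] Comp_Fo[of "Ho X" "Go Z" "Ho X"] Comp_Fo[of "Go Z" "Ho X" "Go Z"]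
      by (simp add: iso_arrow_def Go_in_Ob Fo_Go)
    then show "\<exists>X \<in> Ob D. \<exists>f. iso_arrow B (Fo (Ho X)) Z f" using \<open>X \<in> Ob D\<close> by blast
  qed (auto simp: H.Fo_in_Ob Fo_in_Ob Hom_Fo H.Fm_in_Hom H.Fm_Id Id_Fo H.Fm_Comp Comp_Fo
      intro!: H.full_faithful)
qed

end

section \<open>Completely join-primes in algebraic completely distributive lattices\<close>

lemma completely_join_primes_closed: "p \<in> completely_join_primes D \<Longrightarrow> p \<in> carrier D"
  by (simp add: completely_join_primes_def)

context complete_lattice
begin

lemma le_inf_iff:
  assumes "A \<subseteq> carrier L" "x \<in> carrier L" shows "x \<sqsubseteq> \<Sqinter> A \<longleftrightarrow> (\<forall>a \<in> A. x \<sqsubseteq> a)"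
proof
  show "\<forall>a \<in> A. x \<sqsubseteq> a" if "x \<sqsubseteq> \<Sqinter> A"
    using le_trans[OF that inf_lower[OF assms(1)]] assms by (simp add: subset_iff)
  show "x \<sqsubseteq> \<Sqinter> A" if "\<forall>a \<in> A. x \<sqsubseteq> a"
    using assms that by (intro inf_greatest) auto
qed

lemma sup_le_iff:
  assumes "A \<subseteq> carrier L" "x \<in> carrier L" shows "\<Squnion> A \<sqsubseteq> x \<longleftrightarrow> (\<forall>a \<in> A. a \<sqsubseteq> x)"
proof
  show "\<forall>a \<in> A. a \<sqsubseteq> x" if "\<Squnion> A \<sqsubseteq> x"
    using le_trans[OF sup_upper[OF assms(1)] that] assms by (simp add: subset_iff)
  show "\<Squnion> A \<sqsubseteq> x" if "\<forall>a \<in> A. a \<sqsubseteq> x"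
    using assms that by (intro sup_least) auto
qed

lemma prime_le_sup_iff:
  assumes "p \<in> completely_join_primes L" "A \<subseteq> carrier L"
  shows "p \<sqsubseteq> \<Squnion> A \<longleftrightarrow> (\<exists>a \<in> A. p \<sqsubseteq> a)"
proof
  show "\<exists>a \<in> A. p \<sqsubseteq> a" if "p \<sqsubseteq> \<Squnion> A"
    using assms that unfolding completely_join_primes_def by blast
  show "p \<sqsubseteq> \<Squnion> A" if "\<exists>a \<in> A. p \<sqsubseteq> a"
  proof -
    from that obtain a where a: "a \<in> A" "p \<sqsubseteq> a" ..
    then show ?thesis
      using le_trans[OF a(2) sup_upper[OF assms(2) a(1)]] assms completely_join_primes_closed[OF assms(1)]
      by auto
  qed
qed

lemma eq_lowerI:
  assumes "x \<in> carrier L" "y \<in> carrier L" "\<And>z. z \<in> carrier L \<Longrightarrow> z \<sqsubseteq> x \<longleftrightarrow> z \<sqsubseteq> y"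
  shows "x = y"
  using assms(3)[OF assms(1)] assms(3)[OF assms(2)] by (intro le_antisym) (simp_all add: assms)

text \<open>The bottom lies below the empty join, which has no term for a prime to be below. Needed
  where a unitor sends a pair to the bottom.\<close>

lemma prime_not_le_bottom: "p \<in> completely_join_primes L \<Longrightarrow> \<not> p \<sqsubseteq> \<bottom>"
proof
  assume p: "p \<in> completely_join_primes L" "p \<sqsubseteq> \<bottom>"
  have "p \<sqsubseteq> \<Squnion> {}"
    using le_trans[OF p(2), of "\<Squnion> {}"] bottom_lower completely_join_primes_closed[OF p(1)] by simp
  then show False using prime_le_sup_iff[OF p(1), of "{}"] by simp
qed

end

text \<open>Equivalent to \<^locale>\<open>acdl\<close>, see \<open>acdl_iff_spatial_lattice\<close>.\<close>

locale spatial_lattice = complete_lattice D for D (structure) +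
  assumes le_primesI:
    "\<lbrakk>x \<in> carrier D; y \<in> carrier D; \<And>p. \<lbrakk>p \<in> completely_join_primes D; p \<sqsubseteq> x\<rbrakk> \<Longrightarrow> p \<sqsubseteq> y\<rbrakk>
     \<Longrightarrow> x \<sqsubseteq> y"
begin

lemma eq_primesI:
  assumes "x \<in> carrier D" "y \<in> carrier D"
    "\<And>p. p \<in> completely_join_primes D \<Longrightarrow> p \<sqsubseteq> x \<longleftrightarrow> p \<sqsubseteq> y"
  shows "x = y"
  by (rule le_antisym[OF le_primesI le_primesI]) (simp_all add: assms)

lemma sup_primes:
  assumes "x \<in> carrier D" shows "\<Squnion> {p \<in> completely_join_primes D. p \<sqsubseteq> x} = x"
proof (rule eq_primesI)
  have c: "{p \<in> completely_join_primes D. p \<sqsubseteq> x} \<subseteq> carrier D"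
    by (auto dest: completely_join_primes_closed)
  then show "\<Squnion> {p \<in> completely_join_primes D. p \<sqsubseteq> x} \<in> carrier D" by simp
  fix p assume p: "p \<in> completely_join_primes D"
  have "p \<sqsubseteq> x" if "q \<in> completely_join_primes D" "q \<sqsubseteq> x" "p \<sqsubseteq> q" for q
    by (rule le_trans[OF that(3,2)])
      (simp_all add: assms completely_join_primes_closed[OF p] completely_join_primes_closed[OF that(1)])
  moreover have "p \<sqsubseteq> p" using completely_join_primes_closed[OF p] by simp
  ultimately show "p \<sqsubseteq> \<Squnion> {p \<in> completely_join_primes D. p \<sqsubseteq> x} \<longleftrightarrow> p \<sqsubseteq> x"
    using prime_le_sup_iff[OF p c] p by auto
qed (rule assms)

text \<open>Primes are compact, with covers reducible to one element, which gives algebraicity.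
  Complete distributivity is tested on primes, for which being below a join means being below a
  member.\<close>

lemma acdl: "acdl D"
proof (unfold_locales)
  fix x assume x: "x \<in> carrier D"
  let ?K = "{k \<in> carrier D. k \<sqsubseteq> x \<and>
    (\<forall>A. A \<subseteq> carrier D \<and> k \<sqsubseteq> \<Squnion> A \<longrightarrow> (\<exists>F. finite F \<and> F \<subseteq> A \<and> k \<sqsubseteq> \<Squnion> F))}"
  have K: "?K \<subseteq> carrier D" by blast
  show "x = \<Squnion> ?K"
  proof (rule le_antisym)
    show "x \<sqsubseteq> \<Squnion> ?K"
    proof (rule le_primesI)
      fix p assume p: "p \<in> completely_join_primes D" "p \<sqsubseteq> x"
      note pc = completely_join_primes_closed[OF p(1)]
      have "\<exists>F. finite F \<and> F \<subseteq> A \<and> p \<sqsubseteq> \<Squnion> F" if A: "A \<subseteq> carrier D" "p \<sqsubseteq> \<Squnion> A" for A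
      proof -
        obtain a where "a \<in> A" "p \<sqsubseteq> a" using prime_le_sup_iff[OF p(1) A(1)] A(2) by blast
        then show ?thesis using A by (intro exI[of _ "{a}"]) auto
      qed
      then have "p \<in> ?K" using p pc by blast
      then show "p \<sqsubseteq> \<Squnion> ?K" by (rule sup_upper[OF K])
    qed (use x K in auto)
    show "\<Squnion> ?K \<sqsubseteq> x" using x by (intro sup_least) auto
  qed (use x K in auto)
next
  fix \<A> :: "'a set set" assume \<A>: "\<forall>A \<in> \<A>. A \<subseteq> carrier D"
  let ?L = "(\<lambda>A. \<Squnion> A) ` \<A>" and ?R = "{\<Sqinter> (\<phi> ` \<A>) | \<phi>. \<forall>A \<in> \<A>. \<phi> A \<in> A}"
  have \<phi>: "\<phi> ` \<A> \<subseteq> carrier D" if "\<forall>A \<in> \<A>. \<phi> A \<in> A" for \<phi>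
    using that \<A> by blast
  have c: "?L \<subseteq> carrier D" "?R \<subseteq> carrier D" using \<A> \<phi> by auto
  show "\<Sqinter> ?L = \<Squnion> ?R"
  proof (rule eq_primesI)
    fix p assume p: "p \<in> completely_join_primes D"
    note pc = completely_join_primes_closed[OF p]
    have "p \<sqsubseteq> \<Sqinter> ?L \<longleftrightarrow> (\<forall>A \<in> \<A>. \<exists>a \<in> A. p \<sqsubseteq> a)"
    proof -
      have "(\<forall>a \<in> ?L. p \<sqsubseteq> a) \<longleftrightarrow> (\<forall>A \<in> \<A>. p \<sqsubseteq> \<Squnion> A)" by blast
      then show ?thesis using le_inf_iff[OF c(1) pc] prime_le_sup_iff[OF p] \<A> by simp
    qed
    \<comment> \<open>For a prime the distributive law has become the axiom of choice.\<close>
    also have "\<dots> \<longleftrightarrow> (\<exists>\<phi>. (\<forall>A \<in> \<A>. \<phi> A \<in> A) \<and> (\<forall>A \<in> \<A>. p \<sqsubseteq> \<phi> A))"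
      by metis
    also have "\<dots> \<longleftrightarrow> (\<exists>\<phi>. (\<forall>A \<in> \<A>. \<phi> A \<in> A) \<and> p \<sqsubseteq> \<Sqinter> (\<phi> ` \<A>))"
    proof -
      have "(\<forall>A \<in> \<A>. p \<sqsubseteq> \<phi> A) \<longleftrightarrow> p \<sqsubseteq> \<Sqinter> (\<phi> ` \<A>)" if "\<forall>A \<in> \<A>. \<phi> A \<in> A" for \<phi>
        using le_inf_iff[OF \<phi>[OF that] pc] by simp
      then show ?thesis by meson
    qed
    also have "\<dots> \<longleftrightarrow> p \<sqsubseteq> \<Squnion> ?R"
      unfolding prime_le_sup_iff[OF p c(2)] by blast
    finally show "p \<sqsubseteq> \<Sqinter> ?L \<longleftrightarrow> p \<sqsubseteq> \<Squnion> ?R" .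
  qed (rule inf_closed[OF c(1)] sup_closed[OF c(2)])+
qed

end

text \<open>
  Given a compact \<open>k\<close> below \<open>x\<close> but not below \<open>y\<close>, an element \<open>m\<close> maximal among those above \<open>y\<close>
  and not above \<open>k\<close> is completely meet-prime, and the meet of all elements not below \<open>m\<close> is a
  completely join-prime that is below \<open>x\<close> but not below \<open>y\<close>.
\<close>

lemma (in acdl) ex_prime_separating:
  assumes x: "x \<in> carrier D" and y: "y \<in> carrier D" and nle: "\<not> x \<sqsubseteq> y"
  shows "\<exists>p \<in> completely_join_primes D. p \<sqsubseteq> x \<and> \<not> p \<sqsubseteq> y"
proof -
  let ?K = "{k \<in> carrier D. k \<sqsubseteq> x \<and>
    (\<forall>A. A \<subseteq> carrier D \<and> k \<sqsubseteq> \<Squnion> A \<longrightarrow> (\<exists>F. finite F \<and> F \<subseteq> A \<and> k \<sqsubseteq> \<Squnion> F))}"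
  have K: "?K \<subseteq> carrier D" by (rule Collect_subset)
  have "\<not> \<Squnion> ?K \<sqsubseteq> y" unfolding algebraic[OF x, symmetric] by (rule nle)
  then have "\<exists>k \<in> ?K. \<not> k \<sqsubseteq> y" unfolding sup_le_iff[OF K y] by simp
  then obtain k where "k \<in> ?K" "\<not> k \<sqsubseteq> y" ..
  then have k: "k \<in> carrier D" "k \<sqsubseteq> x" "\<not> k \<sqsubseteq> y"
    and compact: "\<And>A. \<lbrakk>A \<subseteq> carrier D; k \<sqsubseteq> \<Squnion> A\<rbrakk> \<Longrightarrow> \<exists>F. finite F \<and> F \<subseteq> A \<and> k \<sqsubseteq> \<Squnion> F"
    by auto
  let ?Z = "{z \<in> carrier D. y \<sqsubseteq> z \<and> \<not> k \<sqsubseteq> z}"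
  have "\<exists>m \<in> ?Z. \<forall>a \<in> ?Z. m \<sqsubseteq> a \<longrightarrow> a = m"
  proof (rule predicate_Zorn)
    show "partial_order_on ?Z (relation_of (\<sqsubseteq>) ?Z)"
      by (rule partial_order_on_relation_ofI) (auto intro: le_trans le_antisym)
    fix C assume "C \<in> Chains (relation_of (\<sqsubseteq>) ?Z)"
    then have C: "\<And>a b. \<lbrakk>a \<in> C; b \<in> C\<rbrakk> \<Longrightarrow> a \<in> ?Z \<and> b \<in> ?Z \<and> (a \<sqsubseteq> b \<or> b \<sqsubseteq> a)"
      by (auto simp: Chains_def relation_of_def)
    then have CZ: "C \<subseteq> ?Z" by blast
    \<comment> \<open>\<open>y\<close> is adjoined so that the empty chain has an upper bound in
      \<open>?Z\<close> as well.\<close>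
    let ?A = "insert y C"
    have A: "?A \<subseteq> carrier D" using CZ y by blast
    have "\<not> k \<sqsubseteq> \<Squnion> ?A"
    proof
      assume "k \<sqsubseteq> \<Squnion> ?A"
      then obtain F where F: "finite F" "F \<subseteq> ?A" "k \<sqsubseteq> \<Squnion> F" using compact[OF A] by blast
      \<comment> \<open>Some member of the chain, or \<open>y\<close>, bounds the finite set
        \<open>F\<close>, so \<open>k\<close> would already lie below it.\<close>
      have "\<exists>m \<in> ?A. \<forall>a \<in> F. a \<sqsubseteq> m" using F(1,2)
      proof induction
        case (insert b F)
        then obtain m where m: "m \<in> ?A" "\<forall>a \<in> F. a \<sqsubseteq> m" by blast
        have tot: "b \<sqsubseteq> m \<or> m \<sqsubseteq> b" using C m(1) insert.prems y by (auto intro: le_refl)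
        show ?case
        proof (cases "b \<sqsubseteq> m")
          case True then show ?thesis using m by auto
        next
          case False
          with tot have "m \<sqsubseteq> b" by simp
          have c: "b \<in> carrier D" "m \<in> carrier D" "F \<subseteq> carrier D" using m A insert.prems by auto
          have "a \<sqsubseteq> b" if "a \<in> F" for a
            using le_trans[OF m(2)[rule_format, OF that] \<open>m \<sqsubseteq> b\<close>] c that by auto
          then show ?thesis using insert.prems c by (intro bexI[of _ b]) auto
        qed
      qed blast
      then obtain m where m: "m \<in> ?A" "\<forall>a \<in> F. a \<sqsubseteq> m" by blast
      have "\<Squnion> F \<sqsubseteq> m" using m F(2) A by (intro sup_least) auto
      moreover have "F \<subseteq> carrier D" "m \<in> carrier D" using F(2) A m(1) by auto
      ultimately have "k \<sqsubseteq> m" using le_trans[OF F(3), of m] k(1) by simp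
      then show False using m(1) CZ k(3) by auto
    qed
    then have "\<Squnion> ?A \<in> ?Z" using A sup_upper[OF A, of y] by simp
    moreover have "\<forall>a \<in> C. a \<sqsubseteq> \<Squnion> ?A" using sup_upper[OF A] by simp
    ultimately show "\<exists>u \<in> ?Z. \<forall>a \<in> C. a \<sqsubseteq> u" by (rule rev_bexI)
  qed
  then obtain m where mZ: "m \<in> ?Z" and max: "\<forall>a \<in> ?Z. m \<sqsubseteq> a \<longrightarrow> a = m" ..
  from mZ have m: "m \<in> carrier D" "y \<sqsubseteq> m" "\<not> k \<sqsubseteq> m" by simp_all
  have meet_prime: "\<exists>a \<in> A. a \<sqsubseteq> m" if A: "A \<subseteq> carrier D" "\<Sqinter> A \<sqsubseteq> m" for A
  proof (rule ccontr)
    assume none: "\<not> (\<exists>a \<in> A. a \<sqsubseteq> m)"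
    \<comment> \<open>Distributivity is applied to the pairs \<open>{m, a}\<close>. By maximality of
      \<open>m\<close> every join of \<open>m\<close> and \<open>a\<close> lies above
      \<open>k\<close>; a choice function either picks \<open>m\<close> somewhere or picks out all
      of \<open>A\<close>, and in both cases its meet lies below \<open>m\<close>.\<close>
    let ?\<A> = "(\<lambda>a. {m, a}) ` A"
    have \<A>: "\<forall>B \<in> ?\<A>. B \<subseteq> carrier D" using m(1) A(1) by blast
    have "k \<sqsubseteq> \<Squnion> {m, a}" if a: "a \<in> A" for a
    proof (rule ccontr)
      assume not: "\<not> k \<sqsubseteq> \<Squnion> {m, a}"
      have c: "{m, a} \<subseteq> carrier D" using a m(1) A(1) by blast
      have "m \<sqsubseteq> \<Squnion> {m, a}" using sup_upper[OF c] by simp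
      then have "\<Squnion> {m, a} = m"
        using max[rule_format, of "\<Squnion> {m, a}"] not c m le_trans[OF m(2), of "\<Squnion> {m, a}"] y by simp
      moreover have "a \<sqsubseteq> \<Squnion> {m, a}" using sup_upper[OF c] by simp
      ultimately show False using none a by auto
    qed
    then have kle: "k \<sqsubseteq> \<Sqinter> ((\<lambda>B. \<Squnion> B) ` ?\<A>)"
      using \<A> k(1) by (intro inf_greatest) auto
    have "\<Sqinter> ((\<lambda>B. \<Squnion> B) ` ?\<A>) \<sqsubseteq> m"
      unfolding completely_distributive[OF \<A>]
    proof (rule sup_least)
      have \<phi>c: "\<phi> ` ?\<A> \<subseteq> carrier D" if "\<forall>B \<in> ?\<A>. \<phi> B \<in> B" for \<phi>
        using that \<A> by blast
      then show "{\<Sqinter> (\<phi> ` ?\<A>) | \<phi>. \<forall>B \<in> ?\<A>. \<phi> B \<in> B} \<subseteq> carrier D" by auto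
      fix z assume "z \<in> {\<Sqinter> (\<phi> ` ?\<A>) | \<phi>. \<forall>B \<in> ?\<A>. \<phi> B \<in> B}"
      then obtain \<phi> where \<phi>: "\<forall>B \<in> ?\<A>. \<phi> B \<in> B" and z: "z = \<Sqinter> (\<phi> ` ?\<A>)" by blast
      show "z \<sqsubseteq> m"
      proof (cases "m \<in> \<phi> ` ?\<A>")
        case True
        then show ?thesis using inf_lower[OF \<phi>c[OF \<phi>]] z by simp
      next
        case False
        have "\<phi> {m, a} = a" if "a \<in> A" for a
        proof -
          have "\<phi> {m, a} \<in> {m, a}" "\<phi> {m, a} \<in> \<phi> ` ?\<A>" using \<phi> that by auto
          then show ?thesis using False by auto
        qed
        then have "\<phi> ` ?\<A> = A" by (force simp: image_image)
        then show ?thesis using z A(2) by simp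
      qed
    qed (rule m(1))
    from le_trans[OF kle this k(1) _ m(1)] show False
      using m(3) \<A> sup_closed by (auto simp: image_subset_iff)
  qed
  let ?P = "{z \<in> carrier D. \<not> z \<sqsubseteq> m}"
  have P: "?P \<subseteq> carrier D" by blast
  \<comment> \<open>If the meet were below \<open>m\<close>, so would be a member of
    \<open>?P\<close>.\<close>
  have pm: "\<not> \<Sqinter> ?P \<sqsubseteq> m" using meet_prime[OF P] by blast
  have "\<Sqinter> ?P \<in> completely_join_primes D"
    unfolding completely_join_primes_def
  proof (intro CollectI conjI allI impI)
    show pc: "\<Sqinter> ?P \<in> carrier D" using P by simp
    fix A assume A: "A \<subseteq> carrier D \<and> \<Sqinter> ?P \<sqsubseteq> \<Squnion> A"
    then have "\<not> \<Squnion> A \<sqsubseteq> m" using pm le_trans[OF _ _ pc, of "\<Squnion> A" m] m(1) by auto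
    then obtain a where a: "a \<in> A" "\<not> a \<sqsubseteq> m" using sup_le_iff[of A m] A m(1) by auto
    then have "\<Sqinter> ?P \<sqsubseteq> a" using A by (intro inf_lower[OF P]) auto
    then show "\<exists>a \<in> A. \<Sqinter> ?P \<sqsubseteq> a" using a(1) by (rule rev_bexI[rotated])
  qed
  moreover have "\<Sqinter> ?P \<sqsubseteq> x"
    using le_trans[OF inf_lower[OF P, of k] k(2)] k(1) m(3) P x inf_closed[OF P] by simp
  moreover have "\<not> \<Sqinter> ?P \<sqsubseteq> y"
    using pm le_trans[OF _ m(2) inf_closed[OF P] y m(1)] by (rule contrapos_nn)
  ultimately show ?thesis by (intro bexI[of _ "\<Sqinter> ?P"] conjI)
qed

sublocale acdl \<subseteq> spatial_lattice
proof unfold_locales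
  fix x y assume "x \<in> carrier D" "y \<in> carrier D"
    and "\<And>p. \<lbrakk>p \<in> completely_join_primes D; p \<sqsubseteq> x\<rbrakk> \<Longrightarrow> p \<sqsubseteq> y"
  then show "x \<sqsubseteq> y" using ex_prime_separating[of x y] by fast
qed

lemma acdl_iff_spatial_lattice: "acdl D \<longleftrightarrow> spatial_lattice D"
proof
  assume "acdl D"
  then interpret acdl D .
  show "spatial_lattice D" by (rule spatial_lattice_axioms)
qed (rule spatial_lattice.acdl)

section \<open>Tensor products and completely join-primes\<close>

text \<open>Membership of \<open>(d, e)\<close> says that its pure tensor lies below. Meets are
  therefore intersections on arbitrary pairs, whereas joins will be described on pairs of
  primes.\<close>

lemma (in two_complete_lattices) tensor_inf_mem_iff:
  assumes "\<A> \<subseteq> carrier T" "d \<in> carrier D" "e \<in> carrier E"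
  shows "(d, e) \<in> \<Sqinter>\<^bsub>T\<^esub> \<A> \<longleftrightarrow> (\<forall>I \<in> \<A>. (d, e) \<in> I)"
proof -
  note P = pure_tensor_closed(1)[OF assms(2,3)]
  have "(d, e) \<in> \<Sqinter>\<^bsub>T\<^esub> \<A> \<longleftrightarrow> pure_tensor D E d e \<sqsubseteq>\<^bsub>T\<^esub> \<Sqinter>\<^bsub>T\<^esub> \<A>"
    using pure_tensor_le_iff[OF T.inf_closed[OF assms(1)] assms(2,3)] by simp
  also have "\<dots> \<longleftrightarrow> (\<forall>I \<in> \<A>. pure_tensor D E d e \<sqsubseteq>\<^bsub>T\<^esub> I)"
    by (rule T.le_inf_iff[OF assms(1) P])
  also have "\<dots> \<longleftrightarrow> (\<forall>I \<in> \<A>. (d, e) \<in> I)"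
  proof (rule ball_cong[OF refl])
    fix I assume "I \<in> \<A>"
    then have "I \<in> carrier T" using assms(1) by blast
    then show "pure_tensor D E d e \<sqsubseteq>\<^bsub>T\<^esub> I \<longleftrightarrow> (d, e) \<in> I"
      using pure_tensor_le_iff[OF _ assms(2,3)] by simp
  qed
  finally show ?thesis .
qed

lemma (in two_complete_lattices) tensor_lift_closed:
  assumes "complete_lattice F" "I \<in> carrier T"
    "\<And>d e. \<lbrakk>d \<in> carrier D; e \<in> carrier E\<rbrakk> \<Longrightarrow> \<beta> d e \<in> carrier F"
  shows "tensor_lift D E F \<beta> I \<in> carrier F"
proof -
  interpret F: complete_lattice F by (rule assms)
  have "{\<beta> d e | d e. (d, e) \<in> I} \<subseteq> carrier F"
    using tensor_memD(1,2)[OF assms(2)] assms(3) by blast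
  then show ?thesis using assms(2) by (simp add: tensor_lift_def)
qed

text \<open>\<open>tensor_lift\<close> is itself a join, so a prime below it is below one of its
  terms. \<open>tensor_map\<close>, the associator and both unitors are lifts and are all evaluated
  in this way.\<close>

lemma (in two_complete_lattices) prime_le_tensor_lift_iff:
  assumes "complete_lattice F" "I \<in> carrier T"
    "\<And>d e. \<lbrakk>d \<in> carrier D; e \<in> carrier E\<rbrakk> \<Longrightarrow> \<beta> d e \<in> carrier F"
    "r \<in> completely_join_primes F"
  shows "r \<sqsubseteq>\<^bsub>F\<^esub> tensor_lift D E F \<beta> I \<longleftrightarrow> (\<exists>d e. (d, e) \<in> I \<and> r \<sqsubseteq>\<^bsub>F\<^esub> \<beta> d e)"
proof -
  interpret F: complete_lattice F by (rule assms)
  have "{\<beta> d e | d e. (d, e) \<in> I} \<subseteq> carrier F"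
    using tensor_memD(1,2)[OF assms(2)] assms(3) by blast
  from F.prime_le_sup_iff[OF assms(4) this] show ?thesis
    using assms(2) by (auto simp: tensor_lift_def)
qed

section \<open>Tensor products described by pairs of primes\<close>

locale two_spatial_lattices = D: spatial_lattice D + E: spatial_lattice E
  for D :: "('a, 'x) gorder_scheme" and E :: "('b, 'y) gorder_scheme"

sublocale two_spatial_lattices \<subseteq> two_complete_lattices
  by unfold_locales

context two_spatial_lattices
begin

text \<open>\<open>d\<close> and \<open>e\<close> are joins of primes. Closure under joins works in
  one variable at a time, so \<open>d\<close> is reached for each fixed prime \<open>q\<close>, and
  then \<open>e\<close>.\<close>

lemma tensor_mem_iff_primes:
  assumes I: "I \<in> carrier T" and d: "d \<in> carrier D" and e: "e \<in> carrier E"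
  shows "(d, e) \<in> I \<longleftrightarrow>
    (\<forall>p \<in> completely_join_primes D. \<forall>q \<in> completely_join_primes E.
       p \<sqsubseteq>\<^bsub>D\<^esub> d \<longrightarrow> q \<sqsubseteq>\<^bsub>E\<^esub> e \<longrightarrow> (p, q) \<in> I)" (is "_ \<longleftrightarrow> ?R")
proof
  assume "(d, e) \<in> I"
  from tensor_memD(3)[OF I this] show ?R by (simp add: completely_join_primes_closed)
next
  assume R: ?R
  let ?P = "{p \<in> completely_join_primes D. p \<sqsubseteq>\<^bsub>D\<^esub> d}"
  let ?Q = "{q \<in> completely_join_primes E. q \<sqsubseteq>\<^bsub>E\<^esub> e}"
  have c: "?P \<subseteq> carrier D" "?Q \<subseteq> carrier E" by (auto dest: completely_join_primes_closed)
  have "(d, q) \<in> I" if q: "q \<in> ?Q" for q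
  proof -
    have "(\<Squnion>\<^bsub>D\<^esub> ?P, q) \<in> I"
      using q R c by (intro tensor_memD(4)[OF I]) auto
    then show ?thesis by (simp add: D.sup_primes[OF d])
  qed
  then have "(d, \<Squnion>\<^bsub>E\<^esub> ?Q) \<in> I" by (rule tensor_memD(5)[OF I d c(2)])
  then show "(d, e) \<in> I" by (simp add: E.sup_primes[OF e])
qed

lemma tensor_subsetI:
  assumes "I \<in> carrier T" "J \<in> carrier T"
    "\<And>p q. \<lbrakk>p \<in> completely_join_primes D; q \<in> completely_join_primes E; (p, q) \<in> I\<rbrakk> \<Longrightarrow> (p, q) \<in> J"
  shows "I \<subseteq> J"
proof (rule subrelI)
  fix d e assume de: "(d, e) \<in> I"
  note c = tensor_memD(1,2)[OF assms(1) de]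
  show "(d, e) \<in> J"
    using de assms(3) unfolding tensor_mem_iff_primes[OF assms(1) c] tensor_mem_iff_primes[OF assms(2) c]
    by simp
qed

lemma tensor_eqI:
  assumes "I \<in> carrier T" "J \<in> carrier T"
    "\<And>p q. \<lbrakk>p \<in> completely_join_primes D; q \<in> completely_join_primes E\<rbrakk> \<Longrightarrow> (p, q) \<in> I \<longleftrightarrow> (p, q) \<in> J"
  shows "I = J"
  by (rule subset_antisym; rule tensor_subsetI) (simp_all add: assms)

text \<open>The largest element of the tensor product whose pairs of primes all lie in
  \<open>W\<close>. It provides explicit upper bounds for joins and pure tensors, which are
  themselves only given as least elements.\<close>

definition rectangles_in :: "('a \<times> 'b) set \<Rightarrow> ('a \<times> 'b) set" where
  "rectangles_in W = {(d, e). d \<in> carrier D \<and> e \<in> carrier E \<and>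
     (\<forall>p \<in> completely_join_primes D. \<forall>q \<in> completely_join_primes E.
        p \<sqsubseteq>\<^bsub>D\<^esub> d \<longrightarrow> q \<sqsubseteq>\<^bsub>E\<^esub> e \<longrightarrow> (p, q) \<in> W)}"

lemma rectangles_in_closed: "rectangles_in W \<in> carrier T"
proof (rule tensor_memI)
  fix d e d' e'
  assume *: "(d, e) \<in> rectangles_in W" "d' \<in> carrier D" "e' \<in> carrier E" "d' \<sqsubseteq>\<^bsub>D\<^esub> d" "e' \<sqsubseteq>\<^bsub>E\<^esub> e"
  then have c: "d \<in> carrier D" "e \<in> carrier E" by (simp_all add: rectangles_in_def)
  have "p \<sqsubseteq>\<^bsub>D\<^esub> d" if "p \<in> completely_join_primes D" "p \<sqsubseteq>\<^bsub>D\<^esub> d'" for p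
    using D.le_trans[OF that(2) *(4)] completely_join_primes_closed[OF that(1)] c * by simp
  moreover have "q \<sqsubseteq>\<^bsub>E\<^esub> e" if "q \<in> completely_join_primes E" "q \<sqsubseteq>\<^bsub>E\<^esub> e'" for q
    using E.le_trans[OF that(2) *(5)] completely_join_primes_closed[OF that(1)] c * by simp
  ultimately show "(d', e') \<in> rectangles_in W" using * by (simp add: rectangles_in_def)
next
  fix A e assume "A \<subseteq> carrier D" "e \<in> carrier E" "\<And>a. a \<in> A \<Longrightarrow> (a, e) \<in> rectangles_in W"
  then show "(\<Squnion>\<^bsub>D\<^esub> A, e) \<in> rectangles_in W"
    using D.prime_le_sup_iff[of _ A] by (auto simp: rectangles_in_def)
next
  fix d B assume "d \<in> carrier D" "B \<subseteq> carrier E" "\<And>b. b \<in> B \<Longrightarrow> (d, b) \<in> rectangles_in W"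
  then show "(d, \<Squnion>\<^bsub>E\<^esub> B) \<in> rectangles_in W"
    using E.prime_le_sup_iff[of _ B] by (auto simp: rectangles_in_def)
qed (auto simp: rectangles_in_def)

text \<open>The union of \<open>\<A>\<close> need not be closed under joins, but
  \<open>rectangles_in (\<Union> \<A>)\<close> is an element above all members of
  \<open>\<A>\<close>, and it contains no pair of primes outside the union.\<close>

lemma tensor_sup_mem_iff:
  assumes "\<A> \<subseteq> carrier T" "p \<in> completely_join_primes D" "q \<in> completely_join_primes E"
  shows "(p, q) \<in> \<Squnion>\<^bsub>T\<^esub> \<A> \<longleftrightarrow> (\<exists>I \<in> \<A>. (p, q) \<in> I)"
proof
  assume pq: "(p, q) \<in> \<Squnion>\<^bsub>T\<^esub> \<A>"
  have "I \<subseteq> rectangles_in (\<Union> \<A>)" if "I \<in> \<A>" for I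
  proof (rule subrelI)
    fix d e assume de: "(d, e) \<in> I"
    have I: "I \<in> carrier T" using that assms(1) by blast
    note c = tensor_memD(1,2)[OF I de]
    show "(d, e) \<in> rectangles_in (\<Union> \<A>)"
      using de tensor_mem_iff_primes[OF I c] that c unfolding rectangles_in_def by blast
  qed
  then have "\<Squnion>\<^bsub>T\<^esub> \<A> \<sqsubseteq>\<^bsub>T\<^esub> rectangles_in (\<Union> \<A>)"
    using assms(1) rectangles_in_closed by (intro T.sup_least) simp_all
  then have "(p, q) \<in> rectangles_in (\<Union> \<A>)" using pq by auto
  then have "(p, q) \<in> \<Union> \<A>" using assms(2,3) by (simp add: rectangles_in_def)
  then show "\<exists>I \<in> \<A>. (p, q) \<in> I" by blast
next
  assume "\<exists>I \<in> \<A>. (p, q) \<in> I"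
  then obtain I where "I \<in> \<A>" "(p, q) \<in> I" ..
  then show "(p, q) \<in> \<Squnion>\<^bsub>T\<^esub> \<A>" using T.sup_upper[OF assms(1)] by auto
qed

text \<open>Stated for primes because every element of the tensor product contains all pairs with a
  bottom component. The upper bound is \<open>rectangles_in\<close> of the pairs below
  \<open>(d, e)\<close>.\<close>

lemma pure_tensor_mem_iff:
  assumes d: "d \<in> carrier D" and e: "e \<in> carrier E"
    and p: "p \<in> completely_join_primes D" and q: "q \<in> completely_join_primes E"
  shows "(p, q) \<in> pure_tensor D E d e \<longleftrightarrow> p \<sqsubseteq>\<^bsub>D\<^esub> d \<and> q \<sqsubseteq>\<^bsub>E\<^esub> e"
proof
  note c = completely_join_primes_closed[OF p] completely_join_primes_closed[OF q]
  let ?W = "rectangles_in {(p, q). p \<sqsubseteq>\<^bsub>D\<^esub> d \<and> q \<sqsubseteq>\<^bsub>E\<^esub> e}"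
  have "(d, e) \<in> ?W" using d e by (simp add: rectangles_in_def)
  then have "pure_tensor D E d e \<subseteq> ?W" using pure_tensor_le_iff[OF rectangles_in_closed d e] by simp
  then show "p \<sqsubseteq>\<^bsub>D\<^esub> d \<and> q \<sqsubseteq>\<^bsub>E\<^esub> e" if "(p, q) \<in> pure_tensor D E d e"
    using that p q c unfolding rectangles_in_def by auto
  show "(p, q) \<in> pure_tensor D E d e" if "p \<sqsubseteq>\<^bsub>D\<^esub> d \<and> q \<sqsubseteq>\<^bsub>E\<^esub> e"
    using tensor_memD(3)[OF pure_tensor_closed[OF d e] c] that by simp
qed

text \<open>The pure tensor lies below \<open>I\<close> exactly if \<open>(p, q) \<in> I\<close>,
  and on pairs of primes joins are unions.\<close>

lemma pure_tensor_prime: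
  assumes p: "p \<in> completely_join_primes D" and q: "q \<in> completely_join_primes E"
  shows "pure_tensor D E p q \<in> completely_join_primes T"
proof -
  note c = completely_join_primes_closed[OF p] completely_join_primes_closed[OF q]
  have "\<exists>I \<in> \<A>. pure_tensor D E p q \<sqsubseteq>\<^bsub>T\<^esub> I" if "\<A> \<subseteq> carrier T" "pure_tensor D E p q \<sqsubseteq>\<^bsub>T\<^esub> \<Squnion>\<^bsub>T\<^esub> \<A>" for \<A>
  proof -
    have "(p, q) \<in> \<Squnion>\<^bsub>T\<^esub> \<A>" using that(2) pure_tensor_closed(2)[OF c] by auto
    with that(1) obtain I where I: "I \<in> \<A>" "(p, q) \<in> I"
      using tensor_sup_mem_iff[OF _ p q, of \<A>] by blast
    then have "pure_tensor D E p q \<sqsubseteq>\<^bsub>T\<^esub> I" using pure_tensor_le_iff[OF _ c, of I] \<open>\<A> \<subseteq> carrier T\<close> by auto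
    with I(1) show ?thesis by (rule rev_bexI)
  qed
  then show ?thesis using pure_tensor_closed(1)[OF c] by (simp add: completely_join_primes_def)
qed

text \<open>Lattices with enough primes are closed under tensor products, which makes the prime
  criteria available for threefold products.\<close>

lemma tensor_spatial: "spatial_lattice T"
proof unfold_locales
  fix I J
  assume I: "I \<in> carrier T" and J: "J \<in> carrier T"
    and le: "\<And>P. \<lbrakk>P \<in> completely_join_primes T; P \<sqsubseteq>\<^bsub>T\<^esub> I\<rbrakk> \<Longrightarrow> P \<sqsubseteq>\<^bsub>T\<^esub> J"
  have "I \<subseteq> J"
  proof (rule tensor_subsetI[OF I J])
    fix p q assume *: "p \<in> completely_join_primes D" "q \<in> completely_join_primes E" "(p, q) \<in> I"
    note c = completely_join_primes_closed[OF *(1)] completely_join_primes_closed[OF *(2)]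
    show "(p, q) \<in> J"
      using le[OF pure_tensor_prime[OF *(1,2)]] *(3) pure_tensor_le_iff[OF I c] pure_tensor_le_iff[OF J c]
      by simp
  qed
  then show "I \<sqsubseteq>\<^bsub>T\<^esub> J" by simp
qed

sublocale T: spatial_lattice T
  by (rule tensor_spatial)

text \<open>\<open>P\<close> is the join of the pure tensors of its pairs of primes; being prime it
  lies below one of them, which lies below \<open>P\<close> in turn.\<close>

lemma tensor_primeE:
  assumes P: "P \<in> completely_join_primes T"
  obtains p q where "p \<in> completely_join_primes D" "q \<in> completely_join_primes E" "P = pure_tensor D E p q"
proof -
  note Pc = completely_join_primes_closed[OF P]
  let ?A = "{pure_tensor D E p q | p q. p \<in> completely_join_primes D \<and> q \<in> completely_join_primes E \<and> (p, q) \<in> P}"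
  have A: "?A \<subseteq> carrier T" by (auto dest!: completely_join_primes_closed intro: pure_tensor_closed(1))
  have "P \<subseteq> \<Squnion>\<^bsub>T\<^esub> ?A"
  proof (rule tensor_subsetI[OF Pc T.sup_closed[OF A]])
    fix p q assume *: "p \<in> completely_join_primes D" "q \<in> completely_join_primes E" "(p, q) \<in> P"
    have "(p, q) \<in> pure_tensor D E p q"
      by (rule pure_tensor_closed(2)) (simp_all add: * completely_join_primes_closed)
    then show "(p, q) \<in> \<Squnion>\<^bsub>T\<^esub> ?A" using * unfolding tensor_sup_mem_iff[OF A *(1,2)] by blast
  qed
  then have "\<exists>I \<in> ?A. P \<sqsubseteq>\<^bsub>T\<^esub> I" using T.prime_le_sup_iff[OF P A] by simp
  then obtain p q where *: "p \<in> completely_join_primes D" "q \<in> completely_join_primes E" "(p, q) \<in> P"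
    "P \<subseteq> pure_tensor D E p q" by auto
  have "pure_tensor D E p q \<subseteq> P"
    using pure_tensor_le_iff[OF Pc, of p q] * by (simp add: completely_join_primes_closed)
  then show ?thesis using * by (intro that[of p q]) auto
qed

end

section \<open>Maps between tensor products, tested on primes\<close>

lemma tensor_map_closed:
  assumes "complete_lattice D" "complete_lattice E" "complete_lattice D'" "complete_lattice E'"
    and f: "\<And>d. d \<in> carrier D \<Longrightarrow> f d \<in> carrier D'"
    and g: "\<And>e. e \<in> carrier E \<Longrightarrow> g e \<in> carrier E'"
    and I: "I \<in> carrier (tensor D E)"
  shows "tensor_map D E D' E' f g I \<in> carrier (tensor D' E')"
proof -
  interpret S: two_complete_lattices D E using assms by (simp add: two_complete_lattices_def)
  interpret T: two_complete_lattices D' E' using assms by (simp add: two_complete_lattices_def)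
  show ?thesis
    unfolding tensor_map_def
    by (intro S.tensor_lift_closed T.tensor_complete_lattice I T.pure_tensor_closed(1) f g)
qed

text \<open>Membership means that a prime pure tensor lies below a join of pure tensors, hence below
  one of them.\<close>

lemma tensor_map_mem_iff:
  assumes "complete_lattice D" "complete_lattice E" "spatial_lattice D'" "spatial_lattice E'"
    and f: "\<And>d. d \<in> carrier D \<Longrightarrow> f d \<in> carrier D'"
    and g: "\<And>e. e \<in> carrier E \<Longrightarrow> g e \<in> carrier E'"
    and I: "I \<in> carrier (tensor D E)"
    and p: "p \<in> completely_join_primes D'" and q: "q \<in> completely_join_primes E'"
  shows "(p, q) \<in> tensor_map D E D' E' f g I \<longleftrightarrow>
    (\<exists>d e. (d, e) \<in> I \<and> p \<sqsubseteq>\<^bsub>D'\<^esub> f d \<and> q \<sqsubseteq>\<^bsub>E'\<^esub> g e)"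
proof -
  interpret S: two_complete_lattices D E using assms by (simp add: two_complete_lattices_def)
  interpret T: two_spatial_lattices D' E' using assms by (simp add: two_spatial_lattices_def)
  note c = completely_join_primes_closed[OF p] completely_join_primes_closed[OF q]
  have cl: "pure_tensor D' E' (f d) (g e) \<in> carrier T.T" if "d \<in> carrier D" "e \<in> carrier E" for d e
    using T.pure_tensor_closed(1) f g that by blast
  note m = S.tensor_lift_closed[where \<beta>="\<lambda>d e. pure_tensor D' E' (f d) (g e)", OF T.tensor_complete_lattice I cl]
  have "(p, q) \<in> tensor_map D E D' E' f g I \<longleftrightarrow> pure_tensor D' E' p q \<sqsubseteq>\<^bsub>T.T\<^esub> tensor_map D E D' E' f g I"
    unfolding tensor_map_def using T.pure_tensor_le_iff[OF m c] by simp
  also have "\<dots> \<longleftrightarrow> (\<exists>d e. (d, e) \<in> I \<and> pure_tensor D' E' p q \<sqsubseteq>\<^bsub>T.T\<^esub> pure_tensor D' E' (f d) (g e))"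
    unfolding tensor_map_def
    by (rule S.prime_le_tensor_lift_iff[OF T.tensor_complete_lattice I cl T.pure_tensor_prime[OF p q]])
  also have "\<dots> \<longleftrightarrow> (\<exists>d e. (d, e) \<in> I \<and> p \<sqsubseteq>\<^bsub>D'\<^esub> f d \<and> q \<sqsubseteq>\<^bsub>E'\<^esub> g e)"
  proof -
    have "pure_tensor D' E' p q \<sqsubseteq>\<^bsub>T.T\<^esub> pure_tensor D' E' (f d) (g e) \<longleftrightarrow> p \<sqsubseteq>\<^bsub>D'\<^esub> f d \<and> q \<sqsubseteq>\<^bsub>E'\<^esub> g e"
      if "(d, e) \<in> I" for d e
      using T.pure_tensor_le_iff[OF cl c] T.pure_tensor_mem_iff[OF f g p q] S.tensor_memD(1,2)[OF I that]
      by simp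
    then show ?thesis by meson
  qed
  finally show ?thesis .
qed

text \<open>The associator is a lift inside a lift, so primality is applied twice and yields
  \<open>X\<close>, \<open>z\<close>, \<open>x\<close>, \<open>y\<close> above the three primes.
  Downward closure of \<open>I\<close> then shrinks \<open>X\<close> to the pure tensor of
  \<open>p\<close> and \<open>q\<close>, and \<open>z\<close> to \<open>r\<close>. As every prime of
  \<open>tensor E F\<close> is a pure tensor of primes, the criterion determines the associated
  element.\<close>

lemma tensor_assoc_mem_iff:
  assumes "spatial_lattice D" "spatial_lattice E" "spatial_lattice F"
    and I: "I \<in> carrier (tensor (tensor D E) F)"
  shows "tensor_assoc D E F I \<in> carrier (tensor D (tensor E F))"
    and "\<And>p q r. \<lbrakk>p \<in> completely_join_primes D; q \<in> completely_join_primes E; r \<in> completely_join_primes F\<rbrakk> \<Longrightarrow>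
      (p, pure_tensor E F q r) \<in> tensor_assoc D E F I \<longleftrightarrow> (pure_tensor D E p q, r) \<in> I"
proof -
  interpret DE: two_spatial_lattices D E using assms by (simp add: two_spatial_lattices_def)
  interpret EF: two_spatial_lattices E F using assms by (simp add: two_spatial_lattices_def)
  interpret L: two_spatial_lattices "tensor D E" F
    using assms DE.tensor_spatial by (simp add: two_spatial_lattices_def)
  interpret R: two_spatial_lattices D "tensor E F"
    using assms EF.tensor_spatial by (simp add: two_spatial_lattices_def)
  let ?\<beta> = "\<lambda>z x y. pure_tensor D (tensor E F) x (pure_tensor E F y z)"
  have b: "?\<beta> z x y \<in> carrier R.T" if "z \<in> carrier F" "x \<in> carrier D" "y \<in> carrier E" for x y z
    using that by (intro R.pure_tensor_closed(1) EF.pure_tensor_closed(1))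
  have l: "tensor_lift D E R.T (?\<beta> z) X \<in> carrier R.T" if "X \<in> carrier DE.T" "z \<in> carrier F" for X z
    using that by (intro DE.tensor_lift_closed R.tensor_complete_lattice b)
  show cl: "tensor_assoc D E F I \<in> carrier R.T"
    unfolding tensor_assoc_def by (intro L.tensor_lift_closed R.tensor_complete_lattice I l)
  fix p q r
  assume p: "p \<in> completely_join_primes D" and q: "q \<in> completely_join_primes E"
    and r: "r \<in> completely_join_primes F"
  note c = completely_join_primes_closed[OF p] completely_join_primes_closed[OF q]
    completely_join_primes_closed[OF r]
  note qr = EF.pure_tensor_prime[OF q r]
  note qrc = completely_join_primes_closed[OF qr]
  note pqr = R.pure_tensor_prime[OF p qr]
  have 1: "pure_tensor D (tensor E F) p (pure_tensor E F q r) \<sqsubseteq>\<^bsub>R.T\<^esub> ?\<beta> z x y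
      \<longleftrightarrow> p \<sqsubseteq>\<^bsub>D\<^esub> x \<and> q \<sqsubseteq>\<^bsub>E\<^esub> y \<and> r \<sqsubseteq>\<^bsub>F\<^esub> z"
    if "x \<in> carrier D" "y \<in> carrier E" "z \<in> carrier F" for x y z
    using R.pure_tensor_le_iff[OF b[OF that(3,1,2)] c(1) qrc]
      R.pure_tensor_mem_iff[OF that(1) EF.pure_tensor_closed(1)[OF that(2,3)] p qr]
      EF.pure_tensor_le_iff[OF EF.pure_tensor_closed(1)[OF that(2,3)] c(2,3)]
      EF.pure_tensor_mem_iff[OF that(2,3) q r] by simp
  have "(p, pure_tensor E F q r) \<in> tensor_assoc D E F I \<longleftrightarrow>
      pure_tensor D (tensor E F) p (pure_tensor E F q r) \<sqsubseteq>\<^bsub>R.T\<^esub> tensor_assoc D E F I"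
    using R.pure_tensor_le_iff[OF cl c(1) qrc] by simp
  also have "\<dots> \<longleftrightarrow> (\<exists>X z. (X, z) \<in> I \<and>
      pure_tensor D (tensor E F) p (pure_tensor E F q r) \<sqsubseteq>\<^bsub>R.T\<^esub> tensor_lift D E R.T (?\<beta> z) X)"
    unfolding tensor_assoc_def
    by (rule L.prime_le_tensor_lift_iff[OF R.tensor_complete_lattice I l pqr])
  also have "\<dots> \<longleftrightarrow> (\<exists>X z. (X, z) \<in> I \<and> (\<exists>x y. (x, y) \<in> X \<and>
      pure_tensor D (tensor E F) p (pure_tensor E F q r) \<sqsubseteq>\<^bsub>R.T\<^esub> ?\<beta> z x y))"
    using DE.prime_le_tensor_lift_iff[OF R.tensor_complete_lattice _ b pqr] L.tensor_memD(1,2)[OF I]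
    by (intro ex_cong1 conj_cong refl) simp
  also have "\<dots> \<longleftrightarrow> (\<exists>X z. (X, z) \<in> I \<and> (\<exists>x y. (x, y) \<in> X \<and> p \<sqsubseteq>\<^bsub>D\<^esub> x \<and> q \<sqsubseteq>\<^bsub>E\<^esub> y \<and> r \<sqsubseteq>\<^bsub>F\<^esub> z))"
  proof (intro ex_cong1 conj_cong refl)
    fix X z x y assume *: "(X, z) \<in> I" "(x, y) \<in> X"
    note Xz = L.tensor_memD(1,2)[OF I *(1)]
    show "pure_tensor D (tensor E F) p (pure_tensor E F q r) \<sqsubseteq>\<^bsub>R.T\<^esub> ?\<beta> z x y
        \<longleftrightarrow> p \<sqsubseteq>\<^bsub>D\<^esub> x \<and> q \<sqsubseteq>\<^bsub>E\<^esub> y \<and> r \<sqsubseteq>\<^bsub>F\<^esub> z"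
      by (rule 1[OF DE.tensor_memD(1,2)[OF Xz(1) *(2)] Xz(2)])
  qed
  also have "\<dots> \<longleftrightarrow> (pure_tensor D E p q, r) \<in> I"
  proof
    assume "(pure_tensor D E p q, r) \<in> I"
    moreover have "(p, q) \<in> pure_tensor D E p q" by (rule DE.pure_tensor_closed(2)[OF c(1,2)])
    moreover have "p \<sqsubseteq>\<^bsub>D\<^esub> p" "q \<sqsubseteq>\<^bsub>E\<^esub> q" "r \<sqsubseteq>\<^bsub>F\<^esub> r" using c by simp_all
    ultimately show "\<exists>X z. (X, z) \<in> I \<and> (\<exists>x y. (x, y) \<in> X \<and> p \<sqsubseteq>\<^bsub>D\<^esub> x \<and> q \<sqsubseteq>\<^bsub>E\<^esub> y \<and> r \<sqsubseteq>\<^bsub>F\<^esub> z)"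
      by (intro exI conjI)
  next
    assume "\<exists>X z. (X, z) \<in> I \<and> (\<exists>x y. (x, y) \<in> X \<and> p \<sqsubseteq>\<^bsub>D\<^esub> x \<and> q \<sqsubseteq>\<^bsub>E\<^esub> y \<and> r \<sqsubseteq>\<^bsub>F\<^esub> z)"
    then obtain X z x y where *: "(X, z) \<in> I" "(x, y) \<in> X" "p \<sqsubseteq>\<^bsub>D\<^esub> x" "q \<sqsubseteq>\<^bsub>E\<^esub> y" "r \<sqsubseteq>\<^bsub>F\<^esub> z" by auto
    note X = L.tensor_memD(1)[OF I *(1)]
    have "pure_tensor D E p q \<sqsubseteq>\<^bsub>DE.T\<^esub> X"
      using DE.tensor_memD(3)[OF X *(2) c(1,2) *(3,4)] DE.pure_tensor_le_iff[OF X c(1,2)] by simp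
    from L.tensor_memD(3)[OF I *(1) DE.pure_tensor_closed(1)[OF c(1,2)] c(3) this *(5)]
    show "(pure_tensor D E p q, r) \<in> I" .
  qed
  finally show "(p, pure_tensor E F q r) \<in> tensor_assoc D E F I \<longleftrightarrow> (pure_tensor D E p q, r) \<in> I" .
qed

section \<open>The two-element lattice of truth values\<close>

lemma two_le [simp]: "a \<sqsubseteq>\<^bsub>two\<^esub> b \<longleftrightarrow> (a \<longrightarrow> b)"
  by (auto simp: two_def)

lemma two_carrier [simp]: "carrier two = UNIV"
  by (simp add: two_def)

lemma two_complete_lattice: "complete_lattice two"
proof -
  have "partial_order two" by unfold_locales (auto simp: two_def)
  moreover have "least two (True \<in> A) (Upper two A)" "greatest two (False \<notin> A) (Lower two A)" for A
    by (auto simp: least_def greatest_def Upper_def Lower_def) (metis (full_types))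
  ultimately show ?thesis
    by (intro complete_lattice.intro complete_lattice_axioms.intro) blast+
qed

interpretation two: complete_lattice two
  by (rule two_complete_lattice)

lemma two_sup [simp]: "\<Squnion>\<^bsub>two\<^esub> A \<longleftrightarrow> True \<in> A"
  using two.sup_le_iff[of A "\<Squnion>\<^bsub>two\<^esub> A"] two.sup_le_iff[of A False] by auto

lemma two_inf [simp]: "\<Sqinter>\<^bsub>two\<^esub> A \<longleftrightarrow> False \<notin> A"
proof -
  have "(\<forall>a \<in> A. a) \<longleftrightarrow> False \<notin> A" by (metis (full_types))
  then show ?thesis using two.le_inf_iff[of A True] by simp
qed

lemma two_primes: "completely_join_primes two = {True}"
  by (auto simp: completely_join_primes_def)

lemma two_spatial_lattice: "spatial_lattice two"
  by unfold_locales (simp add: two_primes)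

section \<open>Residuals and comultiplications\<close>

text \<open>A comonoid and its translation are records that extend the same order differently, and
  lattice operations take the whole record as argument. They depend on \<open>carrier\<close>,
  \<open>eq\<close> and \<open>le\<close> alone; for \<open>acdl\<close> this is read off the
  criterion by primes.\<close>

lemma order_cong:
  fixes D :: "('a, 'x) gorder_scheme" and E :: "('a, 'y) gorder_scheme"
  assumes "carrier D = carrier E" "eq D = eq E" "le D = le E"
  shows "Lattice.sup D = Lattice.sup E" "Lattice.inf D = Lattice.inf E" "\<top>\<^bsub>D\<^esub> = \<top>\<^bsub>E\<^esub>"
    "completely_join_primes D = completely_join_primes E"
    "complete_lattice D \<longleftrightarrow> complete_lattice E" "acdl D \<longleftrightarrow> acdl E"
proof -
  have "Upper D = Upper E" "Lower D = Lower E"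
    by (simp_all add: fun_eq_iff Upper_def Lower_def assms)
  moreover have "least D = least E" "greatest D = greatest E"
    by (simp_all add: fun_eq_iff least_def greatest_def assms)
  ultimately show sup: "Lattice.sup D = Lattice.sup E" and inf: "Lattice.inf D = Lattice.inf E"
    and "\<top>\<^bsub>D\<^esub> = \<top>\<^bsub>E\<^esub>" and cl: "complete_lattice D \<longleftrightarrow> complete_lattice E"
    by (simp_all add: fun_eq_iff Lattice.sup_def Lattice.inf_def Order.top_def complete_lattice_def
        complete_lattice_axioms_def partial_order_def partial_order_axioms_def
        weak_partial_order_def weak_partial_order_axioms_def equivalence_def assms)
  show p: "completely_join_primes D = completely_join_primes E"
    by (simp add: completely_join_primes_def sup assms)
  show "acdl D \<longleftrightarrow> acdl E"
    unfolding acdl_iff_spatial_lattice spatial_lattice_def spatial_lattice_axioms_def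
    by (simp add: cl p assms)
qed

text \<open>\<open>comult C c\<close> is the graph of a Galois connection, and the two residuals are
  its two adjoint maps. They are restricted in both arguments because \<open>lres_closed\<close> and
  \<open>rres_closed\<close> demand extensional functions.\<close>

definition residuation_of :: "'a comonoid \<Rightarrow> 'a residuation" where
  "residuation_of C =
     \<lparr>carrier = carrier C, eq = eq C, le = le C,
      lres = (\<lambda>a \<in> carrier C. \<lambda>c \<in> carrier C. \<Squnion>\<^bsub>C\<^esub> {b \<in> carrier C. (a, b) \<in> comult C c}),
      rres = (\<lambda>c \<in> carrier C. \<lambda>b \<in> carrier C. \<Squnion>\<^bsub>C\<^esub> {a \<in> carrier C. (a, b) \<in> comult C c})\<rparr>"

text \<open>The pairs are described by the left residual; by residuation the right one gives the
  same set. The restrictions to the carrier make the two translations inverse to each other as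
  equalities of records.\<close>

definition comonoid_of :: "'a residuation \<Rightarrow> 'a comonoid" where
  "comonoid_of R =
     \<lparr>carrier = carrier R, eq = eq R, le = le R,
      comult = (\<lambda>c \<in> carrier R. {(a, b). a \<in> carrier R \<and> b \<in> carrier R \<and> b \<sqsubseteq>\<^bsub>R\<^esub> a \<rightharpoondown>\<^bsub>R\<^esub> c}),
      counit = (\<lambda>c \<in> carrier R. residuation_unit R \<sqsubseteq>\<^bsub>R\<^esub> c)\<rparr>"

lemma residuation_of_simps [simp]:
  "carrier (residuation_of C) = carrier C" "eq (residuation_of C) = eq C" "le (residuation_of C) = le C"
  by (simp_all add: residuation_of_def)

lemma comonoid_of_simps [simp]:
  "carrier (comonoid_of R) = carrier R" "eq (comonoid_of R) = eq R" "le (comonoid_of R) = le R"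
  by (simp_all add: comonoid_of_def)

lemmas residuation_of_order [simp] =
  order_cong[of "residuation_of C" C for C, OF residuation_of_simps]

lemmas comonoid_of_order [simp] =
  order_cong[of "comonoid_of R" R for R, OF comonoid_of_simps]

text \<open>Both residuals are determined by one ternary relation \<open>P a b c\<close>, meaning \<open>a \<cdot> b \<le> c\<close>.\<close>

lemma residuation_acdlI:
  fixes R :: "'a residuation" (structure)
  assumes acdl: "acdl R"
    and lres_closed: "lres R \<in> carrier R \<rightarrow>\<^sub>E carrier R \<rightarrow>\<^sub>E carrier R"
    and rres_closed: "rres R \<in> carrier R \<rightarrow>\<^sub>E carrier R \<rightarrow>\<^sub>E carrier R"
    and l: "\<And>a b c. \<lbrakk>a \<in> carrier R; b \<in> carrier R; c \<in> carrier R\<rbrakk> \<Longrightarrow> b \<sqsubseteq> a \<rightharpoondown> c \<longleftrightarrow> P a b c"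
    and r: "\<And>a b c. \<lbrakk>a \<in> carrier R; b \<in> carrier R; c \<in> carrier R\<rbrakk> \<Longrightarrow> a \<sqsubseteq> c \<leftharpoondown> b \<longleftrightarrow> P a b c"
    and inf: "\<And>a b A. \<lbrakk>a \<in> carrier R; b \<in> carrier R; A \<subseteq> carrier R\<rbrakk> \<Longrightarrow>
      P a b (\<Sqinter> A) \<longleftrightarrow> (\<forall>c \<in> A. P a b c)"
  shows "residuation_acdl R"
proof -
  interpret acdl R by (rule acdl)
  have lc: "x \<rightharpoondown> z \<in> carrier R" and rc: "z \<leftharpoondown> x \<in> carrier R" if "x \<in> carrier R" "z \<in> carrier R" for x z
    using lres_closed rres_closed that by (auto simp: PiE_iff)
  have eq_InfI: "u = \<Sqinter> (f ` A)"
    if u: "u \<in> carrier R" and f: "f ` A \<subseteq> carrier R"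
      and iff: "\<And>b. b \<in> carrier R \<Longrightarrow> b \<sqsubseteq> u \<longleftrightarrow> (\<forall>a \<in> A. b \<sqsubseteq> f a)" for u A and f :: "'a \<Rightarrow> 'a"
    by (rule eq_lowerI[OF u inf_closed[OF f]]) (simp add: le_inf_iff[OF f] iff)
  have "preserves_meets R R (\<lambda>z. x \<rightharpoondown> z)" and "preserves_meets R R (\<lambda>z. z \<leftharpoondown> x)" if x: "x \<in> carrier R" for x
    unfolding preserves_meets_def
  proof -
    have "x \<rightharpoondown> \<Sqinter> A = \<Sqinter> ((\<lambda>z. x \<rightharpoondown> z) ` A)" and "\<Sqinter> A \<leftharpoondown> x = \<Sqinter> ((\<lambda>z. z \<leftharpoondown> x) ` A)" if A: "A \<subseteq> carrier R" for A
    proof -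
      note Ac = subsetD[OF A]
      show "x \<rightharpoondown> \<Sqinter> A = \<Sqinter> ((\<lambda>z. x \<rightharpoondown> z) ` A)" "\<Sqinter> A \<leftharpoondown> x = \<Sqinter> ((\<lambda>z. z \<leftharpoondown> x) ` A)"
        by (rule eq_InfI; use x A Ac lc rc in \<open>auto simp: l r inf\<close>)+
    qed
    then show "\<forall>A. A \<subseteq> carrier R \<longrightarrow> x \<rightharpoondown> \<Sqinter> A = \<Sqinter> ((\<lambda>z. x \<rightharpoondown> z) ` A)"
      "\<forall>A. A \<subseteq> carrier R \<longrightarrow> \<Sqinter> A \<leftharpoondown> x = \<Sqinter> ((\<lambda>z. z \<leftharpoondown> x) ` A)" by simp_all
  qed
  moreover have "joins_to_meets R R (\<lambda>x. x \<rightharpoondown> z)" and "joins_to_meets R R (\<lambda>x. z \<leftharpoondown> x)" if z: "z \<in> carrier R" for z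
    unfolding joins_to_meets_def
  proof -
    have "\<Squnion> A \<rightharpoondown> z = \<Sqinter> ((\<lambda>x. x \<rightharpoondown> z) ` A)" and "z \<leftharpoondown> \<Squnion> A = \<Sqinter> ((\<lambda>x. z \<leftharpoondown> x) ` A)" if A: "A \<subseteq> carrier R" for A
    proof -
      note Ac = subsetD[OF A]
      have "P (\<Squnion> A) b z \<longleftrightarrow> (\<forall>a \<in> A. P a b z)" "P b (\<Squnion> A) z \<longleftrightarrow> (\<forall>a \<in> A. P b a z)" if b: "b \<in> carrier R" for b
        using sup_le_iff[OF A rc[OF b z]] r[OF sup_closed[OF A] b z] r[OF Ac b z]
          sup_le_iff[OF A lc[OF b z]] l[OF b sup_closed[OF A] z] l[OF b Ac z] by simp_all
      then show "\<Squnion> A \<rightharpoondown> z = \<Sqinter> ((\<lambda>x. x \<rightharpoondown> z) ` A)" "z \<leftharpoondown> \<Squnion> A = \<Sqinter> ((\<lambda>x. z \<leftharpoondown> x) ` A)"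
        by (intro eq_InfI; use z A Ac lc rc in \<open>auto simp: l r\<close>)+
    qed
    then show "\<forall>A. A \<subseteq> carrier R \<longrightarrow> \<Squnion> A \<rightharpoondown> z = \<Sqinter> ((\<lambda>x. x \<rightharpoondown> z) ` A)"
      "\<forall>A. A \<subseteq> carrier R \<longrightarrow> z \<leftharpoondown> \<Squnion> A = \<Sqinter> ((\<lambda>x. z \<leftharpoondown> x) ` A)" by simp_all
  qed
  ultimately show ?thesis
    by (intro residuation_acdl.intro residuation_acdl_axioms.intro acdl lres_closed rres_closed)
      (simp_all add: l r)
qed

lemma (in spatial_lattice) preserves_joinsI:
  assumes f: "\<And>x. x \<in> carrier D \<Longrightarrow> f x \<in> carrier D"
    and iff: "\<And>q A. \<lbrakk>q \<in> completely_join_primes D; A \<subseteq> carrier D\<rbrakk> \<Longrightarrow> q \<sqsubseteq> f (\<Squnion> A) \<longleftrightarrow> (\<exists>a \<in> A. q \<sqsubseteq> f a)"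
  shows "preserves_joins D D f"
  unfolding preserves_joins_def
proof (intro allI impI)
  fix A assume A: "A \<subseteq> carrier D"
  then have i: "f ` A \<subseteq> carrier D" using f by blast
  show "f (\<Squnion> A) = \<Squnion> (f ` A)"
    by (rule eq_primesI[OF f[OF sup_closed[OF A]] sup_closed[OF i]])
      (simp add: iff[OF _ A] prime_le_sup_iff[OF _ i])
qed

section \<open>Residuals computed on primes\<close>

context residuation_acdl
begin

lemma lres_in_carrier [simp]: "x \<in> carrier R \<Longrightarrow> z \<in> carrier R \<Longrightarrow> x \<rightharpoondown> z \<in> carrier R"
  using lres_closed by (auto simp: PiE_iff)

lemma rres_in_carrier [simp]: "x \<in> carrier R \<Longrightarrow> z \<in> carrier R \<Longrightarrow> z \<leftharpoondown> x \<in> carrier R"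
  using rres_closed by (auto simp: PiE_iff)

lemma lres_mono:
  assumes "a' \<in> carrier R" "a \<in> carrier R" "c \<in> carrier R" "c' \<in> carrier R"
    "b \<in> carrier R" "b' \<in> carrier R" "a' \<sqsubseteq> a" "b' \<sqsubseteq> b" "c \<sqsubseteq> c'" "b \<sqsubseteq> a \<rightharpoondown> c"
  shows "b' \<sqsubseteq> a' \<rightharpoondown> c'"
proof -
  have "b' \<sqsubseteq> a \<rightharpoondown> c" using le_trans[OF assms(8,10)] assms by simp
  then have "a \<sqsubseteq> c \<leftharpoondown> b'" using residuation assms by simp
  then have "a' \<sqsubseteq> c \<leftharpoondown> b'" using le_trans[OF assms(7)] assms by simp
  then have 1: "b' \<sqsubseteq> a' \<rightharpoondown> c" using residuation assms by simp
  \<comment> \<open>Monotony in \<open>c\<close> is read off the preservation of the meet of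
    \<open>c\<close> and \<open>c'\<close>, which is \<open>c\<close>.\<close>
  have "\<Sqinter> {c, c'} = c"
    using assms inf_lower[of "{c, c'}" c] inf_greatest[of "{c, c'}" c] by (intro le_antisym) auto
  moreover have "a' \<rightharpoondown> \<Sqinter> {c, c'} = \<Sqinter> {a' \<rightharpoondown> c, a' \<rightharpoondown> c'}"
    using lres_meets[OF assms(1)] assms unfolding preserves_meets_def by (elim allE[of _ "{c, c'}"]) simp
  ultimately have "a' \<rightharpoondown> c \<sqsubseteq> a' \<rightharpoondown> c'"
    using inf_lower[of "{a' \<rightharpoondown> c, a' \<rightharpoondown> c'}" "a' \<rightharpoondown> c'"] assms by simp
  then show ?thesis using le_trans[OF 1] assms by simp
qed

text \<open>Joins in the second variable are immediate; for the first, residuation rewrites the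
  condition as \<open>a \<sqsubseteq> c \<leftharpoondown> b\<close>. The set is the
  comultiplication that belongs to the residuals.\<close>

lemma residual_tensor:
  assumes "c \<in> carrier R"
  shows "{(a, b). a \<in> carrier R \<and> b \<in> carrier R \<and> b \<sqsubseteq> a \<rightharpoondown> c} \<in> carrier (tensor R R)" (is "?\<Gamma> \<in> _")
proof -
  interpret RR: two_complete_lattices R R by unfold_locales
  show ?thesis
  proof (rule RR.tensor_memI)
    fix d e d' e'
    assume "(d, e) \<in> ?\<Gamma>" "d' \<in> carrier R" "e' \<in> carrier R" "d' \<sqsubseteq> d" "e' \<sqsubseteq> e"
    then show "(d', e') \<in> ?\<Gamma>" using lres_mono[of d' d c c e e'] assms by simp
  next
    fix A e assume *: "A \<subseteq> carrier R" "e \<in> carrier R" "\<And>a. a \<in> A \<Longrightarrow> (a, e) \<in> ?\<Gamma>"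
    have "a \<sqsubseteq> c \<leftharpoondown> e" if "a \<in> A" for a
      using *(3)[OF that] residuation[OF _ *(2) assms] by blast
    then have "\<Squnion> A \<sqsubseteq> c \<leftharpoondown> e" using * assms by (intro sup_least) simp_all
    then show "(\<Squnion> A, e) \<in> ?\<Gamma>" using * residuation assms by simp
  next
    fix d B assume *: "d \<in> carrier R" "B \<subseteq> carrier R" "\<And>b. b \<in> B \<Longrightarrow> (d, b) \<in> ?\<Gamma>"
    then have "\<Squnion> B \<sqsubseteq> d \<rightharpoondown> c" using assms by (intro sup_least) auto
    then show "(d, \<Squnion> B) \<in> ?\<Gamma>" using * by simp
  qed auto
qed

text \<open>\<open>x\<close> is the join of the primes below it, and the residual turns that join
  into a meet.\<close>

lemma le_lres_iff_primes:
  assumes "x \<in> carrier R" "z \<in> carrier R" "q \<in> carrier R"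
  shows "q \<sqsubseteq> x \<rightharpoondown> z \<longleftrightarrow> (\<forall>p \<in> completely_join_primes R. p \<sqsubseteq> x \<longrightarrow> q \<sqsubseteq> p \<rightharpoondown> z)"
proof -
  let ?P = "{p \<in> completely_join_primes R. p \<sqsubseteq> x}"
  have P: "?P \<subseteq> carrier R" by (auto dest: completely_join_primes_closed)
  have "x \<rightharpoondown> z = \<Sqinter> ((\<lambda>p. p \<rightharpoondown> z) ` ?P)"
    using lres_joins_to_meets[OF assms(2), unfolded joins_to_meets_def, rule_format, OF P]
    by (simp add: sup_primes[OF assms(1)])
  moreover have "(\<lambda>p. p \<rightharpoondown> z) ` ?P \<subseteq> carrier R" using P assms(2) by auto
  ultimately show ?thesis by (auto simp: le_inf_iff assms)
qed

lemma le_rres_iff_primes: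
  assumes "y \<in> carrier R" "z \<in> carrier R" "q \<in> carrier R"
  shows "q \<sqsubseteq> z \<leftharpoondown> y \<longleftrightarrow> (\<forall>r \<in> completely_join_primes R. r \<sqsubseteq> y \<longrightarrow> q \<sqsubseteq> z \<leftharpoondown> r)"
proof -
  let ?P = "{p \<in> completely_join_primes R. p \<sqsubseteq> y}"
  have P: "?P \<subseteq> carrier R" by (auto dest: completely_join_primes_closed)
  have "z \<leftharpoondown> y = \<Sqinter> ((\<lambda>p. z \<leftharpoondown> p) ` ?P)"
    using rres_joins_to_meets[OF assms(2), unfolded joins_to_meets_def, rule_format, OF P]
    by (simp add: sup_primes[OF assms(1)])
  moreover have "(\<lambda>p. z \<leftharpoondown> p) ` ?P \<subseteq> carrier R" using P assms(2) by auto
  ultimately show ?thesis by (auto simp: le_inf_iff assms)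
qed

text \<open>Each denominator is a join of primes and becomes a meet, which the residual by the other
  one preserves. Associativity is thereby reduced to prime denominators.\<close>

lemma le_lres_rres_iff_primes:
  assumes x: "x \<in> carrier R" and y: "y \<in> carrier R" and z: "z \<in> carrier R" and q: "q \<in> carrier R"
  shows "q \<sqsubseteq> x \<rightharpoondown> (z \<leftharpoondown> y) \<longleftrightarrow>
      (\<forall>p \<in> completely_join_primes R. \<forall>r \<in> completely_join_primes R.
         p \<sqsubseteq> x \<longrightarrow> r \<sqsubseteq> y \<longrightarrow> q \<sqsubseteq> p \<rightharpoondown> (z \<leftharpoondown> r))"
    and "q \<sqsubseteq> (x \<rightharpoondown> z) \<leftharpoondown> y \<longleftrightarrow>
      (\<forall>p \<in> completely_join_primes R. \<forall>r \<in> completely_join_primes R.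
         p \<sqsubseteq> x \<longrightarrow> r \<sqsubseteq> y \<longrightarrow> q \<sqsubseteq> (p \<rightharpoondown> z) \<leftharpoondown> r)"
proof -
  have "q \<sqsubseteq> p \<rightharpoondown> (z \<leftharpoondown> y) \<longleftrightarrow> (\<forall>r \<in> completely_join_primes R. r \<sqsubseteq> y \<longrightarrow> q \<sqsubseteq> p \<rightharpoondown> (z \<leftharpoondown> r))"
    if p: "p \<in> completely_join_primes R" for p
  proof -
    note pc = completely_join_primes_closed[OF p]
    let ?A = "(\<lambda>r. z \<leftharpoondown> r) ` {r \<in> completely_join_primes R. r \<sqsubseteq> y}"
    have P: "{r \<in> completely_join_primes R. r \<sqsubseteq> y} \<subseteq> carrier R"
      by (auto dest: completely_join_primes_closed)
    then have A: "?A \<subseteq> carrier R" using z by auto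
    have zy: "z \<leftharpoondown> y = \<Sqinter> ?A"
      using rres_joins_to_meets[OF z, unfolded joins_to_meets_def, rule_format, OF P]
      by (simp add: sup_primes[OF y])
    have "p \<rightharpoondown> (z \<leftharpoondown> y) = \<Sqinter> ((\<lambda>w. p \<rightharpoondown> w) ` ?A)"
      unfolding zy using lres_meets[OF pc] A unfolding preserves_meets_def by blast
    moreover have "(\<lambda>w. p \<rightharpoondown> w) ` ?A \<subseteq> carrier R" using A pc by auto
    ultimately show ?thesis by (auto simp: le_inf_iff q)
  qed
  then show "q \<sqsubseteq> x \<rightharpoondown> (z \<leftharpoondown> y) \<longleftrightarrow>
      (\<forall>p \<in> completely_join_primes R. \<forall>r \<in> completely_join_primes R.
         p \<sqsubseteq> x \<longrightarrow> r \<sqsubseteq> y \<longrightarrow> q \<sqsubseteq> p \<rightharpoondown> (z \<leftharpoondown> r))"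
    unfolding le_lres_iff_primes[OF x rres_in_carrier[OF y z] q] by (auto simp: Ball_def)
  have "q \<sqsubseteq> (x \<rightharpoondown> z) \<leftharpoondown> r \<longleftrightarrow> (\<forall>p \<in> completely_join_primes R. p \<sqsubseteq> x \<longrightarrow> q \<sqsubseteq> (p \<rightharpoondown> z) \<leftharpoondown> r)"
    if r: "r \<in> completely_join_primes R" for r
  proof -
    note rc = completely_join_primes_closed[OF r]
    let ?A = "(\<lambda>p. p \<rightharpoondown> z) ` {p \<in> completely_join_primes R. p \<sqsubseteq> x}"
    have P: "{p \<in> completely_join_primes R. p \<sqsubseteq> x} \<subseteq> carrier R"
      by (auto dest: completely_join_primes_closed)
    then have A: "?A \<subseteq> carrier R" using z by auto
    have xz: "x \<rightharpoondown> z = \<Sqinter> ?A"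
      using lres_joins_to_meets[OF z, unfolded joins_to_meets_def, rule_format, OF P]
      by (simp add: sup_primes[OF x])
    have "(x \<rightharpoondown> z) \<leftharpoondown> r = \<Sqinter> ((\<lambda>w. w \<leftharpoondown> r) ` ?A)"
      unfolding xz using rres_meets[OF rc] A unfolding preserves_meets_def by blast
    moreover have "(\<lambda>w. w \<leftharpoondown> r) ` ?A \<subseteq> carrier R" using A rc by auto
    ultimately show ?thesis by (auto simp: le_inf_iff q)
  qed
  then show "q \<sqsubseteq> (x \<rightharpoondown> z) \<leftharpoondown> y \<longleftrightarrow>
      (\<forall>p \<in> completely_join_primes R. \<forall>r \<in> completely_join_primes R.
         p \<sqsubseteq> x \<longrightarrow> r \<sqsubseteq> y \<longrightarrow> q \<sqsubseteq> (p \<rightharpoondown> z) \<leftharpoondown> r)"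
    unfolding le_rres_iff_primes[OF y lres_in_carrier[OF x z] q] by (auto simp: Ball_def)
qed

lemma associative_iff_primes:
  "(\<forall>x \<in> carrier R. \<forall>y \<in> carrier R. \<forall>z \<in> carrier R. x \<rightharpoondown> (z \<leftharpoondown> y) = (x \<rightharpoondown> z) \<leftharpoondown> y) \<longleftrightarrow>
   (\<forall>p \<in> completely_join_primes R. \<forall>q \<in> completely_join_primes R. \<forall>r \<in> completely_join_primes R.
      \<forall>z \<in> carrier R. q \<sqsubseteq> p \<rightharpoondown> (z \<leftharpoondown> r) \<longleftrightarrow> q \<sqsubseteq> (p \<rightharpoondown> z) \<leftharpoondown> r)" (is "_ \<longleftrightarrow> ?P")
proof
  assume P: ?P
  show "\<forall>x \<in> carrier R. \<forall>y \<in> carrier R. \<forall>z \<in> carrier R. x \<rightharpoondown> (z \<leftharpoondown> y) = (x \<rightharpoondown> z) \<leftharpoondown> y"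
  proof (intro ballI eq_primesI)
    fix x y z q
    assume c: "x \<in> carrier R" "y \<in> carrier R" "z \<in> carrier R" and q: "q \<in> completely_join_primes R"
    show "q \<sqsubseteq> x \<rightharpoondown> (z \<leftharpoondown> y) \<longleftrightarrow> q \<sqsubseteq> (x \<rightharpoondown> z) \<leftharpoondown> y"
      unfolding le_lres_rres_iff_primes[OF c completely_join_primes_closed[OF q]]
      using P q c(3) by simp
  qed simp_all
qed (simp add: completely_join_primes_closed)

text \<open>The left side is one bracketing of the coassociative law read on primes. Among the
  \<open>a\<close> with \<open>r \<sqsubseteq> a \<rightharpoondown> c\<close> there is a largest
  one, \<open>c \<leftharpoondown> r\<close>, and it can be taken as the witness.\<close>

lemma ex_left_factor_iff:
  assumes "p \<in> carrier R" "q \<in> carrier R" "r \<in> carrier R" "c \<in> carrier R"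
  shows "(\<exists>a \<in> carrier R. r \<sqsubseteq> a \<rightharpoondown> c \<and> q \<sqsubseteq> p \<rightharpoondown> a) \<longleftrightarrow> q \<sqsubseteq> p \<rightharpoondown> (c \<leftharpoondown> r)"
proof
  assume "\<exists>a \<in> carrier R. r \<sqsubseteq> a \<rightharpoondown> c \<and> q \<sqsubseteq> p \<rightharpoondown> a"
  then obtain a where a: "a \<in> carrier R" "r \<sqsubseteq> a \<rightharpoondown> c" "q \<sqsubseteq> p \<rightharpoondown> a" by blast
  then have "a \<sqsubseteq> c \<leftharpoondown> r" using residuation assms by simp
  then show "q \<sqsubseteq> p \<rightharpoondown> (c \<leftharpoondown> r)" using lres_mono[of p p a "c \<leftharpoondown> r" q q] a assms by simp
next
  assume "q \<sqsubseteq> p \<rightharpoondown> (c \<leftharpoondown> r)"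
  moreover have "r \<sqsubseteq> (c \<leftharpoondown> r) \<rightharpoondown> c" using residuation[of "c \<leftharpoondown> r" r c] assms by simp
  ultimately show "\<exists>a \<in> carrier R. r \<sqsubseteq> a \<rightharpoondown> c \<and> q \<sqsubseteq> p \<rightharpoondown> a"
    using assms by (intro bexI[of _ "c \<leftharpoondown> r"]) simp_all
qed

text \<open>The other bracketing: here \<open>p \<rightharpoondown> c\<close> is the largest
  candidate for \<open>b\<close>, and residuation then exchanges the roles of \<open>q\<close> and
  \<open>r\<close>.\<close>

lemma ex_right_factor_iff:
  assumes "p \<in> carrier R" "q \<in> carrier R" "r \<in> carrier R" "c \<in> carrier R"
  shows "(\<exists>b \<in> carrier R. b \<sqsubseteq> p \<rightharpoondown> c \<and> r \<sqsubseteq> q \<rightharpoondown> b) \<longleftrightarrow> q \<sqsubseteq> (p \<rightharpoondown> c) \<leftharpoondown> r"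
proof
  assume "\<exists>b \<in> carrier R. b \<sqsubseteq> p \<rightharpoondown> c \<and> r \<sqsubseteq> q \<rightharpoondown> b"
  then obtain b where b: "b \<in> carrier R" "b \<sqsubseteq> p \<rightharpoondown> c" "r \<sqsubseteq> q \<rightharpoondown> b" by blast
  then have "r \<sqsubseteq> q \<rightharpoondown> (p \<rightharpoondown> c)" using lres_mono[of q q b "p \<rightharpoondown> c" r r] assms by simp
  then show "q \<sqsubseteq> (p \<rightharpoondown> c) \<leftharpoondown> r" using residuation assms by simp
next
  assume "q \<sqsubseteq> (p \<rightharpoondown> c) \<leftharpoondown> r"
  then have "r \<sqsubseteq> q \<rightharpoondown> (p \<rightharpoondown> c)" using residuation assms by simp
  then show "\<exists>b \<in> carrier R. b \<sqsubseteq> p \<rightharpoondown> c \<and> r \<sqsubseteq> q \<rightharpoondown> b"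
    using assms by (intro bexI[of _ "p \<rightharpoondown> c"]) simp_all
qed

lemma residuation_unit_eq:
  assumes "is_residuation_unit R e" shows "residuation_unit R = e"
  unfolding residuation_unit_def
  using assms residuation_unit_unique[OF residuation_acdl_axioms] by (intro the_equality) blast+

end

lemma (in derivation_acdl) residuation_unit: "is_residuation_unit R (residuation_unit R)"
  using prime_unital residuation_unit_eq by auto

section \<open>The comonoid laws on completely join-primes\<close>

context spatial_lattice
begin

interpretation DD: two_spatial_lattices D D
  by unfold_locales

interpretation L: two_spatial_lattices "tensor D D" D
  by unfold_locales

interpretation R: two_spatial_lattices D "tensor D D"
  by unfold_locales

text \<open>Both sides are elements of the product of \<open>D\<close> with
  \<open>tensor D D\<close>, whose pairs of primes consist of some \<open>p\<close> and a pure
  tensor of primes. What remains on such a pair is a factorisation through a middle element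
  \<open>a\<close> or \<open>b\<close>.\<close>

lemma coassociative_iff_primes:
  assumes \<gamma>: "\<And>c. c \<in> carrier D \<Longrightarrow> \<gamma> c \<in> carrier (tensor D D)" and c: "c \<in> carrier D"
  shows "tensor_assoc D D D (tensor_map D D (tensor D D) D \<gamma> (\<lambda>x. x) (\<gamma> c))
      = tensor_map D D D (tensor D D) (\<lambda>x. x) \<gamma> (\<gamma> c) \<longleftrightarrow>
    (\<forall>p \<in> completely_join_primes D. \<forall>q \<in> completely_join_primes D. \<forall>r \<in> completely_join_primes D.
      (\<exists>a \<in> carrier D. (a, r) \<in> \<gamma> c \<and> (p, q) \<in> \<gamma> a) \<longleftrightarrow> (\<exists>b \<in> carrier D. (p, b) \<in> \<gamma> c \<and> (q, r) \<in> \<gamma> b))"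
    (is "?l = ?r \<longleftrightarrow> _")
proof -
  let ?m = "tensor_map D D (tensor D D) D \<gamma> (\<lambda>x. x) (\<gamma> c)"
  note cl = complete_lattice_axioms DD.tensor_complete_lattice
  note sp = spatial_lattice_axioms DD.tensor_spatial
  have m: "?m \<in> carrier L.T" by (rule tensor_map_closed[OF cl(1,1,2,1) \<gamma> _ \<gamma>[OF c]])
  have r: "?r \<in> carrier R.T" by (rule tensor_map_closed[OF cl(1,1,1,2) _ \<gamma> \<gamma>[OF c]])
  note l = tensor_assoc_mem_iff[OF sp(1,1,1) m]
  have 1: "(p, pure_tensor D D q r) \<in> ?l \<longleftrightarrow> (\<exists>a \<in> carrier D. (a, r) \<in> \<gamma> c \<and> (p, q) \<in> \<gamma> a)"
    if pqr: "p \<in> completely_join_primes D" "q \<in> completely_join_primes D" "r \<in> completely_join_primes D"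
    for p q r
  proof -
    note k = completely_join_primes_closed[OF pqr(1)] completely_join_primes_closed[OF pqr(2)]
      completely_join_primes_closed[OF pqr(3)]
    have "(p, pure_tensor D D q r) \<in> ?l \<longleftrightarrow> (\<exists>a e. (a, e) \<in> \<gamma> c \<and> pure_tensor D D p q \<sqsubseteq>\<^bsub>DD.T\<^esub> \<gamma> a \<and> r \<sqsubseteq> e)"
      unfolding l(2)[OF pqr]
      by (rule tensor_map_mem_iff[OF cl(1,1) sp(2,1) \<gamma> _ \<gamma>[OF c] DD.pure_tensor_prime[OF pqr(1,2)] pqr(3)])
    \<comment> \<open>Downward closure allows \<open>e\<close> to be replaced by
      \<open>r\<close>.\<close>
    also have "\<dots> \<longleftrightarrow> (\<exists>a \<in> carrier D. (a, r) \<in> \<gamma> c \<and> (p, q) \<in> \<gamma> a)"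
    proof
      assume "\<exists>a e. (a, e) \<in> \<gamma> c \<and> pure_tensor D D p q \<sqsubseteq>\<^bsub>DD.T\<^esub> \<gamma> a \<and> r \<sqsubseteq> e"
      then obtain a e where ae: "(a, e) \<in> \<gamma> c" "pure_tensor D D p q \<sqsubseteq>\<^bsub>DD.T\<^esub> \<gamma> a" "r \<sqsubseteq> e" by blast
      note a = DD.tensor_memD(1)[OF \<gamma>[OF c] ae(1)]
      have "(a, r) \<in> \<gamma> c" using DD.tensor_memD(3)[OF \<gamma>[OF c] ae(1) a k(3) _ ae(3)] a by simp
      moreover have "(p, q) \<in> \<gamma> a" using ae(2) DD.pure_tensor_le_iff[OF \<gamma>[OF a] k(1,2)] by simp
      ultimately show "\<exists>a \<in> carrier D. (a, r) \<in> \<gamma> c \<and> (p, q) \<in> \<gamma> a" using a by blast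
    next
      assume "\<exists>a \<in> carrier D. (a, r) \<in> \<gamma> c \<and> (p, q) \<in> \<gamma> a"
      then obtain a where a: "a \<in> carrier D" "(a, r) \<in> \<gamma> c" "(p, q) \<in> \<gamma> a" by blast
      then show "\<exists>a e. (a, e) \<in> \<gamma> c \<and> pure_tensor D D p q \<sqsubseteq>\<^bsub>DD.T\<^esub> \<gamma> a \<and> r \<sqsubseteq> e"
        using DD.pure_tensor_le_iff[OF \<gamma>[OF a(1)] k(1,2)] k(3) by (intro exI[of _ a] exI[of _ r]) simp
    qed
    finally show ?thesis .
  qed
  have 2: "(p, pure_tensor D D q r) \<in> ?r \<longleftrightarrow> (\<exists>b \<in> carrier D. (p, b) \<in> \<gamma> c \<and> (q, r) \<in> \<gamma> b)"
    if pqr: "p \<in> completely_join_primes D" "q \<in> completely_join_primes D" "r \<in> completely_join_primes D"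
    for p q r
  proof -
    note k = completely_join_primes_closed[OF pqr(1)] completely_join_primes_closed[OF pqr(2)]
      completely_join_primes_closed[OF pqr(3)]
    have "(p, pure_tensor D D q r) \<in> ?r \<longleftrightarrow> (\<exists>d b. (d, b) \<in> \<gamma> c \<and> p \<sqsubseteq> d \<and> pure_tensor D D q r \<sqsubseteq>\<^bsub>DD.T\<^esub> \<gamma> b)"
      by (rule tensor_map_mem_iff[OF cl(1,1) sp(1,2) _ \<gamma> \<gamma>[OF c] pqr(1) DD.pure_tensor_prime[OF pqr(2,3)]])
    also have "\<dots> \<longleftrightarrow> (\<exists>b \<in> carrier D. (p, b) \<in> \<gamma> c \<and> (q, r) \<in> \<gamma> b)"
    proof
      assume "\<exists>d b. (d, b) \<in> \<gamma> c \<and> p \<sqsubseteq> d \<and> pure_tensor D D q r \<sqsubseteq>\<^bsub>DD.T\<^esub> \<gamma> b"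
      then obtain d b where db: "(d, b) \<in> \<gamma> c" "p \<sqsubseteq> d" "pure_tensor D D q r \<sqsubseteq>\<^bsub>DD.T\<^esub> \<gamma> b" by blast
      note b = DD.tensor_memD(2)[OF \<gamma>[OF c] db(1)]
      have "(p, b) \<in> \<gamma> c" using DD.tensor_memD(3)[OF \<gamma>[OF c] db(1) k(1) b db(2)] b by simp
      moreover have "(q, r) \<in> \<gamma> b" using db(3) DD.pure_tensor_le_iff[OF \<gamma>[OF b] k(2,3)] by simp
      ultimately show "\<exists>b \<in> carrier D. (p, b) \<in> \<gamma> c \<and> (q, r) \<in> \<gamma> b" using b by blast
    next
      assume "\<exists>b \<in> carrier D. (p, b) \<in> \<gamma> c \<and> (q, r) \<in> \<gamma> b"
      then obtain b where b: "b \<in> carrier D" "(p, b) \<in> \<gamma> c" "(q, r) \<in> \<gamma> b" by blast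
      then show "\<exists>d b. (d, b) \<in> \<gamma> c \<and> p \<sqsubseteq> d \<and> pure_tensor D D q r \<sqsubseteq>\<^bsub>DD.T\<^esub> \<gamma> b"
        using DD.pure_tensor_le_iff[OF \<gamma>[OF b(1)] k(2,3)] k(1) by (intro exI[of _ p] exI[of _ b]) simp
    qed
    finally show ?thesis .
  qed
  have "?l = ?r \<longleftrightarrow> (\<forall>p \<in> completely_join_primes D. \<forall>q \<in> completely_join_primes D. \<forall>r \<in> completely_join_primes D.
      (p, pure_tensor D D q r) \<in> ?l \<longleftrightarrow> (p, pure_tensor D D q r) \<in> ?r)" (is "_ \<longleftrightarrow> ?P")
  proof
    assume P: ?P
    show "?l = ?r"
    proof (rule R.tensor_eqI[OF l(1) r])
      fix p X assume p: "p \<in> completely_join_primes D" and "X \<in> completely_join_primes DD.T"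
      then obtain q r where "q \<in> completely_join_primes D" "r \<in> completely_join_primes D"
        "X = pure_tensor D D q r" by (elim DD.tensor_primeE)
      then show "(p, X) \<in> ?l \<longleftrightarrow> (p, X) \<in> ?r" using P p by simp
    qed
  qed simp
  then show ?thesis using 1 2 by simp
qed

text \<open>The unitor sends a pair with first component \<open>False\<close> to the bottom, below
  which there are no primes, so for a prime \<open>p\<close> it is membership of
  \<open>(True, p)\<close> that counts.\<close>

lemma left_counit_iff_primes:
  assumes I: "I \<in> carrier (tensor D D)" and c: "c \<in> carrier D"
  shows "tensor_left_unitor D (tensor_map D D two D \<epsilon> (\<lambda>x. x) I) = c \<longleftrightarrow>
    (\<forall>p \<in> completely_join_primes D. (\<exists>a. \<epsilon> a \<and> (a, p) \<in> I) \<longleftrightarrow> p \<sqsubseteq> c)" (is "?u = c \<longleftrightarrow> _")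
proof -
  interpret two_spatial_lattices two D
    using two_spatial_lattice spatial_lattice_axioms by (simp add: two_spatial_lattices_def)
  let ?m = "tensor_map D D two D \<epsilon> (\<lambda>x. x) I"
  have m: "?m \<in> carrier T"
    by (rule tensor_map_closed[OF complete_lattice_axioms complete_lattice_axioms
          two_complete_lattice complete_lattice_axioms _ _ I]) simp_all
  have b: "(if b then d else \<bottom>) \<in> carrier D" if "b \<in> carrier two" "d \<in> carrier D" for b d using that by simp
  have u: "?u \<in> carrier D"
    unfolding tensor_left_unitor_def by (rule tensor_lift_closed[OF complete_lattice_axioms m b])
  have "p \<sqsubseteq> ?u \<longleftrightarrow> (\<exists>a. \<epsilon> a \<and> (a, p) \<in> I)" if p: "p \<in> completely_join_primes D" for p
  proof -
    note pc = completely_join_primes_closed[OF p]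
    have "p \<sqsubseteq> ?u \<longleftrightarrow> (\<exists>b d. (b, d) \<in> ?m \<and> p \<sqsubseteq> (if b then d else \<bottom>))"
      unfolding tensor_left_unitor_def
      by (rule prime_le_tensor_lift_iff[OF complete_lattice_axioms m b p])
    also have "\<dots> \<longleftrightarrow> (True, p) \<in> ?m"
    proof
      assume "\<exists>b d. (b, d) \<in> ?m \<and> p \<sqsubseteq> (if b then d else \<bottom>)"
      then obtain b d where "(b, d) \<in> ?m" "p \<sqsubseteq> (if b then d else \<bottom>)" by blast
      then have "(True, d) \<in> ?m" "p \<sqsubseteq> d" using prime_not_le_bottom[OF p] by (auto split: if_splits)
      then show "(True, p) \<in> ?m" using tensor_memD(3)[OF m, of True d True p] pc by simp
    qed (use pc in force)
    also have "\<dots> \<longleftrightarrow> (\<exists>a e. (a, e) \<in> I \<and> True \<sqsubseteq>\<^bsub>two\<^esub> \<epsilon> a \<and> p \<sqsubseteq> e)"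
      by (rule tensor_map_mem_iff[OF complete_lattice_axioms complete_lattice_axioms
          two_spatial_lattice spatial_lattice_axioms _ _ I _ p]) (simp_all add: two_primes)
    also have "\<dots> \<longleftrightarrow> (\<exists>a. \<epsilon> a \<and> (a, p) \<in> I)"
    proof
      assume "\<exists>a e. (a, e) \<in> I \<and> True \<sqsubseteq>\<^bsub>two\<^esub> \<epsilon> a \<and> p \<sqsubseteq> e"
      then obtain a e where ae: "(a, e) \<in> I" "\<epsilon> a" "p \<sqsubseteq> e" by auto
      note a = DD.tensor_memD(1)[OF I ae(1)]
      have "(a, p) \<in> I" using DD.tensor_memD(3)[OF I ae(1) a pc _ ae(3)] a by simp
      then show "\<exists>a. \<epsilon> a \<and> (a, p) \<in> I" using ae(2) by blast
    qed (use pc in auto)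
    finally show ?thesis .
  qed
  then show ?thesis using eq_primesI[OF u c] by auto
qed

lemma right_counit_iff_primes:
  assumes I: "I \<in> carrier (tensor D D)" and c: "c \<in> carrier D"
  shows "tensor_right_unitor D (tensor_map D D D two (\<lambda>x. x) \<epsilon> I) = c \<longleftrightarrow>
    (\<forall>p \<in> completely_join_primes D. (\<exists>b. \<epsilon> b \<and> (p, b) \<in> I) \<longleftrightarrow> p \<sqsubseteq> c)" (is "?u = c \<longleftrightarrow> _")
proof -
  interpret two_spatial_lattices D two
    using two_spatial_lattice spatial_lattice_axioms by (simp add: two_spatial_lattices_def)
  let ?m = "tensor_map D D D two (\<lambda>x. x) \<epsilon> I"
  have m: "?m \<in> carrier T"
    by (rule tensor_map_closed[OF complete_lattice_axioms complete_lattice_axioms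
          complete_lattice_axioms two_complete_lattice _ _ I]) simp_all
  have b: "(if b then d else \<bottom>) \<in> carrier D" if "d \<in> carrier D" "b \<in> carrier two" for b d using that by simp
  have u: "?u \<in> carrier D"
    unfolding tensor_right_unitor_def by (rule tensor_lift_closed[OF complete_lattice_axioms m b])
  have "p \<sqsubseteq> ?u \<longleftrightarrow> (\<exists>a. \<epsilon> a \<and> (p, a) \<in> I)" if p: "p \<in> completely_join_primes D" for p
  proof -
    note pc = completely_join_primes_closed[OF p]
    have "p \<sqsubseteq> ?u \<longleftrightarrow> (\<exists>d b. (d, b) \<in> ?m \<and> p \<sqsubseteq> (if b then d else \<bottom>))"
      unfolding tensor_right_unitor_def
      by (rule prime_le_tensor_lift_iff[OF complete_lattice_axioms m b p])
    also have "\<dots> \<longleftrightarrow> (p, True) \<in> ?m"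
    proof
      assume "\<exists>d b. (d, b) \<in> ?m \<and> p \<sqsubseteq> (if b then d else \<bottom>)"
      then obtain b d where "(d, b) \<in> ?m" "p \<sqsubseteq> (if b then d else \<bottom>)" by blast
      then have "(d, True) \<in> ?m" "p \<sqsubseteq> d" using prime_not_le_bottom[OF p] by (auto split: if_splits)
      then show "(p, True) \<in> ?m" using tensor_memD(3)[OF m, of d True p True] pc by simp
    qed (use pc in force)
    also have "\<dots> \<longleftrightarrow> (\<exists>e a. (e, a) \<in> I \<and> p \<sqsubseteq> e \<and> True \<sqsubseteq>\<^bsub>two\<^esub> \<epsilon> a)"
      by (rule tensor_map_mem_iff[OF complete_lattice_axioms complete_lattice_axioms
          spatial_lattice_axioms two_spatial_lattice _ _ I p]) (simp_all add: two_primes)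
    also have "\<dots> \<longleftrightarrow> (\<exists>a. \<epsilon> a \<and> (p, a) \<in> I)"
    proof
      assume "\<exists>e a. (e, a) \<in> I \<and> p \<sqsubseteq> e \<and> True \<sqsubseteq>\<^bsub>two\<^esub> \<epsilon> a"
      then obtain a e where ae: "(e, a) \<in> I" "\<epsilon> a" "p \<sqsubseteq> e" by auto
      note a = DD.tensor_memD(2)[OF I ae(1)]
      have "(p, a) \<in> I" using DD.tensor_memD(3)[OF I ae(1) pc a ae(3)] a by simp
      then show "\<exists>a. \<epsilon> a \<and> (p, a) \<in> I" using ae(2) by blast
    qed (use pc in auto)
    finally show ?thesis .
  qed
  then show ?thesis using eq_primesI[OF u c] by auto
qed

end

section \<open>Comonoids as derivation ACDLs\<close>

context acdl_comonoid
begin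

interpretation CC: two_spatial_lattices C C
  by unfold_locales

abbreviation (input) "R \<equiv> residuation_of C"

lemma comult_closed: "c \<in> carrier C \<Longrightarrow> comult C c \<in> carrier (tensor C C)"
  using comult_morphism by (auto simp: acdl_morphisms_def)

lemma comult_extensional: "comult C \<in> extensional (carrier C)"
  using comult_morphism by (auto simp: acdl_morphisms_def PiE_iff)

lemma counit_extensional: "counit C \<in> extensional (carrier C)"
  using counit_morphism by (auto simp: acdl_morphisms_def PiE_iff)

lemma comult_memD:
  assumes "c \<in> carrier C" "(a, b) \<in> comult C c" shows "a \<in> carrier C" "b \<in> carrier C"
  using CC.tensor_memD(1,2)[OF comult_closed] assms by blast+

text \<open>The join that defines the residual is attained, because \<open>comult C c\<close> is
  closed under joins in the second variable; downward closure gives the rest.\<close>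

lemma le_lres_iff:
  assumes "a \<in> carrier C" "b \<in> carrier C" "c \<in> carrier C"
  shows "b \<sqsubseteq> a \<rightharpoondown>\<^bsub>R\<^esub> c \<longleftrightarrow> (a, b) \<in> comult C c"
proof -
  let ?B = "{b \<in> carrier C. (a, b) \<in> comult C c}"
  have B: "?B \<subseteq> carrier C" by blast
  have eq: "a \<rightharpoondown>\<^bsub>R\<^esub> c = \<Squnion> ?B" using assms by (simp add: residuation_of_def)
  have m: "(a, \<Squnion> ?B) \<in> comult C c"
    by (rule CC.tensor_memD(5)[OF comult_closed[OF assms(3)] assms(1) B]) simp
  show ?thesis
    unfolding eq
    using sup_upper[OF B, of b] CC.tensor_memD(3)[OF comult_closed[OF assms(3)] m assms(1,2)] assms
    by auto
qed

lemma le_rres_iff: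
  assumes "a \<in> carrier C" "b \<in> carrier C" "c \<in> carrier C"
  shows "a \<sqsubseteq> c \<leftharpoondown>\<^bsub>R\<^esub> b \<longleftrightarrow> (a, b) \<in> comult C c"
proof -
  let ?A = "{a \<in> carrier C. (a, b) \<in> comult C c}"
  have A: "?A \<subseteq> carrier C" by blast
  have eq: "c \<leftharpoondown>\<^bsub>R\<^esub> b = \<Squnion> ?A" using assms by (simp add: residuation_of_def)
  have m: "(\<Squnion> ?A, b) \<in> comult C c"
    by (rule CC.tensor_memD(4)[OF comult_closed[OF assms(3)] A assms(2)]) simp
  show ?thesis
    unfolding eq
    using sup_upper[OF A, of a] CC.tensor_memD(3)[OF comult_closed[OF assms(3)] m assms(1,2)] assms
    by auto
qed

lemma comult_inf_mem_iff:
  assumes "X \<subseteq> carrier C" "a \<in> carrier C" "b \<in> carrier C"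
  shows "(a, b) \<in> comult C (\<Sqinter> X) \<longleftrightarrow> (\<forall>x \<in> X. (a, b) \<in> comult C x)"
proof -
  have "comult C (\<Sqinter> X) = \<Sqinter>\<^bsub>CC.T\<^esub> (comult C ` X)"
    using comult_morphism assms(1) by (simp add: acdl_morphisms_def preserves_meets_def)
  moreover have "comult C ` X \<subseteq> carrier CC.T" using comult_closed assms(1) by blast
  ultimately show ?thesis using CC.tensor_inf_mem_iff[OF _ assms(2,3)] by simp
qed

lemma comult_sup_mem_iff:
  assumes "X \<subseteq> carrier C" "p \<in> completely_join_primes C" "q \<in> completely_join_primes C"
  shows "(p, q) \<in> comult C (\<Squnion> X) \<longleftrightarrow> (\<exists>x \<in> X. (p, q) \<in> comult C x)"
proof -
  have "comult C (\<Squnion> X) = \<Squnion>\<^bsub>CC.T\<^esub> (comult C ` X)"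
    using comult_morphism assms(1) by (simp add: acdl_morphisms_def preserves_joins_def)
  moreover have "comult C ` X \<subseteq> carrier CC.T" using comult_closed assms(1) by blast
  ultimately show ?thesis using CC.tensor_sup_mem_iff[OF _ assms(2,3)] by simp
qed

lemma residuals_closed:
  assumes "a \<in> carrier C" "c \<in> carrier C"
  shows "a \<rightharpoondown>\<^bsub>R\<^esub> c \<in> carrier C" "c \<leftharpoondown>\<^bsub>R\<^esub> a \<in> carrier C"
  using assms by (simp_all add: residuation_of_def)

lemma residuation_acdl_residuation_of: "residuation_acdl R"
proof (rule residuation_acdlI[where P = "\<lambda>a b c. (a, b) \<in> comult C c"])
  show "acdl R" by (simp add: acdl_axioms)
  show "lres R \<in> carrier R \<rightarrow>\<^sub>E carrier R \<rightarrow>\<^sub>E carrier R" "rres R \<in> carrier R \<rightarrow>\<^sub>E carrier R \<rightarrow>\<^sub>E carrier R"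
    by (auto simp: residuation_of_def)
qed (simp_all add: le_lres_iff le_rres_iff comult_inf_mem_iff)

text \<open>Preservation of meets puts the meet of all elements with true counit among them, and
  preservation of joins makes the counit monotone. The counit is thus the indicator of a principal
  filter, whose generator will be the unit.\<close>

lemma counit_iff:
  assumes "a \<in> carrier C"
  shows "counit C a \<longleftrightarrow> \<Sqinter> {a \<in> carrier C. counit C a} \<sqsubseteq> a" (is "_ \<longleftrightarrow> ?e \<sqsubseteq> a")
proof
  have E: "{a \<in> carrier C. counit C a} \<subseteq> carrier C" by blast
  show "?e \<sqsubseteq> a" if "counit C a" using inf_lower[OF E] assms that by simp
  assume le: "?e \<sqsubseteq> a"
  have "counit C ?e = \<Sqinter>\<^bsub>two\<^esub> (counit C ` {a \<in> carrier C. counit C a})"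
    using counit_morphism E unfolding acdl_morphisms_def preserves_meets_def by blast
  then have e: "counit C ?e" by auto
  have c: "{?e, a} \<subseteq> carrier C" using assms E by simp
  have "a = \<Squnion> {?e, a}" using le c sup_upper[OF c, of a] by (intro le_antisym sup_least) auto
  moreover have "counit C (\<Squnion> {?e, a}) = \<Squnion>\<^bsub>two\<^esub> (counit C ` {?e, a})"
    using counit_morphism c unfolding acdl_morphisms_def preserves_joins_def by blast
  ultimately show "counit C a" using e by simp
qed

text \<open>Being above \<open>?e\<close> means having true counit, and the counit preserves
  joins.\<close>

lemma unit_prime: "\<Sqinter> {a \<in> carrier C. counit C a} \<in> completely_join_primes C" (is "?e \<in> _")
  unfolding completely_join_primes_def
proof (intro CollectI conjI allI impI)
  show "?e \<in> carrier C" by (rule inf_closed) blast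
  fix A assume A: "A \<subseteq> carrier C \<and> ?e \<sqsubseteq> \<Squnion> A"
  then have "counit C (\<Squnion> A)" using counit_iff by simp
  moreover have "counit C (\<Squnion> A) = \<Squnion>\<^bsub>two\<^esub> (counit C ` A)"
    using counit_morphism A by (simp add: acdl_morphisms_def preserves_joins_def)
  ultimately obtain a where a: "a \<in> A" "counit C a" by auto
  then have "?e \<sqsubseteq> a" using counit_iff A by blast
  with a(1) show "\<exists>a \<in> A. ?e \<sqsubseteq> a" by (rule rev_bexI)
qed

text \<open>On primes the counit laws speak of some \<open>a\<close> with true counit. The least
  such \<open>a\<close> is the meet \<open>?e\<close>, so by downward closure it can be used in
  place of any other.\<close>

lemma is_unit: "is_residuation_unit R (\<Sqinter> {a \<in> carrier C. counit C a})" (is "is_residuation_unit R ?e")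
proof -
  have ec: "?e \<in> carrier C" by (rule completely_join_primes_closed[OF unit_prime])
  have cu: "counit C a \<longleftrightarrow> ?e \<sqsubseteq> a" if "a \<in> carrier C" for a by (rule counit_iff[OF that])
  have "?e \<rightharpoondown>\<^bsub>R\<^esub> z = z" if z: "z \<in> carrier C" for z
  proof (rule eq_primesI[OF residuals_closed(1)[OF ec z] z])
    fix p assume p: "p \<in> completely_join_primes C"
    note pc = completely_join_primes_closed[OF p]
    have "(\<exists>a. counit C a \<and> (a, p) \<in> comult C z) \<longleftrightarrow> (?e, p) \<in> comult C z"
    proof
      assume "\<exists>a. counit C a \<and> (a, p) \<in> comult C z"
      then obtain a where a: "counit C a" "(a, p) \<in> comult C z" by blast
      have "?e \<sqsubseteq> a" using cu a(1) comult_memD(1)[OF z a(2)] by blast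
      then show "(?e, p) \<in> comult C z"
        using CC.tensor_memD(3)[OF comult_closed[OF z] a(2) ec pc] pc by simp
    qed (use cu ec in blast)
    moreover have "(\<exists>a. counit C a \<and> (a, p) \<in> comult C z) \<longleftrightarrow> p \<sqsubseteq> z"
      by (rule left_counit_iff_primes[OF comult_closed[OF z] z, THEN iffD1, OF counit_left[OF z], rule_format, OF p])
    ultimately show "p \<sqsubseteq> ?e \<rightharpoondown>\<^bsub>R\<^esub> z \<longleftrightarrow> p \<sqsubseteq> z" using le_lres_iff[OF ec pc z] by simp
  qed
  moreover have "z \<leftharpoondown>\<^bsub>R\<^esub> ?e = z" if z: "z \<in> carrier C" for z
  proof (rule eq_primesI[OF residuals_closed(2)[OF ec z] z])
    fix p assume p: "p \<in> completely_join_primes C"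
    note pc = completely_join_primes_closed[OF p]
    have "(\<exists>a. counit C a \<and> (p, a) \<in> comult C z) \<longleftrightarrow> (p, ?e) \<in> comult C z"
    proof
      assume "\<exists>a. counit C a \<and> (p, a) \<in> comult C z"
      then obtain a where a: "counit C a" "(p, a) \<in> comult C z" by blast
      have "?e \<sqsubseteq> a" using cu a(1) comult_memD(2)[OF z a(2)] by blast
      then show "(p, ?e) \<in> comult C z"
        using CC.tensor_memD(3)[OF comult_closed[OF z] a(2) pc ec] pc by simp
    qed (use cu ec in blast)
    moreover have "(\<exists>a. counit C a \<and> (p, a) \<in> comult C z) \<longleftrightarrow> p \<sqsubseteq> z"
      by (rule right_counit_iff_primes[OF comult_closed[OF z] z, THEN iffD1, OF counit_right[OF z], rule_format, OF p])
    ultimately show "p \<sqsubseteq> z \<leftharpoondown>\<^bsub>R\<^esub> ?e \<longleftrightarrow> p \<sqsubseteq> z" using le_rres_iff[OF pc ec z] by simp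
  qed
  ultimately show ?thesis using unit_prime by (simp add: is_residuation_unit_def)
qed

text \<open>Associativity is coassociativity on primes with the largest witnesses inserted. Purity
  is preservation of joins by \<open>comult C\<close>: for a pair of primes, membership in a join of
  the tensor product is membership in one of its terms.\<close>

theorem derivation_acdl_residuation_of: "derivation_acdl R"
proof -
  interpret R: residuation_acdl R by (rule residuation_acdl_residuation_of)
  have pr: "q \<sqsubseteq> p \<rightharpoondown>\<^bsub>R\<^esub> (z \<leftharpoondown>\<^bsub>R\<^esub> r) \<longleftrightarrow> q \<sqsubseteq> (p \<rightharpoondown>\<^bsub>R\<^esub> z) \<leftharpoondown>\<^bsub>R\<^esub> r"
    if pqr: "p \<in> completely_join_primes C" "q \<in> completely_join_primes C" "r \<in> completely_join_primes C"
      and z: "z \<in> carrier C" for p q r z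
  proof -
    note k = completely_join_primes_closed[OF pqr(1)] completely_join_primes_closed[OF pqr(2)]
      completely_join_primes_closed[OF pqr(3)]
    have "\<forall>p \<in> completely_join_primes C. \<forall>q \<in> completely_join_primes C. \<forall>r \<in> completely_join_primes C.
        (\<exists>a \<in> carrier C. (a, r) \<in> comult C z \<and> (p, q) \<in> comult C a) \<longleftrightarrow>
        (\<exists>b \<in> carrier C. (p, b) \<in> comult C z \<and> (q, r) \<in> comult C b)"
      by (rule iffD1[OF coassociative_iff_primes[of "comult C" z] coassociative[OF z]])
        (simp_all add: comult_closed z)
    from this[rule_format, OF pqr]
    have "(\<exists>a \<in> carrier C. (a, r) \<in> comult C z \<and> (p, q) \<in> comult C a) \<longleftrightarrow>
        (\<exists>b \<in> carrier C. (p, b) \<in> comult C z \<and> (q, r) \<in> comult C b)" .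
    moreover have "(\<exists>a \<in> carrier C. (a, r) \<in> comult C z \<and> (p, q) \<in> comult C a) \<longleftrightarrow>
        (\<exists>a \<in> carrier C. r \<sqsubseteq> a \<rightharpoondown>\<^bsub>R\<^esub> z \<and> q \<sqsubseteq> p \<rightharpoondown>\<^bsub>R\<^esub> a)"
      using z k by (intro bex_cong) (simp_all add: le_lres_iff)
    moreover have "(\<exists>b \<in> carrier C. (p, b) \<in> comult C z \<and> (q, r) \<in> comult C b) \<longleftrightarrow>
        (\<exists>b \<in> carrier C. b \<sqsubseteq> p \<rightharpoondown>\<^bsub>R\<^esub> z \<and> r \<sqsubseteq> q \<rightharpoondown>\<^bsub>R\<^esub> b)"
      using z k by (intro bex_cong) (simp_all add: le_lres_iff)
    ultimately show ?thesis
      using R.ex_left_factor_iff[of p q r z] R.ex_right_factor_iff[of p q r z] k z by simp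
  qed
  show ?thesis
  proof (intro derivation_acdl.intro derivation_acdl_axioms.intro)
    show "residuation_acdl R" by (rule residuation_acdl_residuation_of)
    show "x \<rightharpoondown>\<^bsub>R\<^esub> (z \<leftharpoondown>\<^bsub>R\<^esub> y) = (x \<rightharpoondown>\<^bsub>R\<^esub> z) \<leftharpoondown>\<^bsub>R\<^esub> y"
      if "x \<in> carrier R" "y \<in> carrier R" "z \<in> carrier R" for x y z
      using R.associative_iff_primes pr that by simp
    show "\<exists>e. is_residuation_unit R e" using is_unit by blast
    fix p assume "p \<in> completely_join_primes R"
    then have p: "p \<in> completely_join_primes C" by simp
    note pc = completely_join_primes_closed[OF p]
    show "preserves_joins R R (\<lambda>z. p \<rightharpoondown>\<^bsub>R\<^esub> z)" "preserves_joins R R (\<lambda>z. z \<leftharpoondown>\<^bsub>R\<^esub> p)"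
      by (rule R.preserves_joinsI; use p pc residuals_closed in
          \<open>simp add: completely_join_primes_closed le_lres_iff le_rres_iff comult_sup_mem_iff subset_iff\<close>)+
  qed
qed

lemma counit_iff_unit:
  assumes "a \<in> carrier C" shows "counit C a \<longleftrightarrow> residuation_unit R \<sqsubseteq> a"
  using counit_iff[OF assms] residuation_acdl.residuation_unit_eq[OF residuation_acdl_residuation_of is_unit]
  by simp

lemma comonoid_of_residuation_of: "comonoid_of R = C"
proof (rule comonoid.equality)
  show "comult (comonoid_of R) = comult C"
  proof (rule extensionalityI[of _ "carrier C"])
    show "comult (comonoid_of R) \<in> extensional (carrier C)" by (simp add: comonoid_of_def)
    fix c assume c: "c \<in> carrier C"
    show "comult (comonoid_of R) c = comult C c"
      using c le_lres_iff[OF _ _ c] comult_memD[OF c] by (auto simp: comonoid_of_def)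
  qed (rule comult_extensional)
  show "counit (comonoid_of R) = counit C"
  proof (rule extensionalityI[of _ "carrier C"])
    show "counit (comonoid_of R) \<in> extensional (carrier C)" by (simp add: comonoid_of_def)
    fix c assume c: "c \<in> carrier C"
    show "counit (comonoid_of R) c = counit C c"
      using counit_iff_unit[OF c] c by (simp add: comonoid_of_def)
  qed (rule counit_extensional)
qed simp_all

end

section \<open>Derivation ACDLs as comonoids\<close>

context derivation_acdl
begin

interpretation RR: two_spatial_lattices R R
  by unfold_locales

abbreviation (input) "C \<equiv> comonoid_of R"

lemma comult_of_mem_iff:
  assumes "c \<in> carrier R" shows "(a, b) \<in> comult C c \<longleftrightarrow> a \<in> carrier R \<and> b \<in> carrier R \<and> b \<sqsubseteq> a \<rightharpoondown> c"
  using assms by (simp add: comonoid_of_def)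

lemma comult_of_closed: "c \<in> carrier R \<Longrightarrow> comult C c \<in> carrier (tensor R R)"
  using residual_tensor by (simp add: comonoid_of_def)

lemma counit_of: "c \<in> carrier R \<Longrightarrow> counit C c \<longleftrightarrow> residuation_unit R \<sqsubseteq> c"
  by (simp add: comonoid_of_def)

lemma tensor_of: "tensor C C = tensor R R"
  by (simp add: tensor_def)

lemma unit_prime: "residuation_unit R \<in> completely_join_primes R"
  and unit_closed: "residuation_unit R \<in> carrier R"
  and unit_left: "z \<in> carrier R \<Longrightarrow> residuation_unit R \<rightharpoondown> z = z"
  and unit_right: "z \<in> carrier R \<Longrightarrow> z \<leftharpoondown> residuation_unit R = z"
proof -
  note u = residuation_unit[unfolded is_residuation_unit_def]
  show "residuation_unit R \<in> completely_join_primes R" by (rule u[THEN conjunct1])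
  then show "residuation_unit R \<in> carrier R" by (rule completely_join_primes_closed)
  show "residuation_unit R \<rightharpoondown> z = z" "z \<leftharpoondown> residuation_unit R = z" if "z \<in> carrier R"
    using u[THEN conjunct2, rule_format, OF that] by simp_all
qed

text \<open>The correspondence read backwards: purity gives preservation of joins by the
  comultiplication, primality of the unit gives it for the counit, and associativity gives the
  coassociative law.\<close>

theorem acdl_comonoid_comonoid_of: "acdl_comonoid C"
proof -
  interpret C: spatial_lattice C
    by (simp add: acdl_iff_spatial_lattice[symmetric] acdl_axioms)
  have cc: "comult C c \<in> carrier (tensor C C)" if "c \<in> carrier C" for c
    using comult_of_closed that tensor_of by simp
  have img: "comult C ` A \<subseteq> carrier RR.T" if "A \<subseteq> carrier R" for A
    using comult_of_closed that by blast
  show ?thesis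
  proof (intro acdl_comonoid.intro acdl_comonoid_axioms.intro)
    show "acdl C" by (simp add: acdl_axioms)
    have "comult C (\<Squnion> A) = \<Squnion>\<^bsub>RR.T\<^esub> (comult C ` A)" if A: "A \<subseteq> carrier R" for A
    proof (rule RR.tensor_eqI[OF comult_of_closed[OF sup_closed[OF A]] RR.T.sup_closed[OF img[OF A]]])
      fix p q assume p: "p \<in> completely_join_primes R" and q: "q \<in> completely_join_primes R"
      note pc = completely_join_primes_closed[OF p] and qc = completely_join_primes_closed[OF q]
      have i: "(\<lambda>z. p \<rightharpoondown> z) ` A \<subseteq> carrier R" using A pc by auto
      have "(p, q) \<in> comult C (\<Squnion> A) \<longleftrightarrow> q \<sqsubseteq> p \<rightharpoondown> \<Squnion> A"
        using comult_of_mem_iff[OF sup_closed[OF A]] pc qc by simp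
      \<comment> \<open>Purity enters here, \<open>p\<close> being prime.\<close>
      also have "p \<rightharpoondown> \<Squnion> A = \<Squnion> ((\<lambda>z. p \<rightharpoondown> z) ` A)"
        using pure_left[OF p] A by (simp add: preserves_joins_def)
      also have "q \<sqsubseteq> \<dots> \<longleftrightarrow> (\<exists>z \<in> A. q \<sqsubseteq> p \<rightharpoondown> z)"
        using prime_le_sup_iff[OF q i] by simp
      also have "\<dots> \<longleftrightarrow> (\<exists>z \<in> A. (p, q) \<in> comult C z)"
        by (intro ball_cong bex_cong HOL.refl)
          (simp add: comult_of_mem_iff[OF subsetD[OF A]] pc qc)
      finally show "(p, q) \<in> comult C (\<Squnion> A) \<longleftrightarrow> (p, q) \<in> \<Squnion>\<^bsub>RR.T\<^esub> (comult C ` A)"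
        using RR.tensor_sup_mem_iff[OF img[OF A] p q] by simp
    qed
    moreover have "comult C (\<Sqinter> A) = \<Sqinter>\<^bsub>RR.T\<^esub> (comult C ` A)" if A: "A \<subseteq> carrier R" for A
    proof (rule RR.tensor_eqI[OF comult_of_closed[OF inf_closed[OF A]] RR.T.inf_closed[OF img[OF A]]])
      fix p q assume p: "p \<in> completely_join_primes R" and q: "q \<in> completely_join_primes R"
      note pc = completely_join_primes_closed[OF p] and qc = completely_join_primes_closed[OF q]
      have i: "(\<lambda>z. p \<rightharpoondown> z) ` A \<subseteq> carrier R" using A pc by auto
      have "(p, q) \<in> comult C (\<Sqinter> A) \<longleftrightarrow> q \<sqsubseteq> p \<rightharpoondown> \<Sqinter> A"
        using comult_of_mem_iff[OF inf_closed[OF A]] pc qc by simp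
      also have "p \<rightharpoondown> \<Sqinter> A = \<Sqinter> ((\<lambda>z. p \<rightharpoondown> z) ` A)"
        using lres_meets[OF pc] A by (simp add: preserves_meets_def)
      also have "q \<sqsubseteq> \<dots> \<longleftrightarrow> (\<forall>z \<in> A. q \<sqsubseteq> p \<rightharpoondown> z)"
        using le_inf_iff[OF i qc] by simp
      also have "\<dots> \<longleftrightarrow> (\<forall>z \<in> A. (p, q) \<in> comult C z)"
        by (intro ball_cong bex_cong HOL.refl)
          (simp add: comult_of_mem_iff[OF subsetD[OF A]] pc qc)
      finally show "(p, q) \<in> comult C (\<Sqinter> A) \<longleftrightarrow> (p, q) \<in> \<Sqinter>\<^bsub>RR.T\<^esub> (comult C ` A)"
        using RR.tensor_inf_mem_iff[OF img[OF A] pc qc] by simp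
    qed
    moreover have "comult C \<in> extensional (carrier R)" by (simp add: comonoid_of_def)
    ultimately show "comult C \<in> acdl_morphisms C (tensor C C)"
      using comult_of_closed
      by (simp add: acdl_morphisms_def preserves_joins_def preserves_meets_def tensor_of PiE_iff)
    have "counit C (\<Squnion> A) \<longleftrightarrow> True \<in> counit C ` A" if A: "A \<subseteq> carrier R" for A
    proof -
      have "(\<exists>a \<in> A. residuation_unit R \<sqsubseteq> a) \<longleftrightarrow> (\<exists>a \<in> A. counit C a)"
        by (intro bex_cong HOL.refl) (simp add: counit_of subsetD[OF A])
      then show ?thesis
        using prime_le_sup_iff[OF unit_prime A] counit_of[OF sup_closed[OF A]] by auto
    qed
    moreover have "counit C (\<Sqinter> A) \<longleftrightarrow> False \<notin> counit C ` A" if A: "A \<subseteq> carrier R" for A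
    proof -
      have "(\<forall>a \<in> A. residuation_unit R \<sqsubseteq> a) \<longleftrightarrow> (\<forall>a \<in> A. counit C a)"
        by (intro ball_cong HOL.refl) (simp add: counit_of subsetD[OF A])
      then show ?thesis
        using le_inf_iff[OF A unit_closed] counit_of[OF inf_closed[OF A]] by auto
    qed
    moreover have "counit C \<in> extensional (carrier R)" by (simp add: comonoid_of_def)
    ultimately show "counit C \<in> acdl_morphisms C two"
      by (simp add: acdl_morphisms_def preserves_joins_def preserves_meets_def PiE_iff)
    fix c assume "c \<in> carrier C"
    then have c: "c \<in> carrier R" "c \<in> carrier C" by simp_all
    show "tensor_assoc C C C (tensor_map C C (tensor C C) C (comult C) (\<lambda>x. x) (comult C c))
        = tensor_map C C C (tensor C C) (\<lambda>x. x) (comult C) (comult C c)"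
    proof (rule C.coassociative_iff_primes[THEN iffD2, OF _ c(2)], erule cc, intro ballI)
      fix p q r
      assume "p \<in> completely_join_primes C" "q \<in> completely_join_primes C" "r \<in> completely_join_primes C"
      then have k: "p \<in> carrier R" "q \<in> carrier R" "r \<in> carrier R"
        by (simp_all add: completely_join_primes_closed)
      have "(\<exists>a \<in> carrier C. (a, r) \<in> comult C c \<and> (p, q) \<in> comult C a) \<longleftrightarrow>
          (\<exists>a \<in> carrier R. r \<sqsubseteq> a \<rightharpoondown> c \<and> q \<sqsubseteq> p \<rightharpoondown> a)"
        using c k by (simp add: comult_of_mem_iff cong: bex_cong)
      also have "\<dots> \<longleftrightarrow> (\<exists>b \<in> carrier R. b \<sqsubseteq> p \<rightharpoondown> c \<and> r \<sqsubseteq> q \<rightharpoondown> b)"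
        unfolding ex_left_factor_iff[OF k c(1)] ex_right_factor_iff[OF k c(1)]
        using associative k c by simp
      also have "\<dots> \<longleftrightarrow> (\<exists>b \<in> carrier C. (p, b) \<in> comult C c \<and> (q, r) \<in> comult C b)"
        using c k by (simp add: comult_of_mem_iff cong: bex_cong)
      finally show "(\<exists>a \<in> carrier C. (a, r) \<in> comult C c \<and> (p, q) \<in> comult C a) \<longleftrightarrow>
          (\<exists>b \<in> carrier C. (p, b) \<in> comult C c \<and> (q, r) \<in> comult C b)" .
    qed
    show "tensor_left_unitor C (tensor_map C C two C (counit C) (\<lambda>x. x) (comult C c)) = c"
      unfolding C.left_counit_iff_primes[OF cc[OF c(2)] c(2)]
    proof (intro ballI iffI)
      fix p assume "p \<in> completely_join_primes C"
      then have pc: "p \<in> carrier R" by (simp add: completely_join_primes_closed)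
      show "p \<sqsubseteq>\<^bsub>C\<^esub> c" if "\<exists>a. counit C a \<and> (a, p) \<in> comult C c"
      proof -
        from that obtain a where a: "counit C a" "(a, p) \<in> comult C c" by blast
        then have "a \<in> carrier R" "p \<sqsubseteq> a \<rightharpoondown> c" using comult_of_mem_iff[OF c(1)] by auto
        then have "p \<sqsubseteq> residuation_unit R \<rightharpoondown> c"
          using lres_mono[of "residuation_unit R" a c c p p] a(1) counit_of pc c unit_closed by simp
        then show ?thesis using unit_left c by simp
      qed
      show "\<exists>a. counit C a \<and> (a, p) \<in> comult C c" if "p \<sqsubseteq>\<^bsub>C\<^esub> c"
        using that unit_left unit_closed c pc comult_of_mem_iff[OF c(1)] counit_of
        by (intro exI[of _ "residuation_unit R"]) simp
    qed
    show "tensor_right_unitor C (tensor_map C C C two (\<lambda>x. x) (counit C) (comult C c)) = c"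
      unfolding C.right_counit_iff_primes[OF cc[OF c(2)] c(2)]
    proof (intro ballI iffI)
      fix p assume "p \<in> completely_join_primes C"
      then have pc: "p \<in> carrier R" by (simp add: completely_join_primes_closed)
      \<comment> \<open>The unit law on this side concerns the right residual, so residuation trades
        it for a condition on \<open>p \<rightharpoondown> c\<close>, in terms of which the
        comultiplication is defined.\<close>
      have u: "residuation_unit R \<sqsubseteq> p \<rightharpoondown> c \<longleftrightarrow> p \<sqsubseteq> c"
        using residuation[OF pc unit_closed c(1)] unit_right c by simp
      show "p \<sqsubseteq>\<^bsub>C\<^esub> c" if "\<exists>a. counit C a \<and> (p, a) \<in> comult C c"
      proof -
        from that obtain a where a: "counit C a" "(p, a) \<in> comult C c" by blast
        then have "a \<in> carrier R" "a \<sqsubseteq> p \<rightharpoondown> c" using comult_of_mem_iff[OF c(1)] by auto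
        then have "residuation_unit R \<sqsubseteq> p \<rightharpoondown> c"
          using le_trans[of "residuation_unit R" a "p \<rightharpoondown> c"] a(1) counit_of pc c unit_closed by simp
        then show ?thesis using u by simp
      qed
      show "\<exists>a. counit C a \<and> (p, a) \<in> comult C c" if "p \<sqsubseteq>\<^bsub>C\<^esub> c"
        using that u unit_closed c pc comult_of_mem_iff[OF c(1)] counit_of
        by (intro exI[of _ "residuation_unit R"]) simp
    qed
  qed
qed

lemma sup_lower_set: "x \<in> carrier R \<Longrightarrow> \<Squnion> {b \<in> carrier R. b \<sqsubseteq> x} = x"
proof -
  assume x: "x \<in> carrier R"
  have B: "{b \<in> carrier R. b \<sqsubseteq> x} \<subseteq> carrier R" by blast
  show ?thesis
    using x sup_least[OF B x] sup_upper[OF B, of x] sup_closed[OF B] by (intro le_antisym) simp_all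
qed

lemma residuation_of_comonoid_of: "residuation_of C = R"
proof (rule residuation.equality)
  show "lres (residuation_of C) = lres R"
  proof (rule extensionalityI[of _ "carrier R"])
    show "lres (residuation_of C) \<in> extensional (carrier R)" by (simp add: residuation_of_def)
    show "lres R \<in> extensional (carrier R)" using lres_closed by (simp add: PiE_iff)
    fix a assume a: "a \<in> carrier R"
    show "lres (residuation_of C) a = lres R a"
    proof (rule extensionalityI[of _ "carrier R"])
      show "lres (residuation_of C) a \<in> extensional (carrier R)" using a by (simp add: residuation_of_def)
      show "lres R a \<in> extensional (carrier R)" using lres_closed a by (auto simp: PiE_iff)
      fix c assume c: "c \<in> carrier R"
      show "lres (residuation_of C) a c = lres R a c"
        using a c sup_lower_set[of "a \<rightharpoondown> c"] comult_of_mem_iff[OF c]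
        by (simp add: residuation_of_def cong: conj_cong)
    qed
  qed
  show "rres (residuation_of C) = rres R"
  proof (rule extensionalityI[of _ "carrier R"])
    show "rres (residuation_of C) \<in> extensional (carrier R)" by (simp add: residuation_of_def)
    show "rres R \<in> extensional (carrier R)" using rres_closed by (simp add: PiE_iff)
    fix c assume c: "c \<in> carrier R"
    show "rres (residuation_of C) c = rres R c"
    proof (rule extensionalityI[of _ "carrier R"])
      show "rres (residuation_of C) c \<in> extensional (carrier R)" using c by (simp add: residuation_of_def)
      show "rres R c \<in> extensional (carrier R)" using rres_closed c by (auto simp: PiE_iff)
      fix b assume b: "b \<in> carrier R"
      have "(a, b) \<in> comult C c \<longleftrightarrow> a \<sqsubseteq> c \<leftharpoondown> b" if "a \<in> carrier R" for a
        using comult_of_mem_iff[OF c] residuation[OF that b c] that b by simp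
      then have "{a \<in> carrier R. (a, b) \<in> comult C c} = {a \<in> carrier R. a \<sqsubseteq> c \<leftharpoondown> b}"
        by (simp cong: conj_cong)
      then show "rres (residuation_of C) c b = rres R c b"
        using b c sup_lower_set[of "c \<leftharpoondown> b"] by (simp add: residuation_of_def)
    qed
  qed
qed simp_all

end

section \<open>Morphisms of comonoids and of derivation ACDLs\<close>

lemma preserves_joins_mono:
  assumes "complete_lattice D" "complete_lattice E" "preserves_joins D E f"
    "\<And>x. x \<in> carrier D \<Longrightarrow> f x \<in> carrier E"
    and xy: "x \<in> carrier D" "y \<in> carrier D" "x \<sqsubseteq>\<^bsub>D\<^esub> y"
  shows "f x \<sqsubseteq>\<^bsub>E\<^esub> f y"
proof -
  interpret D: complete_lattice D by (rule assms)
  interpret E: complete_lattice E by (rule assms)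
  have c: "{x, y} \<subseteq> carrier D" using xy by simp
  have "\<Squnion>\<^bsub>D\<^esub> {x, y} = y"
    using xy D.sup_upper[OF c, of y] D.sup_least[OF c, of y] D.sup_closed[OF c]
    by (intro D.le_antisym) auto
  then have "f y = \<Squnion>\<^bsub>E\<^esub> {f x, f y}"
    using assms(3) c unfolding preserves_joins_def by (metis image_empty image_insert)
  then show ?thesis using E.sup_upper[of "{f x, f y}" "f x"] assms(4) xy by simp
qed

text \<open>In contrast to \<open>tensor_map_mem_iff\<close> this covers arbitrary pairs: membership
  is tested on the primes below \<open>f d\<close> and \<open>g e\<close>, for which
  \<open>(d, e)\<close> itself is the witness.\<close>

lemma tensor_map_memI:
  assumes "complete_lattice D" "complete_lattice E" "spatial_lattice D'" "spatial_lattice E'"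
    and f: "\<And>d. d \<in> carrier D \<Longrightarrow> f d \<in> carrier D'"
    and g: "\<And>e. e \<in> carrier E \<Longrightarrow> g e \<in> carrier E'"
    and I: "I \<in> carrier (tensor D E)" and de: "(d, e) \<in> I"
  shows "(f d, g e) \<in> tensor_map D E D' E' f g I"
proof -
  interpret S: two_complete_lattices D E using assms by (simp add: two_complete_lattices_def)
  interpret T: two_spatial_lattices D' E' using assms by (simp add: two_spatial_lattices_def)
  note c = S.tensor_memD(1,2)[OF I de]
  have m: "tensor_map D E D' E' f g I \<in> carrier (tensor D' E')"
    by (rule tensor_map_closed[OF assms(1,2) T.D.complete_lattice_axioms T.E.complete_lattice_axioms f g I])
  show ?thesis
    unfolding T.tensor_mem_iff_primes[OF m f[OF c(1)] g[OF c(2)]]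
  proof (intro ballI impI)
    fix p q assume p: "p \<in> completely_join_primes D'" "q \<in> completely_join_primes E'"
      and le: "p \<sqsubseteq>\<^bsub>D'\<^esub> f d" "q \<sqsubseteq>\<^bsub>E'\<^esub> g e"
    have ex: "\<exists>d e. (d, e) \<in> I \<and> p \<sqsubseteq>\<^bsub>D'\<^esub> f d \<and> q \<sqsubseteq>\<^bsub>E'\<^esub> g e"
      using de le by (intro exI conjI)
    show "(p, q) \<in> tensor_map D E D' E' f g I"
      by (rule iffD2[OF tensor_map_mem_iff[OF assms(1-4) _ _ I p]]) (fact f g ex)+
  qed
qed

locale two_comonoids = C: acdl_comonoid C + C': acdl_comonoid C'
  for C :: "'a comonoid" and C' :: "'b comonoid"
begin

abbreviation "R \<equiv> residuation_of C"

abbreviation "R' \<equiv> residuation_of C'"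

text \<open>The rewrites make the inherited facts about residuals speak of the carrier and order of
  \<open>C\<close>, so that they combine with facts about the comonoid.\<close>

sublocale R: derivation_acdl R
  rewrites "carrier (residuation_of C) = carrier C" and "le (residuation_of C) = le C"
  by (rule C.derivation_acdl_residuation_of) simp_all

sublocale R': derivation_acdl R'
  rewrites "carrier (residuation_of C') = carrier C'" and "le (residuation_of C') = le C'"
  by (rule C'.derivation_acdl_residuation_of) simp_all

sublocale TC: two_spatial_lattices C' C'
  by unfold_locales

lemmas spatial = C.complete_lattice_axioms C.complete_lattice_axioms
  C'.spatial_lattice_axioms C'.spatial_lattice_axioms

lemmas complete = C.complete_lattice_axioms C.complete_lattice_axioms
  C'.complete_lattice_axioms C'.complete_lattice_axioms

lemma tensor_map_comult_closed:
  assumes "f \<in> carrier C \<rightarrow> carrier C'" "c \<in> carrier C"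
  shows "tensor_map C C C' C' f f (comult C c) \<in> carrier (tensor C' C')"
  by (rule tensor_map_closed[OF complete _ _ C.comult_closed[OF assms(2)]]) (use assms(1) in auto)

lemma tensor_map_comult_mem_iff:
  assumes "f \<in> carrier C \<rightarrow> carrier C'" "c \<in> carrier C"
    "p \<in> completely_join_primes C'" "q \<in> completely_join_primes C'"
  shows "(p, q) \<in> tensor_map C C C' C' f f (comult C c) \<longleftrightarrow>
    (\<exists>a b. (a, b) \<in> comult C c \<and> p \<sqsubseteq>\<^bsub>C'\<^esub> f a \<and> q \<sqsubseteq>\<^bsub>C'\<^esub> f b)"
  by (rule tensor_map_mem_iff[OF spatial _ _ C.comult_closed[OF assms(2)] assms(3,4)])
    (use assms(1) in auto)

lemma tensor_map_comult_memI:
  assumes "f \<in> carrier C \<rightarrow> carrier C'" "c \<in> carrier C" "(a, b) \<in> comult C c"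
  shows "(f a, f b) \<in> tensor_map C C C' C' f f (comult C c)"
  by (rule tensor_map_memI[OF spatial _ _ C.comult_closed[OF assms(2)] assms(3)])
    (use assms(1) in auto)

text \<open>Both conditions are tested on the generic pairs
  \<open>(x, x \<rightharpoondown> z)\<close> of the comultiplication at \<open>z\<close>: every
  other pair \<open>(a, b)\<close> of it has \<open>b\<close> below
  \<open>a \<rightharpoondown> z\<close>.\<close>

lemma tensor_map_comult_subset_iff:
  assumes fP: "f \<in> carrier C \<rightarrow> carrier C'"
    and mono: "\<And>x y. \<lbrakk>x \<in> carrier C; y \<in> carrier C; x \<sqsubseteq>\<^bsub>C\<^esub> y\<rbrakk> \<Longrightarrow> f x \<sqsubseteq>\<^bsub>C'\<^esub> f y"
  shows "(\<forall>c \<in> carrier C. tensor_map C C C' C' f f (comult C c) \<subseteq> comult C' (f c)) \<longleftrightarrow>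
    (\<forall>x \<in> carrier C. \<forall>z \<in> carrier C. f (x \<rightharpoondown>\<^bsub>R\<^esub> z) \<sqsubseteq>\<^bsub>C'\<^esub> f x \<rightharpoondown>\<^bsub>R'\<^esub> f z)" (is "?L \<longleftrightarrow> ?P")
proof
  note f = funcset_mem[OF fP]
  assume L: ?L
  show ?P
  proof (intro ballI)
    fix x z assume x: "x \<in> carrier C" and z: "z \<in> carrier C"
    note xz = C.residuals_closed(1)[OF x z]
    have "(x, x \<rightharpoondown>\<^bsub>R\<^esub> z) \<in> comult C z"
      using C.le_lres_iff[OF x xz z] xz by simp
    then have "(f x, f (x \<rightharpoondown>\<^bsub>R\<^esub> z)) \<in> tensor_map C C C' C' f f (comult C z)"
      by (rule tensor_map_comult_memI[OF fP z])
    then have "(f x, f (x \<rightharpoondown>\<^bsub>R\<^esub> z)) \<in> comult C' (f z)" using L z by blast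
    then show "f (x \<rightharpoondown>\<^bsub>R\<^esub> z) \<sqsubseteq>\<^bsub>C'\<^esub> f x \<rightharpoondown>\<^bsub>R'\<^esub> f z"
      using C'.le_lres_iff[OF f[OF x] f[OF xz] f[OF z]] by simp
  qed
next
  note f = funcset_mem[OF fP]
  assume P: ?P
  show ?L
  proof
    fix c assume c: "c \<in> carrier C"
    show "tensor_map C C C' C' f f (comult C c) \<subseteq> comult C' (f c)"
    proof (rule TC.tensor_subsetI[OF tensor_map_comult_closed[OF fP c] C'.comult_closed[OF f[OF c]]])
      fix p q assume p: "p \<in> completely_join_primes C'" "q \<in> completely_join_primes C'"
        and pq: "(p, q) \<in> tensor_map C C C' C' f f (comult C c)"
      note k = completely_join_primes_closed[OF p(1)] completely_join_primes_closed[OF p(2)]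
      obtain a b where ab: "(a, b) \<in> comult C c" "p \<sqsubseteq>\<^bsub>C'\<^esub> f a" "q \<sqsubseteq>\<^bsub>C'\<^esub> f b"
        using pq unfolding tensor_map_comult_mem_iff[OF fP c p] by blast
      note a = C.comult_memD[OF c ab(1)]
      have "b \<sqsubseteq>\<^bsub>C\<^esub> a \<rightharpoondown>\<^bsub>R\<^esub> c" using C.le_lres_iff[OF a c] ab(1) by simp
      then have "f b \<sqsubseteq>\<^bsub>C'\<^esub> f (a \<rightharpoondown>\<^bsub>R\<^esub> c)" using mono a(2) C.residuals_closed(1)[OF a(1) c] by simp
      moreover have "f (a \<rightharpoondown>\<^bsub>R\<^esub> c) \<sqsubseteq>\<^bsub>C'\<^esub> f a \<rightharpoondown>\<^bsub>R'\<^esub> f c" using P a(1) c by simp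
      ultimately have "f b \<sqsubseteq>\<^bsub>C'\<^esub> f a \<rightharpoondown>\<^bsub>R'\<^esub> f c"
        using C'.le_trans[of "f b" "f (a \<rightharpoondown>\<^bsub>R\<^esub> c)" "f a \<rightharpoondown>\<^bsub>R'\<^esub> f c"] f a c C.residuals_closed(1)[OF a(1) c]
          C'.residuals_closed(1)[OF f[OF a(1)] f[OF c]] by simp
      then have m: "(f a, f b) \<in> comult C' (f c)"
        using C'.le_lres_iff[OF f[OF a(1)] f[OF a(2)] f[OF c]] by simp
      show "(p, q) \<in> comult C' (f c)"
        by (rule TC.tensor_memD(3)[OF C'.comult_closed[OF f[OF c]] m k ab(2,3)])
    qed
  qed
qed

text \<open>\<open>tensor_map_comult_subset_iff\<close> identifies the lax comultiplication law with
  the residual inequality. The counit condition for all \<open>c\<close> follows from its instance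
  at the unit, because \<open>\<rho>\<close> is monotone.\<close>

theorem corelational_morphisms_eq:
  "corelational_comonoid_morphisms C C' = corelational_residuation_morphisms R R'"
proof (rule Set.set_eqI)
  fix \<rho>
  have "\<rho> \<in> corelational_comonoid_morphisms C C' \<longleftrightarrow> \<rho> \<in> corelational_residuation_morphisms R R'"
    if \<rho>: "\<rho> \<in> carrier C \<rightarrow>\<^sub>E carrier C'" "preserves_joins C C' \<rho>"
  proof -
    have fP: "\<rho> \<in> carrier C \<rightarrow> carrier C'" using \<rho>(1) by auto
    note f = funcset_mem[OF fP]
    have mono: "\<rho> x \<sqsubseteq>\<^bsub>C'\<^esub> \<rho> y" if "x \<in> carrier C" "y \<in> carrier C" "x \<sqsubseteq>\<^bsub>C\<^esub> y" for x y
      by (rule preserves_joins_mono[OF complete(1,3) \<rho>(2) f that])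
    have "(\<forall>c \<in> carrier C. counit C c \<longrightarrow> counit C' (\<rho> c)) \<longleftrightarrow> residuation_unit R' \<sqsubseteq>\<^bsub>C'\<^esub> \<rho> (residuation_unit R)"
    proof
      assume "\<forall>c \<in> carrier C. counit C c \<longrightarrow> counit C' (\<rho> c)"
      then show "residuation_unit R' \<sqsubseteq>\<^bsub>C'\<^esub> \<rho> (residuation_unit R)"
        using R.unit_closed C.counit_iff_unit[of "residuation_unit R"]
          C'.counit_iff_unit[of "\<rho> (residuation_unit R)"] f by simp
    next
      assume u: "residuation_unit R' \<sqsubseteq>\<^bsub>C'\<^esub> \<rho> (residuation_unit R)"
      show "\<forall>c \<in> carrier C. counit C c \<longrightarrow> counit C' (\<rho> c)"
      proof (intro ballI impI)
        fix c assume c: "c \<in> carrier C" "counit C c"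
        then have "\<rho> (residuation_unit R) \<sqsubseteq>\<^bsub>C'\<^esub> \<rho> c"
          using mono R.unit_closed C.counit_iff_unit by simp
        then have "residuation_unit R' \<sqsubseteq>\<^bsub>C'\<^esub> \<rho> c"
          using C'.le_trans[OF u] R'.unit_closed R.unit_closed f c(1) by simp
        then show "counit C' (\<rho> c)" using C'.counit_iff_unit f c(1) by simp
      qed
    qed
    then show ?thesis
      using tensor_map_comult_subset_iff[OF fP mono] \<rho>
      by (simp add: corelational_comonoid_morphisms_def corelational_residuation_morphisms_def
          preserves_joins_def tensor_def)
  qed
  then show "\<rho> \<in> corelational_comonoid_morphisms C C' \<longleftrightarrow> \<rho> \<in> corelational_residuation_morphisms R R'"
    by (auto simp: corelational_comonoid_morphisms_def corelational_residuation_morphisms_def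
        preserves_joins_def)
qed

lemma acdl_morphisms_residuation_of: "acdl_morphisms R R' = acdl_morphisms C C'"
  by (simp add: acdl_morphisms_def preserves_joins_def preserves_meets_def)

text \<open>The left adjoint \<open>adj\<close> exists because \<open>f\<close> preserves meets.
  Equality of the comultiplications splits a pair of primes \<open>p\<close>, \<open>q\<close> in
  the comultiplication at \<open>f z\<close> along \<open>f\<close>, and the best splitting is
  \<open>adj p\<close>, \<open>adj q\<close>. An arbitrary \<open>y\<close> is handled through the
  primes below it.\<close>

lemma residuation_morphism_if_pure:
  assumes "f \<in> pure_comonoid_morphisms C C'" shows "f \<in> residuation_morphisms R R'"
proof -
  have fm: "f \<in> acdl_morphisms C C'"
    and comult: "\<And>c. c \<in> carrier C \<Longrightarrow> tensor_map C C C' C' f f (comult C c) = comult C' (f c)"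
    and counit: "\<And>c. c \<in> carrier C \<Longrightarrow> counit C c = counit C' (f c)"
    using assms by (auto simp: pure_comonoid_morphisms_def)
  have fP: "f \<in> carrier C \<rightarrow> carrier C'" using fm by (auto simp: acdl_morphisms_def)
  note f = funcset_mem[OF fP]
  have fj: "preserves_joins C C' f" using fm by (simp add: acdl_morphisms_def)
  have mono: "f x \<sqsubseteq>\<^bsub>C'\<^esub> f y" if "x \<in> carrier C" "y \<in> carrier C" "x \<sqsubseteq>\<^bsub>C\<^esub> y" for x y
    by (rule preserves_joins_mono[OF complete(1,3) fj f that])
  have meets: "f (\<Sqinter>\<^bsub>C\<^esub> A) = \<Sqinter>\<^bsub>C'\<^esub> (f ` A)" if "A \<subseteq> carrier C" for A
    using fm that by (simp add: acdl_morphisms_def preserves_meets_def)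
  have forth: "f (x \<rightharpoondown>\<^bsub>R\<^esub> z) \<sqsubseteq>\<^bsub>C'\<^esub> f x \<rightharpoondown>\<^bsub>R'\<^esub> f z" if "x \<in> carrier C" "z \<in> carrier C" for x z
    using tensor_map_comult_subset_iff[OF fP mono] comult that by simp
  have memI: "(f a, f b) \<in> comult C' (f c)" if "(a, b) \<in> comult C c" "c \<in> carrier C" for a b c
    using tensor_map_comult_memI[OF fP that(2,1)] comult[OF that(2)]
    by simp
  have forth': "f (z \<leftharpoondown>\<^bsub>R\<^esub> x) \<sqsubseteq>\<^bsub>C'\<^esub> f z \<leftharpoondown>\<^bsub>R'\<^esub> f x" if x: "x \<in> carrier C" and z: "z \<in> carrier C" for x z
  proof -
    note xz = C.residuals_closed(2)[OF x z]
    have "(z \<leftharpoondown>\<^bsub>R\<^esub> x, x) \<in> comult C z" using C.le_rres_iff[OF xz x z] xz by simp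
    then show ?thesis using C'.le_rres_iff[OF f[OF xz] f[OF x] f[OF z]] memI z by simp
  qed
  define adj where "adj y = \<Sqinter>\<^bsub>C\<^esub> {x \<in> carrier C. y \<sqsubseteq>\<^bsub>C'\<^esub> f x}" for y
  have adjc: "adj y \<in> carrier C" for y unfolding adj_def by (rule C.inf_closed) blast
  have adj_le: "adj y \<sqsubseteq>\<^bsub>C\<^esub> x" if "x \<in> carrier C" "y \<sqsubseteq>\<^bsub>C'\<^esub> f x" for x y
    unfolding adj_def by (rule C.inf_lower) (use that in auto)
  have le_adj: "y \<sqsubseteq>\<^bsub>C'\<^esub> f (adj y)" if y: "y \<in> carrier C'" for y
  proof -
    have s: "{x \<in> carrier C. y \<sqsubseteq>\<^bsub>C'\<^esub> f x} \<subseteq> carrier C" by blast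
    have i: "f ` {x \<in> carrier C. y \<sqsubseteq>\<^bsub>C'\<^esub> f x} \<subseteq> carrier C'" using f by blast
    show ?thesis unfolding adj_def meets[OF s] by (rule C'.inf_greatest[OF i y]) blast
  qed
  have split: "\<exists>a b. (a, b) \<in> comult C z \<and> p \<sqsubseteq>\<^bsub>C'\<^esub> f a \<and> q \<sqsubseteq>\<^bsub>C'\<^esub> f b"
    if "z \<in> carrier C" "p \<in> completely_join_primes C'" "q \<in> completely_join_primes C'"
      "(p, q) \<in> comult C' (f z)" for p q z
    using tensor_map_comult_mem_iff[OF fP that(1,2,3)]
      that(4) comult[OF that(1)] by simp
  \<comment> \<open>\<open>adj p\<close> and \<open>adj q\<close> lie below the components of any
    splitting, so downward closure puts them into the comultiplication.\<close>
  have split': "(adj p, adj q) \<in> comult C z"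
    if z: "z \<in> carrier C" and p: "p \<in> completely_join_primes C'" and q: "q \<in> completely_join_primes C'"
      and pq: "(p, q) \<in> comult C' (f z)" for p q z
  proof -
    obtain a b where ab: "(a, b) \<in> comult C z" "p \<sqsubseteq>\<^bsub>C'\<^esub> f a" "q \<sqsubseteq>\<^bsub>C'\<^esub> f b"
      using split[OF z p q pq] by blast
    note k = C.comult_memD[OF z ab(1)]
    interpret CC: two_complete_lattices C C by unfold_locales
    show ?thesis
      by (rule CC.tensor_memD(3)[OF C.comult_closed[OF z] ab(1) adjc adjc adj_le[OF k(1) ab(2)] adj_le[OF k(2) ab(3)]])
  qed
  have back_eq: "y \<rightharpoondown>\<^bsub>R'\<^esub> f z = f (adj y \<rightharpoondown>\<^bsub>R\<^esub> z)" if y: "y \<in> carrier C'" and z: "z \<in> carrier C" for y z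
  proof (rule C'.eq_primesI)
    note az = C.residuals_closed(1)[OF adjc[of y] z]
    show c1: "y \<rightharpoondown>\<^bsub>R'\<^esub> f z \<in> carrier C'" by (rule C'.residuals_closed(1)[OF y f[OF z]])
    show c2: "f (adj y \<rightharpoondown>\<^bsub>R\<^esub> z) \<in> carrier C'" by (rule f[OF az])
    fix r assume r: "r \<in> completely_join_primes C'"
    note rc = completely_join_primes_closed[OF r]
    show "r \<sqsubseteq>\<^bsub>C'\<^esub> y \<rightharpoondown>\<^bsub>R'\<^esub> f z \<longleftrightarrow> r \<sqsubseteq>\<^bsub>C'\<^esub> f (adj y \<rightharpoondown>\<^bsub>R\<^esub> z)"
    proof
      assume le: "r \<sqsubseteq>\<^bsub>C'\<^esub> y \<rightharpoondown>\<^bsub>R'\<^esub> f z"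
      \<comment> \<open>\<open>?w\<close> is the largest element that forms a pair with
        \<open>adj r\<close> at \<open>z\<close>. Showing \<open>y\<close> below \<open>f ?w\<close>
        one prime at a time gives \<open>adj y\<close> below \<open>?w\<close>, and residuation
        turns this into the desired bound on \<open>adj r\<close>.\<close>
      let ?w = "z \<leftharpoondown>\<^bsub>R\<^esub> adj r"
      have w: "?w \<in> carrier C" by (rule C.residuals_closed(2)[OF adjc z])
      have "y \<sqsubseteq>\<^bsub>C'\<^esub> f ?w"
      proof (rule C'.le_primesI[OF y f[OF w]])
        fix q assume q: "q \<in> completely_join_primes C'" "q \<sqsubseteq>\<^bsub>C'\<^esub> y"
        note qc = completely_join_primes_closed[OF q(1)]
        have "r \<sqsubseteq>\<^bsub>C'\<^esub> q \<rightharpoondown>\<^bsub>R'\<^esub> f z"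
          using R'.le_lres_iff_primes[OF y f[OF z] rc] le q by simp
        then have "(q, r) \<in> comult C' (f z)" using C'.le_lres_iff[OF qc rc f[OF z]] by simp
        then have "(adj q, adj r) \<in> comult C z" by (rule split'[OF z q(1) r])
        then have "adj q \<sqsubseteq>\<^bsub>C\<^esub> ?w" using C.le_rres_iff[OF adjc adjc z] by simp
        then have "f (adj q) \<sqsubseteq>\<^bsub>C'\<^esub> f ?w" by (rule mono[OF adjc w])
        then show "q \<sqsubseteq>\<^bsub>C'\<^esub> f ?w"
          using C'.le_trans[OF le_adj[OF qc]] qc f adjc w by simp
      qed
      then have "adj y \<sqsubseteq>\<^bsub>C\<^esub> ?w" by (rule adj_le[OF w])
      then have "adj r \<sqsubseteq>\<^bsub>C\<^esub> adj y \<rightharpoondown>\<^bsub>R\<^esub> z"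
        using C.le_rres_iff[OF adjc adjc z] C.le_lres_iff[OF adjc adjc z] by simp
      then have "f (adj r) \<sqsubseteq>\<^bsub>C'\<^esub> f (adj y \<rightharpoondown>\<^bsub>R\<^esub> z)" by (rule mono[OF adjc az])
      then show "r \<sqsubseteq>\<^bsub>C'\<^esub> f (adj y \<rightharpoondown>\<^bsub>R\<^esub> z)" using C'.le_trans[OF le_adj[OF rc]] rc f adjc az by simp
    next
      assume "r \<sqsubseteq>\<^bsub>C'\<^esub> f (adj y \<rightharpoondown>\<^bsub>R\<^esub> z)"
      then have "r \<sqsubseteq>\<^bsub>C'\<^esub> f (adj y) \<rightharpoondown>\<^bsub>R'\<^esub> f z"
        using C'.le_trans[OF _ forth[OF adjc z] rc c2] C'.residuals_closed(1)[OF f[OF adjc] f[OF z]] by simp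
      then show "r \<sqsubseteq>\<^bsub>C'\<^esub> y \<rightharpoondown>\<^bsub>R'\<^esub> f z"
        using R'.lres_mono[of y "f (adj y)" "f z" "f z" r r] le_adj[OF y] y z f adjc rc by simp
    qed
  qed
  have back_eq': "f z \<leftharpoondown>\<^bsub>R'\<^esub> y = f (z \<leftharpoondown>\<^bsub>R\<^esub> adj y)" if y: "y \<in> carrier C'" and z: "z \<in> carrier C" for y z
  proof (rule C'.eq_primesI)
    note az = C.residuals_closed(2)[OF adjc[of y] z]
    show c1: "f z \<leftharpoondown>\<^bsub>R'\<^esub> y \<in> carrier C'" by (rule C'.residuals_closed(2)[OF y f[OF z]])
    show c2: "f (z \<leftharpoondown>\<^bsub>R\<^esub> adj y) \<in> carrier C'" by (rule f[OF az])
    fix r assume r: "r \<in> completely_join_primes C'"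
    note rc = completely_join_primes_closed[OF r]
    show "r \<sqsubseteq>\<^bsub>C'\<^esub> f z \<leftharpoondown>\<^bsub>R'\<^esub> y \<longleftrightarrow> r \<sqsubseteq>\<^bsub>C'\<^esub> f (z \<leftharpoondown>\<^bsub>R\<^esub> adj y)"
    proof
      assume le: "r \<sqsubseteq>\<^bsub>C'\<^esub> f z \<leftharpoondown>\<^bsub>R'\<^esub> y"
      let ?w = "adj r \<rightharpoondown>\<^bsub>R\<^esub> z"
      have w: "?w \<in> carrier C" by (rule C.residuals_closed(1)[OF adjc z])
      have "y \<sqsubseteq>\<^bsub>C'\<^esub> f ?w"
      proof (rule C'.le_primesI[OF y f[OF w]])
        fix q assume q: "q \<in> completely_join_primes C'" "q \<sqsubseteq>\<^bsub>C'\<^esub> y"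
        note qc = completely_join_primes_closed[OF q(1)]
        have "r \<sqsubseteq>\<^bsub>C'\<^esub> f z \<leftharpoondown>\<^bsub>R'\<^esub> q"
          using R'.le_rres_iff_primes[OF y f[OF z] rc] le q by simp
        then have "(r, q) \<in> comult C' (f z)" using C'.le_rres_iff[OF rc qc f[OF z]] by simp
        then have "(adj r, adj q) \<in> comult C z" by (rule split'[OF z r q(1)])
        then have "adj q \<sqsubseteq>\<^bsub>C\<^esub> ?w" using C.le_lres_iff[OF adjc adjc z] by simp
        then have "f (adj q) \<sqsubseteq>\<^bsub>C'\<^esub> f ?w" by (rule mono[OF adjc w])
        then show "q \<sqsubseteq>\<^bsub>C'\<^esub> f ?w"
          using C'.le_trans[OF le_adj[OF qc]] qc f adjc w by simp
      qed
      then have "adj y \<sqsubseteq>\<^bsub>C\<^esub> ?w" by (rule adj_le[OF w])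
      then have "adj r \<sqsubseteq>\<^bsub>C\<^esub> z \<leftharpoondown>\<^bsub>R\<^esub> adj y"
        using C.le_rres_iff[OF adjc adjc z] C.le_lres_iff[OF adjc adjc z] by simp
      then have "f (adj r) \<sqsubseteq>\<^bsub>C'\<^esub> f (z \<leftharpoondown>\<^bsub>R\<^esub> adj y)" by (rule mono[OF adjc az])
      then show "r \<sqsubseteq>\<^bsub>C'\<^esub> f (z \<leftharpoondown>\<^bsub>R\<^esub> adj y)" using C'.le_trans[OF le_adj[OF rc]] rc f adjc az by simp
    next
      assume "r \<sqsubseteq>\<^bsub>C'\<^esub> f (z \<leftharpoondown>\<^bsub>R\<^esub> adj y)"
      then have "r \<sqsubseteq>\<^bsub>C'\<^esub> f z \<leftharpoondown>\<^bsub>R'\<^esub> f (adj y)"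
        using C'.le_trans[OF _ forth'[OF adjc z] rc c2] C'.residuals_closed(2)[OF f[OF adjc] f[OF z]] by simp
      then have "f (adj y) \<sqsubseteq>\<^bsub>C'\<^esub> r \<rightharpoondown>\<^bsub>R'\<^esub> f z"
        using C'.le_lres_iff[OF rc f[OF adjc] f[OF z]] C'.le_rres_iff[OF rc f[OF adjc] f[OF z]] by simp
      then have "y \<sqsubseteq>\<^bsub>C'\<^esub> r \<rightharpoondown>\<^bsub>R'\<^esub> f z"
        using C'.le_trans[OF le_adj[OF y] _ y] f adjc C'.residuals_closed(1)[OF rc f[OF z]] by simp
      then show "r \<sqsubseteq>\<^bsub>C'\<^esub> f z \<leftharpoondown>\<^bsub>R'\<^esub> y"
        using C'.le_lres_iff[OF rc y f[OF z]] C'.le_rres_iff[OF rc y f[OF z]] by simp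
    qed
  qed
  have unit: "residuation_unit R \<sqsubseteq>\<^bsub>C\<^esub> x \<longleftrightarrow> residuation_unit R' \<sqsubseteq>\<^bsub>C'\<^esub> f x" if "x \<in> carrier C" for x
    using C.counit_iff_unit[OF that] C'.counit_iff_unit[OF f[OF that]] counit[OF that] by simp
  show ?thesis
    unfolding residuation_morphisms_def acdl_morphisms_residuation_of residuation_of_simps
  proof (intro CollectI conjI ballI)
    fix y z assume "y \<in> carrier C'" "z \<in> carrier C"
    then show "\<exists>x \<in> carrier C. y \<sqsubseteq>\<^bsub>C'\<^esub> f x \<and> y \<rightharpoondown>\<^bsub>R'\<^esub> f z = f (x \<rightharpoondown>\<^bsub>R\<^esub> z)"
      and "\<exists>x \<in> carrier C. y \<sqsubseteq>\<^bsub>C'\<^esub> f x \<and> f z \<leftharpoondown>\<^bsub>R'\<^esub> y = f (z \<leftharpoondown>\<^bsub>R\<^esub> x)"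
      using adjc le_adj back_eq back_eq' by (intro bexI[of _ "adj y"] conjI; simp)+
  qed (use fm forth forth' unit in simp_all)
qed

text \<open>(Forth) gives one inclusion. For the other, (Back) at the prime \<open>p\<close> yields
  \<open>x\<close>, and the image under \<open>f\<close> of the generic pair
  \<open>(x, x \<rightharpoondown> c)\<close> lies above \<open>(p, q)\<close>.\<close>

lemma pure_if_residuation_morphism:
  assumes "f \<in> residuation_morphisms R R'" shows "f \<in> pure_comonoid_morphisms C C'"
proof -
  have fm: "f \<in> acdl_morphisms C C'"
    and forth: "\<And>x z. \<lbrakk>x \<in> carrier C; z \<in> carrier C\<rbrakk> \<Longrightarrow> f (x \<rightharpoondown>\<^bsub>R\<^esub> z) \<sqsubseteq>\<^bsub>C'\<^esub> f x \<rightharpoondown>\<^bsub>R'\<^esub> f z"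
    and back_eq: "\<And>y z. \<lbrakk>y \<in> carrier C'; z \<in> carrier C\<rbrakk> \<Longrightarrow>
      \<exists>x \<in> carrier C. y \<sqsubseteq>\<^bsub>C'\<^esub> f x \<and> y \<rightharpoondown>\<^bsub>R'\<^esub> f z = f (x \<rightharpoondown>\<^bsub>R\<^esub> z)"
    and unit: "\<And>x. x \<in> carrier C \<Longrightarrow> residuation_unit R \<sqsubseteq>\<^bsub>C\<^esub> x \<longleftrightarrow> residuation_unit R' \<sqsubseteq>\<^bsub>C'\<^esub> f x"
    using assms unfolding residuation_morphisms_def acdl_morphisms_residuation_of residuation_of_simps
    by simp_all
  have fP: "f \<in> carrier C \<rightarrow> carrier C'" using fm by (auto simp: acdl_morphisms_def)
  note f = funcset_mem[OF fP]
  have fj: "preserves_joins C C' f" using fm by (simp add: acdl_morphisms_def)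
  have mono: "f x \<sqsubseteq>\<^bsub>C'\<^esub> f y" if "x \<in> carrier C" "y \<in> carrier C" "x \<sqsubseteq>\<^bsub>C\<^esub> y" for x y
    by (rule preserves_joins_mono[OF complete(1,3) fj f that])
  have "tensor_map C C C' C' f f (comult C c) = comult C' (f c)" if c: "c \<in> carrier C" for c
  proof (rule subset_antisym)
    show "tensor_map C C C' C' f f (comult C c) \<subseteq> comult C' (f c)"
      using tensor_map_comult_subset_iff[OF fP mono] forth c by simp
    show "comult C' (f c) \<subseteq> tensor_map C C C' C' f f (comult C c)"
    proof (rule TC.tensor_subsetI[OF C'.comult_closed[OF f[OF c]] tensor_map_comult_closed[OF fP c]])
      fix p q assume p: "p \<in> completely_join_primes C'" "q \<in> completely_join_primes C'"
        and pq: "(p, q) \<in> comult C' (f c)"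
      note k = completely_join_primes_closed[OF p(1)] completely_join_primes_closed[OF p(2)]
      obtain x where x: "x \<in> carrier C" "p \<sqsubseteq>\<^bsub>C'\<^esub> f x" "p \<rightharpoondown>\<^bsub>R'\<^esub> f c = f (x \<rightharpoondown>\<^bsub>R\<^esub> c)"
        using back_eq[OF k(1) c] by blast
      note xc = C.residuals_closed(1)[OF x(1) c]
      have "(x, x \<rightharpoondown>\<^bsub>R\<^esub> c) \<in> comult C c" using C.le_lres_iff[OF x(1) xc c] xc by simp
      moreover have "q \<sqsubseteq>\<^bsub>C'\<^esub> f (x \<rightharpoondown>\<^bsub>R\<^esub> c)" using C'.le_lres_iff[OF k f[OF c]] pq x(3) by simp
      ultimately have "\<exists>a b. (a, b) \<in> comult C c \<and> p \<sqsubseteq>\<^bsub>C'\<^esub> f a \<and> q \<sqsubseteq>\<^bsub>C'\<^esub> f b"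
        using x(2) by (intro exI conjI)
      then show "(p, q) \<in> tensor_map C C C' C' f f (comult C c)"
        unfolding tensor_map_comult_mem_iff[OF fP c p] .
    qed
  qed
  moreover have "counit C c = counit C' (f c)" if "c \<in> carrier C" for c
    using unit[OF that] C.counit_iff_unit[OF that] C'.counit_iff_unit[OF f[OF that]] by simp
  ultimately show ?thesis using fm by (simp add: pure_comonoid_morphisms_def)
qed

theorem pure_morphisms_eq: "pure_comonoid_morphisms C C' = residuation_morphisms R R'"
  using residuation_morphism_if_pure pure_if_residuation_morphism by blast

end

section \<open>The categories of derivation ACDLs and of comonoids\<close>

lemma preserves_joins_compose:
  assumes "complete_lattice D" "f \<in> carrier D \<rightarrow> carrier E" "preserves_joins D E f" "preserves_joins E F g"
  shows "preserves_joins D F (compose (carrier D) g f)"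
  unfolding preserves_joins_def
proof (intro allI impI)
  interpret D: complete_lattice D by (rule assms)
  fix A assume A: "A \<subseteq> carrier D"
  have "compose (carrier D) g f (\<Squnion>\<^bsub>D\<^esub> A) = g (\<Squnion>\<^bsub>E\<^esub> (f ` A))"
    using A assms(3) by (simp add: compose_def preserves_joins_def)
  also have "\<dots> = \<Squnion>\<^bsub>F\<^esub> (g ` f ` A)"
  proof -
    have "f ` A \<subseteq> carrier E" using A assms(2) by auto
    then show ?thesis using assms(4) by (simp add: preserves_joins_def)
  qed
  also have "g ` f ` A = compose (carrier D) g f ` A"
    unfolding image_image by (intro image_cong HOL.refl) (simp add: compose_def subsetD[OF A])
  finally show "compose (carrier D) g f (\<Squnion>\<^bsub>D\<^esub> A) = \<Squnion>\<^bsub>F\<^esub> (compose (carrier D) g f ` A)" .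
qed

lemma preserves_meets_compose:
  assumes "complete_lattice D" "f \<in> carrier D \<rightarrow> carrier E" "preserves_meets D E f" "preserves_meets E F g"
  shows "preserves_meets D F (compose (carrier D) g f)"
  unfolding preserves_meets_def
proof (intro allI impI)
  interpret D: complete_lattice D by (rule assms)
  fix A assume A: "A \<subseteq> carrier D"
  have "compose (carrier D) g f (\<Sqinter>\<^bsub>D\<^esub> A) = g (\<Sqinter>\<^bsub>E\<^esub> (f ` A))"
    using A assms(3) by (simp add: compose_def preserves_meets_def)
  also have "\<dots> = \<Sqinter>\<^bsub>F\<^esub> (g ` f ` A)"
  proof -
    have "f ` A \<subseteq> carrier E" using A assms(2) by auto
    then show ?thesis using assms(4) by (simp add: preserves_meets_def)
  qed
  also have "g ` f ` A = compose (carrier D) g f ` A"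
    unfolding image_image by (intro image_cong HOL.refl) (simp add: compose_def subsetD[OF A])
  finally show "compose (carrier D) g f (\<Sqinter>\<^bsub>D\<^esub> A) = \<Sqinter>\<^bsub>F\<^esub> (compose (carrier D) g f ` A)" .
qed

lemma preserves_identity:
  assumes "complete_lattice D"
  shows "preserves_joins D D (\<lambda>x \<in> carrier D. x)" "preserves_meets D D (\<lambda>x \<in> carrier D. x)"
proof -
  interpret D: complete_lattice D by (rule assms)
  have "(\<lambda>x \<in> carrier D. x) ` A = A" if "A \<subseteq> carrier D" for A using that by force
  then show "preserves_joins D D (\<lambda>x \<in> carrier D. x)" "preserves_meets D D (\<lambda>x \<in> carrier D. x)"
    by (simp_all add: preserves_joins_def preserves_meets_def)
qed

text \<open>Witnesses of (Back) are chained: first one for \<open>g\<close>, then, at that element,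
  one for \<open>f\<close>; monotony of \<open>g\<close> keeps the first bound.\<close>

lemma residuation_morphisms_compose:
  assumes R: "derivation_acdl R" and S: "derivation_acdl S" and T: "derivation_acdl T"
    and f: "f \<in> residuation_morphisms R S" and g: "g \<in> residuation_morphisms S T"
  shows "compose (carrier R) g f \<in> residuation_morphisms R T"
proof -
  interpret R: derivation_acdl R by (rule R)
  interpret S: derivation_acdl S by (rule S)
  interpret T: derivation_acdl T by (rule T)
  let ?h = "compose (carrier R) g f"
  have fc: "f \<in> carrier R \<rightarrow> carrier S" and gc: "g \<in> carrier S \<rightarrow> carrier T"
    using f g by (auto simp: residuation_morphisms_def acdl_morphisms_def)
  note fx = funcset_mem[OF fc] and gx = funcset_mem[OF gc]
  have gj: "preserves_joins S T g" using g by (simp add: residuation_morphisms_def acdl_morphisms_def)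
  have gmono: "g x \<sqsubseteq>\<^bsub>T\<^esub> g y" if "x \<in> carrier S" "y \<in> carrier S" "x \<sqsubseteq>\<^bsub>S\<^esub> y" for x y
    by (rule preserves_joins_mono[OF S.complete_lattice_axioms T.complete_lattice_axioms gj gx that])
  have h: "?h x = g (f x)" if "x \<in> carrier R" for x using that by (simp add: compose_def)
  have hm: "?h \<in> acdl_morphisms R T"
    using f g fc gc
      preserves_joins_compose[OF R.complete_lattice_axioms fc, of T g]
      preserves_meets_compose[OF R.complete_lattice_axioms fc, of T g]
    by (auto simp: residuation_morphisms_def acdl_morphisms_def compose_def)
  have f1: "f (x \<rightharpoondown>\<^bsub>R\<^esub> z) \<sqsubseteq>\<^bsub>S\<^esub> f x \<rightharpoondown>\<^bsub>S\<^esub> f z" "f (z \<leftharpoondown>\<^bsub>R\<^esub> x) \<sqsubseteq>\<^bsub>S\<^esub> f z \<leftharpoondown>\<^bsub>S\<^esub> f x"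
    if "x \<in> carrier R" "z \<in> carrier R" for x z
    using f that by (simp_all add: residuation_morphisms_def)
  have g1: "g (x \<rightharpoondown>\<^bsub>S\<^esub> z) \<sqsubseteq>\<^bsub>T\<^esub> g x \<rightharpoondown>\<^bsub>T\<^esub> g z" "g (z \<leftharpoondown>\<^bsub>S\<^esub> x) \<sqsubseteq>\<^bsub>T\<^esub> g z \<leftharpoondown>\<^bsub>T\<^esub> g x"
    if "x \<in> carrier S" "z \<in> carrier S" for x z
    using g that by (simp_all add: residuation_morphisms_def)
  have f2: "\<exists>x \<in> carrier R. y \<sqsubseteq>\<^bsub>S\<^esub> f x \<and> y \<rightharpoondown>\<^bsub>S\<^esub> f z = f (x \<rightharpoondown>\<^bsub>R\<^esub> z)"
    "\<exists>x \<in> carrier R. y \<sqsubseteq>\<^bsub>S\<^esub> f x \<and> f z \<leftharpoondown>\<^bsub>S\<^esub> y = f (z \<leftharpoondown>\<^bsub>R\<^esub> x)"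
    if "y \<in> carrier S" "z \<in> carrier R" for y z
    using f that by (simp_all add: residuation_morphisms_def)
  have g2: "\<exists>x \<in> carrier S. y \<sqsubseteq>\<^bsub>T\<^esub> g x \<and> y \<rightharpoondown>\<^bsub>T\<^esub> g z = g (x \<rightharpoondown>\<^bsub>S\<^esub> z)"
    "\<exists>x \<in> carrier S. y \<sqsubseteq>\<^bsub>T\<^esub> g x \<and> g z \<leftharpoondown>\<^bsub>T\<^esub> y = g (z \<leftharpoondown>\<^bsub>S\<^esub> x)"
    if "y \<in> carrier T" "z \<in> carrier S" for y z
    using g that by (simp_all add: residuation_morphisms_def)
  show ?thesis
    unfolding residuation_morphisms_def
  proof (intro CollectI conjI ballI hm)
    fix x z assume xz: "x \<in> carrier R" "z \<in> carrier R"
    have "g (f (x \<rightharpoondown>\<^bsub>R\<^esub> z)) \<sqsubseteq>\<^bsub>T\<^esub> g (f x \<rightharpoondown>\<^bsub>S\<^esub> f z)"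
      using f1(1)[OF xz] xz fx by (intro gmono) simp_all
    from T.le_trans[OF this g1(1)[OF fx fx]] show "?h (x \<rightharpoondown>\<^bsub>R\<^esub> z) \<sqsubseteq>\<^bsub>T\<^esub> ?h x \<rightharpoondown>\<^bsub>T\<^esub> ?h z"
      using xz fx gx by (simp add: h)
    have "g (f (z \<leftharpoondown>\<^bsub>R\<^esub> x)) \<sqsubseteq>\<^bsub>T\<^esub> g (f z \<leftharpoondown>\<^bsub>S\<^esub> f x)"
      using f1(2)[OF xz] xz fx by (intro gmono) simp_all
    from T.le_trans[OF this g1(2)[OF fx fx]] show "?h (z \<leftharpoondown>\<^bsub>R\<^esub> x) \<sqsubseteq>\<^bsub>T\<^esub> ?h z \<leftharpoondown>\<^bsub>T\<^esub> ?h x"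
      using xz fx gx by (simp add: h)
  next
    fix w z assume w: "w \<in> carrier T" and z: "z \<in> carrier R"
    obtain y where y: "y \<in> carrier S" "w \<sqsubseteq>\<^bsub>T\<^esub> g y" "w \<rightharpoondown>\<^bsub>T\<^esub> g (f z) = g (y \<rightharpoondown>\<^bsub>S\<^esub> f z)"
      using g2(1)[OF w fx[OF z]] by blast
    obtain x where x: "x \<in> carrier R" "y \<sqsubseteq>\<^bsub>S\<^esub> f x" "y \<rightharpoondown>\<^bsub>S\<^esub> f z = f (x \<rightharpoondown>\<^bsub>R\<^esub> z)"
      using f2(1)[OF y(1) z] by blast
    have "w \<sqsubseteq>\<^bsub>T\<^esub> g (f x)"
      by (rule T.le_trans[OF y(2) gmono[OF y(1) fx[OF x(1)] x(2)] w gx[OF y(1)] gx[OF fx[OF x(1)]]])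
    then show "\<exists>x \<in> carrier R. w \<sqsubseteq>\<^bsub>T\<^esub> ?h x \<and> w \<rightharpoondown>\<^bsub>T\<^esub> ?h z = ?h (x \<rightharpoondown>\<^bsub>R\<^esub> z)"
      using x y z by (intro bexI[of _ x]) (simp_all add: h)
    obtain y where y: "y \<in> carrier S" "w \<sqsubseteq>\<^bsub>T\<^esub> g y" "g (f z) \<leftharpoondown>\<^bsub>T\<^esub> w = g (f z \<leftharpoondown>\<^bsub>S\<^esub> y)"
      using g2(2)[OF w fx[OF z]] by blast
    obtain x where x: "x \<in> carrier R" "y \<sqsubseteq>\<^bsub>S\<^esub> f x" "f z \<leftharpoondown>\<^bsub>S\<^esub> y = f (z \<leftharpoondown>\<^bsub>R\<^esub> x)"
      using f2(2)[OF y(1) z] by blast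
    have "w \<sqsubseteq>\<^bsub>T\<^esub> g (f x)"
      by (rule T.le_trans[OF y(2) gmono[OF y(1) fx[OF x(1)] x(2)] w gx[OF y(1)] gx[OF fx[OF x(1)]]])
    then show "\<exists>x \<in> carrier R. w \<sqsubseteq>\<^bsub>T\<^esub> ?h x \<and> ?h z \<leftharpoondown>\<^bsub>T\<^esub> w = ?h (z \<leftharpoondown>\<^bsub>R\<^esub> x)"
      using x y z by (intro bexI[of _ x]) (simp_all add: h)
  next
    fix x assume x: "x \<in> carrier R"
    have "residuation_unit R \<sqsubseteq>\<^bsub>R\<^esub> x \<longleftrightarrow> residuation_unit S \<sqsubseteq>\<^bsub>S\<^esub> f x"
      using f x by (simp add: residuation_morphisms_def)
    moreover have "residuation_unit S \<sqsubseteq>\<^bsub>S\<^esub> f x \<longleftrightarrow> residuation_unit T \<sqsubseteq>\<^bsub>T\<^esub> g (f x)"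
      using g fx[OF x] by (simp add: residuation_morphisms_def)
    ultimately show "residuation_unit R \<sqsubseteq>\<^bsub>R\<^esub> x \<longleftrightarrow> residuation_unit T \<sqsubseteq>\<^bsub>T\<^esub> ?h x"
      using x by (simp add: h)
  qed
qed

lemma residuation_morphisms_identity:
  assumes R: "derivation_acdl R"
  shows "(\<lambda>x \<in> carrier R. x) \<in> residuation_morphisms R R"
proof -
  interpret R: derivation_acdl R by (rule R)
  have "(\<lambda>x \<in> carrier R. x) \<in> acdl_morphisms R R"
    using preserves_identity[OF R.complete_lattice_axioms] by (simp add: acdl_morphisms_def)
  then show ?thesis by (auto simp: residuation_morphisms_def)
qed

lemma corelational_residuation_morphisms_compose:
  assumes R: "derivation_acdl R" and S: "derivation_acdl S" and T: "derivation_acdl T"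
    and f: "f \<in> corelational_residuation_morphisms R S" and g: "g \<in> corelational_residuation_morphisms S T"
  shows "compose (carrier R) g f \<in> corelational_residuation_morphisms R T"
proof -
  interpret R: derivation_acdl R by (rule R)
  interpret S: derivation_acdl S by (rule S)
  interpret T: derivation_acdl T by (rule T)
  let ?h = "compose (carrier R) g f"
  have fc: "f \<in> carrier R \<rightarrow> carrier S" and gc: "g \<in> carrier S \<rightarrow> carrier T"
    using f g by (auto simp: corelational_residuation_morphisms_def)
  note fx = funcset_mem[OF fc] and gx = funcset_mem[OF gc]
  have gj: "preserves_joins S T g" using g by (simp add: corelational_residuation_morphisms_def)
  have gmono: "g x \<sqsubseteq>\<^bsub>T\<^esub> g y" if "x \<in> carrier S" "y \<in> carrier S" "x \<sqsubseteq>\<^bsub>S\<^esub> y" for x y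
    by (rule preserves_joins_mono[OF S.complete_lattice_axioms T.complete_lattice_axioms gj gx that])
  have h: "?h x = g (f x)" if "x \<in> carrier R" for x using that by (simp add: compose_def)
  have f1: "f (x \<rightharpoondown>\<^bsub>R\<^esub> z) \<sqsubseteq>\<^bsub>S\<^esub> f x \<rightharpoondown>\<^bsub>S\<^esub> f z" if "x \<in> carrier R" "z \<in> carrier R" for x z
    using f that by (simp add: corelational_residuation_morphisms_def)
  have g1: "g (x \<rightharpoondown>\<^bsub>S\<^esub> z) \<sqsubseteq>\<^bsub>T\<^esub> g x \<rightharpoondown>\<^bsub>T\<^esub> g z" if "x \<in> carrier S" "z \<in> carrier S" for x z
    using g that by (simp add: corelational_residuation_morphisms_def)
  show ?thesis
    unfolding corelational_residuation_morphisms_def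
  proof (intro CollectI conjI ballI)
    show "?h \<in> carrier R \<rightarrow>\<^sub>E carrier T" using fx gx by (auto simp: compose_def)
    show "preserves_joins R T ?h"
      using f gj by (intro preserves_joins_compose[OF R.complete_lattice_axioms fc])
        (simp_all add: corelational_residuation_morphisms_def)
    show "?h \<top>\<^bsub>R\<^esub> = \<top>\<^bsub>T\<^esub>"
      using f g by (simp add: h corelational_residuation_morphisms_def)
    fix x z assume xz: "x \<in> carrier R" "z \<in> carrier R"
    have "g (f (x \<rightharpoondown>\<^bsub>R\<^esub> z)) \<sqsubseteq>\<^bsub>T\<^esub> g (f x \<rightharpoondown>\<^bsub>S\<^esub> f z)"
      using f1(1)[OF xz] xz fx by (intro gmono) simp_all
    from T.le_trans[OF this g1(1)[OF fx fx]] show "?h (x \<rightharpoondown>\<^bsub>R\<^esub> z) \<sqsubseteq>\<^bsub>T\<^esub> ?h x \<rightharpoondown>\<^bsub>T\<^esub> ?h z"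
      using xz fx gx by (simp add: h)
  next
    have "g (residuation_unit S) \<sqsubseteq>\<^bsub>T\<^esub> g (f (residuation_unit R))"
      using f fx R.unit_closed S.unit_closed by (intro gmono) (simp_all add: corelational_residuation_morphisms_def)
    moreover have "residuation_unit T \<sqsubseteq>\<^bsub>T\<^esub> g (residuation_unit S)"
      using g by (simp add: corelational_residuation_morphisms_def)
    ultimately show "residuation_unit T \<sqsubseteq>\<^bsub>T\<^esub> ?h (residuation_unit R)"
      using T.le_trans[of "residuation_unit T" "g (residuation_unit S)" "g (f (residuation_unit R))"]
        R.unit_closed S.unit_closed T.unit_closed fx gx by (simp add: h)
  qed
qed

text \<open>The top is the empty meet, and the unit condition is (Unit) at the unit itself.
  Identities and isomorphisms are thereby inherited by \<open>RelDerACDL\<close>.\<close>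

lemma residuation_morphisms_corelational:
  assumes R: "derivation_acdl R" and S: "derivation_acdl S" and f: "f \<in> residuation_morphisms R S"
  shows "f \<in> corelational_residuation_morphisms R S"
proof -
  interpret R: derivation_acdl R by (rule R)
  interpret S: derivation_acdl S by (rule S)
  have "f \<top>\<^bsub>R\<^esub> = \<top>\<^bsub>S\<^esub>"
  proof -
    have t: "\<Sqinter>\<^bsub>R\<^esub> {} = \<top>\<^bsub>R\<^esub>" "\<Sqinter>\<^bsub>S\<^esub> {} = \<top>\<^bsub>S\<^esub>"
      using R.weak_inf_empty S.weak_inf_empty by (simp_all add: R.eq_is_equal S.eq_is_equal)
    have "preserves_meets R S f" using f by (simp add: residuation_morphisms_def acdl_morphisms_def)
    from this[unfolded preserves_meets_def, rule_format, of "{}"] show ?thesis using t by simp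
  qed
  moreover have "residuation_unit S \<sqsubseteq>\<^bsub>S\<^esub> f (residuation_unit R)"
  proof -
    have "residuation_unit R \<sqsubseteq>\<^bsub>R\<^esub> x \<longleftrightarrow> residuation_unit S \<sqsubseteq>\<^bsub>S\<^esub> f x" if "x \<in> carrier R" for x
      using f that by (simp add: residuation_morphisms_def)
    from this[OF R.unit_closed] show ?thesis using R.unit_closed by simp
  qed
  ultimately show ?thesis
    using f by (simp add: residuation_morphisms_def corelational_residuation_morphisms_def acdl_morphisms_def)
qed

lemma residuation_morphisms_extensional:
  "f \<in> residuation_morphisms R S \<Longrightarrow> f \<in> carrier R \<rightarrow> carrier S \<and> f \<in> extensional (carrier R)"
  "f \<in> corelational_residuation_morphisms R S \<Longrightarrow> f \<in> carrier R \<rightarrow> carrier S \<and> f \<in> extensional (carrier R)"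
  by (auto simp: residuation_morphisms_def corelational_residuation_morphisms_def acdl_morphisms_def PiE_iff)

lemma DerACDL_category: "category (DerACDL small)"
  by (rule concrete_category[where U = carrier])
    (auto simp: DerACDL_def PiE_iff dest: residuation_morphisms_extensional
      intro: residuation_morphisms_identity residuation_morphisms_compose)

lemma RelDerACDL_category: "category (RelDerACDL small)"
  by (rule concrete_category[where U = carrier])
    (auto simp: RelDerACDL_def PiE_iff dest: residuation_morphisms_extensional
      intro: residuation_morphisms_corelational residuation_morphisms_identity
        corelational_residuation_morphisms_compose)

lemma small_primes_cong [simp]:
  "small_primes small (comonoid_of R) \<longleftrightarrow> small_primes small R"
  "small_primes small (residuation_of C) \<longleftrightarrow> small_primes small C"
  by (simp_all add: small_primes_def)

lemma comonoid_morphisms_comonoid_of: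
  assumes R: "derivation_acdl R" and S: "derivation_acdl S"
  shows "pure_comonoid_morphisms (comonoid_of R) (comonoid_of S) = residuation_morphisms R S"
    and "corelational_comonoid_morphisms (comonoid_of R) (comonoid_of S) = corelational_residuation_morphisms R S"
proof -
  have tc: "two_comonoids (comonoid_of R) (comonoid_of S)"
    using R S by (simp add: two_comonoids_def derivation_acdl.acdl_comonoid_comonoid_of)
  show "pure_comonoid_morphisms (comonoid_of R) (comonoid_of S) = residuation_morphisms R S"
    using two_comonoids.pure_morphisms_eq[OF tc]
    by (simp add: derivation_acdl.residuation_of_comonoid_of R S)
  show "corelational_comonoid_morphisms (comonoid_of R) (comonoid_of S) = corelational_residuation_morphisms R S"
    using two_comonoids.corelational_morphisms_eq[OF tc]
    by (simp add: derivation_acdl.residuation_of_comonoid_of R S)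
qed

text \<open>Corresponding hom-sets are equal sets of functions, not merely in bijection, so the
  translation is a renaming of objects.\<close>

lemma relabelling_Comon: "relabelling (DerACDL small) (Comon small) comonoid_of residuation_of"
  by (intro relabelling.intro DerACDL_category)
    (simp_all add: DerACDL_def Comon_def derivation_acdl.acdl_comonoid_comonoid_of
      acdl_comonoid.derivation_acdl_residuation_of derivation_acdl.residuation_of_comonoid_of
      acdl_comonoid.comonoid_of_residuation_of comonoid_morphisms_comonoid_of)

lemma relabelling_RelComon: "relabelling (RelDerACDL small) (RelComon small) comonoid_of residuation_of"
  by (intro relabelling.intro RelDerACDL_category)
    (simp_all add: RelDerACDL_def RelComon_def derivation_acdl.acdl_comonoid_comonoid_of
      acdl_comonoid.derivation_acdl_residuation_of derivation_acdl.residuation_of_comonoid_of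
      acdl_comonoid.comonoid_of_residuation_of comonoid_morphisms_comonoid_of)

section \<open>The lattice of upsets of an ordered monoid\<close>

text \<open>
  Upsets rather than downsets: \<open>{x. \<rho> x \<inter> V \<noteq> {}}\<close> is an upset for a relational morphism \<open>\<rho>\<close>, since
  \<open>\<rho>\<close> is monotone.
\<close>

definition upsets :: "'a ord_monoid \<Rightarrow> 'a set set" where
  "upsets M = {U. U \<subseteq> carrier M \<and> (\<forall>u \<in> U. \<forall>x \<in> carrier M. u \<preceq>\<^bsub>M\<^esub> x \<longrightarrow> x \<in> U)}"

definition principal_upset :: "'a ord_monoid \<Rightarrow> 'a \<Rightarrow> 'a set" where
  "principal_upset M x = {y \<in> carrier M. x \<preceq>\<^bsub>M\<^esub> y}"

text \<open>These are the residuals of the elementwise product of subsets. That product need not be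
  an upset, but the residuals of upsets are.\<close>

definition upset_residuation :: "'a ord_monoid \<Rightarrow> 'a set residuation" where
  "upset_residuation M =
     \<lparr>carrier = upsets M, eq = (=), le = (\<subseteq>),
      lres = (\<lambda>U \<in> upsets M. \<lambda>V \<in> upsets M. {b \<in> carrier M. \<forall>a \<in> U. a \<otimes>\<^bsub>M\<^esub> b \<in> V}),
      rres = (\<lambda>V \<in> upsets M. \<lambda>U \<in> upsets M. {a \<in> carrier M. \<forall>b \<in> U. a \<otimes>\<^bsub>M\<^esub> b \<in> V})\<rparr>"

lemma upset_residuation_simps [simp]:
  "carrier (upset_residuation M) = upsets M"
  "eq (upset_residuation M) = (=)"
  "le (upset_residuation M) = (\<subseteq>)"
  by (simp_all add: upset_residuation_def)

lemma upset_residuals: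
  assumes "U \<in> upsets M" "V \<in> upsets M"
  shows "U \<rightharpoondown>\<^bsub>upset_residuation M\<^esub> V = {b \<in> carrier M. \<forall>a \<in> U. a \<otimes>\<^bsub>M\<^esub> b \<in> V}"
    and "V \<leftharpoondown>\<^bsub>upset_residuation M\<^esub> U = {a \<in> carrier M. \<forall>b \<in> U. a \<otimes>\<^bsub>M\<^esub> b \<in> V}"
  using assms by (simp_all add: upset_residuation_def)

context ordered_monoid
begin

interpretation order: partial_order "\<lparr>carrier = carrier M, eq = (=), le = mle M\<rparr>"
  by (rule mle_partial_order)

lemma mle_refl [simp]: "x \<in> carrier M \<Longrightarrow> x \<preceq> x"
  using order.le_refl by simp

lemma mle_trans: "\<lbrakk>x \<preceq> y; y \<preceq> z; x \<in> carrier M; y \<in> carrier M; z \<in> carrier M\<rbrakk> \<Longrightarrow> x \<preceq> z"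
  using order.le_trans[of x y z] by simp

lemma mle_antisym: "\<lbrakk>x \<preceq> y; y \<preceq> x; x \<in> carrier M; y \<in> carrier M\<rbrakk> \<Longrightarrow> x = y"
  using order.le_antisym[of x y] by simp

abbreviation "U \<equiv> upset_residuation M"

lemma upsetsI:
  assumes "A \<subseteq> carrier M" "\<And>x y. \<lbrakk>x \<in> A; y \<in> carrier M; x \<preceq> y\<rbrakk> \<Longrightarrow> y \<in> A"
  shows "A \<in> upsets M"
  using assms unfolding upsets_def by blast

lemma upsetsD:
  assumes "A \<in> upsets M"
  shows "\<And>x. x \<in> A \<Longrightarrow> x \<in> carrier M" "\<And>x y. \<lbrakk>x \<in> A; x \<preceq> y; y \<in> carrier M\<rbrakk> \<Longrightarrow> y \<in> A"
  using assms unfolding upsets_def by blast+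

lemma Union_upsets: "\<A> \<subseteq> upsets M \<Longrightarrow> \<Union> \<A> \<in> upsets M"
  unfolding upsets_def by blast

lemma Inter_upsets: "\<A> \<subseteq> upsets M \<Longrightarrow> carrier M \<inter> \<Inter> \<A> \<in> upsets M"
  unfolding upsets_def by blast

lemma carrier_upset: "carrier M \<in> upsets M"
  unfolding upsets_def by blast

lemma principal_upset_mem_iff: "y \<in> principal_upset M x \<longleftrightarrow> y \<in> carrier M \<and> x \<preceq> y"
  by (simp add: principal_upset_def)

lemma principal_upset_closed:
  assumes "x \<in> carrier M" shows "principal_upset M x \<in> upsets M"
proof (rule upsetsI)
  fix y z assume "y \<in> principal_upset M x" "z \<in> carrier M" "y \<preceq> z"
  then show "z \<in> principal_upset M x"
    using mle_trans[of x y z] assms by (simp add: principal_upset_mem_iff)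
qed (simp add: principal_upset_def)

lemma principal_upset_subset_iff:
  assumes "A \<in> upsets M" "x \<in> carrier M" shows "principal_upset M x \<subseteq> A \<longleftrightarrow> x \<in> A"
proof
  show "x \<in> A" if "principal_upset M x \<subseteq> A"
    using that assms(2) by (auto simp: principal_upset_mem_iff subset_iff)
  show "principal_upset M x \<subseteq> A" if "x \<in> A"
    using upsetsD(2)[OF assms(1) that] by (auto simp: principal_upset_mem_iff)
qed

lemma upsets_complete_lattice: "complete_lattice U"
proof -
  have po: "partial_order U" by unfold_locales auto
  have "\<exists>A. greatest U A (Lower U \<A>)" if "\<A> \<subseteq> carrier U" for \<A>
  proof (rule exI)
    \<comment> \<open>The intersection with \<open>carrier M\<close> gives the empty family the
      right meet.\<close>
    show "greatest U (carrier M \<inter> \<Inter> \<A>) (Lower U \<A>)"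
    proof -
      have c: "\<A> \<subseteq> upsets M" using that by simp
      have "B \<subseteq> carrier M \<inter> \<Inter> \<A>" if "B \<in> Lower U \<A>" for B
        using that c upsetsD(1)[of B] by (auto simp: Lower_def)
      moreover have "carrier M \<inter> \<Inter> \<A> \<in> Lower U \<A>"
        using Inter_upsets[OF c] by (auto simp: Lower_def)
      moreover have "Lower U \<A> \<subseteq> upsets M" by (auto simp: Lower_def)
      ultimately show ?thesis by (simp add: greatest_def)
    qed
  qed
  moreover have "\<exists>A. least U A (Upper U \<A>)" if "\<A> \<subseteq> carrier U" for \<A>
  proof (rule exI)
    show "least U (\<Union> \<A>) (Upper U \<A>)"
    proof -
      have c: "\<A> \<subseteq> upsets M" using that by simp
      have "\<Union> \<A> \<subseteq> B" if "B \<in> Upper U \<A>" for B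
        using that c by (auto simp: Upper_def)
      moreover have "\<Union> \<A> \<in> Upper U \<A>"
        using Union_upsets[OF c] by (auto simp: Upper_def)
      moreover have "Upper U \<A> \<subseteq> upsets M" by (auto simp: Upper_def)
      ultimately show ?thesis by (simp add: least_def)
    qed
  qed
  ultimately show ?thesis
    using po by (simp add: complete_lattice_def complete_lattice_axioms_def)
qed

interpretation U: complete_lattice U
  by (rule upsets_complete_lattice)

lemma upsets_sup: 
  assumes "\<A> \<subseteq> upsets M" shows "\<Squnion>\<^bsub>U\<^esub> \<A> = \<Union> \<A>"
proof -
  have A: "\<A> \<subseteq> carrier U" using assms by simp
  have "\<Squnion>\<^bsub>U\<^esub> \<A> \<subseteq> \<Union> \<A>"
    using U.sup_least[OF A, of "\<Union> \<A>"] Union_upsets[OF assms] by auto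
  moreover have "B \<subseteq> \<Squnion>\<^bsub>U\<^esub> \<A>" if "B \<in> \<A>" for B
    using U.sup_upper[OF A that] by simp
  ultimately show ?thesis by blast
qed

lemma upsets_inf: 
  assumes "\<A> \<subseteq> upsets M" shows "\<Sqinter>\<^bsub>U\<^esub> \<A> = carrier M \<inter> \<Inter> \<A>"
proof -
  have A: "\<A> \<subseteq> carrier U" using assms by simp
  have "carrier M \<inter> \<Inter> \<A> \<subseteq> \<Sqinter>\<^bsub>U\<^esub> \<A>"
    using U.inf_greatest[OF A, of "carrier M \<inter> \<Inter> \<A>"] Inter_upsets[OF assms] by auto
  moreover have "\<Sqinter>\<^bsub>U\<^esub> \<A> \<subseteq> B" if "B \<in> \<A>" for B
    using U.inf_lower[OF A that] by simp
  moreover have "\<Sqinter>\<^bsub>U\<^esub> \<A> \<subseteq> carrier M"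
    using U.inf_closed[OF A] upsetsD(1) by auto
  ultimately show ?thesis by blast
qed

lemma upsets_top: "\<top>\<^bsub>U\<^esub> = carrier M"
proof (rule subset_antisym)
  show "carrier M \<subseteq> \<top>\<^bsub>U\<^esub>" using U.top_higher[of "carrier M"] carrier_upset by simp
  show "\<top>\<^bsub>U\<^esub> \<subseteq> carrier M" using U.top_closed upsetsD(1) by auto
qed

lemma upset_eq_Union:
  assumes "A \<in> upsets M" shows "A = \<Union> (principal_upset M ` A)"
proof (rule Set.set_eqI)
  fix y
  show "y \<in> A \<longleftrightarrow> y \<in> \<Union> (principal_upset M ` A)"
    using upsetsD[OF assms] by (auto simp: principal_upset_mem_iff intro: bexI[of _ y])
qed

text \<open>Joins are unions, and a principal upset lies in an upset as soon as its generator
  does.\<close>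

lemma principal_upset_prime:
  assumes "x \<in> carrier M" shows "principal_upset M x \<in> completely_join_primes U"
  unfolding completely_join_primes_def
proof (intro CollectI conjI allI impI)
  show "principal_upset M x \<in> carrier U" using principal_upset_closed[OF assms] by simp
  fix \<A> assume \<A>: "\<A> \<subseteq> carrier U \<and> principal_upset M x \<sqsubseteq>\<^bsub>U\<^esub> \<Squnion>\<^bsub>U\<^esub> \<A>"
  then have sub: "\<A> \<subseteq> upsets M" by simp
  have "principal_upset M x \<subseteq> \<Union> \<A>" using \<A> upsets_sup[OF sub] by simp
  then have "x \<in> \<Union> \<A>" using principal_upset_subset_iff[OF Union_upsets[OF sub] assms] by simp
  then obtain B where "B \<in> \<A>" "x \<in> B" by blast
  then show "\<exists>B \<in> \<A>. principal_upset M x \<sqsubseteq>\<^bsub>U\<^esub> B"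
    using principal_upset_subset_iff[OF _ assms] sub by auto
qed

text \<open>A prime is the union of the principal upsets of its elements, hence contained in one of
  them.\<close>

lemma upset_primes: "completely_join_primes U = principal_upset M ` carrier M"
proof (rule subset_antisym)
  show "principal_upset M ` carrier M \<subseteq> completely_join_primes U" using principal_upset_prime by blast
  show "completely_join_primes U \<subseteq> principal_upset M ` carrier M"
  proof
    fix P assume P: "P \<in> completely_join_primes U"
    then have Pc: "P \<in> upsets M" using completely_join_primes_closed[OF P] by simp
    let ?A = "principal_upset M ` P"
    have A: "?A \<subseteq> carrier U" using principal_upset_closed upsetsD(1)[OF Pc] by auto
    have "P \<sqsubseteq>\<^bsub>U\<^esub> \<Squnion>\<^bsub>U\<^esub> ?A" using upset_eq_Union[OF Pc] upsets_sup[of ?A] A by simp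
    then obtain x where x: "x \<in> P" "P \<subseteq> principal_upset M x"
      using U.prime_le_sup_iff[OF P A] by auto
    have xc: "x \<in> carrier M" by (rule upsetsD(1)[OF Pc x(1)])
    have "P = principal_upset M x" using x principal_upset_subset_iff[OF Pc xc] by auto
    then show "P \<in> principal_upset M ` carrier M" using xc by simp
  qed
qed

lemma upsets_spatial: "spatial_lattice U"
proof (intro spatial_lattice.intro spatial_lattice_axioms.intro upsets_complete_lattice)
  fix A B assume A: "A \<in> carrier U" and B: "B \<in> carrier U"
    and le: "\<And>P. \<lbrakk>P \<in> completely_join_primes U; P \<sqsubseteq>\<^bsub>U\<^esub> A\<rbrakk> \<Longrightarrow> P \<sqsubseteq>\<^bsub>U\<^esub> B"
  have c: "A \<in> upsets M" "B \<in> upsets M" using A B by simp_all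
  have "x \<in> B" if "x \<in> A" for x
  proof -
    note x = upsetsD(1)[OF c(1) that]
    show ?thesis
      using le[OF principal_upset_prime[OF x]] that
        principal_upset_subset_iff[OF c(1) x] principal_upset_subset_iff[OF c(2) x] by simp
  qed
  then show "A \<sqsubseteq>\<^bsub>U\<^esub> B" by auto
qed

lemma upset_residuals_closed:
  assumes A: "A \<in> upsets M" and C: "C \<in> upsets M"
  shows "A \<rightharpoondown>\<^bsub>U\<^esub> C \<in> upsets M" "C \<leftharpoondown>\<^bsub>U\<^esub> A \<in> upsets M"
  unfolding upset_residuals[OF A C]
proof -
  show "{b \<in> carrier M. \<forall>a \<in> A. a \<otimes> b \<in> C} \<in> upsets M"
  proof (rule upsetsI)
    fix x y assume x: "x \<in> {b \<in> carrier M. \<forall>a \<in> A. a \<otimes> b \<in> C}" and y: "y \<in> carrier M" "x \<preceq> y"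
    have "a \<otimes> y \<in> C" if "a \<in> A" for a
      using upsetsD(1)[OF A that] x y that mult_mono[of a a x y] upsetsD(2)[OF C, of "a \<otimes> x" "a \<otimes> y"]
      by simp
    then show "y \<in> {b \<in> carrier M. \<forall>a \<in> A. a \<otimes> b \<in> C}" using y by simp
  qed blast
  show "{a \<in> carrier M. \<forall>b \<in> A. a \<otimes> b \<in> C} \<in> upsets M"
  proof (rule upsetsI)
    fix x y assume x: "x \<in> {a \<in> carrier M. \<forall>b \<in> A. a \<otimes> b \<in> C}" and y: "y \<in> carrier M" "x \<preceq> y"
    have "y \<otimes> a \<in> C" if "a \<in> A" for a
      using upsetsD(1)[OF A that] x y that mult_mono[of x y a a] upsetsD(2)[OF C, of "x \<otimes> a" "y \<otimes> a"]
      by simp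
    then show "y \<in> {a \<in> carrier M. \<forall>b \<in> A. a \<otimes> b \<in> C}" using y by simp
  qed blast
qed

text \<open>Since multiplication is monotone and \<open>C\<close> is an upset, testing the generator
  \<open>a\<close> suffices. The residual by a principal upset is therefore the inverse image under
  a translation.\<close>

lemma upset_lres_principal_mem_iff:
  assumes "a \<in> carrier M" "b \<in> carrier M" "C \<in> upsets M"
  shows "b \<in> principal_upset M a \<rightharpoondown>\<^bsub>U\<^esub> C \<longleftrightarrow> a \<otimes> b \<in> C"
  unfolding upset_residuals(1)[OF principal_upset_closed[OF assms(1)] assms(3)]
proof
  assume ab: "a \<otimes> b \<in> C"
  have "x \<otimes> b \<in> C" if "x \<in> principal_upset M a" for x
    using that ab assms mult_mono[of a x b b] upsetsD(2)[OF assms(3), of "a \<otimes> b" "x \<otimes> b"]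
    by (simp add: principal_upset_mem_iff)
  then show "b \<in> {b \<in> carrier M. \<forall>x \<in> principal_upset M a. x \<otimes> b \<in> C}" using assms(2) by simp
qed (use assms in \<open>simp add: principal_upset_mem_iff\<close>)

lemma upset_rres_principal_mem_iff:
  assumes "a \<in> carrier M" "b \<in> carrier M" "C \<in> upsets M"
  shows "a \<in> C \<leftharpoondown>\<^bsub>U\<^esub> principal_upset M b \<longleftrightarrow> a \<otimes> b \<in> C"
  unfolding upset_residuals(2)[OF principal_upset_closed[OF assms(2)] assms(3)]
proof
  assume ab: "a \<otimes> b \<in> C"
  have "a \<otimes> x \<in> C" if "x \<in> principal_upset M b" for x
    using that ab assms mult_mono[of a a b x] upsetsD(2)[OF assms(3), of "a \<otimes> b" "a \<otimes> x"]
    by (simp add: principal_upset_mem_iff)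
  then show "a \<in> {a \<in> carrier M. \<forall>x \<in> principal_upset M b. a \<otimes> x \<in> C}" using assms(1) by simp
qed (use assms in \<open>simp add: principal_upset_mem_iff\<close>)

lemma upset_unit: "is_residuation_unit U (principal_upset M \<one>)"
proof -
  have "principal_upset M \<one> \<rightharpoondown>\<^bsub>U\<^esub> Z = Z" "Z \<leftharpoondown>\<^bsub>U\<^esub> principal_upset M \<one> = Z" if Z: "Z \<in> upsets M" for Z
  proof -
    note c = principal_upset_closed[OF one_closed]
    have "x \<in> principal_upset M \<one> \<rightharpoondown>\<^bsub>U\<^esub> Z \<longleftrightarrow> x \<in> Z" for x
      using upset_lres_principal_mem_iff[OF one_closed _ Z, of x] upsetsD(1)[OF Z, of x]
        upsetsD(1)[OF upset_residuals_closed(1)[OF c Z], of x] by (cases "x \<in> carrier M") auto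
    then show "principal_upset M \<one> \<rightharpoondown>\<^bsub>U\<^esub> Z = Z" by (intro Set.set_eqI)
    have "x \<in> Z \<leftharpoondown>\<^bsub>U\<^esub> principal_upset M \<one> \<longleftrightarrow> x \<in> Z" for x
      using upset_rres_principal_mem_iff[OF _ one_closed Z, of x] upsetsD(1)[OF Z, of x]
        upsetsD(1)[OF upset_residuals_closed(2)[OF c Z], of x] by (cases "x \<in> carrier M") auto
    then show "Z \<leftharpoondown>\<^bsub>U\<^esub> principal_upset M \<one> = Z" by (intro Set.set_eqI)
  qed
  then show ?thesis
    using principal_upset_prime[OF one_closed] by (simp add: is_residuation_unit_def)
qed

lemma upset_residuation_acdl: "residuation_acdl U"
proof (rule residuation_acdlI[where P = "\<lambda>A B C. \<forall>a \<in> A. \<forall>b \<in> B. a \<otimes> b \<in> C"])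
  show "acdl U" by (rule spatial_lattice.acdl[OF upsets_spatial])
  show "lres U \<in> carrier U \<rightarrow>\<^sub>E carrier U \<rightarrow>\<^sub>E carrier U" "rres U \<in> carrier U \<rightarrow>\<^sub>E carrier U \<rightarrow>\<^sub>E carrier U"
    using upset_residuals_closed by (auto simp: PiE_iff extensional_def upset_residuation_def)
next
  fix A B C assume "A \<in> carrier U" "B \<in> carrier U" "C \<in> carrier U"
  then have c: "A \<in> upsets M" "B \<in> upsets M" "C \<in> upsets M" by simp_all
  show "B \<sqsubseteq>\<^bsub>U\<^esub> A \<rightharpoondown>\<^bsub>U\<^esub> C \<longleftrightarrow> (\<forall>a \<in> A. \<forall>b \<in> B. a \<otimes> b \<in> C)"
    using upset_residuals(1)[OF c(1,3)] upsetsD(1)[OF c(2)] by auto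
  show "A \<sqsubseteq>\<^bsub>U\<^esub> C \<leftharpoondown>\<^bsub>U\<^esub> B \<longleftrightarrow> (\<forall>a \<in> A. \<forall>b \<in> B. a \<otimes> b \<in> C)"
    using upset_residuals(2)[OF c(2,3)] upsetsD(1)[OF c(1)] by auto
next
  fix A B \<A> assume "A \<in> carrier U" "B \<in> carrier U" "\<A> \<subseteq> carrier U"
  then have c: "A \<in> upsets M" "B \<in> upsets M" "\<A> \<subseteq> upsets M" by simp_all
  show "(\<forall>a \<in> A. \<forall>b \<in> B. a \<otimes> b \<in> \<Sqinter>\<^bsub>U\<^esub> \<A>) \<longleftrightarrow> (\<forall>C \<in> \<A>. \<forall>a \<in> A. \<forall>b \<in> B. a \<otimes> b \<in> C)"
    unfolding upsets_inf[OF c(3)] using upsetsD(1)[OF c(1)] upsetsD(1)[OF c(2)] by auto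
qed

theorem upset_derivation_acdl: "derivation_acdl U"
proof (intro derivation_acdl.intro derivation_acdl_axioms.intro)
  show "residuation_acdl U" by (rule upset_residuation_acdl)
  show "\<exists>e. is_residuation_unit U e" using upset_unit by blast
  show "X \<rightharpoondown>\<^bsub>U\<^esub> (Z \<leftharpoondown>\<^bsub>U\<^esub> Y) = (X \<rightharpoondown>\<^bsub>U\<^esub> Z) \<leftharpoondown>\<^bsub>U\<^esub> Y"
    if "X \<in> carrier U" "Y \<in> carrier U" "Z \<in> carrier U" for X Y Z
  proof -
    have c: "X \<in> upsets M" "Y \<in> upsets M" "Z \<in> upsets M" using that by simp_all
    \<comment> \<open>Both sides quantify over \<open>a \<in> X\<close> and
      \<open>y \<in> Y\<close>, so \<open>m_assoc\<close> decides; the memberships in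
      \<open>carrier M\<close> come from unfolding the inner residual.\<close>
    have "(\<forall>a \<in> X. a \<otimes> b \<in> carrier M \<and> (\<forall>y \<in> Y. (a \<otimes> b) \<otimes> y \<in> Z)) \<longleftrightarrow>
        (\<forall>y \<in> Y. b \<otimes> y \<in> carrier M \<and> (\<forall>a \<in> X. a \<otimes> (b \<otimes> y) \<in> Z))" if "b \<in> carrier M" for b
      using upsetsD(1)[OF c(1)] upsetsD(1)[OF c(2)] that by (auto simp: m_assoc)
    moreover have "X \<rightharpoondown>\<^bsub>U\<^esub> (Z \<leftharpoondown>\<^bsub>U\<^esub> Y) = {b \<in> carrier M. \<forall>a \<in> X. a \<otimes> b \<in> Z \<leftharpoondown>\<^bsub>U\<^esub> Y}"
      and "(X \<rightharpoondown>\<^bsub>U\<^esub> Z) \<leftharpoondown>\<^bsub>U\<^esub> Y = {b \<in> carrier M. \<forall>y \<in> Y. b \<otimes> y \<in> X \<rightharpoondown>\<^bsub>U\<^esub> Z}"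
      by (rule upset_residuals(1)[OF c(1) upset_residuals_closed(2)[OF c(2,3)]]
          upset_residuals(2)[OF c(2) upset_residuals_closed(1)[OF c(1,3)]])+
    ultimately show ?thesis
      unfolding upset_residuals(1)[OF c(1,3)] upset_residuals(2)[OF c(2,3)]
      by (simp cong: conj_cong)
  qed
  fix P assume "P \<in> completely_join_primes U"
  then obtain x where x: "x \<in> carrier M" and P: "P = principal_upset M x"
    using upset_primes by auto
  note Pc = principal_upset_closed[OF x]
  interpret U: spatial_lattice U by (rule upsets_spatial)
  \<comment> \<open>Purity rests on this: inverse images under translations commute with
    unions.\<close>
  have mem: "principal_upset M y \<sqsubseteq>\<^bsub>U\<^esub> P \<rightharpoondown>\<^bsub>U\<^esub> C \<longleftrightarrow> x \<otimes> y \<in> C"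
    "principal_upset M y \<sqsubseteq>\<^bsub>U\<^esub> C \<leftharpoondown>\<^bsub>U\<^esub> P \<longleftrightarrow> y \<otimes> x \<in> C" if y: "y \<in> carrier M" and C: "C \<in> upsets M" for y C
    unfolding P using upset_lres_principal_mem_iff[OF x y C] upset_rres_principal_mem_iff[OF y x C]
      principal_upset_subset_iff[OF upset_residuals_closed(1)[OF Pc C] y]
      principal_upset_subset_iff[OF upset_residuals_closed(2)[OF Pc C] y] by simp_all
  show "preserves_joins U U (\<lambda>Z. P \<rightharpoondown>\<^bsub>U\<^esub> Z)" "preserves_joins U U (\<lambda>Z. Z \<leftharpoondown>\<^bsub>U\<^esub> P)"
    by (rule U.preserves_joinsI; use Pc P upset_residuals_closed mem in
        \<open>auto simp del: upset_residuation_simps(3) simp: upset_primes upsets_sup Union_upsets subset_iff\<close>)+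
qed

lemma upset_residuation_unit: "residuation_unit U = principal_upset M \<one>"
  by (rule residuation_acdl.residuation_unit_eq[OF upset_residuation_acdl upset_unit])

lemma upset_small_primes:
  assumes "small (carrier M)" shows "small_primes small U"
proof -
  have "inj_on (principal_upset M) (carrier M)"
  proof (rule inj_onI)
    fix x y assume xy: "x \<in> carrier M" "y \<in> carrier M" and eq: "principal_upset M x = principal_upset M y"
    have "x \<in> principal_upset M y" "y \<in> principal_upset M x"
      using xy eq principal_upset_mem_iff[of x x] principal_upset_mem_iff[of y y] by auto
    then show "x = y" using xy by (intro mle_antisym) (auto simp: principal_upset_mem_iff)
  qed
  then have "carrier M \<approx> completely_join_primes U"
    unfolding upset_primes eqpoll_def bij_betw_def by blast
  then show ?thesis using assms by (auto simp: small_primes_def)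
qed

end

section \<open>The categories of ordered monoids\<close>

lemma monotone_monoid_homsD:
  assumes "h \<in> monotone_monoid_homs M N"
  shows "h \<in> carrier M \<rightarrow> carrier N" "h \<in> extensional (carrier M)" "h \<one>\<^bsub>M\<^esub> = \<one>\<^bsub>N\<^esub>"
    "\<And>x y. \<lbrakk>x \<in> carrier M; y \<in> carrier M\<rbrakk> \<Longrightarrow> h (x \<otimes>\<^bsub>M\<^esub> y) = h x \<otimes>\<^bsub>N\<^esub> h y"
    "\<And>x y. \<lbrakk>x \<in> carrier M; y \<in> carrier M; x \<preceq>\<^bsub>M\<^esub> y\<rbrakk> \<Longrightarrow> h x \<preceq>\<^bsub>N\<^esub> h y"
  using assms by (auto simp: monotone_monoid_homs_def PiE_iff hom_def)

lemma monotone_monoid_homsI: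
  assumes "h \<in> carrier M \<rightarrow> carrier N" "h \<in> extensional (carrier M)" "h \<one>\<^bsub>M\<^esub> = \<one>\<^bsub>N\<^esub>"
    "\<And>x y. \<lbrakk>x \<in> carrier M; y \<in> carrier M\<rbrakk> \<Longrightarrow> h (x \<otimes>\<^bsub>M\<^esub> y) = h x \<otimes>\<^bsub>N\<^esub> h y"
    "\<And>x y. \<lbrakk>x \<in> carrier M; y \<in> carrier M; x \<preceq>\<^bsub>M\<^esub> y\<rbrakk> \<Longrightarrow> h x \<preceq>\<^bsub>N\<^esub> h y"
  shows "h \<in> monotone_monoid_homs M N"
  using assms by (auto simp: monotone_monoid_homs_def PiE_iff hom_def)

lemma relational_morphismsD:
  assumes "\<rho> \<in> relational_morphisms M N"
  shows "\<rho> \<in> extensional (carrier M)" "\<one>\<^bsub>N\<^esub> \<in> \<rho> \<one>\<^bsub>M\<^esub>"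
    "\<And>x y. \<lbrakk>x \<in> carrier M; y \<in> \<rho> x\<rbrakk> \<Longrightarrow> y \<in> carrier N"
    "\<And>x. x \<in> carrier M \<Longrightarrow> \<rho> x \<noteq> {}"
    "\<And>x y z. \<lbrakk>x \<in> carrier M; y \<in> \<rho> x; z \<in> carrier N; z \<preceq>\<^bsub>N\<^esub> y\<rbrakk> \<Longrightarrow> z \<in> \<rho> x"
    "\<And>x y. \<lbrakk>x \<in> carrier M; y \<in> carrier M; x \<preceq>\<^bsub>M\<^esub> y\<rbrakk> \<Longrightarrow> \<rho> x \<subseteq> \<rho> y"
    "\<And>x y a b. \<lbrakk>x \<in> carrier M; y \<in> carrier M; a \<in> \<rho> x; b \<in> \<rho> y\<rbrakk> \<Longrightarrow> a \<otimes>\<^bsub>N\<^esub> b \<in> \<rho> (x \<otimes>\<^bsub>M\<^esub> y)"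
proof -
  have *: "\<rho> x \<in> downsets N - {{}}" if "x \<in> carrier M" for x
    using assms that by (auto simp: relational_morphisms_def)
  show "\<rho> \<in> extensional (carrier M)" "\<one>\<^bsub>N\<^esub> \<in> \<rho> \<one>\<^bsub>M\<^esub>"
    "\<And>x y. \<lbrakk>x \<in> carrier M; y \<in> carrier M; x \<preceq>\<^bsub>M\<^esub> y\<rbrakk> \<Longrightarrow> \<rho> x \<subseteq> \<rho> y"
    "\<And>x y a b. \<lbrakk>x \<in> carrier M; y \<in> carrier M; a \<in> \<rho> x; b \<in> \<rho> y\<rbrakk> \<Longrightarrow> a \<otimes>\<^bsub>N\<^esub> b \<in> \<rho> (x \<otimes>\<^bsub>M\<^esub> y)"
    using assms by (auto simp: relational_morphisms_def PiE_iff)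
  show "y \<in> carrier N" if "x \<in> carrier M" "y \<in> \<rho> x" for x y
    using *[OF that(1)] that(2) by (auto simp: downsets_def)
  show "\<rho> x \<noteq> {}" if "x \<in> carrier M" for x
    using *[OF that] by simp
  show "z \<in> \<rho> x" if "x \<in> carrier M" "y \<in> \<rho> x" "z \<in> carrier N" "z \<preceq>\<^bsub>N\<^esub> y" for x y z
    using *[OF that(1)] that(2-4) by (auto simp: downsets_def)
qed

lemma relational_morphismsI:
  assumes "\<rho> \<in> extensional (carrier M)" "\<one>\<^bsub>N\<^esub> \<in> \<rho> \<one>\<^bsub>M\<^esub>"
    "\<And>x. x \<in> carrier M \<Longrightarrow> \<rho> x \<subseteq> carrier N"
    "\<And>x. x \<in> carrier M \<Longrightarrow> \<rho> x \<noteq> {}"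
    "\<And>x y z. \<lbrakk>x \<in> carrier M; y \<in> \<rho> x; z \<in> carrier N; z \<preceq>\<^bsub>N\<^esub> y\<rbrakk> \<Longrightarrow> z \<in> \<rho> x"
    "\<And>x y. \<lbrakk>x \<in> carrier M; y \<in> carrier M; x \<preceq>\<^bsub>M\<^esub> y\<rbrakk> \<Longrightarrow> \<rho> x \<subseteq> \<rho> y"
    "\<And>x y a b. \<lbrakk>x \<in> carrier M; y \<in> carrier M; a \<in> \<rho> x; b \<in> \<rho> y\<rbrakk> \<Longrightarrow> a \<otimes>\<^bsub>N\<^esub> b \<in> \<rho> (x \<otimes>\<^bsub>M\<^esub> y)"
  shows "\<rho> \<in> relational_morphisms M N"
proof -
  have "\<rho> x \<in> downsets N - {{}}" if "x \<in> carrier M" for x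
    using assms(3,4)[OF that] assms(5)[OF that] by (auto simp: downsets_def)
  then have "\<rho> \<in> carrier M \<rightarrow>\<^sub>E (downsets N - {{}})" using assms(1) by (auto simp: PiE_iff)
  then show ?thesis using assms(2,6,7) by (simp add: relational_morphisms_def)
qed

lemma monotone_monoid_homs_identity:
  assumes "ordered_monoid M" shows "(\<lambda>x \<in> carrier M. x) \<in> monotone_monoid_homs M M"
proof -
  interpret ordered_monoid M by (rule assms)
  show ?thesis by (auto intro: monotone_monoid_homsI)
qed

lemma monotone_monoid_homs_compose:
  assumes "ordered_monoid M" and f: "f \<in> monotone_monoid_homs M N" and g: "g \<in> monotone_monoid_homs N P"
  shows "compose (carrier M) g f \<in> monotone_monoid_homs M P"
proof -
  interpret ordered_monoid M by (rule assms)
  note f = monotone_monoid_homsD[OF f] and g = monotone_monoid_homsD[OF g]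
  have fx: "f x \<in> carrier N" if "x \<in> carrier M" for x by (rule funcset_mem[OF f(1) that])
  show ?thesis using f g fx by (intro monotone_monoid_homsI) (auto simp: compose_def)
qed

lemma OrdMon_category: "category (OrdMon small)"
  by (rule concrete_category[where U = carrier])
    (auto simp: OrdMon_def PiE_iff dest: monotone_monoid_homsD(1,2)
      intro: monotone_monoid_homs_identity monotone_monoid_homs_compose)

lemma relational_morphisms_identity:
  assumes "ordered_monoid M"
  shows "(\<lambda>x \<in> carrier M. {y \<in> carrier M. y \<preceq>\<^bsub>M\<^esub> x}) \<in> relational_morphisms M M"
proof -
  interpret ordered_monoid M by (rule assms)
  show ?thesis
    by (rule relational_morphismsI) (auto intro: mle_trans mult_mono)
qed

lemma relational_morphisms_compose:
  assumes "ordered_monoid M" "ordered_monoid N" "ordered_monoid P"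
    and \<rho>: "\<rho> \<in> relational_morphisms M N" and \<sigma>: "\<sigma> \<in> relational_morphisms N P"
  shows "(\<lambda>x \<in> carrier M. \<Union>y \<in> \<rho> x. \<sigma> y) \<in> relational_morphisms M P" (is "?\<tau> \<in> _")
proof -
  interpret M: ordered_monoid M by (rule assms)
  interpret N: ordered_monoid N by (rule assms)
  note r = relational_morphismsD[OF \<rho>] and s = relational_morphismsD[OF \<sigma>]
  show ?thesis
  proof (rule relational_morphismsI)
    show "\<one>\<^bsub>P\<^esub> \<in> ?\<tau> \<one>\<^bsub>M\<^esub>" using r(2) s(2) by auto
    show "?\<tau> x \<subseteq> carrier P" if "x \<in> carrier M" for x
      using r(3)[OF that] s(3) that by auto
    show "?\<tau> x \<noteq> {}" if "x \<in> carrier M" for x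
      using r(3,4)[OF that] s(4) that by fastforce
    show "z \<in> ?\<tau> x" if x: "x \<in> carrier M" and yz: "y \<in> ?\<tau> x" "z \<in> carrier P" "z \<preceq>\<^bsub>P\<^esub> y" for x y z
    proof -
      obtain w where w: "w \<in> \<rho> x" "y \<in> \<sigma> w" using x yz(1) by auto
      have "z \<in> \<sigma> w" by (rule s(5)[OF r(3)[OF x w(1)] w(2) yz(2,3)])
      then show ?thesis using w(1) x by auto
    qed
    show "?\<tau> x \<subseteq> ?\<tau> y" if "x \<in> carrier M" "y \<in> carrier M" "x \<preceq>\<^bsub>M\<^esub> y" for x y
      using r(6)[OF that] that by auto
    show "a \<otimes>\<^bsub>P\<^esub> b \<in> ?\<tau> (x \<otimes>\<^bsub>M\<^esub> y)"
      if xy: "x \<in> carrier M" "y \<in> carrier M" and ab: "a \<in> ?\<tau> x" "b \<in> ?\<tau> y" for x y a b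
    proof -
      obtain v w where vw: "v \<in> \<rho> x" "a \<in> \<sigma> v" "w \<in> \<rho> y" "b \<in> \<sigma> w" using ab xy by auto
      have "a \<otimes>\<^bsub>P\<^esub> b \<in> \<sigma> (v \<otimes>\<^bsub>N\<^esub> w)"
        by (rule s(7)[OF r(3)[OF xy(1) vw(1)] r(3)[OF xy(2) vw(3)] vw(2,4)])
      moreover have "v \<otimes>\<^bsub>N\<^esub> w \<in> \<rho> (x \<otimes>\<^bsub>M\<^esub> y)" by (rule r(7)[OF xy vw(1,3)])
      ultimately show ?thesis using xy by auto
    qed
  qed simp
qed

text \<open>The identity of the target is neutral because the values of a relational morphism are
  downsets, the identity of the source because the morphism is monotone.\<close>

lemma RelOrdMon_category: "category (RelOrdMon small)"
proof unfold_locales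
  fix X assume "X \<in> Ob (RelOrdMon small)"
  then show "Id (RelOrdMon small) X \<in> Hom (RelOrdMon small) X X"
    by (auto simp: RelOrdMon_def intro: relational_morphisms_identity)
next
  fix X Y Z f g
  assume "X \<in> Ob (RelOrdMon small)" "Y \<in> Ob (RelOrdMon small)" "Z \<in> Ob (RelOrdMon small)"
    "f \<in> Hom (RelOrdMon small) X Y" "g \<in> Hom (RelOrdMon small) Y Z"
  then show "Comp (RelOrdMon small) X Y Z g f \<in> Hom (RelOrdMon small) X Z"
    by (auto simp: RelOrdMon_def intro: relational_morphisms_compose)
next
  fix X Y f
  assume X: "X \<in> Ob (RelOrdMon small)" and Y: "Y \<in> Ob (RelOrdMon small)"
    and "f \<in> Hom (RelOrdMon small) X Y"
  then have "f \<in> relational_morphisms X Y" by (simp add: RelOrdMon_def)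
  note f = relational_morphismsD[OF this]
  interpret X: ordered_monoid X using X by (simp add: RelOrdMon_def)
  interpret Y: ordered_monoid Y using Y by (simp add: RelOrdMon_def)
  have "(\<Union>y \<in> f x. (\<lambda>x \<in> carrier Y. {y \<in> carrier Y. y \<preceq>\<^bsub>Y\<^esub> x}) y) = f x" if x: "x \<in> carrier X" for x
  proof -
    have "(\<Union>y \<in> f x. (\<lambda>x \<in> carrier Y. {y \<in> carrier Y. y \<preceq>\<^bsub>Y\<^esub> x}) y)
        = (\<Union>y \<in> f x. {z \<in> carrier Y. z \<preceq>\<^bsub>Y\<^esub> y})"
      by (intro SUP_cong HOL.refl) (simp add: f(3)[OF x])
    also have "\<dots> = f x"
    proof (rule subset_antisym; rule subsetI)
      fix z assume "z \<in> (\<Union>y \<in> f x. {z \<in> carrier Y. z \<preceq>\<^bsub>Y\<^esub> y})"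
      then obtain y where "y \<in> f x" "z \<in> carrier Y" "z \<preceq>\<^bsub>Y\<^esub> y" by blast
      then show "z \<in> f x" by (rule f(5)[OF x])
    next
      fix z assume "z \<in> f x"
      then show "z \<in> (\<Union>y \<in> f x. {z \<in> carrier Y. z \<preceq>\<^bsub>Y\<^esub> y})"
        using f(3)[OF x] by (intro UN_I[of z]) simp_all
    qed
    finally show ?thesis .
  qed
  then show "Comp (RelOrdMon small) X Y Y (Id (RelOrdMon small) Y) f = f"
    using f(1) by (intro extensionalityI[of _ "carrier X"]) (simp_all add: RelOrdMon_def)
  have "(\<Union>y \<in> (\<lambda>x \<in> carrier X. {y \<in> carrier X. y \<preceq>\<^bsub>X\<^esub> x}) x. f y) = f x" if x: "x \<in> carrier X" for x
  proof (rule subset_antisym; rule subsetI)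
    fix z assume "z \<in> (\<Union>y \<in> (\<lambda>x \<in> carrier X. {y \<in> carrier X. y \<preceq>\<^bsub>X\<^esub> x}) x. f y)"
    then obtain y where "y \<in> carrier X" "y \<preceq>\<^bsub>X\<^esub> x" "z \<in> f y" using x by auto
    then show "z \<in> f x" using f(6)[OF _ x, of y] by blast
  next
    fix z assume "z \<in> f x"
    then show "z \<in> (\<Union>y \<in> (\<lambda>x \<in> carrier X. {y \<in> carrier X. y \<preceq>\<^bsub>X\<^esub> x}) x. f y)"
      using x by (intro UN_I[of x]) simp_all
  qed
  then show "Comp (RelOrdMon small) X X Y f (Id (RelOrdMon small) X) = f"
    using f(1) by (intro extensionalityI[of _ "carrier X"]) (simp_all add: RelOrdMon_def)
next
  fix W X Y Z f g h
  assume "f \<in> Hom (RelOrdMon small) W X"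
  then have "f \<in> relational_morphisms W X" by (simp add: RelOrdMon_def)
  note f = relational_morphismsD(3)[OF this]
  show "Comp (RelOrdMon small) W Y Z h (Comp (RelOrdMon small) W X Y g f)
      = Comp (RelOrdMon small) W X Z (Comp (RelOrdMon small) X Y Z h g) f"
    by (rule extensionalityI[of _ "carrier W"]) (auto simp: RelOrdMon_def f)
qed

section \<open>The duality functors\<close>

definition preimage_map :: "'a ord_monoid \<Rightarrow> 'b ord_monoid \<Rightarrow> ('a \<Rightarrow> 'b) \<Rightarrow> 'b set \<Rightarrow> 'a set" where
  "preimage_map M N h = (\<lambda>V \<in> upsets N. {x \<in> carrier M. h x \<in> V})"

text \<open>The inverse image along \<open>\<rho>\<close> as a relation. If \<open>\<rho> x\<close>
  is the set of elements below \<open>h x\<close>, it agrees with \<open>preimage_map M N h\<close>,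
  since \<open>V\<close> is an upset.\<close>

definition relational_preimage_map ::
  "'a ord_monoid \<Rightarrow> 'b ord_monoid \<Rightarrow> ('a \<Rightarrow> 'b set) \<Rightarrow> 'b set \<Rightarrow> 'a set" where
  "relational_preimage_map M N \<rho> = (\<lambda>V \<in> upsets N. {x \<in> carrier M. \<rho> x \<inter> V \<noteq> {}})"

section \<open>Inverse images along relational morphisms\<close>

locale two_ordered_monoids = M: ordered_monoid M + N: ordered_monoid N
  for M :: "'a ord_monoid" and N :: "'b ord_monoid"
begin

text \<open>The clauses correspond: monotony makes inverse images upsets, non-emptiness of the
  values preserves the top, the clause on the units of the monoids gives the unit condition, and
  closure under products gives the residual inequality.\<close>

lemma relational_preimage_map_morphism:
  assumes \<rho>: "\<rho> \<in> relational_morphisms M N"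
  shows "relational_preimage_map M N \<rho> \<in> corelational_residuation_morphisms N.U M.U" (is "?f \<in> _")
proof -
  note r = relational_morphismsD[OF \<rho>]
  have f: "?f V = {x \<in> carrier M. \<rho> x \<inter> V \<noteq> {}}" if "V \<in> upsets N" for V
    using that by (simp add: relational_preimage_map_def)
  have fc: "?f V \<in> upsets M" if "V \<in> upsets N" for V
    unfolding f[OF that] using r(6) by (intro M.upsetsI) auto
  show ?thesis
    unfolding corelational_residuation_morphisms_def upset_residuation_simps
  proof (intro CollectI conjI ballI)
    show "?f \<in> upsets N \<rightarrow>\<^sub>E upsets M" using fc by (auto simp: PiE_iff relational_preimage_map_def)
    show "preserves_joins N.U M.U ?f"
      unfolding preserves_joins_def upset_residuation_simps
    proof (intro allI impI)
      fix \<A> assume \<A>: "\<A> \<subseteq> upsets N"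
      then have i: "?f ` \<A> \<subseteq> upsets M" using fc by blast
      have "?f V = {x \<in> carrier M. \<rho> x \<inter> V \<noteq> {}}" if "V \<in> \<A>" for V
        by (rule f[OF subsetD[OF \<A> that]])
      then show "?f (\<Squnion>\<^bsub>N.U\<^esub> \<A>) = \<Squnion>\<^bsub>M.U\<^esub> (?f ` \<A>)"
        unfolding N.upsets_sup[OF \<A>] M.upsets_sup[OF i] f[OF N.Union_upsets[OF \<A>]] by auto
    qed
    show "?f \<top>\<^bsub>N.U\<^esub> = \<top>\<^bsub>M.U\<^esub>"
      unfolding N.upsets_top M.upsets_top f[OF N.carrier_upset] using r(3,4) by fastforce
    show "residuation_unit M.U \<subseteq> ?f (residuation_unit N.U)"
      unfolding N.upset_residuation_unit M.upset_residuation_unit f[OF N.principal_upset_closed[OF N.one_closed]]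
    proof
      fix x assume "x \<in> principal_upset M \<one>\<^bsub>M\<^esub>"
      then have x: "x \<in> carrier M" "\<one>\<^bsub>M\<^esub> \<preceq>\<^bsub>M\<^esub> x" by (simp_all add: principal_upset_def)
      have "\<one>\<^bsub>N\<^esub> \<in> \<rho> x" by (rule subsetD[OF r(6)[OF M.one_closed x] r(2)])
      moreover have "\<one>\<^bsub>N\<^esub> \<in> principal_upset N \<one>\<^bsub>N\<^esub>" by (simp add: principal_upset_def)
      ultimately show "x \<in> {x \<in> carrier M. \<rho> x \<inter> principal_upset N \<one>\<^bsub>N\<^esub> \<noteq> {}}" using x(1) by blast
    qed
    fix X Z assume X: "X \<in> upsets N" and Z: "Z \<in> upsets N"
    show "?f (X \<rightharpoondown>\<^bsub>N.U\<^esub> Z) \<subseteq> ?f X \<rightharpoondown>\<^bsub>M.U\<^esub> ?f Z"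
    proof
      fix x assume x: "x \<in> ?f (X \<rightharpoondown>\<^bsub>N.U\<^esub> Z)"
      obtain b where b: "x \<in> carrier M" "b \<in> \<rho> x" "b \<in> X \<rightharpoondown>\<^bsub>N.U\<^esub> Z"
        using x f[OF N.upset_residuals_closed(1)[OF X Z]] by auto
      have "a \<otimes>\<^bsub>M\<^esub> x \<in> ?f Z" if a: "a \<in> ?f X" for a
      proof -
        obtain c where c: "a \<in> carrier M" "c \<in> \<rho> a" "c \<in> X" using a f[OF X] by auto
        have "c \<otimes>\<^bsub>N\<^esub> b \<in> Z" using b(3) c(3) upset_residuals(1)[OF X Z] by auto
        moreover have "c \<otimes>\<^bsub>N\<^esub> b \<in> \<rho> (a \<otimes>\<^bsub>M\<^esub> x)" by (rule r(7)[OF c(1) b(1) c(2) b(2)])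
        ultimately show ?thesis using f[OF Z] c(1) b(1) by auto
      qed
      then show "x \<in> ?f X \<rightharpoondown>\<^bsub>M.U\<^esub> ?f Z" using upset_residuals(1)[OF fc[OF X] fc[OF Z]] b(1) by simp
    qed
  qed
qed

text \<open>The values of \<open>\<rho>\<close> are downsets, so \<open>y \<in> \<rho> x\<close>
  exactly if \<open>x\<close> lies in the inverse image of the principal upset of \<open>y\<close>.
  This makes the map injective and dictates its inverse.\<close>

lemma relational_preimage_map_bij:
  "bij_betw (relational_preimage_map M N) (relational_morphisms M N)
     (corelational_residuation_morphisms N.U M.U)"
proof (rule bij_betwI')
  fix \<rho> \<sigma> assume \<rho>: "\<rho> \<in> relational_morphisms M N" and \<sigma>: "\<sigma> \<in> relational_morphisms M N"
  have sub: "y \<in> \<sigma> x"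
    if \<rho>: "\<rho> \<in> relational_morphisms M N" and \<sigma>: "\<sigma> \<in> relational_morphisms M N"
      and eq: "relational_preimage_map M N \<rho> = relational_preimage_map M N \<sigma>"
      and x: "x \<in> carrier M" and y: "y \<in> \<rho> x" for \<rho> \<sigma> :: "'a \<Rightarrow> 'b set" and x y
  proof -
    note r = relational_morphismsD[OF \<rho>] and s = relational_morphismsD[OF \<sigma>]
    have yc: "y \<in> carrier N" by (rule r(3)[OF x y])
    note P = N.principal_upset_closed[OF yc]
    have "x \<in> relational_preimage_map M N \<rho> (principal_upset N y)"
      using P x y yc by (auto simp: relational_preimage_map_def principal_upset_def)
    then have "x \<in> relational_preimage_map M N \<sigma> (principal_upset N y)" by (simp only: eq)
    then obtain z where "z \<in> \<sigma> x" "y \<preceq>\<^bsub>N\<^esub> z"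
      using P by (auto simp: relational_preimage_map_def principal_upset_def)
    then show "y \<in> \<sigma> x" using s(5)[OF x _ yc] by blast
  qed
  show "(relational_preimage_map M N \<rho> = relational_preimage_map M N \<sigma>) = (\<rho> = \<sigma>)"
  proof
    assume eq: "relational_preimage_map M N \<rho> = relational_preimage_map M N \<sigma>"
    show "\<rho> = \<sigma>"
    proof (rule extensionalityI[OF relational_morphismsD(1)[OF \<rho>] relational_morphismsD(1)[OF \<sigma>]])
      fix x assume x: "x \<in> carrier M"
      show "\<rho> x = \<sigma> x" using sub[OF \<rho> \<sigma> eq x] sub[OF \<sigma> \<rho> eq[symmetric] x] by auto
    qed
  qed simp
next
  fix \<rho> assume "\<rho> \<in> relational_morphisms M N"
  then show "relational_preimage_map M N \<rho> \<in> corelational_residuation_morphisms N.U M.U"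
    by (rule relational_preimage_map_morphism)
next
  fix \<sigma> assume \<sigma>: "\<sigma> \<in> corelational_residuation_morphisms N.U M.U"
  have \<sigma>c: "\<sigma> V \<in> upsets M" if "V \<in> upsets N" for V
    using \<sigma> that by (auto simp: corelational_residuation_morphisms_def)
  have \<sigma>j: "\<sigma> (\<Union> \<A>) = \<Union> (\<sigma> ` \<A>)" if \<A>: "\<A> \<subseteq> upsets N" for \<A>
  proof -
    have i: "\<sigma> ` \<A> \<subseteq> upsets M" using \<sigma>c \<A> by blast
    show ?thesis
      using \<sigma> \<A> unfolding corelational_residuation_morphisms_def preserves_joins_def
      by (simp add: N.upsets_sup[OF \<A>, symmetric] M.upsets_sup[OF i, symmetric])
  qed
  have mono: "\<sigma> V \<subseteq> \<sigma> W" if "V \<in> upsets N" "W \<in> upsets N" "V \<subseteq> W" for V W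
  proof -
    have "\<Union> {V, W} = W" using that(3) by blast
    then show ?thesis using \<sigma>j[of "{V, W}"] that(1,2) by auto
  qed
  \<comment> \<open>Preservation of joins reduces \<open>\<sigma>\<close> to its values on principal
    upsets.\<close>
  have mem_iff: "x \<in> \<sigma> V \<longleftrightarrow> (\<exists>y \<in> V. x \<in> \<sigma> (principal_upset N y))" if V: "V \<in> upsets N" for x V
  proof -
    have i: "principal_upset N ` V \<subseteq> upsets N"
      using N.principal_upset_closed N.upsetsD(1)[OF V] by blast
    have "\<sigma> V = \<Union> (\<sigma> ` principal_upset N ` V)"
      using \<sigma>j[OF i] N.upset_eq_Union[OF V] by simp
    then show ?thesis by auto
  qed
  define \<rho> where "\<rho> = (\<lambda>x \<in> carrier M. {y \<in> carrier N. x \<in> \<sigma> (principal_upset N y)})"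
  have \<rho>: "\<rho> \<in> relational_morphisms M N"
  proof (rule relational_morphismsI)
    show "\<rho> \<in> extensional (carrier M)" by (simp add: \<rho>_def)
    show "\<one>\<^bsub>N\<^esub> \<in> \<rho> \<one>\<^bsub>M\<^esub>"
    proof -
      have "principal_upset M \<one>\<^bsub>M\<^esub> \<subseteq> \<sigma> (principal_upset N \<one>\<^bsub>N\<^esub>)"
        using \<sigma> by (simp add: corelational_residuation_morphisms_def
            N.upset_residuation_unit M.upset_residuation_unit)
      then show ?thesis by (auto simp: \<rho>_def principal_upset_def)
    qed
    fix x assume x: "x \<in> carrier M"
    show "\<rho> x \<subseteq> carrier N" using x by (auto simp: \<rho>_def)
    have "\<sigma> (carrier N) = carrier M"
      using \<sigma> by (simp add: corelational_residuation_morphisms_def N.upsets_top M.upsets_top)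
    then show "\<rho> x \<noteq> {}"
      using mem_iff[OF N.carrier_upset, of x] x by (auto simp: \<rho>_def)
    fix y z assume y: "y \<in> \<rho> x" and z: "z \<in> carrier N" "z \<preceq>\<^bsub>N\<^esub> y"
    have yc: "y \<in> carrier N" "x \<in> \<sigma> (principal_upset N y)" using x y by (simp_all add: \<rho>_def)
    have "principal_upset N y \<subseteq> principal_upset N z"
      using N.principal_upset_subset_iff[OF N.principal_upset_closed[OF z(1)] yc(1)] z yc
      by (simp add: principal_upset_def)
    from mono[OF N.principal_upset_closed[OF yc(1)] N.principal_upset_closed[OF z(1)] this]
    show "z \<in> \<rho> x" using yc(2) x z(1) by (auto simp: \<rho>_def)
  next
    fix x y assume xy: "x \<in> carrier M" "y \<in> carrier M" "x \<preceq>\<^bsub>M\<^esub> y"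
    then show "\<rho> x \<subseteq> \<rho> y"
      using M.upsetsD(2)[OF \<sigma>c[OF N.principal_upset_closed], of _ x y] by (auto simp: \<rho>_def)
  next
    fix x y a b assume xy: "x \<in> carrier M" "y \<in> carrier M" and ab: "a \<in> \<rho> x" "b \<in> \<rho> y"
    have c: "a \<in> carrier N" "b \<in> carrier N" "x \<in> \<sigma> (principal_upset N a)" "y \<in> \<sigma> (principal_upset N b)"
      using ab xy by (simp_all add: \<rho>_def)
    have abc: "a \<otimes>\<^bsub>N\<^esub> b \<in> carrier N" using c by simp
    note A = N.principal_upset_closed[OF c(1)] and B = N.principal_upset_closed[OF c(2)]
      and C = N.principal_upset_closed[OF abc]
    note AC = N.upset_residuals_closed(1)[OF A C]
    \<comment> \<open>The upset generated by the product of \<open>a\<close> and \<open>b\<close> is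
      the least one with this membership; applying \<open>\<sigma>\<close> and its residual
      inequality carries the product from \<open>N\<close> over to \<open>M\<close>.\<close>
    have "b \<in> principal_upset N a \<rightharpoondown>\<^bsub>N.U\<^esub> principal_upset N (a \<otimes>\<^bsub>N\<^esub> b)"
      using N.upset_lres_principal_mem_iff[OF c(1,2) C] abc by (simp add: principal_upset_def)
    then have "principal_upset N b \<subseteq> principal_upset N a \<rightharpoondown>\<^bsub>N.U\<^esub> principal_upset N (a \<otimes>\<^bsub>N\<^esub> b)"
      using N.principal_upset_subset_iff[OF AC c(2)] by simp
    from mono[OF B AC this]
    have "y \<in> \<sigma> (principal_upset N a \<rightharpoondown>\<^bsub>N.U\<^esub> principal_upset N (a \<otimes>\<^bsub>N\<^esub> b))" using c(4) by blast
    moreover have "\<sigma> (principal_upset N a \<rightharpoondown>\<^bsub>N.U\<^esub> principal_upset N (a \<otimes>\<^bsub>N\<^esub> b))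
        \<subseteq> \<sigma> (principal_upset N a) \<rightharpoondown>\<^bsub>M.U\<^esub> \<sigma> (principal_upset N (a \<otimes>\<^bsub>N\<^esub> b))"
      using \<sigma> A C by (simp add: corelational_residuation_morphisms_def)
    ultimately have "x \<otimes>\<^bsub>M\<^esub> y \<in> \<sigma> (principal_upset N (a \<otimes>\<^bsub>N\<^esub> b))"
      using upset_residuals(1)[OF \<sigma>c[OF A] \<sigma>c[OF C]] c(3) by auto
    then show "a \<otimes>\<^bsub>N\<^esub> b \<in> \<rho> (x \<otimes>\<^bsub>M\<^esub> y)" using xy abc by (simp add: \<rho>_def)
  qed
  have "\<sigma> = relational_preimage_map M N \<rho>"
  proof (rule extensionalityI[of _ "upsets N"])
    show "\<sigma> \<in> extensional (upsets N)" "relational_preimage_map M N \<rho> \<in> extensional (upsets N)"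
      using \<sigma> by (simp_all add: corelational_residuation_morphisms_def relational_preimage_map_def PiE_iff)
    fix V assume V: "V \<in> upsets N"
    show "\<sigma> V = relational_preimage_map M N \<rho> V"
    proof (rule Set.set_eqI)
      fix x
      show "x \<in> \<sigma> V \<longleftrightarrow> x \<in> relational_preimage_map M N \<rho> V"
        using mem_iff[OF V, of x] V N.upsetsD(1)[OF V] M.upsetsD(1)[OF \<sigma>c[OF V], of x]
        by (auto simp: relational_preimage_map_def \<rho>_def)
    qed
  qed
  then show "\<exists>\<rho> \<in> relational_morphisms M N. \<sigma> = relational_preimage_map M N \<rho>" using \<rho> by blast
qed

end

section \<open>Inverse images along monotone monoid homomorphisms\<close>

context two_ordered_monoids
begin

lemma preimage_map_morphism:
  assumes h: "h \<in> monotone_monoid_homs M N"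
  shows "preimage_map M N h \<in> residuation_morphisms N.U M.U" (is "?f \<in> _")
proof -
  note hD = monotone_monoid_homsD[OF h]
  have hc: "h x \<in> carrier N" if "x \<in> carrier M" for x by (rule funcset_mem[OF hD(1) that])
  have f: "?f V = {x \<in> carrier M. h x \<in> V}" if "V \<in> upsets N" for V
    using that by (simp add: preimage_map_def)
  have fc: "?f V \<in> upsets M" if V: "V \<in> upsets N" for V
    unfolding f[OF V]
  proof (rule M.upsetsI)
    fix x y assume "x \<in> {x \<in> carrier M. h x \<in> V}" "y \<in> carrier M" "x \<preceq>\<^bsub>M\<^esub> y"
    then show "y \<in> {x \<in> carrier M. h x \<in> V}"
      using N.upsetsD(2)[OF V, of "h x" "h y"] hD(5)[of x y] hc by simp
  qed blast
  have joins: "preserves_joins N.U M.U ?f"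
    unfolding preserves_joins_def upset_residuation_simps
  proof (intro allI impI)
    fix \<A> assume \<A>: "\<A> \<subseteq> upsets N"
    then have i: "?f ` \<A> \<subseteq> upsets M" using fc by blast
    have "?f V = {x \<in> carrier M. h x \<in> V}" if "V \<in> \<A>" for V
      by (rule f[OF subsetD[OF \<A> that]])
    then show "?f (\<Squnion>\<^bsub>N.U\<^esub> \<A>) = \<Squnion>\<^bsub>M.U\<^esub> (?f ` \<A>)"
      unfolding N.upsets_sup[OF \<A>] M.upsets_sup[OF i] f[OF N.Union_upsets[OF \<A>]] by auto
  qed
  have meets: "preserves_meets N.U M.U ?f"
    unfolding preserves_meets_def upset_residuation_simps
  proof (intro allI impI)
    fix \<A> assume \<A>: "\<A> \<subseteq> upsets N"
    then have i: "?f ` \<A> \<subseteq> upsets M" using fc by blast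
    have "?f V = {x \<in> carrier M. h x \<in> V}" if "V \<in> \<A>" for V
      by (rule f[OF subsetD[OF \<A> that]])
    then show "?f (\<Sqinter>\<^bsub>N.U\<^esub> \<A>) = \<Sqinter>\<^bsub>M.U\<^esub> (?f ` \<A>)"
      unfolding N.upsets_inf[OF \<A>] M.upsets_inf[OF i] f[OF N.Inter_upsets[OF \<A>]] using hc by auto
  qed
  have acdl: "?f \<in> acdl_morphisms N.U M.U"
    using joins meets fc by (auto simp: acdl_morphisms_def PiE_iff preimage_map_def)
  show ?thesis
    unfolding residuation_morphisms_def upset_residuation_simps
  proof (intro CollectI conjI ballI acdl)
    fix X Z assume X: "X \<in> upsets N" and Z: "Z \<in> upsets N"
    show "?f (X \<rightharpoondown>\<^bsub>N.U\<^esub> Z) \<subseteq> ?f X \<rightharpoondown>\<^bsub>M.U\<^esub> ?f Z"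
      unfolding upset_residuals(1)[OF fc[OF X] fc[OF Z]] f[OF N.upset_residuals_closed(1)[OF X Z]]
      unfolding f[OF X] f[OF Z] upset_residuals(1)[OF X Z]
      using hD(4) by auto
    show "?f (Z \<leftharpoondown>\<^bsub>N.U\<^esub> X) \<subseteq> ?f Z \<leftharpoondown>\<^bsub>M.U\<^esub> ?f X"
      unfolding upset_residuals(2)[OF fc[OF X] fc[OF Z]] f[OF N.upset_residuals_closed(2)[OF X Z]]
      unfolding f[OF X] f[OF Z] upset_residuals(2)[OF X Z]
      using hD(4) by auto
  next
    fix Y Z assume Y: "Y \<in> upsets M" and Z: "Z \<in> upsets N"
    \<comment> \<open>The upset generated by the image of \<open>Y\<close>, that is, the value at
      \<open>Y\<close> of the left adjoint of the inverse image. It is the witness for both (Back)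
      and (Back').\<close>
    let ?W = "{n \<in> carrier N. \<exists>a \<in> Y. h a \<preceq>\<^bsub>N\<^esub> n}"
    have W: "?W \<in> upsets N"
    proof (rule N.upsetsI)
      fix x y assume "x \<in> ?W" and y: "y \<in> carrier N" "x \<preceq>\<^bsub>N\<^esub> y"
      then obtain a where a: "x \<in> carrier N" "a \<in> Y" "h a \<preceq>\<^bsub>N\<^esub> x" by blast
      have "h a \<preceq>\<^bsub>N\<^esub> y" by (rule N.mle_trans[OF a(3) y(2) hc[OF M.upsetsD(1)[OF Y a(2)]] a(1) y(1)])
      then show "y \<in> ?W" using a(2) y(1) by blast
    qed blast
    have hW: "h a \<in> ?W" if "a \<in> Y" for a
      using hc[OF M.upsetsD(1)[OF Y that]] that by (auto intro: bexI[of _ a])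
    then have sub: "Y \<subseteq> ?f ?W" unfolding f[OF W] using M.upsetsD(1)[OF Y] by blast
    \<comment> \<open>Since multiplication is monotone, the generators \<open>h a\<close> of
      \<open>?W\<close> decide, and on these \<open>h\<close> is multiplicative.\<close>
    have "(\<forall>n \<in> ?W. n \<otimes>\<^bsub>N\<^esub> h b \<in> Z) \<longleftrightarrow> (\<forall>a \<in> Y. h (a \<otimes>\<^bsub>M\<^esub> b) \<in> Z)" if b: "b \<in> carrier M" for b
    proof
      assume "\<forall>n \<in> ?W. n \<otimes>\<^bsub>N\<^esub> h b \<in> Z"
      then show "\<forall>a \<in> Y. h (a \<otimes>\<^bsub>M\<^esub> b) \<in> Z" using hW hD(4)[OF M.upsetsD(1)[OF Y] b] by simp
    next
      assume r: "\<forall>a \<in> Y. h (a \<otimes>\<^bsub>M\<^esub> b) \<in> Z"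
      show "\<forall>n \<in> ?W. n \<otimes>\<^bsub>N\<^esub> h b \<in> Z"
      proof
        fix n assume "n \<in> ?W"
        then obtain a where a: "n \<in> carrier N" "a \<in> Y" "h a \<preceq>\<^bsub>N\<^esub> n" by blast
        note ac = M.upsetsD(1)[OF Y a(2)]
        have "h a \<otimes>\<^bsub>N\<^esub> h b \<in> Z" using r a(2) hD(4)[OF ac b] by auto
        moreover have "h a \<otimes>\<^bsub>N\<^esub> h b \<preceq>\<^bsub>N\<^esub> n \<otimes>\<^bsub>N\<^esub> h b"
          using a hc[OF ac] hc[OF b] by (intro N.mult_mono) simp_all
        ultimately show "n \<otimes>\<^bsub>N\<^esub> h b \<in> Z"
          using N.upsetsD(2)[OF Z] a(1) hc[OF b] by simp
      qed
    qed
    then have "Y \<rightharpoondown>\<^bsub>M.U\<^esub> ?f Z = ?f (?W \<rightharpoondown>\<^bsub>N.U\<^esub> Z)"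
      unfolding upset_residuals(1)[OF Y fc[OF Z]] f[OF N.upset_residuals_closed(1)[OF W Z]]
      unfolding f[OF Z] upset_residuals(1)[OF W Z]
      using hc M.upsetsD(1)[OF Y] by auto
    with W sub show "\<exists>X \<in> upsets N. Y \<subseteq> ?f X \<and> Y \<rightharpoondown>\<^bsub>M.U\<^esub> ?f Z = ?f (X \<rightharpoondown>\<^bsub>N.U\<^esub> Z)" by blast
    have "(\<forall>n \<in> ?W. h b \<otimes>\<^bsub>N\<^esub> n \<in> Z) \<longleftrightarrow> (\<forall>a \<in> Y. h (b \<otimes>\<^bsub>M\<^esub> a) \<in> Z)" if b: "b \<in> carrier M" for b
    proof
      assume "\<forall>n \<in> ?W. h b \<otimes>\<^bsub>N\<^esub> n \<in> Z"
      then show "\<forall>a \<in> Y. h (b \<otimes>\<^bsub>M\<^esub> a) \<in> Z" using hW hD(4)[OF b M.upsetsD(1)[OF Y]] by simp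
    next
      assume r: "\<forall>a \<in> Y. h (b \<otimes>\<^bsub>M\<^esub> a) \<in> Z"
      show "\<forall>n \<in> ?W. h b \<otimes>\<^bsub>N\<^esub> n \<in> Z"
      proof
        fix n assume "n \<in> ?W"
        then obtain a where a: "n \<in> carrier N" "a \<in> Y" "h a \<preceq>\<^bsub>N\<^esub> n" by blast
        note ac = M.upsetsD(1)[OF Y a(2)]
        have "h b \<otimes>\<^bsub>N\<^esub> h a \<in> Z" using r a(2) hD(4)[OF b ac] by auto
        moreover have "h b \<otimes>\<^bsub>N\<^esub> h a \<preceq>\<^bsub>N\<^esub> h b \<otimes>\<^bsub>N\<^esub> n"
          using a hc[OF ac] hc[OF b] by (intro N.mult_mono) simp_all
        ultimately show "h b \<otimes>\<^bsub>N\<^esub> n \<in> Z"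
          using N.upsetsD(2)[OF Z] a(1) hc[OF b] by simp
      qed
    qed
    then have "?f Z \<leftharpoondown>\<^bsub>M.U\<^esub> Y = ?f (Z \<leftharpoondown>\<^bsub>N.U\<^esub> ?W)"
      unfolding upset_residuals(2)[OF Y fc[OF Z]] f[OF N.upset_residuals_closed(2)[OF W Z]]
      unfolding f[OF Z] upset_residuals(2)[OF W Z]
      using hc M.upsetsD(1)[OF Y] by auto
    with W sub show "\<exists>X \<in> upsets N. Y \<subseteq> ?f X \<and> ?f Z \<leftharpoondown>\<^bsub>M.U\<^esub> Y = ?f (Z \<leftharpoondown>\<^bsub>N.U\<^esub> X)" by blast
  next
    fix X assume X: "X \<in> upsets N"
    show "residuation_unit N.U \<subseteq> X \<longleftrightarrow> residuation_unit M.U \<subseteq> ?f X"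
      unfolding N.upset_residuation_unit M.upset_residuation_unit
        N.principal_upset_subset_iff[OF X N.one_closed]
        M.principal_upset_subset_iff[OF fc[OF X] M.one_closed]
      unfolding f[OF X] using hD(3) by simp
  qed
qed

text \<open>For fixed \<open>x\<close> the upsets \<open>V\<close> with \<open>x \<in> f V\<close>
  are closed under meets, and if a union is among them then so is one of its members. They are
  therefore the upsets that contain one particular point, the value of the homomorphism at
  \<open>x\<close>.\<close>

lemma preimage_map_bij:
  "bij_betw (preimage_map M N) (monotone_monoid_homs M N) (residuation_morphisms N.U M.U)"
proof (rule bij_betwI')
  fix h k assume h: "h \<in> monotone_monoid_homs M N" and k: "k \<in> monotone_monoid_homs M N"
  have le: "h x \<preceq>\<^bsub>N\<^esub> k x"
    if h: "h \<in> monotone_monoid_homs M N"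
      and eq: "preimage_map M N h = preimage_map M N k" and x: "x \<in> carrier M" for h k :: "'a \<Rightarrow> 'b" and x
  proof -
    have hx: "h x \<in> carrier N" by (rule funcset_mem[OF monotone_monoid_homsD(1)[OF h] x])
    note P = N.principal_upset_closed[OF hx]
    have "x \<in> preimage_map M N h (principal_upset N (h x))"
      using P x hx by (simp add: preimage_map_def principal_upset_def)
    then have "x \<in> preimage_map M N k (principal_upset N (h x))" by (simp only: eq)
    then show ?thesis using P by (simp add: preimage_map_def principal_upset_def)
  qed
  show "(preimage_map M N h = preimage_map M N k) = (h = k)"
  proof
    assume eq: "preimage_map M N h = preimage_map M N k"
    show "h = k"
    proof (rule extensionalityI[OF monotone_monoid_homsD(2)[OF h] monotone_monoid_homsD(2)[OF k]])
      fix x assume x: "x \<in> carrier M"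
      show "h x = k x"
        by (rule N.mle_antisym[OF le[OF h eq x] le[OF k eq[symmetric] x]
              funcset_mem[OF monotone_monoid_homsD(1)[OF h] x] funcset_mem[OF monotone_monoid_homsD(1)[OF k] x]])
    qed
  qed simp
next
  fix h assume "h \<in> monotone_monoid_homs M N"
  then show "preimage_map M N h \<in> residuation_morphisms N.U M.U" by (rule preimage_map_morphism)
next
  fix f assume fm: "f \<in> residuation_morphisms N.U M.U"
  have fa: "f \<in> acdl_morphisms N.U M.U" using fm by (simp add: residuation_morphisms_def)
  have fc: "f V \<in> upsets M" if "V \<in> upsets N" for V
    using fa that by (auto simp: acdl_morphisms_def)
  have fj: "f (\<Union> \<A>) = \<Union> (f ` \<A>)" if \<A>: "\<A> \<subseteq> upsets N" for \<A>
  proof -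
    have i: "f ` \<A> \<subseteq> upsets M" using fc \<A> by blast
    show ?thesis
      using fa \<A> unfolding acdl_morphisms_def preserves_joins_def
      by (simp add: N.upsets_sup[OF \<A>, symmetric] M.upsets_sup[OF i, symmetric])
  qed
  have fi: "f (carrier N \<inter> \<Inter> \<A>) = carrier M \<inter> \<Inter> (f ` \<A>)" if \<A>: "\<A> \<subseteq> upsets N" for \<A>
  proof -
    have i: "f ` \<A> \<subseteq> upsets M" using fc \<A> by blast
    show ?thesis
      using fa \<A> unfolding acdl_morphisms_def preserves_meets_def
      by (simp add: N.upsets_inf[OF \<A>, symmetric] M.upsets_inf[OF i, symmetric])
  qed
  have mono: "f V \<subseteq> f W" if "V \<in> upsets N" "W \<in> upsets N" "V \<subseteq> W" for V W
  proof -
    have "\<Union> {V, W} = W" using that(3) by blast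
    then show ?thesis using fj[of "{V, W}"] that(1,2) by auto
  qed
  have "\<exists>y \<in> carrier N. \<forall>V \<in> upsets N. x \<in> f V \<longleftrightarrow> y \<in> V" if x: "x \<in> carrier M" for x
  proof -
    let ?\<A> = "{V \<in> upsets N. x \<in> f V}"
    \<comment> \<open>The least upset \<open>V\<close> with \<open>x \<in> f V\<close>. As
      \<open>f\<close> preserves joins, it must be the principal upset of one of its elements
      \<open>y\<close>.\<close>
    let ?W = "carrier N \<inter> \<Inter> ?\<A>"
    have A: "?\<A> \<subseteq> upsets N" by blast
    have W: "?W \<in> upsets N" by (rule N.Inter_upsets[OF A])
    have "x \<in> f ?W" unfolding fi[OF A] using x by blast
    moreover have "principal_upset N ` ?W \<subseteq> upsets N" using N.principal_upset_closed by blast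
    ultimately have "x \<in> \<Union> (f ` principal_upset N ` ?W)"
      using fj[of "principal_upset N ` ?W"] N.upset_eq_Union[OF W] by simp
    then obtain y where y: "y \<in> ?W" "x \<in> f (principal_upset N y)" by blast
    have yc: "y \<in> carrier N" using y(1) by blast
    have "x \<in> f V \<longleftrightarrow> y \<in> V" if V: "V \<in> upsets N" for V
    proof
      show "y \<in> V" if "x \<in> f V" using y(1) V that by blast
      assume "y \<in> V"
      then have "principal_upset N y \<subseteq> V" using N.principal_upset_subset_iff[OF V yc] by simp
      then show "x \<in> f V" using mono[OF N.principal_upset_closed[OF yc] V] y(2) by blast
    qed
    then show ?thesis using yc by blast
  qed
  then obtain g where "\<forall>x \<in> carrier M. g x \<in> carrier N \<and> (\<forall>V \<in> upsets N. x \<in> f V \<longleftrightarrow> g x \<in> V)"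
    by metis
  then have gc: "g x \<in> carrier N" and g: "\<And>V. V \<in> upsets N \<Longrightarrow> x \<in> f V \<longleftrightarrow> g x \<in> V"
    if "x \<in> carrier M" for x using that by simp_all
  have refl: "y \<in> principal_upset N y" if "y \<in> carrier N" for y
    using that by (simp add: principal_upset_def)
  have mult: "g (x \<otimes>\<^bsub>M\<^esub> y) = g x \<otimes>\<^bsub>N\<^esub> g y" if x: "x \<in> carrier M" and y: "y \<in> carrier M" for x y
  proof (rule N.mle_antisym)
    have xy: "x \<otimes>\<^bsub>M\<^esub> y \<in> carrier M" using x y by simp
    show gxy: "g (x \<otimes>\<^bsub>M\<^esub> y) \<in> carrier N" "g x \<otimes>\<^bsub>N\<^esub> g y \<in> carrier N"
      using gc[OF xy] gc[OF x] gc[OF y] by simp_all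
    note A = N.principal_upset_closed[OF gc[OF x]] and C = N.principal_upset_closed[OF gxy(2)]
      and Z = N.principal_upset_closed[OF gxy(1)]
    note AC = N.upset_residuals_closed(1)[OF A C]
    \<comment> \<open>(Forth), applied to the upsets generated by \<open>g x\<close> and by the
      product of \<open>g x\<close> and \<open>g y\<close>, puts that product below
      \<open>g (x \<otimes> y)\<close>.\<close>
    have "g y \<in> principal_upset N (g x) \<rightharpoondown>\<^bsub>N.U\<^esub> principal_upset N (g x \<otimes>\<^bsub>N\<^esub> g y)"
      using N.upset_lres_principal_mem_iff[OF gc[OF x] gc[OF y] C] refl[OF gxy(2)] by simp
    then have "y \<in> f (principal_upset N (g x) \<rightharpoondown>\<^bsub>N.U\<^esub> principal_upset N (g x \<otimes>\<^bsub>N\<^esub> g y))"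
      using g[OF y AC] by simp
    moreover have "f (principal_upset N (g x) \<rightharpoondown>\<^bsub>N.U\<^esub> principal_upset N (g x \<otimes>\<^bsub>N\<^esub> g y))
        \<subseteq> f (principal_upset N (g x)) \<rightharpoondown>\<^bsub>M.U\<^esub> f (principal_upset N (g x \<otimes>\<^bsub>N\<^esub> g y))"
      using fm A C by (simp add: residuation_morphisms_def)
    moreover have "x \<in> f (principal_upset N (g x))" using g[OF x A] refl[OF gc[OF x]] by simp
    ultimately have "x \<otimes>\<^bsub>M\<^esub> y \<in> f (principal_upset N (g x \<otimes>\<^bsub>N\<^esub> g y))"
      unfolding upset_residuals(1)[OF fc[OF A] fc[OF C]] by blast
    then show "g x \<otimes>\<^bsub>N\<^esub> g y \<preceq>\<^bsub>N\<^esub> g (x \<otimes>\<^bsub>M\<^esub> y)" using g[OF xy C] by (simp add: principal_upset_def)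
    \<comment> \<open>The reverse inequality comes from (Back): it turns a residual in
      \<open>M\<close> into the inverse image of a residual in \<open>N\<close>, where
      \<open>g y\<close> can be multiplied by \<open>g x \<in> X\<close>.\<close>
    have "\<exists>X \<in> upsets N. principal_upset M x \<subseteq> f X \<and>
        principal_upset M x \<rightharpoondown>\<^bsub>M.U\<^esub> f (principal_upset N (g (x \<otimes>\<^bsub>M\<^esub> y)))
          = f (X \<rightharpoondown>\<^bsub>N.U\<^esub> principal_upset N (g (x \<otimes>\<^bsub>M\<^esub> y)))"
      using fm Z M.principal_upset_closed[OF x] by (simp add: residuation_morphisms_def)
    then obtain X where X: "X \<in> upsets N" "principal_upset M x \<subseteq> f X"
      "principal_upset M x \<rightharpoondown>\<^bsub>M.U\<^esub> f (principal_upset N (g (x \<otimes>\<^bsub>M\<^esub> y)))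
          = f (X \<rightharpoondown>\<^bsub>N.U\<^esub> principal_upset N (g (x \<otimes>\<^bsub>M\<^esub> y)))" by blast
    have "x \<otimes>\<^bsub>M\<^esub> y \<in> f (principal_upset N (g (x \<otimes>\<^bsub>M\<^esub> y)))" using g[OF xy Z] refl[OF gxy(1)] by simp
    then have "y \<in> f (X \<rightharpoondown>\<^bsub>N.U\<^esub> principal_upset N (g (x \<otimes>\<^bsub>M\<^esub> y)))"
      using M.upset_lres_principal_mem_iff[OF x y fc[OF Z]] X(3) by simp
    then have "g y \<in> X \<rightharpoondown>\<^bsub>N.U\<^esub> principal_upset N (g (x \<otimes>\<^bsub>M\<^esub> y))"
      using g[OF y N.upset_residuals_closed(1)[OF X(1) Z]] by simp
    moreover have "g x \<in> X"
      using M.principal_upset_subset_iff[OF fc[OF X(1)] x] X(2) g[OF x X(1)] by simp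
    ultimately have "g x \<otimes>\<^bsub>N\<^esub> g y \<in> principal_upset N (g (x \<otimes>\<^bsub>M\<^esub> y))"
      unfolding upset_residuals(1)[OF X(1) Z] by blast
    then show "g (x \<otimes>\<^bsub>M\<^esub> y) \<preceq>\<^bsub>N\<^esub> g x \<otimes>\<^bsub>N\<^esub> g y" by (simp add: principal_upset_def)
  qed
  have one: "g \<one>\<^bsub>M\<^esub> = \<one>\<^bsub>N\<^esub>"
  proof -
    \<comment> \<open>The residuation units are the principal upsets of the monoid units, so (Unit)
      says that the unit of \<open>N\<close> and the image of the unit of \<open>M\<close> lie in
      the same upsets.\<close>
    have iff: "\<one>\<^bsub>N\<^esub> \<in> V \<longleftrightarrow> g \<one>\<^bsub>M\<^esub> \<in> V" if V: "V \<in> upsets N" for V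
    proof -
      have "residuation_unit N.U \<subseteq> V \<longleftrightarrow> residuation_unit M.U \<subseteq> f V"
        using fm V by (simp add: residuation_morphisms_def)
      then show ?thesis
        unfolding N.upset_residuation_unit M.upset_residuation_unit
          N.principal_upset_subset_iff[OF V N.one_closed]
          M.principal_upset_subset_iff[OF fc[OF V] M.one_closed] g[OF M.one_closed V] .
    qed
    note g1 = gc[OF M.one_closed]
    show ?thesis
      using iff[OF N.principal_upset_closed[OF N.one_closed]] iff[OF N.principal_upset_closed[OF g1]]
        refl[OF N.one_closed] refl[OF g1] g1
      by (intro N.mle_antisym) (simp_all add: principal_upset_def)
  qed
  have gmono: "g x \<preceq>\<^bsub>N\<^esub> g y" if xy: "x \<in> carrier M" "y \<in> carrier M" "x \<preceq>\<^bsub>M\<^esub> y" for x y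
  proof -
    note A = N.principal_upset_closed[OF gc[OF xy(1)]]
    have "x \<in> f (principal_upset N (g x))" using g[OF xy(1) A] refl[OF gc[OF xy(1)]] by simp
    then have "y \<in> f (principal_upset N (g x))" by (rule M.upsetsD(2)[OF fc[OF A] _ xy(3,2)])
    then show ?thesis using g[OF xy(2) A] by (simp add: principal_upset_def)
  qed
  let ?h = "restrict g (carrier M)"
  have "?h \<in> monotone_monoid_homs M N"
    using gc mult one gmono by (intro monotone_monoid_homsI) auto
  moreover have "f = preimage_map M N ?h"
  proof (rule extensionalityI[of _ "upsets N"])
    show "f \<in> extensional (upsets N)" "preimage_map M N ?h \<in> extensional (upsets N)"
      using fa by (simp_all add: acdl_morphisms_def preimage_map_def PiE_iff)
    fix V assume V: "V \<in> upsets N"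
    have "x \<in> f V \<longleftrightarrow> x \<in> carrier M \<and> g x \<in> V" for x
      using g[OF _ V, of x] M.upsetsD(1)[OF fc[OF V], of x] by blast
    then show "f V = preimage_map M N ?h V"
      using V by (auto simp: preimage_map_def)
  qed
  ultimately show "\<exists>h \<in> monotone_monoid_homs M N. f = preimage_map M N h" by blast
qed

end

section \<open>The ordered monoid of completely join-primes\<close>

text \<open>The order and the left residual determine the remaining structure: the right residual by
  residuation, the unit by its uniqueness. In (Back) the preimage of \<open>y\<close> under the
  bijection is the witness.\<close>

lemma order_iso_residuation_morphism:
  assumes R: "derivation_acdl R" and S: "derivation_acdl S"
    and f: "f \<in> carrier R \<rightarrow>\<^sub>E carrier S" "bij_betw f (carrier R) (carrier S)"
    and le: "\<And>x y. \<lbrakk>x \<in> carrier R; y \<in> carrier R\<rbrakk> \<Longrightarrow> f x \<sqsubseteq>\<^bsub>S\<^esub> f y \<longleftrightarrow> x \<sqsubseteq>\<^bsub>R\<^esub> y"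
    and lres: "\<And>x z. \<lbrakk>x \<in> carrier R; z \<in> carrier R\<rbrakk> \<Longrightarrow> f (x \<rightharpoondown>\<^bsub>R\<^esub> z) = f x \<rightharpoondown>\<^bsub>S\<^esub> f z"
  shows "f \<in> residuation_morphisms R S"
proof -
  interpret R: derivation_acdl R by (rule R)
  interpret S: derivation_acdl S by (rule S)
  have fc: "f x \<in> carrier S" if "x \<in> carrier R" for x using f(1) that by auto
  have surj: "\<exists>x \<in> carrier R. y = f x" if "y \<in> carrier S" for y
    using bij_betw_imp_surj_on[OF f(2)] that by blast
  have img: "f ` A \<subseteq> carrier S" if "A \<subseteq> carrier R" for A using fc that by blast
  have joins: "f (\<Squnion>\<^bsub>R\<^esub> A) = \<Squnion>\<^bsub>S\<^esub> (f ` A)" if A: "A \<subseteq> carrier R" for A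
  proof -
    \<comment> \<open>By surjectivity the join in \<open>S\<close> is some \<open>f u\<close>; it is
      compared with \<open>f (\<Squnion> A)\<close> through their upper bounds, which are all of the
      form \<open>f v\<close>.\<close>
    obtain u where u: "u \<in> carrier R" "\<Squnion>\<^bsub>S\<^esub> (f ` A) = f u" using surj[OF S.sup_closed[OF img[OF A]]] by blast
    have "f (\<Squnion>\<^bsub>R\<^esub> A) \<sqsubseteq>\<^bsub>S\<^esub> f v \<longleftrightarrow> f u \<sqsubseteq>\<^bsub>S\<^esub> f v" if v: "v \<in> carrier R" for v
    proof -
      have "(\<forall>a \<in> A. f a \<sqsubseteq>\<^bsub>S\<^esub> f v) \<longleftrightarrow> (\<forall>a \<in> A. a \<sqsubseteq>\<^bsub>R\<^esub> v)"
        by (intro ball_cong HOL.refl le[OF subsetD[OF A] v])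
      then show ?thesis
        using S.sup_le_iff[OF img[OF A] fc[OF v]] R.sup_le_iff[OF A v] le[OF R.sup_closed[OF A] v] u(2)
        by simp
    qed
    from this[OF u(1)] this[OF R.sup_closed[OF A]] show ?thesis
      unfolding u(2) using fc[OF u(1)] fc[OF R.sup_closed[OF A]] by (intro S.le_antisym) simp_all
  qed
  have meets: "f (\<Sqinter>\<^bsub>R\<^esub> A) = \<Sqinter>\<^bsub>S\<^esub> (f ` A)" if A: "A \<subseteq> carrier R" for A
  proof (rule S.eq_lowerI[OF fc[OF R.inf_closed[OF A]] S.inf_closed[OF img[OF A]]])
    fix y assume "y \<in> carrier S"
    then obtain v where v: "v \<in> carrier R" "y = f v" using surj by blast
    have "(\<forall>a \<in> A. f v \<sqsubseteq>\<^bsub>S\<^esub> f a) \<longleftrightarrow> (\<forall>a \<in> A. v \<sqsubseteq>\<^bsub>R\<^esub> a)"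
      by (intro ball_cong HOL.refl le[OF v(1) subsetD[OF A]])
    then show "y \<sqsubseteq>\<^bsub>S\<^esub> f (\<Sqinter>\<^bsub>R\<^esub> A) \<longleftrightarrow> y \<sqsubseteq>\<^bsub>S\<^esub> \<Sqinter>\<^bsub>S\<^esub> (f ` A)"
      using S.le_inf_iff[OF img[OF A] fc[OF v(1)]] R.le_inf_iff[OF A v(1)] le[OF v(1) R.inf_closed[OF A]] v(2)
      by simp
  qed
  have acdl: "f \<in> acdl_morphisms R S"
    using f(1) joins meets by (simp add: acdl_morphisms_def preserves_joins_def preserves_meets_def)
  have rres: "f (z \<leftharpoondown>\<^bsub>R\<^esub> x) = f z \<leftharpoondown>\<^bsub>S\<^esub> f x" if x: "x \<in> carrier R" and z: "z \<in> carrier R" for x z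
  proof (rule S.eq_lowerI)
    fix y assume "y \<in> carrier S"
    then obtain v where v: "v \<in> carrier R" "y = f v" using surj by blast
    have "f v \<sqsubseteq>\<^bsub>S\<^esub> f (z \<leftharpoondown>\<^bsub>R\<^esub> x) \<longleftrightarrow> x \<sqsubseteq>\<^bsub>R\<^esub> v \<rightharpoondown>\<^bsub>R\<^esub> z"
      using le[OF v(1) R.rres_in_carrier[OF x z]] R.residuation[OF v(1) x z] by simp
    also have "\<dots> \<longleftrightarrow> f x \<sqsubseteq>\<^bsub>S\<^esub> f v \<rightharpoondown>\<^bsub>S\<^esub> f z"
      using le[OF x R.lres_in_carrier[OF v(1) z]] lres[OF v(1) z] by simp
    also have "\<dots> \<longleftrightarrow> f v \<sqsubseteq>\<^bsub>S\<^esub> f z \<leftharpoondown>\<^bsub>S\<^esub> f x"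
      by (rule S.residuation[OF fc[OF v(1)] fc[OF x] fc[OF z]])
    finally show "y \<sqsubseteq>\<^bsub>S\<^esub> f (z \<leftharpoondown>\<^bsub>R\<^esub> x) \<longleftrightarrow> y \<sqsubseteq>\<^bsub>S\<^esub> f z \<leftharpoondown>\<^bsub>S\<^esub> f x" by (simp add: v(2))
  qed (use x z fc in simp_all)
  let ?e = "residuation_unit R"
  have prime: "f ?e \<in> completely_join_primes S"
    unfolding completely_join_primes_def
  proof (intro CollectI conjI allI impI)
    show "f ?e \<in> carrier S" by (rule fc[OF R.unit_closed])
    fix B assume B: "B \<subseteq> carrier S \<and> f ?e \<sqsubseteq>\<^bsub>S\<^esub> \<Squnion>\<^bsub>S\<^esub> B"
    let ?A = "{x \<in> carrier R. f x \<in> B}"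
    have A: "?A \<subseteq> carrier R" by blast
    have "f ` ?A = B" using surj B by blast
    then have "?e \<sqsubseteq>\<^bsub>R\<^esub> \<Squnion>\<^bsub>R\<^esub> ?A"
      using joins[OF A] B le[OF R.unit_closed R.sup_closed[OF A]] by simp
    then obtain a where "a \<in> ?A" "?e \<sqsubseteq>\<^bsub>R\<^esub> a" using R.prime_le_sup_iff[OF R.unit_prime A] by blast
    then show "\<exists>b \<in> B. f ?e \<sqsubseteq>\<^bsub>S\<^esub> b" using le[OF R.unit_closed] by blast
  qed
  have unit_eq: "f ?e \<rightharpoondown>\<^bsub>S\<^esub> z = z" "z \<leftharpoondown>\<^bsub>S\<^esub> f ?e = z" if "z \<in> carrier S" for z
  proof -
    obtain v where v: "v \<in> carrier R" "z = f v" using surj[OF \<open>z \<in> carrier S\<close>] by blast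
    show "f ?e \<rightharpoondown>\<^bsub>S\<^esub> z = z" "z \<leftharpoondown>\<^bsub>S\<^esub> f ?e = z"
      using lres[OF R.unit_closed v(1)] rres[OF R.unit_closed v(1)] R.unit_left[OF v(1)] R.unit_right[OF v(1)]
      by (simp_all add: v(2))
  qed
  have "is_residuation_unit S (f ?e)"
    using prime unit_eq by (simp add: is_residuation_unit_def)
  then have unit: "residuation_unit S = f ?e" by (rule S.residuation_unit_eq)
  show ?thesis
    unfolding residuation_morphisms_def
  proof (intro CollectI conjI ballI acdl)
    fix x z assume x: "x \<in> carrier R" and z: "z \<in> carrier R"
    show "f (x \<rightharpoondown>\<^bsub>R\<^esub> z) \<sqsubseteq>\<^bsub>S\<^esub> f x \<rightharpoondown>\<^bsub>S\<^esub> f z" "f (z \<leftharpoondown>\<^bsub>R\<^esub> x) \<sqsubseteq>\<^bsub>S\<^esub> f z \<leftharpoondown>\<^bsub>S\<^esub> f x"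
      using lres[OF x z] rres[OF x z] fc x z by simp_all
  next
    fix y z assume y: "y \<in> carrier S" and z: "z \<in> carrier R"
    obtain v where v: "v \<in> carrier R" "y = f v" using surj[OF y] by blast
    show "\<exists>x \<in> carrier R. y \<sqsubseteq>\<^bsub>S\<^esub> f x \<and> y \<rightharpoondown>\<^bsub>S\<^esub> f z = f (x \<rightharpoondown>\<^bsub>R\<^esub> z)"
      "\<exists>x \<in> carrier R. y \<sqsubseteq>\<^bsub>S\<^esub> f x \<and> f z \<leftharpoondown>\<^bsub>S\<^esub> y = f (z \<leftharpoondown>\<^bsub>R\<^esub> x)"
      using v y lres[OF v(1) z] rres[OF v(1) z] by (auto intro!: bexI[of _ v])
  next
    fix x assume "x \<in> carrier R"
    then show "?e \<sqsubseteq>\<^bsub>R\<^esub> x \<longleftrightarrow> residuation_unit S \<sqsubseteq>\<^bsub>S\<^esub> f x" by (simp add: unit le R.unit_closed)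
  qed
qed

text \<open>The inverse of such a bijection satisfies the same hypotheses, so both directions are
  morphisms. The isomorphism is stated from \<open>S\<close> to \<open>R\<close>, the direction in
  which essential surjectivity asks for it.\<close>

lemma order_iso_iso_arrow:
  assumes R: "R \<in> Ob (DerACDL small)" and S: "S \<in> Ob (DerACDL small)"
    and f: "f \<in> carrier R \<rightarrow>\<^sub>E carrier S" "bij_betw f (carrier R) (carrier S)"
    and le: "\<And>x y. \<lbrakk>x \<in> carrier R; y \<in> carrier R\<rbrakk> \<Longrightarrow> f x \<sqsubseteq>\<^bsub>S\<^esub> f y \<longleftrightarrow> x \<sqsubseteq>\<^bsub>R\<^esub> y"
    and lres: "\<And>x z. \<lbrakk>x \<in> carrier R; z \<in> carrier R\<rbrakk> \<Longrightarrow> f (x \<rightharpoondown>\<^bsub>R\<^esub> z) = f x \<rightharpoondown>\<^bsub>S\<^esub> f z"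
  shows "\<exists>g. iso_arrow (DerACDL small) S R g"
proof -
  interpret R: derivation_acdl R using R by (simp add: DerACDL_def)
  interpret S: derivation_acdl S using S by (simp add: DerACDL_def)
  note RS = R.derivation_acdl_axioms S.derivation_acdl_axioms
  let ?g = "restrict (inv_into (carrier R) f) (carrier S)"
  have gc: "?g y \<in> carrier R" and fg: "f (?g y) = y" if "y \<in> carrier S" for y
    using that bij_betw_imp_surj_on[OF f(2)] by (simp_all add: inv_into_into f_inv_into_f)
  have gf: "?g (f x) = x" if "x \<in> carrier R" for x
    using that f(1) bij_betw_imp_inj_on[OF f(2)] by auto
  have fm: "f \<in> residuation_morphisms R S" by (rule order_iso_residuation_morphism[OF RS f le lres])
  have gm: "?g \<in> residuation_morphisms S R"
  proof (rule order_iso_residuation_morphism[OF RS(2,1)])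
    show "?g \<in> carrier S \<rightarrow>\<^sub>E carrier R" using gc by auto
    show "bij_betw ?g (carrier S) (carrier R)"
      using bij_betw_inv_into[OF f(2)] by (simp cong: bij_betw_cong)
    fix x y assume xy: "x \<in> carrier S" "y \<in> carrier S"
    show "?g x \<sqsubseteq>\<^bsub>R\<^esub> ?g y \<longleftrightarrow> x \<sqsubseteq>\<^bsub>S\<^esub> y"
      using le[OF gc[OF xy(1)] gc[OF xy(2)]] unfolding fg[OF xy(1)] fg[OF xy(2)] by (rule sym)
    have "f (?g x \<rightharpoondown>\<^bsub>R\<^esub> ?g y) = x \<rightharpoondown>\<^bsub>S\<^esub> y"
      using lres[OF gc[OF xy(1)] gc[OF xy(2)]] unfolding fg[OF xy(1)] fg[OF xy(2)] .
    then show "?g (x \<rightharpoondown>\<^bsub>S\<^esub> y) = ?g x \<rightharpoondown>\<^bsub>R\<^esub> ?g y"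
      using gf[OF R.lres_in_carrier[OF gc[OF xy(1)] gc[OF xy(2)]]] by metis
  qed
  have "compose (carrier S) f ?g = (\<lambda>x \<in> carrier S. x)"
    unfolding compose_def by (intro restrict_ext fg)
  moreover have "compose (carrier R) ?g f = (\<lambda>x \<in> carrier R. x)"
    unfolding compose_def by (intro restrict_ext gf)
  ultimately have "iso_arrow (DerACDL small) S R ?g"
    using fm gm unfolding iso_arrow_def by (auto simp: DerACDL_def)
  then show ?thesis by blast
qed

section \<open>Reconstruction of the monoid from the primes\<close>

context derivation_acdl
begin

definition residual_product :: "'a \<Rightarrow> 'a \<Rightarrow> 'a" where
  "residual_product p q = \<Sqinter> {c \<in> carrier R. q \<sqsubseteq> p \<rightharpoondown> c}"

lemma residual_product_closed: "residual_product p q \<in> carrier R"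
  unfolding residual_product_def by (rule inf_closed) blast

text \<open>The map \<open>\<lambda>z. p \<rightharpoondown> z\<close> preserves meets, so the meet
  that defines the product still satisfies the defining condition. Multiplication by
  \<open>p\<close> is the left adjoint of this map.\<close>

lemma residual_product_le_iff:
  assumes p: "p \<in> carrier R" and q: "q \<in> carrier R" and c: "c \<in> carrier R"
  shows "residual_product p q \<sqsubseteq> c \<longleftrightarrow> q \<sqsubseteq> p \<rightharpoondown> c"
proof
  let ?A = "{c \<in> carrier R. q \<sqsubseteq> p \<rightharpoondown> c}"
  have A: "?A \<subseteq> carrier R" by blast
  show "residual_product p q \<sqsubseteq> c" if "q \<sqsubseteq> p \<rightharpoondown> c"
    unfolding residual_product_def using that c by (intro inf_lower[OF A]) simp
  have i: "(\<lambda>z. p \<rightharpoondown> z) ` ?A \<subseteq> carrier R" using p by auto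
  have eq: "p \<rightharpoondown> residual_product p q = \<Sqinter> ((\<lambda>z. p \<rightharpoondown> z) ` ?A)"
    unfolding residual_product_def by (rule lres_meets[OF p, unfolded preserves_meets_def, rule_format, OF A])
  have "q \<sqsubseteq> p \<rightharpoondown> residual_product p q" unfolding eq by (rule inf_greatest[OF i q]) blast
  then show "q \<sqsubseteq> p \<rightharpoondown> c" if "residual_product p q \<sqsubseteq> c"
    using lres_mono[of p p "residual_product p q" c q q] that p q c residual_product_closed by simp
qed

text \<open>Purity moves the residual by \<open>p\<close> inside the join, and the prime
  \<open>q\<close> then selects a term.\<close>

lemma residual_product_prime:
  assumes p: "p \<in> completely_join_primes R" and q: "q \<in> completely_join_primes R"
  shows "residual_product p q \<in> completely_join_primes R"
  unfolding completely_join_primes_def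
proof (intro CollectI conjI allI impI residual_product_closed)
  note pc = completely_join_primes_closed[OF p] and qc = completely_join_primes_closed[OF q]
  fix A assume "A \<subseteq> carrier R \<and> residual_product p q \<sqsubseteq> \<Squnion> A"
  then have A: "A \<subseteq> carrier R" and le: "residual_product p q \<sqsubseteq> \<Squnion> A" by simp_all
  have i: "(\<lambda>z. p \<rightharpoondown> z) ` A \<subseteq> carrier R" using A pc by auto
  have "q \<sqsubseteq> p \<rightharpoondown> \<Squnion> A" using residual_product_le_iff[OF pc qc sup_closed[OF A]] le by simp
  then have "q \<sqsubseteq> \<Squnion> ((\<lambda>z. p \<rightharpoondown> z) ` A)"
    using pure_left[OF p] A by (simp add: preserves_joins_def)
  then obtain a where a: "a \<in> A" "q \<sqsubseteq> p \<rightharpoondown> a" using prime_le_sup_iff[OF q i] by auto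
  then have "residual_product p q \<sqsubseteq> a" using residual_product_le_iff[OF pc qc subsetD[OF A a(1)]] by simp
  with a(1) show "\<exists>a \<in> A. residual_product p q \<sqsubseteq> a" by (rule rev_bexI)
qed

lemma eq_upperI:
  assumes "x \<in> carrier R" "y \<in> carrier R" "\<And>z. z \<in> carrier R \<Longrightarrow> x \<sqsubseteq> z \<longleftrightarrow> y \<sqsubseteq> z"
  shows "x = y"
  using assms(3)[OF assms(1)] assms(3)[OF assms(2)] assms(1,2) by (intro le_antisym) simp_all

text \<open>Two elements with the same upper bounds are equal. The condition of lying below
  \<open>d\<close> is moved through the adjunctions until the two bracketings differ exactly by the
  associativity of the residuals.\<close>

lemma residual_product_assoc:
  assumes c: "x \<in> carrier R" "y \<in> carrier R" "z \<in> carrier R"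
  shows "residual_product (residual_product x y) z = residual_product x (residual_product y z)"
proof (rule eq_upperI[OF residual_product_closed residual_product_closed])
  fix d assume d: "d \<in> carrier R"
  note p = residual_product_closed
  have "residual_product (residual_product x y) z \<sqsubseteq> d \<longleftrightarrow> z \<sqsubseteq> residual_product x y \<rightharpoondown> d"
    by (rule residual_product_le_iff[OF p c(3) d])
  also have "\<dots> \<longleftrightarrow> residual_product x y \<sqsubseteq> d \<leftharpoondown> z"
    by (rule residuation[OF p c(3) d])
  also have "\<dots> \<longleftrightarrow> y \<sqsubseteq> x \<rightharpoondown> (d \<leftharpoondown> z)"
    by (rule residual_product_le_iff[OF c(1,2) rres_in_carrier[OF c(3) d]])
  also have "\<dots> \<longleftrightarrow> y \<sqsubseteq> (x \<rightharpoondown> d) \<leftharpoondown> z"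
    by (simp only: associative[OF c(1,3) d])
  also have "\<dots> \<longleftrightarrow> z \<sqsubseteq> y \<rightharpoondown> (x \<rightharpoondown> d)"
    by (rule residuation[OF c(2,3) lres_in_carrier[OF c(1) d], symmetric])
  also have "\<dots> \<longleftrightarrow> residual_product y z \<sqsubseteq> x \<rightharpoondown> d"
    by (rule residual_product_le_iff[OF c(2,3) lres_in_carrier[OF c(1) d], symmetric])
  also have "\<dots> \<longleftrightarrow> residual_product x (residual_product y z) \<sqsubseteq> d"
    by (rule residual_product_le_iff[OF c(1) p d, symmetric])
  finally show "residual_product (residual_product x y) z \<sqsubseteq> d
      \<longleftrightarrow> residual_product x (residual_product y z) \<sqsubseteq> d" .
qed

lemma residual_product_unit:
  assumes x: "x \<in> carrier R"
  shows "residual_product (residuation_unit R) x = x" "residual_product x (residuation_unit R) = x"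
proof -
  note e = unit_closed
  show "residual_product (residuation_unit R) x = x"
    by (rule eq_upperI[OF residual_product_closed x]) (simp add: residual_product_le_iff[OF e x] unit_left)
  show "residual_product x (residuation_unit R) = x"
    by (rule eq_upperI[OF residual_product_closed x])
      (simp add: residual_product_le_iff[OF x e] residuation[OF x e] unit_right)
qed

lemma residual_product_mono:
  assumes "x \<in> carrier R" "x' \<in> carrier R" "y \<in> carrier R" "y' \<in> carrier R" "x \<sqsubseteq> x'" "y \<sqsubseteq> y'"
  shows "residual_product x y \<sqsubseteq> residual_product x' y'"
proof -
  let ?c = "residual_product x' y'"
  have "y' \<sqsubseteq> x' \<rightharpoondown> ?c"
    using residual_product_le_iff[OF assms(2,4) residual_product_closed, of x' y'] residual_product_closed by simp
  then have "y \<sqsubseteq> x \<rightharpoondown> ?c"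
    using lres_mono[of x x' ?c ?c y' y] assms residual_product_closed by simp
  then show ?thesis using residual_product_le_iff[OF assms(1,3) residual_product_closed] by simp
qed

text \<open>The order is reversed because \<open>x \<mapsto> principal_upset M x\<close> reverses it.\<close>

definition prime_monoid :: "'b set \<Rightarrow> ('b \<Rightarrow> 'a) \<Rightarrow> 'b ord_monoid" where
  "prime_monoid A \<phi> =
     \<lparr>carrier = A,
      mult = (\<lambda>a b. inv_into A \<phi> (residual_product (\<phi> a) (\<phi> b))),
      one = inv_into A \<phi> (residuation_unit R),
      mle = (\<lambda>a b. \<phi> b \<sqsubseteq> \<phi> a)\<rparr>"

context
  fixes A :: "'b set" and \<phi> :: "'b \<Rightarrow> 'a"
  assumes \<phi>: "bij_betw \<phi> A (completely_join_primes R)"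
begin

lemma \<phi>_prime: "a \<in> A \<Longrightarrow> \<phi> a \<in> completely_join_primes R"
  using \<phi> by (rule bij_betwE[THEN bspec])

lemma \<phi>_closed: "a \<in> A \<Longrightarrow> \<phi> a \<in> carrier R"
  by (rule completely_join_primes_closed[OF \<phi>_prime])

lemma \<phi>_inv:
  assumes "p \<in> completely_join_primes R" shows "\<phi> (inv_into A \<phi> p) = p" "inv_into A \<phi> p \<in> A"
  using assms bij_betw_imp_surj_on[OF \<phi>] by (auto simp: f_inv_into_f inv_into_into)

lemma \<phi>_eqI: "\<lbrakk>a \<in> A; b \<in> A; \<phi> a = \<phi> b\<rbrakk> \<Longrightarrow> a = b"
  using inj_onD[OF bij_betw_imp_inj_on[OF \<phi>]] by blast

lemma prime_monoid_simps:
  "carrier (prime_monoid A \<phi>) = A"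
  "a \<preceq>\<^bsub>prime_monoid A \<phi>\<^esub> b \<longleftrightarrow> \<phi> b \<sqsubseteq> \<phi> a"
  "\<lbrakk>a \<in> A; b \<in> A\<rbrakk> \<Longrightarrow> a \<otimes>\<^bsub>prime_monoid A \<phi>\<^esub> b \<in> A"
  "\<lbrakk>a \<in> A; b \<in> A\<rbrakk> \<Longrightarrow> \<phi> (a \<otimes>\<^bsub>prime_monoid A \<phi>\<^esub> b) = residual_product (\<phi> a) (\<phi> b)"
  "\<one>\<^bsub>prime_monoid A \<phi>\<^esub> \<in> A" "\<phi> \<one>\<^bsub>prime_monoid A \<phi>\<^esub> = residuation_unit R"
  using \<phi>_inv[OF residual_product_prime[OF \<phi>_prime \<phi>_prime]] \<phi>_inv[OF unit_prime]
  by (simp_all add: prime_monoid_def)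

lemma prime_monoid_ordered_monoid: "ordered_monoid (prime_monoid A \<phi>)"
proof -
  note s = prime_monoid_simps
  have "monoid (prime_monoid A \<phi>)"
  proof
    fix x y z assume "x \<in> carrier (prime_monoid A \<phi>)" "y \<in> carrier (prime_monoid A \<phi>)" "z \<in> carrier (prime_monoid A \<phi>)"
    then have xyz: "x \<in> A" "y \<in> A" "z \<in> A" by (simp_all add: s(1))
    show "x \<otimes>\<^bsub>prime_monoid A \<phi>\<^esub> y \<otimes>\<^bsub>prime_monoid A \<phi>\<^esub> z
        = x \<otimes>\<^bsub>prime_monoid A \<phi>\<^esub> (y \<otimes>\<^bsub>prime_monoid A \<phi>\<^esub> z)"
      using xyz by (intro \<phi>_eqI) (simp_all add: s(3,4) residual_product_assoc \<phi>_closed)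
  next
    fix x assume "x \<in> carrier (prime_monoid A \<phi>)"
    then have x: "x \<in> A" by (simp add: s(1))
    show "\<one>\<^bsub>prime_monoid A \<phi>\<^esub> \<otimes>\<^bsub>prime_monoid A \<phi>\<^esub> x = x" "x \<otimes>\<^bsub>prime_monoid A \<phi>\<^esub> \<one>\<^bsub>prime_monoid A \<phi>\<^esub> = x"
      using x by (auto intro!: \<phi>_eqI simp: s(3-6) residual_product_unit \<phi>_closed)
  qed (simp_all add: s(1,3,5))
  moreover have "partial_order \<lparr>carrier = carrier (prime_monoid A \<phi>), eq = (=), le = mle (prime_monoid A \<phi>)\<rparr>"
  proof (unfold_locales, goal_cases)
    case (5 x y)
    then have "x \<in> A" "y \<in> A" "\<phi> y \<sqsubseteq> \<phi> x" "\<phi> x \<sqsubseteq> \<phi> y" by (simp_all add: s(1,2))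
    then show ?case using \<phi>_eqI[of x y] le_antisym[of "\<phi> x" "\<phi> y"] \<phi>_closed by simp
  next
    case (6 x y z)
    then have "x \<in> A" "y \<in> A" "z \<in> A" "\<phi> y \<sqsubseteq> \<phi> x" "\<phi> z \<sqsubseteq> \<phi> y" by (simp_all add: s(1,2))
    then show ?case using le_trans[of "\<phi> z" "\<phi> y" "\<phi> x"] \<phi>_closed by (simp add: s(2))
  qed (simp_all add: s(1,2) \<phi>_closed)
  moreover have "x \<otimes>\<^bsub>prime_monoid A \<phi>\<^esub> y \<preceq>\<^bsub>prime_monoid A \<phi>\<^esub> x' \<otimes>\<^bsub>prime_monoid A \<phi>\<^esub> y'"
    if "x \<in> A" "x' \<in> A" "y \<in> A" "y' \<in> A" "\<phi> x' \<sqsubseteq> \<phi> x" "\<phi> y' \<sqsubseteq> \<phi> y" for x x' y y'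
    using that residual_product_mono[of "\<phi> x'" "\<phi> x" "\<phi> y'" "\<phi> y"] \<phi>_closed by (simp add: s(2,4))
  ultimately show ?thesis
    by (simp add: ordered_monoid_def ordered_monoid_axioms_def s(1,2))
qed

text \<open>An element corresponds to the primes below it. Since the order of the monoid is
  reversed, downward closed sets of primes are its upsets. Such a set is recovered from its join by
  primality, and an element from its primes because there are enough of them.\<close>

lemma prime_monoid_upsets_iso:
  "\<exists>f \<in> carrier R \<rightarrow>\<^sub>E upsets (prime_monoid A \<phi>). bij_betw f (carrier R) (upsets (prime_monoid A \<phi>)) \<and>
     (\<forall>x \<in> carrier R. \<forall>y \<in> carrier R. f x \<subseteq> f y \<longleftrightarrow> x \<sqsubseteq> y) \<and>
     (\<forall>x \<in> carrier R. \<forall>z \<in> carrier R.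
        f (x \<rightharpoondown> z) = f x \<rightharpoondown>\<^bsub>upset_residuation (prime_monoid A \<phi>)\<^esub> f z)"
proof -
  let ?M = "prime_monoid A \<phi>"
  interpret M: ordered_monoid ?M by (rule prime_monoid_ordered_monoid)
  note s = prime_monoid_simps
  let ?f = "\<lambda>x \<in> carrier R. {a \<in> A. \<phi> a \<sqsubseteq> x}"
  have fc: "?f x \<in> upsets ?M" if x: "x \<in> carrier R" for x
  proof (rule M.upsetsI)
    fix a b assume "a \<in> ?f x" "b \<in> carrier ?M" "a \<preceq>\<^bsub>?M\<^esub> b"
    then have "a \<in> A" "\<phi> a \<sqsubseteq> x" "b \<in> A" "\<phi> b \<sqsubseteq> \<phi> a" using x by (simp_all add: s(1,2))
    then show "b \<in> ?f x" using le_trans[of "\<phi> b" "\<phi> a" x] \<phi>_closed x by simp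
  qed (use x in \<open>auto simp: s(1)\<close>)
  have le: "?f x \<subseteq> ?f y \<longleftrightarrow> x \<sqsubseteq> y" if x: "x \<in> carrier R" and y: "y \<in> carrier R" for x y
  proof
    assume sub: "?f x \<subseteq> ?f y"
    show "x \<sqsubseteq> y"
    proof (rule le_primesI[OF x y])
      fix p assume p: "p \<in> completely_join_primes R" "p \<sqsubseteq> x"
      then have "inv_into A \<phi> p \<in> ?f x" using \<phi>_inv[OF p(1)] x by simp
      then have "inv_into A \<phi> p \<in> ?f y" using sub by blast
      then show "p \<sqsubseteq> y" using \<phi>_inv[OF p(1)] y by simp
    qed
  next
    assume "x \<sqsubseteq> y"
    then have "\<phi> a \<sqsubseteq> y" if "a \<in> A" "\<phi> a \<sqsubseteq> x" for a
      using le_trans[OF that(2)] \<phi>_closed[OF that(1)] x y by simp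
    then show "?f x \<subseteq> ?f y" using x y by auto
  qed
  have surj: "\<exists>x \<in> carrier R. V = ?f x" if V: "V \<in> upsets ?M" for V
  proof
    have VA: "V \<subseteq> A" using M.upsetsD(1)[OF V] by (auto simp: s(1))
    then have i: "\<phi> ` V \<subseteq> carrier R" using \<phi>_closed by blast
    then show c: "\<Squnion> (\<phi> ` V) \<in> carrier R" by simp
    have "a \<in> V \<longleftrightarrow> a \<in> A \<and> \<phi> a \<sqsubseteq> \<Squnion> (\<phi> ` V)" for a
    proof
      assume a: "a \<in> V"
      then show "a \<in> A \<and> \<phi> a \<sqsubseteq> \<Squnion> (\<phi> ` V)" using VA sup_upper[OF i] by blast
    next
      assume a: "a \<in> A \<and> \<phi> a \<sqsubseteq> \<Squnion> (\<phi> ` V)"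
      then obtain b where "b \<in> V" "\<phi> a \<sqsubseteq> \<phi> b" using prime_le_sup_iff[OF \<phi>_prime i] by blast
      then show "a \<in> V" using M.upsetsD(2)[OF V, of b a] a by (simp add: s(1,2))
    qed
    then have "V = {a \<in> A. \<phi> a \<sqsubseteq> \<Squnion> (\<phi> ` V)}" by (intro Set.set_eqI) (simp only: mem_Collect_eq)
    also have "\<dots> = ?f (\<Squnion> (\<phi> ` V))" using c by simp
    finally show "V = ?f (\<Squnion> (\<phi> ` V))" .
  qed
  have lres: "?f (x \<rightharpoondown> z) = ?f x \<rightharpoondown>\<^bsub>M.U\<^esub> ?f z" if x: "x \<in> carrier R" and z: "z \<in> carrier R" for x z
  proof -
    have "\<phi> c \<sqsubseteq> x \<rightharpoondown> z \<longleftrightarrow> (\<forall>a \<in> ?f x. a \<otimes>\<^bsub>?M\<^esub> c \<in> ?f z)" if c: "c \<in> A" for c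
    proof -
      \<comment> \<open>The denominator \<open>x\<close> is replaced by the primes below it, and the
        adjunction that defines the product turns each residual by a prime into a condition on a
        product.\<close>
      have "\<phi> c \<sqsubseteq> x \<rightharpoondown> z \<longleftrightarrow> (\<forall>p \<in> completely_join_primes R. p \<sqsubseteq> x \<longrightarrow> \<phi> c \<sqsubseteq> p \<rightharpoondown> z)"
        by (rule le_lres_iff_primes[OF x z \<phi>_closed[OF c]])
      also have "\<dots> \<longleftrightarrow> (\<forall>a \<in> A. \<phi> a \<sqsubseteq> x \<longrightarrow> \<phi> c \<sqsubseteq> \<phi> a \<rightharpoondown> z)"
        unfolding bij_betw_imp_surj_on[OF \<phi>, symmetric] by simp
      also have "\<dots> \<longleftrightarrow> (\<forall>a \<in> A. \<phi> a \<sqsubseteq> x \<longrightarrow> \<phi> (a \<otimes>\<^bsub>?M\<^esub> c) \<sqsubseteq> z)"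
      proof (intro ball_cong HOL.refl)
        fix a assume a: "a \<in> A"
        show "(\<phi> a \<sqsubseteq> x \<longrightarrow> \<phi> c \<sqsubseteq> \<phi> a \<rightharpoondown> z) \<longleftrightarrow> (\<phi> a \<sqsubseteq> x \<longrightarrow> \<phi> (a \<otimes>\<^bsub>?M\<^esub> c) \<sqsubseteq> z)"
          using residual_product_le_iff[OF \<phi>_closed[OF a] \<phi>_closed[OF c] z] s(4)[OF a c] by simp
      qed
      finally show ?thesis using x z c by (auto simp: s(3))
    qed
    then show ?thesis
      unfolding upset_residuals(1)[OF fc[OF x] fc[OF z]] using x z by (simp add: s(1) cong: conj_cong)
  qed
  have bij: "bij_betw ?f (carrier R) (upsets ?M)"
  proof (rule bij_betwI')
    fix x y assume xy: "x \<in> carrier R" "y \<in> carrier R"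
    show "(?f x = ?f y) = (x = y)"
    proof
      assume "?f x = ?f y"
      then show "x = y" using le[OF xy] le[OF xy(2,1)] xy by (intro le_antisym) simp_all
    qed simp
  qed (use fc surj in simp_all)
  show ?thesis
  proof (rule bexI[of _ ?f])
    show "?f \<in> carrier R \<rightarrow>\<^sub>E upsets ?M" using fc by auto
    show "bij_betw ?f (carrier R) (upsets ?M) \<and>
       (\<forall>x \<in> carrier R. \<forall>y \<in> carrier R. ?f x \<subseteq> ?f y \<longleftrightarrow> x \<sqsubseteq> y) \<and>
       (\<forall>x \<in> carrier R. \<forall>z \<in> carrier R. ?f (x \<rightharpoondown> z) = ?f x \<rightharpoondown>\<^bsub>M.U\<^esub> ?f z)"
      by (intro conjI ballI bij le lres)
  qed
qed

end

end

lemma upset_residuation_Ob: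
  assumes "ordered_monoid M" "small (carrier M)"
  shows "upset_residuation M \<in> Ob (DerACDL small)"
  using assms by (simp add: DerACDL_def ordered_monoid.upset_derivation_acdl ordered_monoid.upset_small_primes)

text \<open>The two categories share objects, identities and composition, and every residuation
  morphism is corelational. Essential surjectivity passes to the relational case in this
  way.\<close>

lemma iso_arrow_RelDerACDL:
  assumes "R \<in> Ob (DerACDL small)" "S \<in> Ob (DerACDL small)" "iso_arrow (DerACDL small) R S f"
  shows "iso_arrow (RelDerACDL small) R S f"
  using assms residuation_morphisms_corelational[of R S] residuation_morphisms_corelational[of S R]
  unfolding iso_arrow_def by (auto simp: DerACDL_def RelDerACDL_def)

lemma upset_residuation_surjective:
  assumes R: "R \<in> Ob (DerACDL small)"
  shows "\<exists>M. ordered_monoid M \<and> small (carrier M) \<and> (\<exists>f. iso_arrow (DerACDL small) (upset_residuation M) R f)"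
proof -
  interpret derivation_acdl R using R by (simp add: DerACDL_def)
  \<comment> \<open>\<open>small_primes\<close> supplies a small set in the type of the monoids that
    is in bijection with the primes; the monoid is built on it.\<close>
  obtain A \<phi> where A: "small A" and \<phi>: "bij_betw \<phi> A (completely_join_primes R)"
    using R by (auto simp: DerACDL_def small_primes_def eqpoll_def)
  show ?thesis
  proof (intro exI[of _ "prime_monoid A \<phi>"] conjI)
    show "ordered_monoid (prime_monoid A \<phi>)" by (rule prime_monoid_ordered_monoid[OF \<phi>])
    show "small (carrier (prime_monoid A \<phi>))" using A by (simp add: prime_monoid_def)
    have U: "upset_residuation (prime_monoid A \<phi>) \<in> Ob (DerACDL small)"
      by (rule upset_residuation_Ob[OF prime_monoid_ordered_monoid[OF \<phi>]]) (simp add: prime_monoid_def A)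
    from prime_monoid_upsets_iso[OF \<phi>] obtain f
      where f: "f \<in> carrier R \<rightarrow>\<^sub>E upsets (prime_monoid A \<phi>)"
        and iso: "bij_betw f (carrier R) (upsets (prime_monoid A \<phi>)) \<and>
          (\<forall>x \<in> carrier R. \<forall>y \<in> carrier R. f x \<subseteq> f y \<longleftrightarrow> x \<sqsubseteq>\<^bsub>R\<^esub> y) \<and>
          (\<forall>x \<in> carrier R. \<forall>z \<in> carrier R.
             f (x \<rightharpoondown>\<^bsub>R\<^esub> z) = f x \<rightharpoondown>\<^bsub>upset_residuation (prime_monoid A \<phi>)\<^esub> f z)" ..
    show "\<exists>f. iso_arrow (DerACDL small) (upset_residuation (prime_monoid A \<phi>)) R f"
      by (rule order_iso_iso_arrow[OF R U, of f]) (simp_all add: f iso)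
  qed
qed

section \<open>The dual equivalences\<close>

lemma opposite_simps [simp]:
  "Ob (opposite C) = Ob C" "Hom (opposite C) X Y = Hom C Y X" "Id (opposite C) = Id C"
  "Comp (opposite C) X Y Z g f = Comp C Z Y X f g"
  by (simp_all add: opposite_def)

text \<open>An arrow from \<open>M\<close> to \<open>N\<close> in the opposite category is a
  homomorphism from \<open>N\<close> to \<open>M\<close>, hence the exchanged arguments of
  \<open>preimage_map\<close>.\<close>

lemma OrdMon_DerACDL:
  "full_faithful_surjective (opposite (OrdMon small)) (DerACDL small) upset_residuation
     (\<lambda>M N. preimage_map N M)"
proof -
  interpret O: category "OrdMon small" by (rule OrdMon_category)
  interpret Op: category "opposite (OrdMon small)" by (rule O.opposite_category)
  interpret D: category "DerACDL small" by (rule DerACDL_category)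
  have bij: "bij_betw (preimage_map N M) (Hom (opposite (OrdMon small)) M N)
      (Hom (DerACDL small) (upset_residuation M) (upset_residuation N))"
    if "M \<in> Ob (opposite (OrdMon small))" "N \<in> Ob (opposite (OrdMon small))" for M N
  proof -
    interpret two_ordered_monoids N M using that by (simp add: OrdMon_def two_ordered_monoids_def)
    show ?thesis using preimage_map_bij by (simp add: OrdMon_def DerACDL_def)
  qed
  show ?thesis
  proof unfold_locales
    fix M assume M: "M \<in> Ob (opposite (OrdMon small))"
    then show "upset_residuation M \<in> Ob (DerACDL small)" by (simp add: OrdMon_def upset_residuation_Ob)
    interpret M: ordered_monoid M using M by (simp add: OrdMon_def)
    have "{x \<in> carrier M. (\<lambda>x \<in> carrier M. x) x \<in> V} = V" if "V \<in> upsets M" for V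
      using M.upsetsD(1)[OF that] by auto
    then show "preimage_map M M (Id (opposite (OrdMon small)) M) = Id (DerACDL small) (upset_residuation M)"
      by (simp add: OrdMon_def DerACDL_def preimage_map_def cong: restrict_cong)
  next
    fix X Y f assume "X \<in> Ob (opposite (OrdMon small))" "Y \<in> Ob (opposite (OrdMon small))"
      and f: "f \<in> Hom (opposite (OrdMon small)) X Y"
    from bij_betwE[OF bij[OF this(1,2)]] f
    show "preimage_map Y X f \<in> Hom (DerACDL small) (upset_residuation X) (upset_residuation Y)" by blast
  next
    fix X Y Z f g
    assume o: "X \<in> Ob (opposite (OrdMon small))" "Y \<in> Ob (opposite (OrdMon small))" "Z \<in> Ob (opposite (OrdMon small))"
      and f: "f \<in> Hom (opposite (OrdMon small)) X Y" and g: "g \<in> Hom (opposite (OrdMon small)) Y Z"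
    have f: "f \<in> monotone_monoid_homs Y X" and g: "g \<in> monotone_monoid_homs Z Y"
      using f g by (simp_all add: OrdMon_def)
    interpret two_ordered_monoids Y X using o by (simp add: OrdMon_def two_ordered_monoids_def)
    have pc: "preimage_map Y X f V \<in> upsets Y" if "V \<in> upsets X" for V
      using residuation_morphisms_extensional(1)[OF preimage_map_morphism[OF f]] that by auto
    have gc: "g x \<in> carrier Y" if "x \<in> carrier Z" for x
      by (rule funcset_mem[OF monotone_monoid_homsD(1)[OF g] that])
    have "{x \<in> carrier Z. compose (carrier Z) f g x \<in> V} = preimage_map Z Y g (preimage_map Y X f V)"
      if V: "V \<in> upsets X" for V
      using pc[OF V] V gc by (auto simp: preimage_map_def compose_def)
    then show "preimage_map Z X (Comp (opposite (OrdMon small)) X Y Z g f)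
        = Comp (DerACDL small) (upset_residuation X) (upset_residuation Y) (upset_residuation Z)
            (preimage_map Z Y g) (preimage_map Y X f)"
      unfolding preimage_map_def[of Z X] by (simp add: OrdMon_def DerACDL_def compose_def cong: restrict_cong)
  next
    fix R assume "R \<in> Ob (DerACDL small)"
    from upset_residuation_surjective[OF this]
    show "\<exists>M \<in> Ob (opposite (OrdMon small)). \<exists>f. iso_arrow (DerACDL small) (upset_residuation M) R f"
      by (auto simp: OrdMon_def)
  qed (rule bij)
qed

lemma RelOrdMon_RelDerACDL:
  "full_faithful_surjective (opposite (RelOrdMon small)) (RelDerACDL small) upset_residuation
     (\<lambda>M N. relational_preimage_map N M)"
proof -
  interpret O: category "RelOrdMon small" by (rule RelOrdMon_category)
  interpret Op: category "opposite (RelOrdMon small)" by (rule O.opposite_category)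
  interpret D: category "RelDerACDL small" by (rule RelDerACDL_category)
  have Ob: "Ob (RelDerACDL small) = Ob (DerACDL small)" by (simp add: RelDerACDL_def DerACDL_def)
  have bij: "bij_betw (relational_preimage_map N M) (Hom (opposite (RelOrdMon small)) M N)
      (Hom (RelDerACDL small) (upset_residuation M) (upset_residuation N))"
    if "M \<in> Ob (opposite (RelOrdMon small))" "N \<in> Ob (opposite (RelOrdMon small))" for M N
  proof -
    interpret two_ordered_monoids N M using that by (simp add: RelOrdMon_def two_ordered_monoids_def)
    show ?thesis using relational_preimage_map_bij by (simp add: RelOrdMon_def RelDerACDL_def)
  qed
  show ?thesis
  proof unfold_locales
    fix M assume M: "M \<in> Ob (opposite (RelOrdMon small))"
    then show "upset_residuation M \<in> Ob (RelDerACDL small)" by (simp add: Ob RelOrdMon_def upset_residuation_Ob)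
    interpret M: ordered_monoid M using M by (simp add: RelOrdMon_def)
    \<comment> \<open>The set of elements below \<open>x\<close> meets an upset exactly if
      \<open>x\<close> belongs to it.\<close>
    have "{x \<in> carrier M. (\<lambda>x \<in> carrier M. {y \<in> carrier M. y \<preceq>\<^bsub>M\<^esub> x}) x \<inter> V \<noteq> {}} = V" (is "?l = V")
      if V: "V \<in> upsets M" for V
    proof (rule subset_antisym; rule subsetI)
      fix x assume "x \<in> ?l"
      then obtain y where "x \<in> carrier M" "y \<preceq>\<^bsub>M\<^esub> x" "y \<in> V" by (auto split: if_splits)
      then show "x \<in> V" using M.upsetsD(2)[OF V, of y x] by simp
    next
      fix x assume "x \<in> V"
      moreover from this have x: "x \<in> carrier M" by (rule M.upsetsD(1)[OF V])
      ultimately have "x \<in> {y \<in> carrier M. y \<preceq>\<^bsub>M\<^esub> x} \<inter> V" by simp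
      with x show "x \<in> ?l" by auto
    qed
    then show "relational_preimage_map M M (Id (opposite (RelOrdMon small)) M)
        = Id (RelDerACDL small) (upset_residuation M)"
      unfolding relational_preimage_map_def by (simp add: RelOrdMon_def RelDerACDL_def cong: restrict_cong)
  next
    fix X Y f assume "X \<in> Ob (opposite (RelOrdMon small))" "Y \<in> Ob (opposite (RelOrdMon small))"
      and f: "f \<in> Hom (opposite (RelOrdMon small)) X Y"
    from bij_betwE[OF bij[OF this(1,2)]] f
    show "relational_preimage_map Y X f \<in> Hom (RelDerACDL small) (upset_residuation X) (upset_residuation Y)" by blast
  next
    fix X Y Z f g
    assume o: "X \<in> Ob (opposite (RelOrdMon small))" "Y \<in> Ob (opposite (RelOrdMon small))" "Z \<in> Ob (opposite (RelOrdMon small))"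
      and f: "f \<in> Hom (opposite (RelOrdMon small)) X Y" and g: "g \<in> Hom (opposite (RelOrdMon small)) Y Z"
    have f: "f \<in> relational_morphisms Y X" and g: "g \<in> relational_morphisms Z Y"
      using f g by (simp_all add: RelOrdMon_def)
    interpret two_ordered_monoids Y X using o by (simp add: RelOrdMon_def two_ordered_monoids_def)
    have pc: "relational_preimage_map Y X f V \<in> upsets Y" if "V \<in> upsets X" for V
      using residuation_morphisms_extensional(2)[OF relational_preimage_map_morphism[OF f]] that by auto
    have "{x \<in> carrier Z. (\<lambda>x \<in> carrier Z. \<Union>y \<in> g x. f y) x \<inter> V \<noteq> {}}
        = relational_preimage_map Z Y g (relational_preimage_map Y X f V)"
      if V: "V \<in> upsets X" for V
      using pc[OF V] V relational_morphismsD(3)[OF g] by (auto simp: relational_preimage_map_def)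
    then show "relational_preimage_map Z X (Comp (opposite (RelOrdMon small)) X Y Z g f)
        = Comp (RelDerACDL small) (upset_residuation X) (upset_residuation Y) (upset_residuation Z)
            (relational_preimage_map Z Y g) (relational_preimage_map Y X f)"
      unfolding relational_preimage_map_def[of Z X]
      by (simp add: RelOrdMon_def RelDerACDL_def compose_def cong: restrict_cong)
  next
    fix R assume "R \<in> Ob (RelDerACDL small)"
    then have R: "R \<in> Ob (DerACDL small)" by (simp add: Ob)
    obtain M f where M: "ordered_monoid M" "small (carrier M)" "iso_arrow (DerACDL small) (upset_residuation M) R f"
      using upset_residuation_surjective[OF R] by blast
    have "iso_arrow (RelDerACDL small) (upset_residuation M) R f"
      by (rule iso_arrow_RelDerACDL[OF upset_residuation_Ob[of M small, OF M(1,2)] R M(3)])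
    then show "\<exists>M \<in> Ob (opposite (RelOrdMon small)). \<exists>f. iso_arrow (RelDerACDL small) (upset_residuation M) R f"
      using M(1,2) by (auto simp: RelOrdMon_def)
  qed (rule bij)
qed

theorem theorem5p23:
  fixes small :: "'a set \<Rightarrow> bool"
  assumes small_equipollent: "\<And>A B. A \<approx> B \<Longrightarrow> small A \<Longrightarrow> small B"
  shows
    "dually_equivalent_categories (OrdMon small) (Comon small) \<and>
     isomorphic_categories (Comon small) (DerACDL small) \<and>
     dually_equivalent_categories (OrdMon small) (DerACDL small) \<and>
     dually_equivalent_categories (RelOrdMon small) (RelComon small) \<and>
     isomorphic_categories (RelComon small) (RelDerACDL small) \<and>
     dually_equivalent_categories (RelOrdMon small) (RelDerACDL small)"
  unfolding dually_equivalent_categories_def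
proof (intro conjI)
  show "equivalent_categories (opposite (OrdMon small)) (DerACDL small)"
    by (rule full_faithful_surjective.equivalent[OF OrdMon_DerACDL])
  show "equivalent_categories (opposite (OrdMon small)) (Comon small)"
    by (rule full_faithful_surjective.equivalent[OF
          relabelling.full_faithful_surjective_comp[OF relabelling_Comon OrdMon_DerACDL]])
  show "isomorphic_categories (Comon small) (DerACDL small)"
    by (rule relabelling.isomorphic[OF relabelling.inverse[OF relabelling_Comon]])
  show "equivalent_categories (opposite (RelOrdMon small)) (RelDerACDL small)"
    by (rule full_faithful_surjective.equivalent[OF RelOrdMon_RelDerACDL])
  show "equivalent_categories (opposite (RelOrdMon small)) (RelComon small)"
    by (rule full_faithful_surjective.equivalent[OF
          relabelling.full_faithful_surjective_comp[OF relabelling_RelComon RelOrdMon_RelDerACDL]])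
  show "isomorphic_categories (RelComon small) (RelDerACDL small)"
    by (rule relabelling.isomorphic[OF relabelling.inverse[OF relabelling_RelComon]])
qed

end
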